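(* For each positive integer $n$ and prime power $q$ let $G$ be any one of the groups $\mathrm{GL}(n,q)$, $\mathrm{PGL}(n,q)$, $\mathrm{SL}(n,q)$, $\mathrm{PSL}(n,q)$, and let \[ \eta_G=\frac1{|G|}\sum_{g\in G}\frac1{\operatorname{ord} g}. \] Then the following hold for each of the four families. (i) There is a real-valued function $\varepsilon(n,q)$ with $\varepsilon(n,q)\to0$ as $\max(n,q)\to\infty$ such that for all $n,q$ \[ \eta_G\leq \exp\big(-(2-\varepsilon(n,q))\sqrt{n\log n\log q}\big). \] (ii) For each fixed prime power $q$, as $n\to\infty$, \[ \eta_G=\exp\big(-(2+o(1))\sqrt{n\log n\log q}\big); \] that is, for every prime power $q$ and every $\delta>0$ there is $n_0$ such that for all $n\geq n_0$ \[ \exp\big(-(2+\delta)\sqrt{n\log n\log q}\big)\leq \eta_G\leq \exp\big(-(2-\delta)\sqrt{n\log n\log q}\big). \]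
   Context: $\operatorname{ord} g$ denotes the order of the element $g$ in the group $G$ (for $\mathrm{PGL}$ and $\mathrm{PSL}$, the order in the quotient group). Logarithms are natural. The function $\varepsilon(n,q)$ in (i) makes precise the $o(1)$ notation, understood to hold in either limit $n\to\infty$ or $q\to\infty$. *)

theory Defs
  imports
    "HOL-Analysis.Analysis"
    "HOL-Algebra.Algebra"
    "HOL-Combinatorics.Permutations"
    "HOL-Number_Theory.Prime_Powers"
    "Jordan_Normal_Form.Matrix"
begin

text \<open>The field is a record of \<open>HOL-Algebra\<close> rather than a type of class \<open>field\<close>, since both
  its cardinality and the matrix size have to be quantified inside a formula.  Every finite field
  has an isomorphic copy with carrier a set of natural numbers, so the type \<open>nat ring\<close> covers all
  finite fields simultaneously.  Only the type of matrices is taken from \<open>Jordan_Normal_Form\<close>: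
  its multiplication and determinant require type classes on the entries, so they are redefined here over a ring record.\<close>

definition mat_monoid :: "nat \<Rightarrow> 'a ring \<Rightarrow> 'a mat monoid" where
  "mat_monoid n F =
    \<lparr>carrier = {A \<in> carrier_mat n n. elements_mat A \<subseteq> carrier F},
     mult = (\<lambda>A B. mat n n (\<lambda>(i, j). \<Oplus>\<^bsub>F\<^esub>k\<in>{..<n}. A $$ (i, k) \<otimes>\<^bsub>F\<^esub> B $$ (k, j))),
     one = mat n n (\<lambda>(i, j). if i = j then \<one>\<^bsub>F\<^esub> else \<zero>\<^bsub>F\<^esub>)\<rparr>"

definition mat_det :: "nat \<Rightarrow> 'a ring \<Rightarrow> 'a mat \<Rightarrow> 'a" where
  "mat_det n F A =
    (\<Oplus>\<^bsub>F\<^esub>p\<in>{p. p permutes {..<n}}. add_pow F (sign p) (\<Otimes>\<^bsub>F\<^esub>i\<in>{..<n}. A $$ (i, p i)))"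

definition scalar_mats :: "nat \<Rightarrow> 'a ring \<Rightarrow> 'a mat set" where
  "scalar_mats n F =
    (\<lambda>c. mat n n (\<lambda>(i, j). if i = j then c else \<zero>\<^bsub>F\<^esub>)) ` (carrier F - {\<zero>\<^bsub>F\<^esub>})"

definition GL :: "nat \<Rightarrow> 'a ring \<Rightarrow> 'a mat monoid" where
  "GL n F = units_of (mat_monoid n F)"

definition SL :: "nat \<Rightarrow> 'a ring \<Rightarrow> 'a mat monoid" where
  "SL n F = (GL n F)\<lparr>carrier := {A \<in> carrier (GL n F). mat_det n F A = \<one>\<^bsub>F\<^esub>}\<rparr>"

definition PGL :: "nat \<Rightarrow> 'a ring \<Rightarrow> 'a mat set monoid" where
  "PGL n F = GL n F Mod scalar_mats n F"

definition PSL :: "nat \<Rightarrow> 'a ring \<Rightarrow> 'a mat set monoid" where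
  "PSL n F = SL n F Mod (scalar_mats n F \<inter> carrier (SL n F))"

definition eta :: "('a, 'b) monoid_scheme \<Rightarrow> real" where
  "eta G = 1 / real (card (carrier G)) * (\<Sum>g\<in>carrier G. 1 / real (group.ord G g))"

end

theory Submission
  imports Defs "HOL-Real_Asymp.Real_Asymp"
begin

text \<open>Upper bound. Since passing to a central quotient shrinks orders and \<open>PSL\<close> loses at most a factor
  \<open>n\<close> against \<open>PGL\<close>, it suffices to treat \<open>PGL\<close>. Let \<open>f\<close> be the monic generator of the annihilator of
  the first unit vector under \<open>g\<close>. At most \<open>q\<^sup>n\<^sup>(\<^sup>n\<^sup>-\<^sup>1\<^sup>)\<close> matrices share the same \<open>f\<close>, and if \<open>g\<^sup>N\<close> is the scalar \<open>c\<close>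
  then \<open>f\<close> divides \<open>X\<^sup>N - c\<close>. Hence the average is at most \<open>4 q\<^sup>-\<^sup>n\<close> times the sum over all monic \<open>f\<close> of
  degree at most \<open>n\<close> of \<open>1/N(f)\<close>, where \<open>N(f)\<close> is the least \<open>N\<close> such that \<open>f\<close> divides some \<open>X\<^sup>N - c\<close>. Replace
  \<open>f\<close> by the set of its irreducible factors of odd multiplicity. If the two largest
  degrees are \<open>d\<close> (with \<open>k\<close> factors) and \<open>d'\<close>, then \<open>1/N(f)\<close> gains on average a factor \<open>q\<^sup>-\<^sup>M\<close>,
  \<open>M = max d (2d')\<close>, up to divisor functions, while distinctness of the factors saves
  \<open>k!\<close> and Rankin's method bounds the number of choices for the factors of degree at most \<open>d'\<close>; both savings
  together are of size \<open>exp(-(n/M) log n)\<close>. By the arithmetic-geometric mean inequality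
  \<open>M log q + (n/M) log n \<ge> 2 sqrt(n log n log q)\<close>.

  Lower bound. With \<open>k\<close> about \<open>sqrt(n log q/log n)\<close> and \<open>n = km + r\<close>, \<open>1 \<le> r \<le> k\<close>, consider products of
  \<open>k\<close> distinct irreducibles of degree \<open>m\<close> with a binomial \<open>X\<^sup>r - c\<close>, where \<open>c\<close> is chosen such that the companion
  matrix has determinant one. All these matrices have order dividing \<open>r(q\<^sup>m - 1)\<close>, and each has at
  least \<open>|GL(n,q)|/q\<^sup>n\<close> conjugates.\<close>

text \<open>The upper bound has to hold uniformly in \<open>q\<close>, which forces two treatments
  of the factors. Orders of X in the ordinary sense are easy to average, but a scalar power of
  \<open>g\<close> becomes trivial only after a further exponent q - 1, and this costs a factor q.
  Against a gain of q^-d that is affordable only when d exceeds a constant K. Factors of degree at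
  most K are therefore compared in pairs of equal degree: for fixed a and N, at most N/d of the b of
  degree d have X^N congruent to the same scalar modulo a and b, and no factor q is lost. Such a
  pair exists as soon as the total degree exceeds K^2. The 2d' in M comes from orders dividing q^d -
  1 and q^d' - 1: their gcd is at most q^(d-d'), so 1/lcm averages to about q^(d-d') q^-d q^-d' =
  q^(-2d'). If n stays bounded and q grows, the target exp(-c sqrt(log q)) is larger than any fixed
  negative power of q, and K = 1 already yields q^(-1/2).\<close>

section \<open>Weighted sets of irreducible polynomials\<close>

text \<open>The exponent saved by Rankin's method with u = n/D: the parameter choice x^D = u saves u
  ln u and costs u. Where this is negative, that is for u below e, the choice x = 1 is used instead
  and saves nothing, hence the truncation at 0.\<close>

definition psi :: "real \<Rightarrow> real" where "psi u = max 0 (u * (ln u - 1))"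

text \<open>Rankin's method: \<open>q\<^sup>n smooth_bound n D\<close> dominates the number of squarefree monic polynomials of
  degree \<open>n\<close> without irreducible factors of degree greater than \<open>D\<close>.\<close>
definition smooth_bound :: "nat \<Rightarrow> nat \<Rightarrow> real" where
  "smooth_bound n D = (if D = 0 then (if n = 0 then 1 else 0) else 3 * real D * exp (- psi (real n / real D)))"

lemma psi_nonneg: "psi u \<ge> 0" by (simp add: psi_def)

text \<open>The chord over [0,1] of the convex function t -> u^t. It is applied with t = d/D in
  \<open>card_SA\<close>.\<close>

lemma powr_le_linear: "u \<ge> 1 \<Longrightarrow> 0 \<le> t \<Longrightarrow> t \<le> 1 \<Longrightarrow> u powr t \<le> 1 + t * (u - 1)" for u t :: real
  using convex_onD[OF exp_convex, of t 0 "ln u"] by (simp add: powr_def algebra_simps)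

lemma sum_UN_le:
  fixes f :: "'b \<Rightarrow> 'c :: ordered_comm_monoid_add"
  assumes "finite D" "\<And>d. d \<in> D \<Longrightarrow> finite (B d)" "\<And>x. f x \<ge> 0"
  shows "sum f (\<Union>d\<in>D. B d) \<le> (\<Sum>d\<in>D. sum f (B d))"
  using assms
proof (induction D rule: finite_induct)
  case (insert x D)
  let ?U = "\<Union>d\<in>D. B d"
  have "sum f (B x \<union> ?U) \<le> sum f (B x \<union> ?U) + sum f (B x \<inter> ?U)"
    using insert.prems by (simp add: add_increasing2 sum_nonneg)
  also have "\<dots> = sum f (B x) + sum f ?U" using insert by (intro sum.union_inter) auto
  also have "\<dots> \<le> sum f (B x) + (\<Sum>d\<in>D. sum f (B d))" using insert by (intro add_left_mono) auto
  finally show ?case using insert.hyps by simp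
qed simp

lemma sum_inverse_le_ln: "D \<ge> 1 \<Longrightarrow> (\<Sum>d=1..D. 1 / real d) \<le> ln (real D) + 1"
proof (induction D rule: dec_induct)
  case (step n)
  have "ln (real n / real (Suc n)) \<le> real n / real (Suc n) - 1" using step by (intro ln_le_minus_one) auto
  then have "1 / real (Suc n) \<le> ln (real (Suc n)) - ln (real n)"
    using step by (simp add: ln_div field_simps)
  then show ?case using step by simp
qed simp

lemma of_nat_le_mult: "a \<le> b * c \<Longrightarrow> real a \<le> real b * real c"
  by (simp flip: of_nat_mult)

text \<open>In the application \<open>I\<close> consists of the monic irreducible polynomials other than \<open>X\<close>, \<open>\<delta>\<close> is the
  degree, \<open>od a\<close> the order of \<open>X\<close> modulo \<open>a\<close>, \<open>pr a b\<close> the least \<open>N \<ge> 1\<close> such that \<open>X\<^sup>N\<close> is congruent to one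
  and the same scalar modulo \<open>a\<close> and \<open>b\<close>, and \<open>w A\<close> the reciprocal of the analogous number for all
  members of \<open>A\<close>.\<close>
locale irr_system =
  fixes I :: "'i set" and \<delta> :: "'i \<Rightarrow> nat" and q :: nat and od :: "'i \<Rightarrow> nat"
    and pr :: "'i \<Rightarrow> 'i \<Rightarrow> nat" and w :: "'i set \<Rightarrow> real"
  assumes q2: "q \<ge> 2"
    and fin: "finite {a \<in> I. \<delta> a = d}"
    and deg1: "a \<in> I \<Longrightarrow> \<delta> a \<ge> 1"
    and cardI: "d * card {a \<in> I. \<delta> a = d} \<le> q ^ d"
    and od1: "a \<in> I \<Longrightarrow> od a \<ge> 1"
    and od_dvd: "a \<in> I \<Longrightarrow> od a dvd q ^ \<delta> a - 1"
    and od_card: "N \<ge> 1 \<Longrightarrow> d * card {a \<in> I. \<delta> a = d \<and> od a = N} \<le> N"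
    and pr1: "a \<in> I \<Longrightarrow> b \<in> I \<Longrightarrow> \<delta> a = \<delta> b \<Longrightarrow> pr a b \<ge> 1"
    and pr_dvd: "a \<in> I \<Longrightarrow> b \<in> I \<Longrightarrow> \<delta> a = \<delta> b \<Longrightarrow> pr a b dvd q ^ \<delta> a - 1"
    and pr_card: "a \<in> I \<Longrightarrow> N \<ge> 1 \<Longrightarrow> \<delta> a * card {b \<in> I. \<delta> b = \<delta> a \<and> pr a b = N} \<le> N"
    and w0: "0 \<le> w A" and w1: "w A \<le> 1"
    and w_od: "A \<subseteq> I \<Longrightarrow> a \<in> A \<Longrightarrow> b \<in> A \<Longrightarrow> w A \<le> real (q - 1) / real (lcm (od a) (od b))"
    and w_pr: "A \<subseteq> I \<Longrightarrow> a \<in> A \<Longrightarrow> b \<in> A \<Longrightarrow> \<delta> a = \<delta> b \<Longrightarrow> w A \<le> 1 / real (pr a b)"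
begin

definition Idg :: "nat \<Rightarrow> 'i set" where "Idg d = {a \<in> I. \<delta> a = d}"
text \<open>A finite set of irreducibles stands for the product of its members, so
  \<open>FA m\<close> models squarefree polynomials of degree \<open>m\<close>, and
  \<open>SA D m\<close> those with all factors of degree at most \<open>D\<close>.\<close>

definition FA :: "nat \<Rightarrow> 'i set set" where "FA m = {A. finite A \<and> A \<subseteq> I \<and> sum \<delta> A = m}"
definition SA :: "nat \<Rightarrow> nat \<Rightarrow> 'i set set" where "SA D m = {A \<in> FA m. \<forall>a\<in>A. \<delta> a \<le> D}"
definition T :: "nat \<Rightarrow> real" where "T m = (\<Sum>A\<in>FA m. w A)"
definition tau :: "nat \<Rightarrow> nat" where "tau d = card {N. N dvd q ^ d - 1}"

lemma finite_Idg: "finite (Idg d)" using fin by (simp add: Idg_def)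
lemma IdgD: "a \<in> Idg d \<Longrightarrow> a \<in> I" "a \<in> Idg d \<Longrightarrow> \<delta> a = d" by (auto simp: Idg_def)
lemma card_Idg: "d * card (Idg d) \<le> q ^ d" using cardI by (simp add: Idg_def)
lemma card_Idg_le: "card (Idg d) \<le> q ^ d"
proof (cases "d = 0")
  case True
  then have "Idg d = {}" using deg1 by (fastforce simp: Idg_def)
  then show ?thesis by (simp only:) simp
next
  case False
  then have "card (Idg d) \<le> d * card (Idg d)" by simp
  then show ?thesis using card_Idg le_trans by blast
qed
lemma card_Idg_real: "d \<ge> 1 \<Longrightarrow> real (card (Idg d)) \<le> real q ^ d / real d"
  using card_Idg[of d] by (simp add: field_simps flip: of_nat_mult of_nat_power)

section \<open>Counting sets without members of large degree\<close>

definition IL :: "nat \<Rightarrow> 'i set" where "IL D = (\<Union>d\<in>{1..D}. Idg d)"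

lemma finite_IL: "finite (IL D)" using finite_Idg by (simp add: IL_def)
lemma IL_iff: "a \<in> IL D \<longleftrightarrow> a \<in> I \<and> \<delta> a \<le> D" using deg1 by (auto simp: IL_def Idg_def)

lemma deg_le_sum: "A \<in> FA m \<Longrightarrow> a \<in> A \<Longrightarrow> \<delta> a \<le> m"
  using member_le_sum[of a A \<delta>] by (auto simp: FA_def)

lemma FA_eq_SA: "FA m = SA m m" using deg_le_sum by (auto simp: SA_def)

lemma SA_sub: "SA D m \<subseteq> Pow (IL D)"
  by (auto simp: SA_def FA_def IL_iff)

lemma finite_SA: "finite (SA D m)" using SA_sub finite_IL by (meson finite_Pow_iff finite_subset)
lemma finite_FA: "finite (FA m)" using finite_SA FA_eq_SA by metis

text \<open>Give each set the weight y^m with y = x/q. The sum of the weights over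
  \<open>SA D m\<close> is at most the sum over all subsets of \<open>IL D\<close>, an Euler product
  of factors 1 + y^delta <= exp(y^delta); \<open>card_Idg_real\<close> turns the exponent into the
  sum of x^d/d. The parameter x stays free.\<close>

lemma rankin:
  assumes x: "x > 0"
  shows "real (card (SA D m)) \<le> (real q / x) ^ m * exp (\<Sum>d=1..D. x ^ d / real d)"
proof -
  define y where "y = x / real q"
  have y: "y > 0" using x q2 by (simp add: y_def)
  have "real (card (SA D m)) * y ^ m = (\<Sum>A\<in>SA D m. \<Prod>a\<in>A. y ^ \<delta> a)"
  proof -
    have "(\<Prod>a\<in>A. y ^ \<delta> a) = y ^ m" if "A \<in> SA D m" for A
      using that by (auto simp: SA_def FA_def power_sum)
    then show ?thesis by simp
  qed
  also have "\<dots> \<le> (\<Sum>A\<in>Pow (IL D). \<Prod>a\<in>A. y ^ \<delta> a)"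
    using SA_sub finite_IL y by (intro sum_mono2) (auto intro!: prod_nonneg)
  also have "\<dots> = (\<Prod>a\<in>IL D. 1 + y ^ \<delta> a)"
    using finite_IL[of D] prod_add[of "IL D" "\<lambda>a. y ^ \<delta> a" "\<lambda>_. 1"] by (simp add: add.commute)
  also have "\<dots> \<le> (\<Prod>a\<in>IL D. exp (y ^ \<delta> a))"
    using y by (intro prod_mono) (auto intro: add_nonneg_nonneg)
  also have "\<dots> = exp (\<Sum>a\<in>IL D. y ^ \<delta> a)" using finite_IL by (simp add: exp_sum)
  also have "(\<Sum>a\<in>IL D. y ^ \<delta> a) = (\<Sum>d=1..D. \<Sum>a\<in>Idg d. y ^ \<delta> a)"
    unfolding IL_def using finite_Idg by (intro sum.UNION_disjoint) (auto simp: Idg_def)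
  also have "\<dots> = (\<Sum>d=1..D. real (card (Idg d)) * y ^ d)" by (intro sum.cong) (auto simp: IdgD)
  also have "exp \<dots> \<le> exp (\<Sum>d=1..D. x ^ d / real d)"
  proof -
    have "real (card (Idg d)) * y ^ d \<le> x ^ d / real d" if d: "d \<in> {1..D}" for d
    proof -
      have "real (card (Idg d)) * y ^ d \<le> (real q ^ d / real d) * y ^ d"
        using card_Idg_real[of d] d y by (intro mult_right_mono) auto
      also have "\<dots> = x ^ d / real d" using q2 by (simp add: y_def power_divide)
      finally show ?thesis .
    qed
    then show ?thesis by (simp only: exp_le_cancel_iff) (rule sum_mono)
  qed
  finally have le: "real (card (SA D m)) * y ^ m \<le> exp (\<Sum>d=1..D. x ^ d / real d)" by simp
  have "(real q / x) ^ m * y ^ m = 1" using x q2 by (simp add: y_def power_mult_distrib[symmetric])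
  then have "real (card (SA D m)) = (real q / x) ^ m * (real (card (SA D m)) * y ^ m)"
    by (metis mult.assoc mult.commute mult.right_neutral)
  also have "\<dots> \<le> (real q / x) ^ m * exp (\<Sum>d=1..D. x ^ d / real d)"
    using le x by (intro mult_left_mono) auto
  finally show ?thesis .
qed

text \<open>With u = m/D, take x^D = u if u >= e and x = 1 otherwise. By convexity (x^d - 1)/d <= (u
  - 1)/D, so the exponent in \<open>rankin\<close> exceeds the harmonic sum by at most u - 1. The
  factor 3 bounds the e in exp(ln D + 1), which appears when x = 1.\<close>

lemma card_SA: "real (card (SA D m)) \<le> real q ^ m * smooth_bound m D"
proof (cases "D = 0")
  case True
  have sub: "A = {}" if "A \<in> SA D m" for A using SA_sub[of D m] True that by (auto simp: IL_def)
  show ?thesis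
  proof (cases "m = 0")
    case m0: True
    have "card (SA D m) \<le> card {{} :: 'i set}" using sub by (intro card_mono) auto
    then show ?thesis using True m0 by (simp add: smooth_bound_def)
  next
    case m0: False
    have "SA D m = {}" using sub m0 by (fastforce simp: SA_def FA_def)
    then show ?thesis using True m0 by (simp add: smooth_bound_def)
  qed
next
  case False
  then have D: "D \<ge> 1" by simp
  have H: "(\<Sum>d=1..D. 1 / real d) \<le> ln (real D) + 1"
    by (rule sum_inverse_le_ln[OF D])
  define u where "u = real m / real D"
  have e3: "exp (ln (real D) + 1) \<le> 3 * real D"
    using D exp_le by (simp add: exp_add)
  show ?thesis
  proof (cases "u \<ge> 1 \<and> u * (ln u - 1) \<ge> 0")
    case c: True
    then have u: "u \<ge> 1" and psi: "psi u = u * (ln u - 1)" by (auto simp: psi_def)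
    define x where "x = u powr (1 / real D)"
    have x: "x > 0" using u by (simp add: x_def)
    have xp: "x ^ d = u powr (real d / real D)" for d
      using x u by (simp add: x_def powr_power)
    have "(\<Sum>d=1..D. x ^ d / real d) \<le> (\<Sum>d=1..D. 1 / real d + (u - 1) / real D)"
    proof (rule sum_mono)
      fix d assume d: "d \<in> {1..D}"
      have "x ^ d \<le> 1 + (real d / real D) * (u - 1)"
        unfolding xp using u d by (intro powr_le_linear) auto
      then show "x ^ d / real d \<le> 1 / real d + (u - 1) / real D" using d by (simp add: field_simps)
    qed
    also have "\<dots> = (\<Sum>d=1..D. 1 / real d) + (u - 1)" using D by (simp add: sum.distrib)
    also have "\<dots> \<le> ln (real D) + u" using H by simp
    finally have S: "(\<Sum>d=1..D. x ^ d / real d) \<le> ln (real D) + u" .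
    have "(real q / x) ^ m = real q ^ m * exp (- u * ln u)"
    proof -
      have "x ^ m = u powr u" unfolding xp u_def ..
      then have "x ^ m = exp (u * ln u)" using u by (simp add: powr_def)
      then show ?thesis by (simp add: power_divide exp_minus field_simps)
    qed
    then have "real (card (SA D m)) \<le> real q ^ m * exp (- u * ln u) * exp (\<Sum>d=1..D. x ^ d / real d)"
      using rankin[OF x, of D m] by simp
    also have "\<dots> \<le> real q ^ m * exp (- u * ln u) * exp (ln (real D) + u)"
      using S q2 by (intro mult_left_mono) auto
    also have "\<dots> = real q ^ m * (real D * exp (- psi u))"
      using D by (simp add: psi exp_add exp_diff exp_minus field_simps)
    also have "\<dots> \<le> real q ^ m * smooth_bound m D" using False q2 by (intro mult_left_mono) (auto simp: smooth_bound_def u_def)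
    finally show ?thesis .
  next
    case c: False
    have psi: "psi u = 0"
    proof (cases "u \<ge> 1")
      case True then show ?thesis using c by (simp add: psi_def)
    next
      case False
      have "u \<ge> 0" by (simp add: u_def)
      then have "u * (ln u - 1) \<le> 0"
      proof (cases "u = 0")
        case False
        then have "ln u \<le> 0" using \<open>u \<ge> 0\<close> \<open>\<not> u \<ge> 1\<close> by simp
        then show ?thesis using \<open>u \<ge> 0\<close> by (intro mult_nonneg_nonpos) auto
      qed simp
      then show ?thesis by (simp add: psi_def)
    qed
    have "real (card (SA D m)) \<le> real q ^ m * exp (\<Sum>d=1..D. 1 / real d)"
      using rankin[of 1 D m] by simp
    also have "\<dots> \<le> real q ^ m * (3 * real D)"
      using H e3 q2 by (intro mult_left_mono) (auto intro: order_trans)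
    finally show ?thesis using False psi by (simp add: smooth_bound_def u_def)
  qed
qed

section \<open>Averages of reciprocal orders\<close>

lemma finite_divs: "d \<ge> 1 \<Longrightarrow> finite {N. N dvd q ^ d - 1}"
  using q2 one_less_power[of q d] by (intro finite_divisors_nat) auto

text \<open>Group by the value N of \<open>od\<close>, a divisor of q^d - 1. At most N/d members
  share the value N and each contributes 1/N, so every divisor contributes at most 1. Compared with
  up to q^d/d members this is a gain of about q^-d.\<close>

lemma sum_od: assumes d: "d \<ge> 1" shows "(\<Sum>a\<in>Idg d. 1 / real (od a)) \<le> real (tau d)"
proof -
  have "(\<Sum>a\<in>Idg d. 1 / real (od a)) = (\<Sum>N\<in>{N. N dvd q ^ d - 1}. \<Sum>a\<in>{a \<in> Idg d. od a = N}. 1 / real (od a))"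
    using finite_Idg finite_divs[OF d] od_dvd by (intro sum.group[symmetric]) (auto simp: Idg_def)
  also have "\<dots> \<le> (\<Sum>N\<in>{N. N dvd q ^ d - 1}. 1)"
  proof (rule sum_mono)
    fix N assume "N \<in> {N. N dvd q ^ d - 1}"
    then have N: "N \<ge> 1" using q2 d one_less_power[of q d] by (cases N) auto
    have "card {a \<in> Idg d. od a = N} \<le> d * card {a \<in> Idg d. od a = N}" using d by simp
    also have "\<dots> \<le> N" using od_card[OF N, of d] by (simp add: Idg_def conj_assoc)
    finally show "(\<Sum>a\<in>{a \<in> Idg d. od a = N}. 1 / real (od a)) \<le> 1" using N by (simp add: field_simps)
  qed
  finally show ?thesis by (simp add: tau_def)
qed

text \<open>As for \<open>sum_od\<close>, but with the first member fixed, so that summing over all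
  pairs gains q^-d only once.\<close>

lemma sum_pr: assumes a: "a \<in> Idg d" shows "(\<Sum>b\<in>Idg d. 1 / real (pr a b)) \<le> real (tau d)"
proof -
  have d: "d \<ge> 1" using deg1 IdgD[OF a] by auto
  have dv: "pr a b dvd q ^ d - 1" if "b \<in> Idg d" for b
    using pr_dvd[of a b] a that by (simp add: Idg_def)
  have "(\<Sum>b\<in>Idg d. 1 / real (pr a b)) = (\<Sum>N\<in>{N. N dvd q ^ d - 1}. \<Sum>b\<in>{b \<in> Idg d. pr a b = N}. 1 / real (pr a b))"
    using finite_Idg finite_divs[OF d] dv by (intro sum.group[symmetric]) auto
  also have "\<dots> \<le> (\<Sum>N\<in>{N. N dvd q ^ d - 1}. 1)"
  proof (rule sum_mono)
    fix N assume "N \<in> {N. N dvd q ^ d - 1}"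
    then have N: "N \<ge> 1" using q2 d one_less_power[of q d] by (cases N) auto
    have "card {b \<in> Idg d. pr a b = N} \<le> d * card {b \<in> Idg d. pr a b = N}" using d by simp
    also have "\<dots> \<le> N" using pr_card[OF IdgD(1)[OF a] N] IdgD(2)[OF a] by (simp add: Idg_def conj_assoc)
    finally show "(\<Sum>b\<in>{b \<in> Idg d. pr a b = N}. 1 / real (pr a b)) \<le> 1" using N by (simp add: field_simps)
  qed
  finally show ?thesis by (simp add: tau_def)
qed

text \<open>The gcd of the two orders divides q^d1 - 1 and q^d2 - 1, hence also q^(d1-d2) - 1 by one
  step of Euclid's algorithm.\<close>

lemma inverse_lcm_le:
  assumes a: "a \<in> Idg d1" and b: "b \<in> Idg d2" and d: "d2 < d1"
  shows "1 / real (lcm (od a) (od b)) \<le> real q ^ (d1 - d2) * (1 / real (od a)) * (1 / real (od b))"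
proof -
  have p: "od a \<ge> 1" "od b \<ge> 1" using od1 IdgD a b by auto
  define g where "g = gcd (od a) (od b)"
  have "g dvd q ^ d1 - 1" "g dvd q ^ d2 - 1"
    using od_dvd[of a] od_dvd[of b] IdgD[OF a] IdgD[OF b] unfolding g_def by (metis dvd_trans gcd_dvd1 gcd_dvd2)+
  moreover have "q ^ d1 - 1 = q ^ (d1 - d2) * (q ^ d2 - 1) + (q ^ (d1 - d2) - 1)"
  proof -
    have "q ^ d1 = q ^ (d1 - d2) * q ^ d2" using d by (simp add: power_add[symmetric])
    moreover have "q ^ d2 \<ge> 1" "q ^ (d1 - d2) \<ge> 1" using q2 by simp_all
    ultimately show ?thesis by (simp add: diff_mult_distrib2)
  qed
  ultimately have "g dvd q ^ (d1 - d2) - 1" by (metis dvd_add_right_iff dvd_mult)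
  moreover have "q ^ (d1 - d2) > 1" using q2 d by (intro one_less_power) auto
  ultimately have "g \<le> q ^ (d1 - d2)" using dvd_imp_le[of g "q ^ (d1 - d2) - 1"] by simp
  then have "real g \<le> real q ^ (d1 - d2)" by (metis of_nat_le_iff of_nat_power)
  moreover have "1 / real (lcm (od a) (od b)) = real g / (real (od a) * real (od b))"
  proof -
    have "real g * real (lcm (od a) (od b)) = real (od a) * real (od b)"
      unfolding g_def by (simp only: of_nat_mult[symmetric] prod_gcd_lcm_nat[symmetric])
    moreover have "real (lcm (od a) (od b)) > 0" using p by (simp add: lcm_pos_nat)
    moreover have "real (od a) * real (od b) > 0" using p by simp
    ultimately show ?thesis by (metis divide_eq_eq frac_eq_eq less_irrefl mult.commute mult_1)
  qed
  ultimately show ?thesis using p by (simp add: divide_right_mono)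
qed

text \<open>The set \<open>A\<close> has \<open>k\<close> members of the largest degree \<open>d1\<close>, and \<open>d2\<close> is the next smaller degree,
  with \<open>d2 = 0\<close> if there is none.\<close>
definition C1 :: "nat \<Rightarrow> nat \<Rightarrow> nat \<Rightarrow> nat \<Rightarrow> 'i set set" where
  "C1 m d1 k d2 = {A \<in> FA m. card (A \<inter> Idg d1) = k \<and> (\<forall>a\<in>A. \<delta> a = d1 \<or> \<delta> a \<le> d2) \<and> (d2 = 0 \<or> A \<inter> Idg d2 \<noteq> {})}"

text \<open>All degrees are at most \<open>K\<close>, and \<open>d\<close> is the largest degree that occurs twice.\<close>
definition C2 :: "nat \<Rightarrow> nat \<Rightarrow> nat \<Rightarrow> 'i set set" where
  "C2 m d K = {A \<in> FA m. (\<forall>a\<in>A. \<delta> a \<le> K) \<and> card (A \<inter> Idg d) \<ge> 2 \<and> (\<forall>e>d. card (A \<inter> Idg e) \<le> 1)}"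

section \<open>Total weight of the classes \<open>C1\<close> and \<open>C2\<close>\<close>

lemma binom_le: assumes d: "d \<ge> 1" shows "real (card (Idg d) choose j) \<le> real q ^ (d * j) / (real d ^ j * fact j)"
proof -
  have "real (card (Idg d) choose j) * fact j \<le> real (card (Idg d)) ^ j"
    by (metis (mono_tags, lifting) binomial_fact_pow of_nat_fact of_nat_le_iff of_nat_mult of_nat_power)
  also have "\<dots> \<le> (real q ^ d / real d) ^ j" using card_Idg_real[OF d] by (intro power_mono) auto
  also have "\<dots> = real q ^ (d * j) / real d ^ j" by (simp add: power_divide power_mult)
  finally show ?thesis using d by (simp add: field_simps)
qed

text \<open>Strip the prescribed members \<open>a\<close> and \<open>b\<close>: what remains is a
  set of k - 1 members of degree d1 and a set with all degrees at most d2. The choice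
  \<open>b = a\<close> prescribes a single member, and then \<open>s = 0\<close>.\<close>

lemma card_C1:
  assumes d: "d2 < d1" and a: "a \<in> Idg d1" and k: "k \<ge> 1" and b: "b \<in> Idg d2 \<or> b = a"
  defines "s \<equiv> (if b = a then 0 else d2)"
  shows "real (card {A \<in> C1 m d1 k d2. a \<in> A \<and> b \<in> A}) \<le>
     (if k * d1 + s \<le> m then real q ^ (m - d1 - s) / (real d1 ^ (k - 1) * fact (k - 1)) * smooth_bound (m - k * d1 - s) d2 else 0)"
proof -
  define f where "f A = (A \<inter> Idg d1 - {a}, A - Idg d1 - {b})" for A
  let ?Y = "{A \<in> C1 m d1 k d2. a \<in> A \<and> b \<in> A}"
  have d1: "d1 \<ge> 1" using d by simp
  have ba: "b \<notin> Idg d1" if "b \<noteq> a" using b that d by (auto simp: Idg_def)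
  have inj: "inj_on f ?Y"
  proof (rule inj_onI)
    fix A B assume AB: "A \<in> ?Y" "B \<in> ?Y" "f A = f B"
    have "A = insert a (A \<inter> Idg d1 - {a}) \<union> insert b (A - Idg d1 - {b})" using AB(1) by auto
    also have "\<dots> = insert a (B \<inter> Idg d1 - {a}) \<union> insert b (B - Idg d1 - {b})" using AB(3) by (simp add: f_def)
    also have "\<dots> = B" using AB(2) by auto
    finally show "A = B" .
  qed
  have im: "f A \<in> {S. S \<subseteq> Idg d1 \<and> card S = k - 1} \<times> SA d2 (m - k * d1 - s) \<and> k * d1 + s \<le> m" if A: "A \<in> ?Y" for A
  proof -
    have A1: "finite A" "A \<subseteq> I" "sum \<delta> A = m" "card (A \<inter> Idg d1) = k" "\<forall>a\<in>A. \<delta> a = d1 \<or> \<delta> a \<le> d2" "a \<in> A" "b \<in> A"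
      using A by (auto simp: C1_def FA_def)
    have "sum \<delta> A = sum \<delta> (A \<inter> Idg d1) + sum \<delta> (A - Idg d1)"
      using A1(1) by (metis sum.Int_Diff)
    also have "sum \<delta> (A \<inter> Idg d1) = k * d1" using A1(4) by (simp add: Idg_def)
    finally have s1: "m = k * d1 + sum \<delta> (A - Idg d1)" using A1(3) by simp
    have s2: "sum \<delta> (A - Idg d1) = s + sum \<delta> (A - Idg d1 - {b})"
    proof (cases "b = a")
      case True then show ?thesis using a by (simp add: s_def)
    next
      case False
      then have "b \<in> A - Idg d1" "\<delta> b = d2" using ba A1(7) b IdgD(2) by auto
      then show ?thesis using A1(1) False by (simp add: s_def sum.remove[of "A - Idg d1" b])
    qed
    have "A - Idg d1 - {b} \<in> SA d2 (m - k * d1 - s)"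
      using A1 s1 s2 by (auto simp: SA_def FA_def Idg_def)
    moreover have "card (A \<inter> Idg d1 - {a}) = k - 1" using A1 a by simp
    moreover have "A \<inter> Idg d1 - {a} \<subseteq> Idg d1" by blast
    ultimately show ?thesis using s1 s2 by (simp add: f_def)
  qed
  show ?thesis
  proof (cases "k * d1 + s \<le> m")
    case False
    then have "?Y = {}" using im by blast
    then show ?thesis using False by (simp only: card.empty if_False of_nat_0)
  next
    case True
    have fin: "finite ({S. S \<subseteq> Idg d1 \<and> card S = k - 1} \<times> SA d2 (m - k * d1 - s))"
      using finite_Idg finite_SA by (intro finite_cartesian_product) (auto intro: finite_subset[of _ "Pow (Idg d1)"])
    have "card ?Y \<le> card ({S. S \<subseteq> Idg d1 \<and> card S = k - 1} \<times> SA d2 (m - k * d1 - s))"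
      using im by (intro card_inj_on_le[OF inj _ fin]) blast
    also have "\<dots> = (card (Idg d1) choose (k - 1)) * card (SA d2 (m - k * d1 - s))"
      by (simp add: card_cartesian_product n_subsets[OF finite_Idg])
    finally have "real (card ?Y) \<le> real (card (Idg d1) choose (k - 1)) * real (card (SA d2 (m - k * d1 - s)))"
      by (rule of_nat_le_mult)
    also have "\<dots> \<le> (real q ^ (d1 * (k - 1)) / (real d1 ^ (k - 1) * fact (k - 1))) * (real q ^ (m - k * d1 - s) * smooth_bound (m - k * d1 - s) d2)"
      using binom_le[OF d1] card_SA by (intro mult_mono) auto
    also have "\<dots> = real q ^ (m - d1 - s) / (real d1 ^ (k - 1) * fact (k - 1)) * smooth_bound (m - k * d1 - s) d2"
    proof -
      have "d1 * (k - 1) + (m - k * d1 - s) = m - d1 - s"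
        using True k by (cases k) (auto simp: algebra_simps)
      then show ?thesis by (simp add: power_add[symmetric] mult.assoc[symmetric])
    qed
    finally show ?thesis unfolding if_P[OF True] .
  qed
qed

lemma smooth_bound_nonneg: "smooth_bound n D \<ge> 0" by (simp add: smooth_bound_def)

lemma finite_C1: "finite (C1 m d1 k d2)" using finite_FA by (rule finite_subset[rotated]) (auto simp: C1_def)
lemma finite_C2: "finite (C2 m d K)" using finite_FA by (rule finite_subset[rotated]) (auto simp: C2_def)

text \<open>Union bound over a prescribed member of the largest degree. Summing q/od over this
  member replaces q^d1 by q times a divisor function, a gain of q^(1 - d1).\<close>

lemma sum_C1_first:
  assumes d: "d2 < d1" and k: "k \<ge> 1"
  shows "(\<Sum>A\<in>C1 m d1 k d2. w A) \<le>
    (if k * d1 \<le> m then real q * real (tau d1) * (real q ^ (m - d1) / (real d1 ^ (k - 1) * fact (k - 1)) * smooth_bound (m - k * d1) d2) else 0)"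
    (is "_ \<le> (if _ then real q * real (tau d1) * ?Z else 0)")
proof -
  have d1: "d1 \<ge> 1" using d by simp
  define Y where "Y a = {A \<in> C1 m d1 k d2. a \<in> A}" for a
  have fY: "finite (Y a)" for a using finite_C1 by (simp add: Y_def)
  have sub: "C1 m d1 k d2 \<subseteq> (\<Union>a\<in>Idg d1. Y a)"
  proof
    fix A assume A: "A \<in> C1 m d1 k d2"
    then have "A \<inter> Idg d1 \<noteq> {}" using k by (auto simp: C1_def)
    then show "A \<in> (\<Union>a\<in>Idg d1. Y a)" using A by (auto simp: Y_def)
  qed
  have "(\<Sum>A\<in>C1 m d1 k d2. w A) \<le> (\<Sum>A\<in>(\<Union>a\<in>Idg d1. Y a). w A)"
    using sub fY finite_Idg w0 by (intro sum_mono2) auto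
  also have "\<dots> \<le> (\<Sum>a\<in>Idg d1. \<Sum>A\<in>Y a. w A)"
    using finite_Idg fY w0 by (intro sum_UN_le) auto
  also have "\<dots> \<le> (\<Sum>a\<in>Idg d1. real q * (1 / real (od a)) * real (card (Y a)))"
  proof (rule sum_mono)
    fix a assume a: "a \<in> Idg d1"
    have "w A \<le> real q * (1 / real (od a))" if "A \<in> Y a" for A
    proof -
      have "w A \<le> real (q - 1) / real (od a)" using w_od[of A a a] that by (auto simp: Y_def C1_def FA_def)
      also have "\<dots> \<le> real q * (1 / real (od a))" by (simp add: divide_right_mono)
      finally show ?thesis .
    qed
    then have "(\<Sum>A\<in>Y a. w A) \<le> of_nat (card (Y a)) * (real q * (1 / real (od a)))" by (rule sum_bounded_above)
    then show "(\<Sum>A\<in>Y a. w A) \<le> real q * (1 / real (od a)) * real (card (Y a))" by (simp add: mult.commute)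
  qed
  also have "\<dots> \<le> (\<Sum>a\<in>Idg d1. real q * (1 / real (od a)) * (if k * d1 \<le> m then ?Z else 0))"
  proof (intro sum_mono mult_left_mono)
    fix a assume a: "a \<in> Idg d1"
    show "real (card (Y a)) \<le> (if k * d1 \<le> m then ?Z else 0)"
      using card_C1[OF d a k, of a m] by (auto simp: Y_def split: if_splits)
  qed simp
  also have "\<dots> = real q * (\<Sum>a\<in>Idg d1. 1 / real (od a)) * (if k * d1 \<le> m then ?Z else 0)"
    by (simp add: sum_distrib_left sum_distrib_right)
  also have "\<dots> \<le> real q * real (tau d1) * (if k * d1 \<le> m then ?Z else 0)"
    using sum_od[OF d1] smooth_bound_nonneg by (intro mult_right_mono mult_left_mono) auto
  finally have le: "(\<Sum>A\<in>C1 m d1 k d2. w A) \<le> real q * real (tau d1) * (if k * d1 \<le> m then ?Z else 0)" .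
  show ?thesis
  proof (cases "k * d1 \<le> m")
    case True then show ?thesis using le unfolding if_P[OF True] by (simp only: mult.assoc)
  next
    case False
    show ?thesis using le unfolding if_not_P[OF False] mult_zero_right .
  qed
qed

text \<open>One member of each of the two largest degrees is prescribed. The gcd costs q^(d1-d2),
  the two averages gain q^(-d1-d2), and with the factor q from \<open>w_od\<close> the total is q^(1
  - 2 d2). This beats \<open>sum_C1_first\<close> when 2 d2 > d1.\<close>

lemma sum_C1_second:
  assumes d: "d2 < d1" "d2 \<ge> 1" and k: "k \<ge> 1"
  shows "(\<Sum>A\<in>C1 m d1 k d2. w A) \<le>
    (if k * d1 + d2 \<le> m then real q * real q ^ (d1 - d2) * real (tau d1) * real (tau d2) * (real q ^ (m - d1 - d2) / (real d1 ^ (k - 1) * fact (k - 1)) * smooth_bound (m - k * d1 - d2) d2) else 0)"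
    (is "_ \<le> (if _ then ?c * real (tau d1) * real (tau d2) * ?Z else 0)")
proof -
  have d1: "d1 \<ge> 1" using d by simp
  define Y where "Y = (\<lambda>(a, b). {A \<in> C1 m d1 k d2. a \<in> A \<and> b \<in> A})"
  have fY: "finite (Y a)" for a using finite_C1 by (simp add: Y_def split: prod.split)
  define J where "J = Idg d1 \<times> Idg d2"
  have fJ: "finite J" using finite_Idg by (simp add: J_def)
  have sub: "C1 m d1 k d2 \<subseteq> (\<Union>a\<in>J. Y a)"
  proof
    fix A assume A: "A \<in> C1 m d1 k d2"
    then have "A \<inter> Idg d1 \<noteq> {}" "A \<inter> Idg d2 \<noteq> {}" using k d by (auto simp: C1_def)
    then obtain a b where "a \<in> A" "a \<in> Idg d1" "b \<in> A" "b \<in> Idg d2" by blast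
    then show "A \<in> (\<Union>a\<in>J. Y a)" using A by (auto simp: Y_def J_def)
  qed
  have "(\<Sum>A\<in>C1 m d1 k d2. w A) \<le> (\<Sum>A\<in>(\<Union>a\<in>J. Y a). w A)"
    using sub fY fJ w0 by (intro sum_mono2) auto
  also have "\<dots> \<le> (\<Sum>a\<in>J. \<Sum>A\<in>Y a. w A)"
    using fJ fY w0 by (intro sum_UN_le) auto
  also have "\<dots> \<le> (\<Sum>(a, b)\<in>J. ?c * (1 / real (od a)) * (1 / real (od b)) * (if k * d1 + d2 \<le> m then ?Z else 0))"
  proof (rule sum_mono, clarify)
    fix a b assume "(a, b) \<in> J"
    then have ab: "a \<in> Idg d1" "b \<in> Idg d2" by (auto simp: J_def)
    have "w A \<le> ?c * (1 / real (od a)) * (1 / real (od b))" if "A \<in> Y (a, b)" for A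
    proof -
      have "w A \<le> real (q - 1) * (1 / real (lcm (od a) (od b)))" using w_od[of A a b] that by (auto simp: Y_def C1_def FA_def)
      also have "\<dots> \<le> real q * (real q ^ (d1 - d2) * (1 / real (od a)) * (1 / real (od b)))"
        using inverse_lcm_le[OF ab d(1)] by (intro mult_mono) auto
      finally show ?thesis by simp
    qed
    then have 1: "(\<Sum>A\<in>Y (a, b). w A) \<le> of_nat (card (Y (a, b))) * (?c * (1 / real (od a)) * (1 / real (od b)))"
      by (rule sum_bounded_above)
    have 2: "real (card (Y (a, b))) \<le> (if k * d1 + d2 \<le> m then ?Z else 0)"
    proof -
      have "b \<noteq> a" using ab d by (auto simp: Idg_def)
      then show ?thesis using card_C1[OF d(1) ab(1) k, of b m] ab(2) by (auto simp: Y_def split: if_splits)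
    qed
    have 3: "of_nat (card (Y (a, b))) * (?c * (1 / real (od a)) * (1 / real (od b))) \<le> (if k * d1 + d2 \<le> m then ?Z else 0) * (?c * (1 / real (od a)) * (1 / real (od b)))"
      by (rule mult_right_mono[OF 2]) simp
    show "(\<Sum>A\<in>Y (a, b). w A) \<le> ?c * (1 / real (od a)) * (1 / real (od b)) * (if k * d1 + d2 \<le> m then ?Z else 0)"
      by (rule order_trans[OF 1 order_trans[OF 3]]) (simp only: mult.commute order_refl)
  qed
  also have "\<dots> = ?c * ((\<Sum>a\<in>Idg d1. 1 / real (od a)) * (\<Sum>b\<in>Idg d2. 1 / real (od b))) * (if k * d1 + d2 \<le> m then ?Z else 0)"
    unfolding J_def sum.cartesian_product[symmetric] sum_product unfolding sum_distrib_left sum_distrib_right by (intro sum.cong refl) (simp only: mult_ac)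
  also have "\<dots> \<le> ?c * (real (tau d1) * real (tau d2)) * (if k * d1 + d2 \<le> m then ?Z else 0)"
    using sum_od[OF d1] sum_od[OF d(2)] smooth_bound_nonneg by (intro mult_right_mono mult_left_mono mult_mono) (auto intro: sum_nonneg)
  finally have le: "(\<Sum>A\<in>C1 m d1 k d2. w A) \<le> ?c * (real (tau d1) * real (tau d2)) * (if k * d1 + d2 \<le> m then ?Z else 0)" .
  show ?thesis
  proof (cases "k * d1 + d2 \<le> m")
    case True then show ?thesis using le unfolding if_P[OF True] by (simp only: mult.assoc)
  next
    case False
    show ?thesis using le unfolding if_not_P[OF False] mult_zero_right .
  qed
qed

text \<open>Apart from \<open>a\<close> and \<open>b\<close> the set consists of members of degree
  above \<open>d\<close>, whose degrees are pairwise distinct and at most \<open>K\<close>, so that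
  their sum \<open>s\<close> is at most K^2, and of members of degree at most \<open>d\<close>.
  Recording \<open>s\<close> fixes the degree sum of the second part.\<close>

lemma card_C2:
  assumes a: "a \<in> Idg d" and b: "b \<in> Idg d" "b \<noteq> a"
  shows "real (card {A \<in> C2 m d K. a \<in> A \<and> b \<in> A}) \<le>
     (\<Sum>s\<in>{s. s \<le> K * K \<and> 2 * d + s \<le> m}. real q ^ (m - 2 * d) * smooth_bound s K * smooth_bound (m - 2 * d - s) d)"
proof -
  let ?Y = "{A \<in> C2 m d K. a \<in> A \<and> b \<in> A}"
  let ?S = "{s. s \<le> K * K \<and> 2 * d + s \<le> m}"
  define U where "U A = {x \<in> A. \<delta> x > d}" for A
  define V where "V A = {x \<in> A. \<delta> x \<le> d} - {a, b}" for A
  define f where "f A = (sum \<delta> (U A), U A, V A)" for A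
  define Z where "Z = (SIGMA s:?S. SA K s \<times> SA d (m - 2 * d - s))"
  have fS: "finite ?S" by (rule finite_subset[of _ "{..K * K}"]) auto
  have fZ: "finite Z" unfolding Z_def using fS finite_SA by (intro finite_SigmaI finite_cartesian_product)
  have inj: "inj_on f ?Y"
  proof (rule inj_onI)
    fix A B assume AB: "A \<in> ?Y" "B \<in> ?Y" "f A = f B"
    have *: "U C \<union> V C \<union> {a, b} = C" if "C \<in> ?Y" for C using that by (auto simp: U_def V_def)
    have "U A = U B" "V A = V B" using AB(3) by (simp_all add: f_def)
    then have "U A \<union> V A \<union> {a, b} = U B \<union> V B \<union> {a, b}" by simp
    then show "A = B" unfolding *[OF AB(1)] *[OF AB(2)] .
  qed
  have im: "f A \<in> Z" if A: "A \<in> ?Y" for A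
  proof -
    have A1: "finite A" "A \<subseteq> I" "sum \<delta> A = m" "\<forall>x\<in>A. \<delta> x \<le> K" "\<forall>e>d. card (A \<inter> Idg e) \<le> 1" "a \<in> A" "b \<in> A"
      using A by (auto simp: C2_def FA_def)
    have fin: "finite (U A)" "finite (V A)" using A1(1) by (auto simp: U_def V_def)
    have eqA: "U A \<union> {x \<in> A. \<delta> x \<le> d} = A" by (auto simp: U_def)
    have "sum \<delta> (U A \<union> {x \<in> A. \<delta> x \<le> d}) = sum \<delta> (U A) + sum \<delta> {x \<in> A. \<delta> x \<le> d}"
    proof (rule sum.union_disjoint[OF fin(1)])
      show "finite {x \<in> A. \<delta> x \<le> d}" using A1(1) by simp
      show "U A \<inter> {x \<in> A. \<delta> x \<le> d} = {}" unfolding U_def by force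
    qed
    then have "m = sum \<delta> (U A) + sum \<delta> {x \<in> A. \<delta> x \<le> d}" by (simp only: eqA A1(3))
    moreover have "sum \<delta> {x \<in> A. \<delta> x \<le> d} = sum \<delta> (V A) + 2 * d"
    proof -
      have "{a, b} \<subseteq> {x \<in> A. \<delta> x \<le> d}" using A1(6,7) IdgD(2)[OF a] IdgD(2)[OF b(1)] by simp
      then have "V A \<union> {a, b} = {x \<in> A. \<delta> x \<le> d}" unfolding V_def by blast
      moreover have "sum \<delta> (V A \<union> {a, b}) = sum \<delta> (V A) + sum \<delta> {a, b}"
        using fin(2) by (intro sum.union_disjoint) (auto simp: V_def)
      ultimately have "sum \<delta> {x \<in> A. \<delta> x \<le> d} = sum \<delta> (V A) + sum \<delta> {a, b}" by (simp only: )
      then show ?thesis using IdgD(2)[OF a] IdgD(2)[OF b(1)] b(2) by simp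
    qed
    ultimately have m: "m = sum \<delta> (U A) + sum \<delta> (V A) + 2 * d" by simp
    have "sum \<delta> (U A) \<le> K * K"
    proof -
      have "inj_on \<delta> (U A)"
      proof (rule inj_onI)
        fix x y assume xy: "x \<in> U A" "y \<in> U A" "\<delta> x = \<delta> y"
        then have "card (A \<inter> Idg (\<delta> x)) \<le> 1" "{x, y} \<subseteq> A \<inter> Idg (\<delta> x)"
          using A1(2,5) by (auto simp: U_def Idg_def)
        then have "card {x, y} \<le> 1" using A1(1) card_mono[of "A \<inter> Idg (\<delta> x)" "{x, y}"] by simp
        then show "x = y" by (cases "x = y") auto
      qed
      moreover have "\<delta> ` U A \<subseteq> {1..K}" using A1(2,4) deg1 by (fastforce simp: U_def)
      ultimately have "card (U A) \<le> K" using card_inj_on_le[of \<delta> "U A" "{1..K}"] by simp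
      moreover have "sum \<delta> (U A) \<le> of_nat (card (U A)) * K" using A1(4) by (intro sum_bounded_above) (auto simp: U_def)
      ultimately show ?thesis by (metis le_trans mult_le_mono1 of_nat_id)
    qed
    then show ?thesis using m A1 fin unfolding f_def Z_def by (auto simp: SA_def FA_def U_def V_def)
  qed
  have "card ?Y \<le> card Z" using im by (intro card_inj_on_le[OF inj _ fZ]) blast
  also have "card Z = (\<Sum>s\<in>?S. card (SA K s) * card (SA d (m - 2 * d - s)))"
    unfolding Z_def using fS finite_SA by (subst card_SigmaI) (auto simp: card_cartesian_product)
  finally have "real (card ?Y) \<le> (\<Sum>s\<in>?S. real (card (SA K s)) * real (card (SA d (m - 2 * d - s))))"
    by (simp flip: of_nat_mult of_nat_sum)
  also have "\<dots> \<le> (\<Sum>s\<in>?S. real q ^ (m - 2 * d) * smooth_bound s K * smooth_bound (m - 2 * d - s) d)"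
  proof (rule sum_mono)
    fix s assume s: "s \<in> ?S"
    have "real (card (SA K s)) * real (card (SA d (m - 2 * d - s))) \<le> (real q ^ s * smooth_bound s K) * (real q ^ (m - 2 * d - s) * smooth_bound (m - 2 * d - s) d)"
      using card_SA smooth_bound_nonneg by (intro mult_mono) auto
    also have "\<dots> = (real q ^ s * real q ^ (m - 2 * d - s)) * smooth_bound s K * smooth_bound (m - 2 * d - s) d" by simp
    also have "real q ^ s * real q ^ (m - 2 * d - s) = real q ^ (m - 2 * d)" using s by (simp add: power_add[symmetric])
    finally show "real (card (SA K s)) * real (card (SA d (m - 2 * d - s))) \<le> real q ^ (m - 2 * d) * smooth_bound s K * smooth_bound (m - 2 * d - s) d" .
  qed
  finally show ?thesis .
qed

text \<open>The bound \<open>w_pr\<close> carries no factor q, in contrast to \<open>w_od\<close>;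
  this matters because \<open>d\<close> is bounded in the applications. Summing over
  \<open>b\<close> costs only the divisor function and summing over \<open>a\<close> costs q^d, so
  against the q^(2d) choices of a pair a factor q^-d is gained.\<close>

lemma sum_C2:
  assumes d: "d \<ge> 1"
  shows "(\<Sum>A\<in>C2 m d K. w A) \<le>
    real (tau d) * (\<Sum>s\<in>{s. s \<le> K * K \<and> 2 * d + s \<le> m}. real q ^ (m - d) * smooth_bound s K * smooth_bound (m - 2 * d - s) d)"
proof -
  let ?S = "{s. s \<le> K * K \<and> 2 * d + s \<le> m}"
  define Z where "Z = (\<Sum>s\<in>?S. real q ^ (m - 2 * d) * smooth_bound s K * smooth_bound (m - 2 * d - s) d)"
  have Z0: "Z \<ge> 0" unfolding Z_def using smooth_bound_nonneg by (intro sum_nonneg) simp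
  define Y where "Y = (\<lambda>(a, b). {A \<in> C2 m d K. a \<in> A \<and> b \<in> A})"
  define J where "J = {(a, b) \<in> Idg d \<times> Idg d. b \<noteq> a}"
  have fJ: "finite J" using finite_Idg unfolding J_def by (auto intro: finite_subset[OF _ finite_cartesian_product[of "Idg d" "Idg d"]])
  have fY: "finite (Y a)" for a using finite_C2 by (simp add: Y_def split: prod.split)
  have sub: "C2 m d K \<subseteq> (\<Union>a\<in>J. Y a)"
  proof
    fix A assume A: "A \<in> C2 m d K"
    then have "card (A \<inter> Idg d) \<ge> 2" by (simp add: C2_def)
    then obtain S where "S \<subseteq> A \<inter> Idg d" "card S = 2" by (rule obtain_subset_with_card_n)
    then obtain a b where "a \<in> A \<inter> Idg d" "b \<in> A \<inter> Idg d" "b \<noteq> a" unfolding card_2_iff by blast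
    then show "A \<in> (\<Union>a\<in>J. Y a)" using A by (auto simp: Y_def J_def)
  qed
  have "(\<Sum>A\<in>C2 m d K. w A) \<le> (\<Sum>A\<in>(\<Union>a\<in>J. Y a). w A)"
    using sub fY fJ w0 by (intro sum_mono2) auto
  also have "\<dots> \<le> (\<Sum>a\<in>J. \<Sum>A\<in>Y a. w A)"
    using fJ fY w0 by (intro sum_UN_le) auto
  also have "\<dots> \<le> (\<Sum>(a, b)\<in>J. (1 / real (pr a b)) * Z)"
  proof (rule sum_mono, clarify)
    fix a b assume "(a, b) \<in> J"
    then have ab: "a \<in> Idg d" "b \<in> Idg d" "b \<noteq> a" by (auto simp: J_def)
    have "w A \<le> 1 / real (pr a b)" if "A \<in> Y (a, b)" for A
      using w_pr[of A a b] that IdgD(2)[OF ab(1)] IdgD(2)[OF ab(2)] by (auto simp: Y_def C2_def FA_def)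
    then have 1: "(\<Sum>A\<in>Y (a, b). w A) \<le> of_nat (card (Y (a, b))) * (1 / real (pr a b))" by (rule sum_bounded_above)
    have "real (card (Y (a, b))) \<le> Z" using card_C2[OF ab, of m K] by (simp add: Y_def Z_def)
    then have "of_nat (card (Y (a, b))) * (1 / real (pr a b)) \<le> Z * (1 / real (pr a b))" by (rule mult_right_mono) simp
    then show "(\<Sum>A\<in>Y (a, b). w A) \<le> (1 / real (pr a b)) * Z" using 1 by (simp only: mult.commute)
  qed
  also have "\<dots> \<le> (\<Sum>(a, b)\<in>Idg d \<times> Idg d. (1 / real (pr a b)) * Z)"
    using finite_Idg Z0 by (intro sum_mono2) (auto simp: J_def)
  also have "\<dots> = (\<Sum>a\<in>Idg d. (\<Sum>b\<in>Idg d. 1 / real (pr a b)) * Z)"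
    by (simp add: sum.cartesian_product[symmetric] sum_distrib_right)
  also have "\<dots> \<le> (\<Sum>a\<in>Idg d. real (tau d) * Z)"
    using sum_pr Z0 by (intro sum_mono mult_right_mono) auto
  also have "\<dots> = real (card (Idg d)) * (real (tau d) * Z)" by simp
  also have "\<dots> \<le> real q ^ d * (real (tau d) * Z)"
    using card_Idg_le Z0 by (intro mult_right_mono) (auto simp flip: of_nat_power)
  also have "\<dots> = real (tau d) * (real q ^ d * Z)" by simp
  also have "real q ^ d * Z = (\<Sum>s\<in>?S. real q ^ (m - d) * smooth_bound s K * smooth_bound (m - 2 * d - s) d)"
    unfolding Z_def sum_distrib_left
  proof (rule sum.cong)
    fix s assume "s \<in> ?S"
    then have "real q ^ d * real q ^ (m - 2 * d) = real q ^ (m - d)" by (simp add: power_add[symmetric])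
    then show "real q ^ d * (real q ^ (m - 2 * d) * smooth_bound s K * smooth_bound (m - 2 * d - s) d) = real q ^ (m - d) * smooth_bound s K * smooth_bound (m - 2 * d - s) d"
      by (simp add: mult.assoc[symmetric])
  qed simp
  finally show ?thesis .
qed

lemma T_le_trivial: "T m \<le> real q ^ m * smooth_bound m m"
proof -
  have "T m \<le> of_nat (card (FA m)) * 1" unfolding T_def using w1 by (intro sum_bounded_above)
  then show ?thesis using card_SA[of m m] FA_eq_SA[of m] by simp
qed

text \<open>A set with all degrees at most \<open>K\<close> and pairwise distinct has degree sum at most \<open>K\<^sup>2\<close>.\<close>
lemma T_decomposition:
  assumes m: "m \<ge> 1" and K: "K \<ge> 1"
  shows "T m \<le> (\<Sum>(d1, k, d2)\<in>{(d1, k, d2). K < d1 \<and> d1 \<le> m \<and> 1 \<le> k \<and> k \<le> m \<and> d2 < d1}. \<Sum>A\<in>C1 m d1 k d2. w A)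
     + (\<Sum>d\<in>{1..K}. \<Sum>A\<in>C2 m d K. w A)
     + (if m \<le> K * K then real q ^ m * smooth_bound m m else 0)"
proof -
  define J where "J = {(d1, k, d2). K < d1 \<and> d1 \<le> m \<and> 1 \<le> k \<and> k \<le> m \<and> d2 < d1}"
  have fJ: "finite J" unfolding J_def by (rule finite_subset[of _ "{..m} \<times> {..m} \<times> {..m}"]) auto
  define Y where "Y = (\<lambda>(d1, k, d2). C1 m d1 k d2)"
  define C3 where "C3 = (if m \<le> K * K then FA m else {})"
  have fin: "finite (Y j)" "finite C3" for j using finite_C1 finite_FA by (auto simp: Y_def C3_def split: prod.split)
  have cover: "FA m \<subseteq> (\<Union>j\<in>J. Y j) \<union> (\<Union>d\<in>{1..K}. C2 m d K) \<union> C3"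
  proof
    fix A assume A: "A \<in> FA m"
    then have A1: "finite A" "A \<subseteq> I" "sum \<delta> A = m" by (auto simp: FA_def)
    then have ne: "A \<noteq> {}" using m by auto
    define d1 where "d1 = Max (\<delta> ` A)"
    have d1: "\<And>a. a \<in> A \<Longrightarrow> \<delta> a \<le> d1" "d1 \<in> \<delta> ` A" using A1(1) ne by (auto simp: d1_def)
    show "A \<in> (\<Union>j\<in>J. Y j) \<union> (\<Union>d\<in>{1..K}. C2 m d K) \<union> C3"
    proof (cases "K < d1")
      case True
      define k where "k = card (A \<inter> Idg d1)"
      define B where "B = A - Idg d1"
      define d2 where "d2 = (if B = {} then 0 else Max (\<delta> ` B))"
      have fB: "finite B" using A1(1) by (simp add: B_def)
      have "A \<inter> Idg d1 \<noteq> {}" using d1(2) A1(2) by (auto simp: Idg_def)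
      then have k1: "k \<ge> 1" using A1(1) by (simp add: k_def Suc_le_eq card_gt_0_iff)
      have "card A \<le> sum \<delta> A" using A1(2) deg1 sum_mono[of A "\<lambda>_. 1" \<delta>] by auto
      moreover have "k \<le> card A" unfolding k_def using A1(1) by (intro card_mono) auto
      ultimately have km: "k \<le> m" using A1(3) by simp
      have d1m: "d1 \<le> m" using d1(2) deg_le_sum[OF A] by auto
      have d2B: "d2 \<in> \<delta> ` B" if "B \<noteq> {}" using Max_in[of "\<delta> ` B"] fB that by (simp add: d2_def)
      have Blt: "\<delta> b < d1" if "b \<in> B" for b using that d1(1)[of b] A1(2) by (auto simp: B_def Idg_def le_less)
      have d2lt: "d2 < d1" using d2B Blt True by (cases "B = {}") (auto simp: d2_def)
      have "\<delta> a = d1 \<or> \<delta> a \<le> d2" if "a \<in> A" for a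
      proof (cases "a \<in> B")
        case True
        then have "\<delta> a \<le> Max (\<delta> ` B)" using fB by simp
        then show ?thesis using True by (auto simp: d2_def)
      qed (use that in \<open>auto simp: B_def Idg_def\<close>)
      moreover have "d2 = 0 \<or> A \<inter> Idg d2 \<noteq> {}"
        using d2B A1(2) by (cases "B = {}") (auto simp: d2_def B_def Idg_def)
      ultimately have "A \<in> C1 m d1 k d2" using A by (auto simp: C1_def k_def)
      moreover have "(d1, k, d2) \<in> J" using True d1m k1 km d2lt by (simp add: J_def)
      ultimately show ?thesis unfolding Y_def by blast
    next
      case False
      then have le: "\<forall>a\<in>A. \<delta> a \<le> K" using d1(1) by force
      \<comment> \<open>The repeated degrees. The largest of them is the index \<open>d\<close> of
        the class \<open>C2\<close> that contains \<open>A\<close>.\<close>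
      define E where "E = {e \<in> {1..K}. card (A \<inter> Idg e) \<ge> 2}"
      have out: "card (A \<inter> Idg e) \<le> 1" if "e \<notin> E" for e
      proof (cases "e \<in> {1..K}")
        case False
        then have "A \<inter> Idg e = {}" using le A1(2) deg1 by (fastforce simp: Idg_def)
        then show ?thesis by (simp only:) simp
      qed (use that in \<open>auto simp: E_def\<close>)
      show ?thesis
      proof (cases "E = {}")
        case False
        define d where "d = Max E"
        have fE: "finite E" by (simp add: E_def)
        have "d \<in> E" using False fE by (simp add: d_def)
        moreover have "card (A \<inter> Idg e) \<le> 1" if "e > d" for e
          using out[of e] that Max_ge[OF fE, of e] unfolding d_def by (meson leD)
        ultimately have "A \<in> C2 m d K" "d \<in> {1..K}" using A le by (auto simp: C2_def E_def)
        then show ?thesis by blast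
      next
        case True
        have "sum \<delta> A = (\<Sum>e\<in>{1..K}. \<Sum>a\<in>{a \<in> A. \<delta> a = e}. \<delta> a)"
          using A1(1,2) le deg1 by (intro sum.group[symmetric]) auto
        also have "\<dots> \<le> (\<Sum>e\<in>{1..K}. K)"
        proof (rule sum_mono)
          fix e assume e: "e \<in> {1..K}"
          have eq: "{a \<in> A. \<delta> a = e} = A \<inter> Idg e" using A1(2) by (auto simp: Idg_def)
          have "sum \<delta> (A \<inter> Idg e) = (\<Sum>a\<in>A \<inter> Idg e. e)" by (rule sum.cong) (simp_all add: Idg_def)
          then have "(\<Sum>a\<in>{a \<in> A. \<delta> a = e}. \<delta> a) = card (A \<inter> Idg e) * e" unfolding eq by simp
          also have "\<dots> \<le> 1 * K" using out[of e] True e by (intro mult_mono) auto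
          finally show "(\<Sum>a\<in>{a \<in> A. \<delta> a = e}. \<delta> a) \<le> K" by simp
        qed
        finally have "m \<le> K * K" using A1(3) by simp
        then show ?thesis using A by (simp add: C3_def)
      qed
    qed
  qed
  have fU: "finite (\<Union>j\<in>J. Y j)" "finite (\<Union>d\<in>{1..K}. C2 m d K)" using fJ fin finite_C2 by auto
  have un: "sum w (A \<union> B) \<le> sum w A + sum w B" if "finite A" "finite B" for A B
    using sum.union_inter[OF that, of w] sum_nonneg[of "A \<inter> B" w] w0 by simp
  have "T m \<le> sum w ((\<Union>j\<in>J. Y j) \<union> (\<Union>d\<in>{1..K}. C2 m d K) \<union> C3)"
    unfolding T_def using cover fU fin w0 by (intro sum_mono2) auto
  moreover have "\<dots> \<le> sum w ((\<Union>j\<in>J. Y j) \<union> (\<Union>d\<in>{1..K}. C2 m d K)) + sum w C3"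
    using fU fin by (intro un) auto
  moreover have "sum w ((\<Union>j\<in>J. Y j) \<union> (\<Union>d\<in>{1..K}. C2 m d K)) \<le> sum w (\<Union>j\<in>J. Y j) + sum w (\<Union>d\<in>{1..K}. C2 m d K)"
    by (rule un[OF fU])
  moreover have "sum w (\<Union>j\<in>J. Y j) \<le> (\<Sum>j\<in>J. sum w (Y j))" using fJ fin w0 by (intro sum_UN_le) auto
  moreover have "sum w (\<Union>d\<in>{1..K}. C2 m d K) \<le> (\<Sum>d\<in>{1..K}. sum w (C2 m d K))"
    using finite_C2 w0 by (intro sum_UN_le) auto
  moreover have "sum w C3 \<le> (if m \<le> K * K then real q ^ m * smooth_bound m m else 0)"
    using T_le_trivial[of m] by (simp add: C3_def T_def)
  ultimately have "T m \<le> (\<Sum>j\<in>J. sum w (Y j)) + (\<Sum>d\<in>{1..K}. sum w (C2 m d K)) + (if m \<le> K * K then real q ^ m * smooth_bound m m else 0)"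
    by linarith
  moreover have "(\<Sum>j\<in>J. sum w (Y j)) = (\<Sum>(d1, k, d2)\<in>J. sum w (C1 m d1 k d2))"
    by (rule sum.cong) (auto simp: Y_def)
  ultimately show ?thesis unfolding J_def by (simp only:)
qed

end

section \<open>Asymptotics of the weighted count\<close>

lemma card_divisors_prime_power:
  fixes n p a :: nat
  assumes n: "n = p ^ a * m" "m > 0" "Factorial_Ring.prime p"
  shows "card {d. d dvd n} \<le> (a + 1) * card {d. d dvd m}"
proof -
  have "{d. d dvd n} \<subseteq> (\<lambda>(i, e). p ^ i * e) ` ({..a} \<times> {d. d dvd m})"
  proof
    fix d assume "d \<in> {d. d dvd n}"
    then have "d dvd p ^ a * m" using n by simp
    then obtain x e where xe: "d = x * e" "x dvd p ^ a" "e dvd m" by (meson division_decomp)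
    obtain i where "i \<le> a" "x = p ^ i" using xe(2) n(3) divides_primepow_nat by blast
    then show "d \<in> (\<lambda>(i, e). p ^ i * e) ` ({..a} \<times> {d. d dvd m})" using xe by auto
  qed
  then have "card {d. d dvd n} \<le> card ({..a} \<times> {d. d dvd m})"
    using n by (intro surj_card_le) auto
  then show ?thesis by (simp add: card_cartesian_product)
qed

text \<open>For a prime $p \ge 2^{1/\theta}$ one has $a+1 \le 2^a \le p^{\theta a}$, so only finitely many
  primes contribute to the constant.\<close>
lemma divisor_bound:
  fixes \<theta> :: real
  assumes \<theta>: "\<theta> > 0"
  obtains C where "C \<ge> 1" "\<And>n. n \<ge> 1 \<Longrightarrow> real (card {d. d dvd n}) \<le> C * real n powr \<theta>"
proof -
  define B where "B = nat \<lceil>2 powr (1 / \<theta>)\<rceil>"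
  \<comment> \<open>From exp t >= 1 + t with t = theta a ln 2 follows a <= 2^(theta a) / (theta ln
    2); adding 1 <= 2^(theta a) gives a + 1 <= c0 2^(theta a).\<close>
  define c0 where "c0 = 1 + 1 / (\<theta> * ln 2)"
  define c where "c p = (if p < B then c0 else 1)" for p :: nat
  have c01: "c0 \<ge> 1" using \<theta> by (simp add: c0_def)
  have step: "real (a + 1) \<le> c p * (real p ^ a) powr \<theta>" if p: "Factorial_Ring.prime p" for p a :: nat
  proof (cases "p < B")
    case True
    have p2: "real p \<ge> 2" using prime_ge_2_nat[OF p] by simp
    have "(2::real) powr (\<theta> * real a) = exp (real a * (\<theta> * ln 2))" by (simp add: powr_def mult_ac)
    then have "real a * (\<theta> * ln 2) \<le> 2 powr (\<theta> * real a) - 1"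
      using exp_ge_add_one_self[of "real a * (\<theta> * ln 2)"] by linarith
    then have "real a \<le> (2 powr (\<theta> * real a)) * (1 / (\<theta> * ln 2))"
      using \<theta> by (simp add: field_simps)
    moreover have "1 \<le> (2::real) powr (\<theta> * real a)" using \<theta> by (intro ge_one_powr_ge_zero) auto
    ultimately have "real (a + 1) \<le> c0 * 2 powr (\<theta> * real a)" by (simp add: c0_def algebra_simps)
    also have "2 powr (\<theta> * real a) \<le> real p powr (\<theta> * real a)" using p2 \<theta> by (intro powr_mono2) auto
    also have "\<dots> = (real p ^ a) powr \<theta>" using p2 by (simp add: powr_powr mult.commute flip: powr_realpow)
    finally show ?thesis using True c01 by (simp add: c_def)
  next
    case False
    have p2: "real p \<ge> 2" using prime_ge_2_nat[OF p] by simp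
    have "2 powr (1 / \<theta>) \<le> real p" using False unfolding B_def by linarith
    then have "(2 powr (1 / \<theta>)) powr \<theta> \<le> real p powr \<theta>" using \<theta> by (intro powr_mono2) auto
    then have "2 \<le> real p powr \<theta>" using \<theta> by (simp add: powr_powr)
    then have "2 ^ a \<le> (real p powr \<theta>) ^ a" by (intro power_mono) auto
    also have "\<dots> = (real p ^ a) powr \<theta>" using p2 by (simp add: powr_powr powr_power mult.commute flip: powr_realpow)
    finally have "2 ^ a \<le> (real p ^ a) powr \<theta>" .
    moreover have "real (a + 1) \<le> 2 ^ a"
      using less_exp[of a] by (metis Suc_eq_plus1 Suc_leI of_nat_le_iff of_nat_numeral of_nat_power)
    ultimately show ?thesis using False by (simp add: c_def)
  qed
  have main: "real (card {d. d dvd n}) \<le> (\<Prod>p\<in>S. c p) * real n powr \<theta>"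
    if "finite S" "n \<ge> 1" "prime_factors n \<subseteq> S" "\<forall>p\<in>S. Factorial_Ring.prime p" for S and n :: nat
    using that
  proof (induction S arbitrary: n rule: finite_induct)
    case empty
    then have "n = 1" by (auto simp: prime_factorization_empty_iff)
    then show ?case by simp
  next
    case (insert p S)
    have p: "Factorial_Ring.prime p" using insert.prems by simp
    define a where "a = multiplicity p n"
    obtain m where m: "n = p ^ a * m" using multiplicity_dvd[of p n] unfolding a_def by blast
    have m0: "m \<ge> 1" using m insert.prems by (cases m) auto
    have "\<not> p dvd m"
    proof
      assume "p dvd m"
      then have "p ^ Suc a dvd n" using m by (auto elim!: dvdE simp: mult_ac)
      then have "Suc a \<le> multiplicity p n" using insert.prems(1) p by (intro multiplicity_geI) auto
      then show False by (simp add: a_def)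
    qed
    have "prime_factors m \<subseteq> S"
    proof
      fix t assume "t \<in> prime_factors m"
      then have t: "t dvd m" "Factorial_Ring.prime t" by (auto simp: in_prime_factors_iff)
      then have "t \<in> prime_factors n" using insert.prems(1) m prime_gt_0_nat[OF p] by (auto simp: in_prime_factors_iff)
      then show "t \<in> S" using insert.prems(2) t(1) \<open>\<not> p dvd m\<close> by blast
    qed
    then have IH: "real (card {d. d dvd m}) \<le> (\<Prod>p\<in>S. c p) * real m powr \<theta>"
      using insert.IH[OF m0] insert.prems by simp
    have cS: "(\<Prod>p\<in>S. c p) \<ge> 0" using c01 by (intro prod_nonneg) (auto simp: c_def)
    have "real (card {d. d dvd n}) \<le> real (a + 1) * real (card {d. d dvd m})"
      using card_divisors_prime_power[OF m _ p] m0 by (intro of_nat_le_mult) simp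
    also have "\<dots> \<le> (c p * (real p ^ a) powr \<theta>) * ((\<Prod>p\<in>S. c p) * real m powr \<theta>)"
      using step[OF p, of a] IH by (intro mult_mono) auto
    also have "\<dots> = (c p * (\<Prod>p\<in>S. c p)) * real n powr \<theta>" using m by (simp add: powr_mult)
    finally show ?case using insert.hyps by simp
  qed
  have cprod: "(\<Prod>p\<in>S. c p) \<le> c0 ^ B" if "finite S" for S
  proof -
    have "(\<Prod>p\<in>S. c p) = (\<Prod>p\<in>S \<inter> {..<B}. c0)" unfolding c_def using that by (simp add: prod.If_cases lessThan_def)
    also have "\<dots> = c0 ^ card (S \<inter> {..<B})" by simp
    also have "\<dots> \<le> c0 ^ B" using c01 card_mono[of "{..<B}" "S \<inter> {..<B}"] by (intro power_increasing) auto
    finally show ?thesis .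
  qed
  show ?thesis
  proof (rule that)
    show "c0 ^ B \<ge> 1" using c01 by simp
    fix n :: nat assume n: "n \<ge> 1"
    have "real (card {d. d dvd n}) \<le> (\<Prod>p\<in>prime_factors n. c p) * real n powr \<theta>"
      using main[of "prime_factors n" n] n by auto
    also have "\<dots> \<le> c0 ^ B * real n powr \<theta>" using cprod by (intro mult_right_mono) auto
    finally show "real (card {d. d dvd n}) \<le> c0 ^ B * real n powr \<theta>" .
  qed
qed

text \<open>The weak form of Stirling's formula; the induction step is ln(1 + 1/j) <= 1/j.\<close>

lemma fact_lower: "exp (real j * (ln (real j) - 1)) \<le> fact j"
proof (induction j)
  case (Suc j)
  show ?case
  proof (cases "j = 0")
    case False
    have "ln (real (Suc j) / real j) \<le> real (Suc j) / real j - 1" using False by (intro ln_le_minus_one) auto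
    then have "real j * (ln (real (Suc j)) - ln (real j)) \<le> 1" using False by (simp add: ln_div field_simps)
    then have "real (Suc j) * (ln (real (Suc j)) - 1) \<le> real j * (ln (real j) - 1) + ln (real (Suc j))"
      by (simp add: algebra_simps)
    then have "exp (real (Suc j) * (ln (real (Suc j)) - 1)) \<le> exp (real j * (ln (real j) - 1)) * real (Suc j)"
      by (metis exp_add exp_le_cancel_iff exp_ln of_nat_0_less_iff zero_less_Suc)
    also have "\<dots> \<le> fact j * real (Suc j)" using Suc by (intro mult_right_mono) auto
    finally show ?thesis by (simp add: mult.commute)
  qed simp
qed simp

section \<open>Optimising the exponent\<close>

lemma amgm: "M > 0 \<Longrightarrow> a \<ge> 0 \<Longrightarrow> b \<ge> 0 \<Longrightarrow> 2 * sqrt (a * b) \<le> a * M + b / (M::real)"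
proof -
  assume M: "M > 0" "a \<ge> 0" "b \<ge> 0"
  have "sqrt (a * b) = sqrt ((a * M) * (b / M))" using M by simp
  also have "\<dots> \<le> (a * M + b / M) / 2" using M by (intro arith_geo_mean_sqrt) auto
  finally show ?thesis by simp
qed

text \<open>If M ln q < 4 sqrt(n ln n ln q), then M < 4 sqrt(n ln n / ln 2) for every q >= 2. The
  two middle conditions make all such M small against n and at most n^(1/2 + theta), independently
  of q; the last one absorbs the constant ln theta - 1 into theta ln n.\<close>

definition large_enough :: "real \<Rightarrow> nat \<Rightarrow> bool" where
  "large_enough \<theta> n \<longleftrightarrow> n \<ge> 2 \<and>
     4 * sqrt (real n * ln (real n) / ln 2) \<le> \<theta> * real n \<and>
     4 * sqrt (real n * ln (real n) / ln 2) \<le> real n powr (1/2 + \<theta>) \<and>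
     1 - ln \<theta> \<le> \<theta> * ln (real n)"

lemma eventually_large_enough:
  assumes "\<theta> > 0" shows "eventually (large_enough \<theta>) sequentially"
proof -
  have 1: "eventually (\<lambda>n::nat. 4 * sqrt (real n * ln (real n) / ln 2) \<le> \<theta> * real n) sequentially"
    using assms by real_asymp
  have 2: "eventually (\<lambda>n::nat. 4 * sqrt (real n * ln (real n) / ln 2) \<le> real n powr (1/2 + \<theta>)) sequentially"
    using assms by real_asymp
  have 3: "eventually (\<lambda>n::nat. 1 - ln \<theta> \<le> \<theta> * ln (real n)) sequentially"
    using assms by real_asymp
  show ?thesis unfolding large_enough_def
    by (intro eventually_conj eventually_ge_at_top 1 2 3)
qed

text \<open>The term with \<open>M * lq\<close> is what the orders gain and \<open>lam\<close> what
  the count of sets saves, about (n/M) ln n with N = n ln n. Lowering both coefficients to 1 - 9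
  theta lets \<open>amgm\<close> apply, the source of the constant 2 in the theorem; 18 is twice
  9.\<close>

lemma exponent_bound:
  fixes \<theta> lq N M lam :: real
  assumes \<theta>: "0 < \<theta>" "\<theta> \<le> 1/20" and M: "M > 0" and lq: "lq \<ge> 0" and N: "N \<ge> 0"
    and lam: "lam \<ge> (1 - 9 * \<theta>) * (N / M)"
  shows "(1 - 3 * \<theta>) * M * lq + lam \<ge> (2 - 18 * \<theta>) * sqrt (N * lq)"
proof -
  have "2 * sqrt (lq * N) \<le> lq * M + N / M" using M lq N by (rule amgm)
  then have "(1 - 9 * \<theta>) * (2 * sqrt (N * lq)) \<le> (1 - 9 * \<theta>) * (lq * M + N / M)"
    using \<theta> by (intro mult_left_mono) (auto simp: mult.commute)
  moreover have "(1 - 9 * \<theta>) * (lq * M) \<le> (1 - 3 * \<theta>) * (lq * M)"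
    using \<theta> M lq by (intro mult_right_mono) auto
  ultimately show ?thesis using lam by (simp add: algebra_simps)
qed

text \<open>The members of the largest degree other than the prescribed one carry the degree j d1,
  the small members the degree n2. Each part saves about its degree times (ln n)/M, so together they
  save nearly (n/M) ln n however the degree is distributed. The remaining d1 + d2 is negligible
  unless M is so large that the first term suffices alone.\<close>

lemma two_degree_exponent:
  fixes n d1 d2 j n2 m :: nat and \<theta> C lq lam Ps :: real
  assumes \<theta>: "0 < \<theta>" "\<theta> \<le> 1/20" and n: "large_enough \<theta> n" and lq: "lq \<ge> ln 2"
    and d: "d2 < d1" "real d1 \<ge> 1 / \<theta>"
    and m: "j * d1 + d1 + n2 + d2 = m" "real m \<ge> (1 - \<theta>) * real n" "m \<le> n" "d2 = 0 \<Longrightarrow> n2 = 0"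
    and lam: "lam \<ge> 0" "j \<ge> 1 \<Longrightarrow> lam \<ge> real j * (ln (real (j * d1)) - 1)"
    and Ps: "Ps \<ge> 0" "d2 \<ge> 1 \<Longrightarrow> Ps \<ge> real n2 / real d2 * (ln (real n2 / real d2) - 1)"
  defines "M \<equiv> max (real d1) (2 * real d2)"
  defines "s \<equiv> sqrt (real n * ln (real n) * lq)"
  shows "(1 - 3 * \<theta>) * M * lq + lam + Ps \<ge> (2 - 18 * \<theta>) * s"
proof -
  have n2': "n \<ge> 2" using n by (simp add: large_enough_def)
  have lq0: "lq > 0" using lq by (meson less_le_trans ln_gt_zero one_less_numeral_iff semiring_norm(76))
  have lnn: "ln (real n) > 0" using n2' by simp
  define N where "N = real n * ln (real n)"
  have N0: "N \<ge> 0" using lnn by (simp add: N_def)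
  have s0: "s \<ge> 0" unfolding s_def N_def[symmetric] using N0 lq0 by simp
  have d1: "real d1 \<ge> 1" using d(2) \<theta> by (smt (verit) le_divide_eq_1_pos)
  have M1: "M \<ge> 1" "real d1 \<le> M" "2 * real d2 \<le> M" using d1 by (auto simp: M_def)
  show ?thesis
  proof (cases "M * lq \<ge> 4 * s")
    case True
    have "(1 - 3 * \<theta>) * (4 * s) \<le> (1 - 3 * \<theta>) * (M * lq)" using True \<theta> by (intro mult_left_mono) auto
    moreover have "(2 - 18 * \<theta>) * s \<le> (1 - 3 * \<theta>) * (4 * s)"
    proof -
      have "(2 - 18 * \<theta>) * s \<le> (4 - 12 * \<theta>) * s" using s0 \<theta> by (intro mult_right_mono) auto
      then show ?thesis by (simp add: algebra_simps)
    qed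
    ultimately show ?thesis using lam(1) Ps(1) by (simp add: mult.assoc)
  next
    case False
    have "M < 4 * s / lq" using False lq0 by (simp add: field_simps)
    also have "s / lq = sqrt (N / lq)"
      using lq0 by (simp add: s_def N_def real_sqrt_mult real_sqrt_divide field_simps)
    then have "4 * s / lq = 4 * sqrt (N / lq)" by simp
    also have "sqrt (N / lq) \<le> sqrt (N / ln 2)" using lq N0 lq0 by (intro real_sqrt_le_mono divide_left_mono mult_pos_pos) auto
    finally have Mlt: "M < 4 * sqrt (N / ln 2)" by simp
    have Mn: "M \<le> \<theta> * real n" and Mp: "M \<le> real n powr (1/2 + \<theta>)"
      using Mlt n by (auto simp: large_enough_def N_def)
    have ln\<theta>: "ln \<theta> + ln (real n) - 1 \<ge> (1 - \<theta>) * ln (real n)"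
      using n by (simp add: large_enough_def algebra_simps)
    define n1 where "n1 = real (j * d1)"
    \<comment> \<open>Subtracting theta n makes the bound trivial when n1 is small; otherwise ln n1
      >= ln(theta n), which is nearly ln n.\<close>
    have L1: "lam \<ge> (n1 - \<theta> * real n) / M * ((1 - \<theta>) * ln (real n))"
    proof (cases "n1 \<ge> \<theta> * real n")
      case False
      then have "(n1 - \<theta> * real n) / M * ((1 - \<theta>) * ln (real n)) \<le> 0"
        using M1 lnn \<theta> by (intro mult_nonpos_nonneg divide_nonpos_pos) auto
      then show ?thesis using lam(1) by linarith
    next
      case True
      have pos: "\<theta> * real n > 0" using \<theta> n2' by simp
      then have j1: "j \<ge> 1" using True by (cases j) (auto simp: n1_def)
      have "ln (\<theta> * real n) \<le> ln n1" using True pos by simp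
      then have ln1: "ln n1 - 1 \<ge> (1 - \<theta>) * ln (real n)" using ln\<theta> \<theta> n2' by (simp add: ln_mult)
      have "(n1 - \<theta> * real n) / M \<le> n1 / real d1"
        using M1 d1 pos True by (intro frac_le) auto
      also have "n1 / real d1 = real j" using d1 by (simp add: n1_def)
      finally have "(n1 - \<theta> * real n) / M * ((1 - \<theta>) * ln (real n)) \<le> real j * (ln n1 - 1)"
        using ln1 lnn \<theta> by (intro mult_mono) auto
      then show ?thesis using lam(2)[OF j1] by (simp add: n1_def)
    qed
    have L2: "Ps \<ge> (real n2 - \<theta> * real n) / M * ((1 - 4 * \<theta>) * ln (real n))"
    proof (cases "real n2 \<ge> \<theta> * real n")
      case False
      then have "(real n2 - \<theta> * real n) / M * ((1 - 4 * \<theta>) * ln (real n)) \<le> 0"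
        using M1 lnn \<theta> by (intro mult_nonpos_nonneg divide_nonpos_pos) auto
      then show ?thesis using Ps(1) by linarith
    next
      case True
      have pos: "\<theta> * real n > 0" using \<theta> n2' by simp
      then have d2: "d2 \<ge> 1" using True m(4) by (cases d2) auto
      define u where "u = real n2 / real d2"
      \<comment> \<open>Only about half of ln n is available as a lower bound for ln u, since d2 may
        have size about n^(1/2 + theta). The factor 2 in 2 d2 <= M makes up for it.\<close>
      have uM: "u \<ge> 2 * real n2 / M"
      proof -
        have "2 * real n2 / M \<le> 2 * real n2 / (2 * real d2)" using M1 d2 by (intro divide_left_mono) auto
        then show ?thesis by (simp add: u_def)
      qed
      have "\<theta> * real n powr (1/2 - \<theta>) = \<theta> * real n / real n powr (1/2 + \<theta>)"
      proof -
        have "real n powr (1/2 - \<theta>) * real n powr (1/2 + \<theta>) = real n" using n2' by (simp flip: powr_add)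
        then show ?thesis using n2' by (simp add: field_simps)
      qed
      also have "\<dots> \<le> real n2 / M" using True Mp M1 pos by (intro frac_le) auto
      also have "\<dots> \<le> 2 * real n2 / M" using M1 by (intro divide_right_mono) auto
      also have "\<dots> \<le> u" by (rule uM)
      finally have ul: "\<theta> * real n powr (1/2 - \<theta>) \<le> u" .
      have tp: "\<theta> * real n powr (1/2 - \<theta>) > 0" using \<theta> n2' by simp
      have "ln (\<theta> * real n powr (1/2 - \<theta>)) \<le> ln u" using ul tp by simp
      moreover have "ln (\<theta> * real n powr (1/2 - \<theta>)) = ln \<theta> + (1/2 - \<theta>) * ln (real n)"
        using \<theta> n2' by (simp add: ln_mult ln_powr)
      ultimately have lnu: "ln u - 1 \<ge> (1/2 - 2 * \<theta>) * ln (real n)"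
        using ln\<theta> by (simp add: algebra_simps)
      have "(real n2 - \<theta> * real n) / M * ((1 - 4 * \<theta>) * ln (real n)) \<le> real n2 / M * ((1 - 4 * \<theta>) * ln (real n))"
        using M1 lnn \<theta> pos by (intro mult_right_mono divide_right_mono) auto
      also have "\<dots> = (2 * real n2 / M) * ((1/2 - 2 * \<theta>) * ln (real n))"
      proof -
        have eq: "(1 - 4 * \<theta>) * ln (real n) = 2 * ((1/2 - 2 * \<theta>) * ln (real n))" by (simp add: algebra_simps)
        show ?thesis unfolding eq by simp
      qed
      also have "\<dots> \<le> u * (ln u - 1)" using uM lnu lnn \<theta> tp ul by (intro mult_mono) auto
      finally show ?thesis using Ps(2)[OF d2] by (simp add: u_def)
    qed
    have "real m = n1 + real d1 + real n2 + real d2" unfolding m(1)[symmetric] n1_def by simp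
    then have sum: "n1 + real n2 \<ge> (1 - 3 * \<theta>) * real n"
      using m(2) M1 Mn by (simp add: algebra_simps)
    have lnp: "(1 - 4 * \<theta>) * ln (real n) \<le> (1 - \<theta>) * ln (real n)" "(1 - 4 * \<theta>) * ln (real n) \<ge> 0"
      using lnn \<theta> by (auto intro: mult_right_mono)
    have "lam \<ge> (n1 - \<theta> * real n) / M * ((1 - 4 * \<theta>) * ln (real n))"
    proof (cases "n1 \<ge> \<theta> * real n")
      case True
      then have "(n1 - \<theta> * real n) / M * ((1 - 4 * \<theta>) * ln (real n)) \<le> (n1 - \<theta> * real n) / M * ((1 - \<theta>) * ln (real n))"
        using lnp M1 by (intro mult_left_mono) auto
      then show ?thesis using L1 by linarith
    next
      case False
      then have "(n1 - \<theta> * real n) / M * ((1 - 4 * \<theta>) * ln (real n)) \<le> 0"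
        using M1 lnp by (intro mult_nonpos_nonneg divide_nonpos_pos) auto
      then show ?thesis using lam(1) by linarith
    qed
    then have "lam + Ps \<ge> (n1 - \<theta> * real n) / M * ((1 - 4 * \<theta>) * ln (real n)) + (real n2 - \<theta> * real n) / M * ((1 - 4 * \<theta>) * ln (real n))"
      using L2 by linarith
    also have "(n1 - \<theta> * real n) / M * ((1 - 4 * \<theta>) * ln (real n)) + (real n2 - \<theta> * real n) / M * ((1 - 4 * \<theta>) * ln (real n))
      = (n1 + real n2 - 2 * \<theta> * real n) / M * ((1 - 4 * \<theta>) * ln (real n))"
      by (simp add: add_divide_distrib diff_divide_distrib algebra_simps)
    finally have "lam + Ps \<ge> (n1 + real n2 - 2 * \<theta> * real n) / M * ((1 - 4 * \<theta>) * ln (real n))" .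
    moreover have "((1 - 5 * \<theta>) * real n) / M * ((1 - 4 * \<theta>) * ln (real n)) \<le> (n1 + real n2 - 2 * \<theta> * real n) / M * ((1 - 4 * \<theta>) * ln (real n))"
      using sum M1 lnp by (intro mult_right_mono divide_right_mono) (auto simp: algebra_simps)
    moreover have "(1 - 9 * \<theta>) * (N / M) \<le> ((1 - 5 * \<theta>) * real n) / M * ((1 - 4 * \<theta>) * ln (real n))"
    proof -
      have "1 - 9 * \<theta> \<le> (1 - 5 * \<theta>) * (1 - 4 * \<theta>)" by (simp add: algebra_simps)
      then have "(1 - 9 * \<theta>) * (N / M) \<le> ((1 - 5 * \<theta>) * (1 - 4 * \<theta>)) * (N / M)"
        using N0 M1 by (intro mult_right_mono) auto
      then show ?thesis by (simp add: N_def mult_ac)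
    qed
    ultimately have "lam + Ps \<ge> (1 - 9 * \<theta>) * (N / M)" by linarith
    from exponent_bound[OF \<theta> _ _ N0 this, of lq] show ?thesis
      using M1 lq0 by (simp add: s_def N_def add.assoc)
  qed
qed

definition sz :: "nat \<Rightarrow> nat \<Rightarrow> real" where "sz n q = sqrt (real n * ln (real n) * ln (real q))"

text \<open>Meant for sets with all degrees at most K. The repeated pair and the larger members of
  distinct degrees take at most 2K + K^2 of the total degree, which has to be negligible; a total
  degree above K^2 forces a repetition; and the last condition says that ln(n/K) is nearly ln
  n.\<close>

definition large_for :: "nat \<Rightarrow> real \<Rightarrow> nat \<Rightarrow> bool" where
  "large_for K \<theta> n \<longleftrightarrow> real (2 * K + K * K) \<le> \<theta> * real n \<and> real (K * K) < (1 - \<theta>) * real n \<and>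
     (1 - \<theta>) * ln (real n) \<le> ln ((1 - 2 * \<theta>) * real n / real K) - 1"

lemma eventually_large_for:
  assumes "0 < \<theta>" "\<theta> \<le> 1/20" "K \<ge> 1" shows "eventually (large_for K \<theta>) sequentially"
proof -
  define c where "c = (1 - 2 * \<theta>) / real K"
  have c: "c > 0" using assms by (simp add: c_def)
  have 1: "eventually (\<lambda>n::nat. real (2 * K + K * K) \<le> \<theta> * real n) sequentially"
    using assms by real_asymp
  have "1 - \<theta> > 0" using assms by simp
  then have 2: "eventually (\<lambda>n::nat. real (K * K) < (1 - \<theta>) * real n) sequentially"
    by real_asymp
  have "eventually (\<lambda>n::nat. 1 - ln c \<le> \<theta> * ln (real n)) sequentially"
    using assms by real_asymp
  then have 3: "eventually (\<lambda>n::nat. (1 - \<theta>) * ln (real n) \<le> ln ((1 - 2 * \<theta>) * real n / real K) - 1) sequentially"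
    using eventually_gt_at_top[of 0]
  proof eventually_elim
    case (elim n)
    have "(1 - 2 * \<theta>) * real n / real K = c * real n" by (simp add: c_def)
    then have "ln ((1 - 2 * \<theta>) * real n / real K) = ln c + ln (real n)" using c elim by (simp add: ln_mult)
    then show ?case using elim by (simp add: algebra_simps)
  qed
  show ?thesis unfolding large_for_def by (intro eventually_conj 1 2 3)
qed

lemma smooth_bound_le: "smooth_bound n D \<le> 3 * real D + 1"
proof -
  have "exp (- psi (real n / real D)) \<le> 1" using psi_nonneg by simp
  then have "3 * real D * exp (- psi (real n / real D)) \<le> 3 * real D * 1" by (intro mult_left_mono) auto
  then show ?thesis by (simp add: smooth_bound_def)
qed

lemma psi_mono: assumes "0 \<le> a" "a \<le> b" shows "psi a \<le> psi b"
proof (cases "a * (ln a - 1) > 0")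
  case True
  then have a: "a > 0" using assms(1) by (cases "a = 0") auto
  then have "ln a - 1 > 0" using True by (simp add: zero_less_mult_iff)
  moreover have "ln a \<le> ln b" using a assms by simp
  ultimately have "a * (ln a - 1) \<le> b * (ln b - 1)" using assms a by (intro mult_mono) auto
  then show ?thesis by (simp add: psi_def)
qed (simp add: psi_def)

lemma smooth_bound_bound:
  assumes "D \<le> n" "N' \<ge> N"
  shows "smooth_bound N' D \<le> (3 * real n + 1) * exp (- (if D = 0 then 0 else psi (real N / real D)))"
proof (cases "D = 0")
  case False
  have "psi (real N / real D) \<le> psi (real N' / real D)" using assms by (intro psi_mono divide_right_mono) auto
  then have "3 * real D * exp (- psi (real N' / real D)) \<le> (3 * real n + 1) * exp (- psi (real N / real D))"
    using assms by (intro mult_mono) auto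
  then show ?thesis using False by (simp add: smooth_bound_def)
qed (simp add: smooth_bound_def)

section \<open>Exponential bounds for the classes\<close>

context irr_system
begin

lemma tau_le:
  assumes C: "\<And>n. n \<ge> 1 \<Longrightarrow> real (card {d. d dvd n}) \<le> C * real n powr \<theta>" and \<theta>: "\<theta> > 0" and C1: "C \<ge> 1" and d: "d \<ge> 1"
  shows "real (tau d) \<le> C * exp (\<theta> * real d * ln (real q))"
proof -
  have n: "q ^ d - 1 \<ge> 1" using q2 d one_less_power[of q d] by simp
  have "real (tau d) \<le> C * real (q ^ d - 1) powr \<theta>" unfolding tau_def using C[OF n] by simp
  also have "\<dots> \<le> C * (real q ^ d) powr \<theta>"
  proof -
    have "real (q ^ d - 1) \<le> real (q ^ d)" by (simp only: of_nat_le_iff diff_le_self)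
    then show ?thesis using C1 \<theta> by (intro mult_left_mono powr_mono2) auto
  qed
  also have "(real q ^ d) powr \<theta> = exp (\<theta> * real d * ln (real q))"
    using q2 by (simp add: powr_def ln_realpow)
  finally show ?thesis .
qed

lemma q_exp: "real q ^ k = exp (real k * ln (real q))"
  using q2 by (simp add: exp_of_nat_mult)

lemma lq: "ln (real q) \<ge> ln 2" "ln (real q) > 0" using q2 by simp_all

text \<open>Everything is normalised by q^m. The 1 in the exponents is the factor q lost in passing
  from scalars to the identity. The third claim removes the parameters whose class contributes
  nothing, so that afterwards the degree equation of \<open>two_degree_exponent\<close> is
  available.\<close>

lemma C1_generic:
  assumes C: "\<And>d. d \<ge> 1 \<Longrightarrow> real (tau d) \<le> C * exp (\<theta> * real d * ln (real q))" and C1: "C \<ge> 1"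
    and d: "d2 < d1" and k: "k \<ge> 1" and m: "m \<le> n" "d1 \<le> m"
  defines "j \<equiv> k - 1" and "n2 \<equiv> m - k * d1 - d2"
  defines "lam \<equiv> ln (real d1 ^ j * fact j)"
  defines "Ps \<equiv> (if d2 = 0 then 0 else psi (real n2 / real d2))"
  defines "W \<equiv> (\<Sum>A\<in>C1 m d1 k d2. w A) / real q ^ m"
  shows "W \<le> (3 * real n + 1) * C\<^sup>2 * exp ((1 + \<theta> * real d1 - real d1) * ln (real q)) * exp (- lam) * exp (- Ps)"
    and "d2 \<ge> 1 \<Longrightarrow> W \<le> (3 * real n + 1) * C\<^sup>2 * exp ((1 + \<theta> * (real d1 + real d2) - 2 * real d2) * ln (real q)) * exp (- lam) * exp (- Ps)"
    and "k * d1 + d2 > m \<or> (d2 = 0 \<and> n2 \<noteq> 0) \<Longrightarrow> W \<le> 0"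
proof -
  let ?l = "ln (real q)"
  have d1: "d1 \<ge> 1" "d1 \<le> n" "d2 \<le> n" using d m by auto
  have qm: "real q ^ m > 0" using q2 by simp
  have L: "1 / (real d1 ^ (k - 1) * fact (k - 1)) = exp (- lam)"
    using d1 by (simp add: lam_def j_def exp_minus inverse_eq_divide)
  have CC: "C \<le> C\<^sup>2" using C1 by (simp add: power2_eq_square)
  show W1: "W \<le> (3 * real n + 1) * C\<^sup>2 * exp ((1 + \<theta> * real d1 - real d1) * ?l) * exp (- lam) * exp (- Ps)"
  proof (cases "k * d1 \<le> m")
    case True
    have "(\<Sum>A\<in>C1 m d1 k d2. w A) \<le> real q * real (tau d1) * (real q ^ (m - d1) / (real d1 ^ (k - 1) * fact (k - 1)) * smooth_bound (m - k * d1) d2)"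
      using sum_C1_first[OF d k, of m] unfolding if_P[OF True] .
    then have "W \<le> real q * real (tau d1) * (real q ^ (m - d1) / (real d1 ^ (k - 1) * fact (k - 1)) * smooth_bound (m - k * d1) d2) / real q ^ m"
      unfolding W_def using qm by (intro divide_right_mono) auto
    also have "\<dots> = real q * (real q ^ (m - d1) / real q ^ m) * real (tau d1) * (1 / (real d1 ^ (k - 1) * fact (k - 1))) * smooth_bound (m - k * d1) d2" by (simp add: mult_ac)
    also have "real q * (real q ^ (m - d1) / real q ^ m) = exp ((1 - real d1) * ?l)"
    proof -
      have "real q * (real q ^ (m - d1) / real q ^ m) = exp ?l * exp (real (m - d1) * ?l) / exp (real m * ?l)"
        using q2 by (simp add: q_exp)
      also have "\<dots> = exp (?l + real (m - d1) * ?l - real m * ?l)" by (simp add: exp_add exp_diff)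
      also have "?l + real (m - d1) * ?l - real m * ?l = (1 - real d1) * ?l" using m by (simp add: of_nat_diff algebra_simps)
      finally show ?thesis .
    qed
    also have "exp ((1 - real d1) * ?l) * real (tau d1) * (1 / (real d1 ^ (k - 1) * fact (k - 1))) * smooth_bound (m - k * d1) d2
      \<le> exp ((1 - real d1) * ?l) * (C\<^sup>2 * exp (\<theta> * real d1 * ?l)) * exp (- lam) * ((3 * real n + 1) * exp (- Ps))"
    proof -
      have "real (tau d1) \<le> C\<^sup>2 * exp (\<theta> * real d1 * ?l)"
        using C[OF d1(1)] CC by (meson exp_ge_zero mult_right_mono order_trans)
      moreover have "smooth_bound (m - k * d1) d2 \<le> (3 * real n + 1) * exp (- Ps)"
        unfolding Ps_def by (rule smooth_bound_bound[OF d1(3)]) (simp add: n2_def)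
      ultimately show ?thesis unfolding L using smooth_bound_nonneg C1 by (intro mult_mono) auto
    qed
    also have "\<dots> = (3 * real n + 1) * C\<^sup>2 * (exp ((1 - real d1) * ?l) * exp (\<theta> * real d1 * ?l)) * exp (- lam) * exp (- Ps)" by (simp add: mult_ac)
    also have "exp ((1 - real d1) * ?l) * exp (\<theta> * real d1 * ?l) = exp ((1 + \<theta> * real d1 - real d1) * ?l)"
      by (simp add: algebra_simps flip: exp_add)
    finally show ?thesis .
  next
    case False
    have "(\<Sum>A\<in>C1 m d1 k d2. w A) \<le> 0" using sum_C1_first[OF d k, of m] unfolding if_not_P[OF False] .
    then have "W \<le> 0" unfolding W_def using qm by (simp add: divide_nonpos_pos)
    then show ?thesis by (rule order_trans) (use C1 in simp)
  qed
  show "W \<le> (3 * real n + 1) * C\<^sup>2 * exp ((1 + \<theta> * (real d1 + real d2) - 2 * real d2) * ?l) * exp (- lam) * exp (- Ps)" if d2: "d2 \<ge> 1"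
  proof (cases "k * d1 + d2 \<le> m")
    case True
    have dm: "d1 + d2 \<le> m" using True k by (metis add_le_cancel_right le_trans mult.commute mult_1_right mult_le_mono2)
    let ?z = "real q * real q ^ (d1 - d2)"
    have "(\<Sum>A\<in>C1 m d1 k d2. w A) \<le> ?z * real (tau d1) * real (tau d2) * (real q ^ (m - d1 - d2) / (real d1 ^ (k - 1) * fact (k - 1)) * smooth_bound (m - k * d1 - d2) d2)"
      using sum_C1_second[OF d d2 k, of m] unfolding if_P[OF True] .
    then have "W \<le> ?z * real (tau d1) * real (tau d2) * (real q ^ (m - d1 - d2) / (real d1 ^ (k - 1) * fact (k - 1)) * smooth_bound (m - k * d1 - d2) d2) / real q ^ m"
      unfolding W_def using qm by (intro divide_right_mono) auto
    also have "\<dots> = (?z * real q ^ (m - d1 - d2) / real q ^ m) * real (tau d1) * real (tau d2) * (1 / (real d1 ^ (k - 1) * fact (k - 1))) * smooth_bound (m - k * d1 - d2) d2" by (simp add: mult_ac)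
    also have "?z * real q ^ (m - d1 - d2) / real q ^ m = exp ((1 - 2 * real d2) * ?l)"
    proof -
      have "?z * real q ^ (m - d1 - d2) / real q ^ m = exp ?l * exp (real (d1 - d2) * ?l) * exp (real (m - d1 - d2) * ?l) / exp (real m * ?l)"
        using q2 by (simp add: q_exp)
      also have "\<dots> = exp (?l + real (d1 - d2) * ?l + real (m - d1 - d2) * ?l - real m * ?l)" by (simp add: exp_add exp_diff)
      also have "?l + real (d1 - d2) * ?l + real (m - d1 - d2) * ?l - real m * ?l = (1 - 2 * real d2) * ?l"
        using d dm by (simp add: of_nat_diff algebra_simps)
      finally show ?thesis .
    qed
    also have "exp ((1 - 2 * real d2) * ?l) * real (tau d1) * real (tau d2) * (1 / (real d1 ^ (k - 1) * fact (k - 1))) * smooth_bound (m - k * d1 - d2) d2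
      \<le> exp ((1 - 2 * real d2) * ?l) * (C * exp (\<theta> * real d1 * ?l)) * (C * exp (\<theta> * real d2 * ?l)) * exp (- lam) * ((3 * real n + 1) * exp (- Ps))"
    proof -
      have "smooth_bound (m - k * d1 - d2) d2 \<le> (3 * real n + 1) * exp (- Ps)"
        unfolding Ps_def by (rule smooth_bound_bound[OF d1(3)]) (simp add: n2_def)
      then show ?thesis unfolding L using smooth_bound_nonneg C1 C[OF d1(1)] C[OF d2] by (intro mult_mono) auto
    qed
    also have "\<dots> = (3 * real n + 1) * C\<^sup>2 * (exp ((1 - 2 * real d2) * ?l) * exp (\<theta> * real d1 * ?l) * exp (\<theta> * real d2 * ?l)) * exp (- lam) * exp (- Ps)"
      by (simp add: mult_ac power2_eq_square)
    also have "exp ((1 - 2 * real d2) * ?l) * exp (\<theta> * real d1 * ?l) * exp (\<theta> * real d2 * ?l) = exp ((1 + \<theta> * (real d1 + real d2) - 2 * real d2) * ?l)"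
      by (simp add: algebra_simps flip: exp_add)
    finally show ?thesis .
  next
    case False
    have "(\<Sum>A\<in>C1 m d1 k d2. w A) \<le> 0" using sum_C1_second[OF d d2 k, of m] unfolding if_not_P[OF False] .
    then have "W \<le> 0" unfolding W_def using qm by (simp add: divide_nonpos_pos)
    then show ?thesis by (rule order_trans) (use C1 in simp)
  qed
  show "W \<le> 0" if z: "k * d1 + d2 > m \<or> (d2 = 0 \<and> n2 \<noteq> 0)"
  proof -
    have "(\<Sum>A\<in>C1 m d1 k d2. w A) \<le> 0"
    proof (cases "d2 = 0")
      case True
      then show ?thesis using sum_C1_first[OF d k, of m] z by (cases "k * d1 \<le> m") (auto simp: smooth_bound_def n2_def)
    next
      case False
      then have F: "\<not> k * d1 + d2 \<le> m" using z by auto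
      show ?thesis using sum_C1_second[OF d _ k, of m] False unfolding if_not_P[OF F] by simp
    qed
    then show ?thesis unfolding W_def using qm by (simp add: divide_nonpos_pos)
  qed
qed

lemma C1_large:
  assumes C: "\<And>d. d \<ge> 1 \<Longrightarrow> real (tau d) \<le> C * exp (\<theta> * real d * ln (real q))" and C1: "C \<ge> 1"
    and \<theta>: "0 < \<theta>" "\<theta> \<le> 1/20" and n: "large_enough \<theta> n"
    and d: "d2 < d1" "real d1 \<ge> 1 / \<theta>" and k: "k \<ge> 1" and m: "m \<le> n" "d1 \<le> m" "real m \<ge> (1 - \<theta>) * real n"
  shows "(\<Sum>A\<in>C1 m d1 k d2. w A) / real q ^ m \<le> (3 * real n + 1) * C\<^sup>2 * exp (- ((2 - 18 * \<theta>) * sz n q))"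
proof (cases "k * d1 + d2 > m \<or> (d2 = 0 \<and> m - k * d1 - d2 \<noteq> 0)")
  case True
  have "(\<Sum>A\<in>C1 m d1 k d2. w A) / real q ^ m \<le> 0" by (rule C1_generic(3)[OF C C1 d(1) k m(1,2) True])
  then show ?thesis by (rule order_trans) (use C1 in simp)
next
  case False
  define j where "j = k - 1"
  define n2 where "n2 = m - k * d1 - d2"
  define lam where "lam = ln (real d1 ^ j * fact j)"
  define Ps where "Ps = (if d2 = 0 then 0 else psi (real n2 / real d2))"
  define M where "M = max (real d1) (2 * real d2)"
  let ?l = "ln (real q)"
  let ?W = "(\<Sum>A\<in>C1 m d1 k d2. w A) / real q ^ m"
  have d1: "d1 \<ge> 1" using d by simp
  \<comment> \<open>Here d1 >= 1/theta enters: theta M pays for the lost factor q, and the divisor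
    functions cost at most 2 theta M more. This explains the coefficient 1 - 3 theta.\<close>
  have \<theta>M: "1 \<le> \<theta> * M" "\<theta> * real d1 \<le> \<theta> * M" "2 * (\<theta> * real d2) \<le> \<theta> * M" "M > 0"
  proof -
    have "1 \<le> \<theta> * real d1" using d(2) \<theta> by (simp add: field_simps)
    moreover show "\<theta> * real d1 \<le> \<theta> * M" using \<theta> by (intro mult_left_mono) (auto simp: M_def)
    ultimately show "1 \<le> \<theta> * M" by linarith
    have "\<theta> * (2 * real d2) \<le> \<theta> * M" using \<theta> by (intro mult_left_mono) (auto simp: M_def)
    then show "2 * (\<theta> * real d2) \<le> \<theta> * M" by simp
    show "M > 0" using d1 by (simp add: M_def)
  qed
  have W: "?W \<le> (3 * real n + 1) * C\<^sup>2 * exp (- ((1 - 3 * \<theta>) * M) * ?l) * exp (- lam) * exp (- Ps)"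
  proof (cases "2 * d2 \<le> d1")
    case True
    then have M: "M = real d1" by (simp add: M_def)
    have "1 + \<theta> * real d1 - real d1 \<le> - ((1 - 3 * \<theta>) * M)" using \<theta>M M by (simp add: algebra_simps)
    then have "exp ((1 + \<theta> * real d1 - real d1) * ?l) \<le> exp (- ((1 - 3 * \<theta>) * M) * ?l)"
      unfolding exp_le_cancel_iff using lq(2) by (intro mult_right_mono) auto
    then have "(3 * real n + 1) * C\<^sup>2 * exp ((1 + \<theta> * real d1 - real d1) * ?l) * exp (- lam) * exp (- Ps)
       \<le> (3 * real n + 1) * C\<^sup>2 * exp (- ((1 - 3 * \<theta>) * M) * ?l) * exp (- lam) * exp (- Ps)"
      by (intro mult_right_mono mult_left_mono) auto
    then show ?thesis using C1_generic(1)[OF C C1 d(1) k m(1,2)] unfolding j_def n2_def lam_def Ps_def by linarith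
  next
    case False
    then have M: "M = 2 * real d2" and d2: "d2 \<ge> 1" by (auto simp: M_def)
    have "1 + \<theta> * (real d1 + real d2) - 2 * real d2 \<le> - ((1 - 3 * \<theta>) * M)" using \<theta>M M by (simp add: algebra_simps)
    then have "exp ((1 + \<theta> * (real d1 + real d2) - 2 * real d2) * ?l) \<le> exp (- ((1 - 3 * \<theta>) * M) * ?l)"
      unfolding exp_le_cancel_iff using lq(2) by (intro mult_right_mono) auto
    then have "(3 * real n + 1) * C\<^sup>2 * exp ((1 + \<theta> * (real d1 + real d2) - 2 * real d2) * ?l) * exp (- lam) * exp (- Ps)
       \<le> (3 * real n + 1) * C\<^sup>2 * exp (- ((1 - 3 * \<theta>) * M) * ?l) * exp (- lam) * exp (- Ps)"
      by (intro mult_right_mono mult_left_mono) auto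
    then show ?thesis using C1_generic(2)[OF C C1 d(1) k m(1,2) d2] unfolding j_def n2_def lam_def Ps_def by linarith
  qed
  have "(1 - 3 * \<theta>) * M * ?l + lam + Ps \<ge> (2 - 18 * \<theta>) * sz n q"
    unfolding M_def sz_def
  proof (rule two_degree_exponent[OF \<theta> n lq(1) d])
    show "j * d1 + d1 + n2 + d2 = m"
    proof -
      have "k * d1 = j * d1 + d1" using k by (cases k) (auto simp: j_def)
      then show ?thesis using False by (simp add: n2_def)
    qed
    show "real m \<ge> (1 - \<theta>) * real n" "m \<le> n" by fact+
    show "n2 = 0" if "d2 = 0" using False that by (auto simp: n2_def)
    have "real d1 ^ j * fact j \<ge> 1 * (1::real)" using d1 by (intro mult_mono) (auto simp: fact_ge_1)
    then show "lam \<ge> 0" by (simp add: lam_def)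
    show "lam \<ge> real j * (ln (real (j * d1)) - 1)" if j: "j \<ge> 1"
    proof -
      have "real j * (ln (real (j * d1)) - 1) = real j * ln (real d1) + real j * (ln (real j) - 1)"
        using j d1 by (simp add: ln_mult algebra_simps)
      also have "real j * (ln (real j) - 1) \<le> ln (fact j)"
        using fact_lower[of j] by (metis exp_gt_zero ln_exp ln_le_cancel_iff less_le_trans)
      also have "real j * ln (real d1) + ln (fact j) = lam" using d1 by (simp add: lam_def ln_mult ln_realpow)
      finally show ?thesis by simp
    qed
    show "Ps \<ge> 0" using psi_nonneg by (simp add: Ps_def)
    show "Ps \<ge> real n2 / real d2 * (ln (real n2 / real d2) - 1)" if "d2 \<ge> 1"
      using that by (simp add: Ps_def psi_def)
  qed
  then have "exp (- ((1 - 3 * \<theta>) * M) * ?l) * exp (- lam) * exp (- Ps) \<le> exp (- ((2 - 18 * \<theta>) * sz n q))"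
    by (simp flip: exp_add)
  then have "(3 * real n + 1) * C\<^sup>2 * (exp (- ((1 - 3 * \<theta>) * M) * ?l) * exp (- lam) * exp (- Ps)) \<le> (3 * real n + 1) * C\<^sup>2 * exp (- ((2 - 18 * \<theta>) * sz n q))"
    by (intro mult_left_mono) auto
  then show ?thesis using W by (simp only: mult.assoc)
qed

text \<open>The same balance with \<open>d\<close> in the role of M: the pair gains q^-d, while
  nearly the whole degree n lies in members of degree at most d, where Rankin's method saves about
  (n/d) ln n because d is bounded.\<close>

lemma C2_large:
  assumes C: "\<And>d. d \<ge> 1 \<Longrightarrow> real (tau d) \<le> C * exp (\<theta> * real d * ln (real q))" and C1: "C \<ge> 1"
    and \<theta>: "0 < \<theta>" "\<theta> \<le> 1/20" and n: "n \<ge> 2" "large_for K \<theta> n"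
    and d: "1 \<le> d" "d \<le> K" and m: "m \<le> n" "real m \<ge> (1 - \<theta>) * real n"
  shows "(\<Sum>A\<in>C2 m d K. w A) / real q ^ m \<le> C * (real (K * K + 1) * ((3 * real K + 1) * (3 * real K + 1))) * exp (- ((2 - 18 * \<theta>) * sz n q))"
proof -
  let ?l = "ln (real q)"
  let ?S = "{s. s \<le> K * K \<and> 2 * d + s \<le> m}"
  define N where "N = real n * ln (real n)"
  have lnn: "ln (real n) > 0" using n by simp
  have N0: "N \<ge> 0" using lnn by (simp add: N_def)
  define Ps where "Ps = (1 - 2 * \<theta>) * (1 - \<theta>) * (N / real d)"
  have qm: "real q ^ m > 0" using q2 by simp
  have nl: "real (2 * K + K * K) \<le> \<theta> * real n" "(1 - \<theta>) * ln (real n) \<le> ln ((1 - 2 * \<theta>) * real n / real K) - 1"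
    using n(2) by (auto simp: large_for_def)
  have GG: "smooth_bound s K * smooth_bound (m - 2 * d - s) d \<le> ((3 * real K + 1) * (3 * real K + 1)) * exp (- Ps)" if s: "s \<in> ?S" for s
  proof -
    define u where "u = real (m - 2 * d - s) / real d"
    have "real (m - 2 * d - s) = real m - 2 * real d - real s" using s by (simp add: of_nat_diff)
    moreover have "2 * real d + real s \<le> real (2 * K + K * K)"
    proof -
      have "2 * d + s \<le> 2 * K + K * K" using s d by auto
      then have "real (2 * d + s) \<le> real (2 * K + K * K)" by (simp only: of_nat_le_iff)
      then show ?thesis by simp
    qed
    ultimately have "real (m - 2 * d - s) \<ge> (1 - 2 * \<theta>) * real n" using m(2) nl(1) by (simp add: algebra_simps)
    then have u: "u \<ge> (1 - 2 * \<theta>) * real n / real d" using d by (simp add: u_def divide_right_mono)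
    have "(1 - 2 * \<theta>) * real n / real K \<le> (1 - 2 * \<theta>) * real n / real d"
      using d \<theta> n by (intro divide_left_mono) auto
    then have uK: "(1 - 2 * \<theta>) * real n / real K \<le> u" using u by linarith
    have pos: "(1 - 2 * \<theta>) * real n / real K > 0" using \<theta> n d by simp
    have "ln ((1 - 2 * \<theta>) * real n / real K) \<le> ln u" using uK pos by simp
    then have lnu: "ln u - 1 \<ge> (1 - \<theta>) * ln (real n)" using nl(2) by linarith
    have "(1 - 2 * \<theta>) * real n / real d * ((1 - \<theta>) * ln (real n)) \<le> u * (ln u - 1)"
      using u lnu lnn \<theta> n uK pos by (intro mult_mono) auto
    also have "\<dots> \<le> psi u" by (simp add: psi_def)
    also have "(1 - 2 * \<theta>) * real n / real d * ((1 - \<theta>) * ln (real n)) = Ps" by (simp add: Ps_def N_def)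
    finally have psu: "psi u \<ge> Ps" .
    have "smooth_bound (m - 2 * d - s) d = 3 * real d * exp (- psi u)" using d by (simp add: smooth_bound_def u_def)
    also have "\<dots> \<le> (3 * real K + 1) * exp (- Ps)" using d psu by (intro mult_mono) auto
    finally have "smooth_bound (m - 2 * d - s) d \<le> (3 * real K + 1) * exp (- Ps)" .
    then have "smooth_bound s K * smooth_bound (m - 2 * d - s) d \<le> (3 * real K + 1) * ((3 * real K + 1) * exp (- Ps))"
      using smooth_bound_le smooth_bound_nonneg by (intro mult_mono) auto
    then show ?thesis by (simp add: mult.assoc)
  qed
  have "(\<Sum>A\<in>C2 m d K. w A) \<le> real (tau d) * (\<Sum>s\<in>?S. real q ^ (m - d) * smooth_bound s K * smooth_bound (m - 2 * d - s) d)"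
    by (rule sum_C2[OF d(1)])
  also have "(\<Sum>s\<in>?S. real q ^ (m - d) * smooth_bound s K * smooth_bound (m - 2 * d - s) d) \<le> of_nat (card ?S) * (real q ^ (m - d) * (((3 * real K + 1) * (3 * real K + 1)) * exp (- Ps)))"
    using GG by (intro sum_bounded_above) (simp add: mult.assoc mult_left_mono)
  also have "real (card ?S) \<le> real (K * K + 1)"
  proof -
    have "card ?S \<le> K * K + 1" using card_mono[of "{..K * K}" ?S] by (simp add: subset_iff)
    then show ?thesis by (simp only: of_nat_le_iff)
  qed
  finally have "(\<Sum>A\<in>C2 m d K. w A) \<le> real (tau d) * (real (K * K + 1) * (real q ^ (m - d) * (((3 * real K + 1) * (3 * real K + 1)) * exp (- Ps))))"
    by (simp add: mult_left_mono mult_right_mono)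
  then have "(\<Sum>A\<in>C2 m d K. w A) / real q ^ m \<le> real (tau d) * (real (K * K + 1) * (real q ^ (m - d) * (((3 * real K + 1) * (3 * real K + 1)) * exp (- Ps)))) / real q ^ m"
    using qm by (intro divide_right_mono) auto
  also have "\<dots> = real (tau d) * ((real q ^ (m - d) / real q ^ m) * (real (K * K + 1) * ((3 * real K + 1) * (3 * real K + 1)) * exp (- Ps)))" by simp
  also have "\<dots> \<le> (C * exp (\<theta> * real d * ?l)) * (exp (- real d * ?l) * (real (K * K + 1) * ((3 * real K + 1) * (3 * real K + 1)) * exp (- Ps)))"
  proof -
    have "real q ^ (m - d) / real q ^ m \<le> exp (- real d * ?l)"
    proof (cases "d \<le> m")
      case True
      then show ?thesis by (simp add: q_exp of_nat_diff algebra_simps flip: exp_diff)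
    next
      case False
      then have "real m < real d" by simp
      moreover have "real d \<le> \<theta> * real n"
      proof -
        have "d \<le> 2 * K + K * K" using d by simp
        then have "real d \<le> real (2 * K + K * K)" by (simp only: of_nat_le_iff)
        then show ?thesis using nl(1) by linarith
      qed
      moreover have "\<theta> * real n < (1 - \<theta>) * real n" using \<theta> n by (intro mult_strict_right_mono) auto
      ultimately show ?thesis using m(2) by linarith
    qed
    then show ?thesis using C[OF d(1)] C1 by (intro mult_mono) auto
  qed
  also have "\<dots> = C * (real (K * K + 1) * ((3 * real K + 1) * (3 * real K + 1))) * (exp (\<theta> * real d * ?l) * exp (- real d * ?l) * exp (- Ps))" by simp
  also have "exp (\<theta> * real d * ?l) * exp (- real d * ?l) * exp (- Ps) = exp (- ((1 - \<theta>) * real d * ?l + Ps))"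
    by (simp add: algebra_simps flip: exp_add)
  also have "\<dots> \<le> exp (- ((2 - 18 * \<theta>) * sz n q))"
  proof -
    have d0: "real d > 0" using d by simp
    have "1 - 9 * \<theta> \<le> (1 - 2 * \<theta>) * (1 - \<theta>)" using \<theta> by (simp add: algebra_simps)
    then have "(1 - 9 * \<theta>) * (N / real d) \<le> Ps" unfolding Ps_def using N0 by (intro mult_right_mono) auto
    from exponent_bound[OF \<theta> d0 _ N0 this, of ?l]
    have "(1 - 3 * \<theta>) * real d * ?l + Ps \<ge> (2 - 18 * \<theta>) * sqrt (N * ?l)" using lq by simp
    moreover have "(1 - 3 * \<theta>) * (real d * ?l) \<le> (1 - \<theta>) * (real d * ?l)" using \<theta> lq by (intro mult_right_mono) auto
    ultimately show ?thesis by (simp add: sz_def N_def mult.assoc)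
  qed
  finally show ?thesis using C1 by (simp add: mult_left_mono)
qed

section \<open>Including the square part\<close>

definition B :: "nat \<Rightarrow> real" where "B m = T m / real q ^ m"

lemma B_trivial: "m \<le> n \<Longrightarrow> B m \<le> 3 * real n + 1"
proof -
  assume "m \<le> n"
  have "T m / real q ^ m \<le> (real q ^ m * smooth_bound m m) / real q ^ m" using T_le_trivial by (intro divide_right_mono) auto
  also have "\<dots> = smooth_bound m m" using q2 by simp
  also have "\<dots> \<le> 3 * real m + 1" by (rule smooth_bound_le)
  finally show ?thesis using \<open>m \<le> n\<close> by (simp add: B_def)
qed

lemma B_nonneg: "B m \<ge> 0" using w0 by (simp add: B_def T_def sum_nonneg)

text \<open>The factor \<open>q\<^sup>j\<close> accounts for the choices of \<open>b\<close> in \<open>f = a b\<^sup>2\<close> with \<open>a\<close> squarefree and \<open>b\<close> of degree \<open>j\<close>.\<close>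
definition Eb :: "nat \<Rightarrow> real" where
  "Eb n = (\<Sum>d\<le>n. \<Sum>j\<le>d div 2. real q ^ j * T (d - 2 * j)) / real q ^ n"

lemma B_decomposition:
  assumes m: "m \<ge> 1" and K: "K \<ge> 1" "K * K < m"
    and b1: "\<And>d1 k d2. K < d1 \<Longrightarrow> d1 \<le> m \<Longrightarrow> 1 \<le> k \<Longrightarrow> d2 < d1 \<Longrightarrow> (\<Sum>A\<in>C1 m d1 k d2. w A) / real q ^ m \<le> b"
    and b2: "\<And>d. 1 \<le> d \<Longrightarrow> d \<le> K \<Longrightarrow> (\<Sum>A\<in>C2 m d K. w A) / real q ^ m \<le> c" and b0: "b \<ge> 0"
  shows "B m \<le> (real m + 1) ^ 3 * b + real K * c"
proof -
  let ?J = "{(d1, k, d2). K < d1 \<and> d1 \<le> m \<and> 1 \<le> k \<and> k \<le> m \<and> d2 < d1}"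
  have sub: "?J \<subseteq> {..m} \<times> {..m} \<times> {..m}" by auto
  have cJ: "real (card ?J) \<le> (real m + 1) ^ 3"
  proof -
    have "card ?J \<le> card ({..m} \<times> {..m} \<times> {..m})" using sub by (intro card_mono) auto
    also have "\<dots> = (m + 1) ^ 3" by (simp add: card_cartesian_product power3_eq_cube)
    finally have "real (card ?J) \<le> real ((m + 1) ^ 3)" by (simp only: of_nat_le_iff)
    then show ?thesis by (simp add: add.commute)
  qed
  have "B m \<le> ((\<Sum>(d1, k, d2)\<in>?J. \<Sum>A\<in>C1 m d1 k d2. w A) + (\<Sum>d\<in>{1..K}. \<Sum>A\<in>C2 m d K. w A) + 0) / real q ^ m"
    unfolding B_def using T_decomposition[OF m K(1)] K(2) by (intro divide_right_mono) auto
  also have "\<dots> = (\<Sum>(d1, k, d2)\<in>?J. (\<Sum>A\<in>C1 m d1 k d2. w A) / real q ^ m) + (\<Sum>d\<in>{1..K}. (\<Sum>A\<in>C2 m d K. w A) / real q ^ m)"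
    by (simp add: add_divide_distrib sum_divide_distrib split_def)
  also have "(\<Sum>(d1, k, d2)\<in>?J. (\<Sum>A\<in>C1 m d1 k d2. w A) / real q ^ m) \<le> of_nat (card ?J) * b"
    using b1 by (intro sum_bounded_above) auto
  also have "of_nat (card ?J) * b \<le> (real m + 1) ^ 3 * b" using cJ b0 by (intro mult_right_mono) auto
  also have "(\<Sum>d\<in>{1..K}. (\<Sum>A\<in>C2 m d K. w A) / real q ^ m) \<le> of_nat (card {1..K}) * c"
    using b2 by (intro sum_bounded_above) auto
  finally show ?thesis by simp
qed

text \<open>A square part of degree 2j has only q^j choices, so a squarefree part whose degree m
  falls short of n is penalised by q^(-(n-m)/2). What remains is to bound each \<open>B m\<close>
  together with its penalty.\<close>

lemma Eb_le:
  assumes b: "\<And>m. m \<le> n \<Longrightarrow> exp (- (real (n - m) / 2 * ln (real q))) * B m \<le> b"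
  shows "Eb n \<le> (real n + 1)\<^sup>2 * b"
proof -
  have b0: "b \<ge> 0" using b[of 0] B_nonneg[of 0] by (meson exp_ge_zero le0 mult_nonneg_nonneg order_trans)
  have trm: "real q ^ j * T (d - 2 * j) / real q ^ n \<le> b" if d: "d \<le> n" and j: "j \<le> d div 2" for d j
  proof -
    have j2: "2 * j \<le> d" using j by simp
    have "real q ^ j * T (d - 2 * j) / real q ^ n = (real q ^ j * real q ^ (d - 2 * j) / real q ^ n) * B (d - 2 * j)"
      using q2 by (simp add: B_def)
    also have "real q ^ j * real q ^ (d - 2 * j) / real q ^ n = exp ((real j + real (d - 2 * j) - real n) * ln (real q))"
      by (simp add: q_exp algebra_simps flip: exp_add exp_diff)
    also have "\<dots> \<le> exp (- (real (n - (d - 2 * j)) / 2 * ln (real q)))"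
    proof -
      have "real j + real (d - 2 * j) - real n \<le> - (real (n - (d - 2 * j)) / 2)"
        using d j2 by (simp add: of_nat_diff field_simps)
      then have "(real j + real (d - 2 * j) - real n) * ln (real q) \<le> - (real (n - (d - 2 * j)) / 2) * ln (real q)"
        by (rule mult_right_mono) (use lq in simp)
      then show ?thesis by simp
    qed
    finally have "real q ^ j * T (d - 2 * j) / real q ^ n \<le> exp (- (real (n - (d - 2 * j)) / 2 * ln (real q))) * B (d - 2 * j)"
      using B_nonneg by (simp add: mult_right_mono)
    also have "\<dots> \<le> b" using d by (intro b) auto
    finally show ?thesis .
  qed
  have "Eb n = (\<Sum>d\<le>n. \<Sum>j\<le>d div 2. real q ^ j * T (d - 2 * j) / real q ^ n)"
    by (simp add: Eb_def sum_divide_distrib)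
  also have "\<dots> \<le> (\<Sum>d\<le>n. (real n + 1) * b)"
  proof (rule sum_mono)
    fix d assume d: "d \<in> {..n}"
    have "(\<Sum>j\<le>d div 2. real q ^ j * T (d - 2 * j) / real q ^ n) \<le> of_nat (card {..d div 2}) * b"
      using trm d by (intro sum_bounded_above) auto
    also have "\<dots> \<le> (real n + 1) * b" using d b0 by (intro mult_right_mono) auto
    finally show "(\<Sum>j\<le>d div 2. real q ^ j * T (d - 2 * j) / real q ^ n) \<le> (real n + 1) * b" .
  qed
  also have "\<dots> = (real n + 1)\<^sup>2 * b" by (simp add: power2_eq_square add.commute)
  finally show ?thesis .
qed

text \<open>For m >= (1 - theta) n the value \<open>B m\<close> itself is small, by
  \<open>C1_large\<close> and \<open>C2_large\<close>. For smaller m the penalty suffices: n - m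
  exceeds theta n, which \<open>large_enough\<close> makes at least 4 sqrt(n ln n / ln 2).\<close>

lemma Eb_large:
  assumes C: "\<And>n. n \<ge> 1 \<Longrightarrow> real (card {d. d dvd n}) \<le> C * real n powr \<theta>" and C1: "C \<ge> 1"
    and \<theta>: "0 < \<theta>" "\<theta> \<le> 1/20" and n: "large_enough \<theta> n" "large_for K \<theta> n" and K: "real K \<ge> 1 / \<theta>"
  shows "Eb n \<le> (real n + 1)\<^sup>2 * ((real n + 1) ^ 3 * ((3 * real n + 1) * C\<^sup>2) +
     real K * (C * (real (K * K + 1) * ((3 * real K + 1) * (3 * real K + 1)))) + (3 * real n + 1)) * exp (- ((2 - 18 * \<theta>) * sz n q))"
proof -
  note tC = tau_le[OF C \<theta>(1) C1]
  define e where "e = exp (- ((2 - 18 * \<theta>) * sz n q))"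
  define c1 where "c1 = (3 * real n + 1) * C\<^sup>2"
  define c2 where "c2 = C * (real (K * K + 1) * ((3 * real K + 1) * (3 * real K + 1)))"
  have pos: "c1 \<ge> 0" "c2 \<ge> 0" "e > 0" using C1 by (auto simp: c1_def c2_def e_def)
  have K1: "K \<ge> 1"
  proof -
    have "1 / \<theta> > 0" using \<theta> by simp
    then show ?thesis using K by linarith
  qed
  have n2: "n \<ge> 2" using n by (simp add: large_enough_def)
  have main: "exp (- (real (n - m) / 2 * ln (real q))) * B m \<le> ((real n + 1) ^ 3 * c1 + real K * c2 + (3 * real n + 1)) * e" if m: "m \<le> n" for m
  proof (cases "real m \<ge> (1 - \<theta>) * real n")
    case True
    have "real (K * K) < real m" using n(2) True by (simp add: large_for_def)
    then have Km: "K * K < m" by (simp only: of_nat_less_iff)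
    have "B m \<le> (real m + 1) ^ 3 * (c1 * e) + real K * (c2 * e)"
    proof (rule B_decomposition[OF _ K1 Km])
      show "m \<ge> 1" using Km by simp
      show "c1 * e \<ge> 0" using pos by simp
      show "(\<Sum>A\<in>C1 m d1 k d2. w A) / real q ^ m \<le> c1 * e" if "K < d1" "d1 \<le> m" "1 \<le> k" "d2 < d1" for d1 k d2
        unfolding c1_def e_def using that K m True by (intro C1_large[OF tC C1 \<theta> n(1)]) auto
      show "(\<Sum>A\<in>C2 m d K. w A) / real q ^ m \<le> c2 * e" if "1 \<le> d" "d \<le> K" for d
        unfolding c2_def e_def using that m True by (intro C2_large[OF tC C1 \<theta> n2 n(2)]) auto
    qed
    also have "\<dots> \<le> (real n + 1) ^ 3 * (c1 * e) + real K * (c2 * e)"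
      using m pos by (intro add_right_mono mult_right_mono power_mono) auto
    also have "\<dots> \<le> ((real n + 1) ^ 3 * c1 + real K * c2 + (3 * real n + 1)) * e" using pos by (simp add: algebra_simps)
    finally have Bm: "B m \<le> ((real n + 1) ^ 3 * c1 + real K * c2 + (3 * real n + 1)) * e" .
    have "exp (- (real (n - m) / 2 * ln (real q))) \<le> 1" using lq by simp
    then have "exp (- (real (n - m) / 2 * ln (real q))) * B m \<le> 1 * B m" using B_nonneg by (intro mult_right_mono) auto
    then show ?thesis using Bm by simp
  next
    case False
    define N where "N = real n * ln (real n)"
    have N0: "N \<ge> 0" using n2 by (simp add: N_def)
    have "real (n - m) \<ge> \<theta> * real n" using False m by (simp add: of_nat_diff algebra_simps)
    also have "\<theta> * real n \<ge> 4 * sqrt (N / ln 2)" using n(1) by (simp add: large_enough_def N_def)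
    finally have nm: "real (n - m) \<ge> 4 * sqrt (N / ln 2)" by simp
    have "2 * sz n q \<le> real (n - m) / 2 * ln (real q)"
    proof -
      have "sz n q = sqrt (N / ln 2 * (ln 2 * ln (real q)))" by (simp add: sz_def N_def)
      also have "\<dots> \<le> sqrt (N / ln 2 * (ln (real q) * ln (real q)))"
        using N0 lq by (intro real_sqrt_le_mono mult_left_mono mult_right_mono) auto
      also have "\<dots> = sqrt (N / ln 2) * ln (real q)"
        unfolding real_sqrt_mult[of "N / ln 2"] using lq by simp
      also have "\<dots> \<le> real (n - m) / 4 * ln (real q)" using nm lq by (intro mult_right_mono) auto
      finally show ?thesis by simp
    qed
    moreover have "(2 - 18 * \<theta>) * sz n q \<le> 2 * sz n q"
    proof -
      have "sz n q \<ge> 0" using N0 lq by (simp add: sz_def N_def)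
      then show ?thesis using \<theta> by (intro mult_right_mono) auto
    qed
    ultimately have "exp (- (real (n - m) / 2 * ln (real q))) \<le> e" by (simp add: e_def)
    then have "exp (- (real (n - m) / 2 * ln (real q))) * B m \<le> e * (3 * real n + 1)"
      using B_trivial[OF m] B_nonneg pos by (intro mult_mono) auto
    also have "\<dots> \<le> ((real n + 1) ^ 3 * c1 + real K * c2 + (3 * real n + 1)) * e"
      using pos by (simp add: algebra_simps)
    finally show ?thesis .
  qed
  show ?thesis using Eb_le[OF main] unfolding c1_def c2_def e_def by (simp only: mult.assoc)
qed

text \<open>For bounded n and large q, with K = 1 and divisor exponent 1/8. A factor of degree d1 >=
  2 gains q^(1 - 7 d1/8) <= q^(-3/4). If all factors are linear, n >= 2 provides two of them and the
  pair gains q^(-7/8). A squarefree part of degree below n already pays q^(-1/2).\<close>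

lemma Eb_fixed:
  assumes C: "\<And>n. n \<ge> 1 \<Longrightarrow> real (card {d. d dvd n}) \<le> C * real n powr (1/8)" and C1: "C \<ge> 1" and n: "n \<ge> 2"
  shows "Eb n \<le> (real n + 1)\<^sup>2 * ((real n + 1) ^ 3 * ((3 * real n + 1) * C\<^sup>2) + C * 32 + (3 * real n + 1)) * exp (- (ln (real q) / 2))"
proof -
  have tC: "real (tau d) \<le> C * exp (1/8 * real d * ln (real q))" if "d \<ge> 1" for d
    by (rule tau_le[OF C _ C1 that]) auto
  define e where "e = exp (- (ln (real q) / 2))"
  define c1 where "c1 = (3 * real n + 1) * C\<^sup>2"
  have pos: "c1 \<ge> 0" "e > 0" using C1 by (auto simp: c1_def e_def)
  let ?l = "ln (real q)"
  have b1: "(\<Sum>A\<in>C1 n d1 k d2. w A) / real q ^ n \<le> c1 * e" if d: "1 < d1" "d1 \<le> n" "1 \<le> k" "d2 < d1" for d1 k d2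
  proof -
    define lam where "lam = ln (real d1 ^ (k - 1) * fact (k - 1))"
    define Ps where "Ps = (if d2 = 0 then 0 else psi (real (n - k * d1 - d2) / real d2))"
    have "real d1 ^ (k - 1) * fact (k - 1) \<ge> 1 * (1::real)" using d by (intro mult_mono) (auto simp: fact_ge_1)
    then have "lam \<ge> 0" by (simp add: lam_def)
    moreover have "Ps \<ge> 0" using psi_nonneg by (simp add: Ps_def)
    ultimately have LP: "exp (- lam) \<le> 1" "exp (- Ps) \<le> 1" by auto
    have "(\<Sum>A\<in>C1 n d1 k d2. w A) / real q ^ n \<le> c1 * exp ((1 + 1/8 * real d1 - real d1) * ?l) * exp (- lam) * exp (- Ps)"
      unfolding c1_def lam_def Ps_def
      by (rule C1_generic(1)[OF tC C1 d(4,3) le_refl d(2)])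
    also have "\<dots> \<le> c1 * exp ((1 + 1/8 * real d1 - real d1) * ?l) * 1 * 1"
      using LP pos by (intro mult_mono) auto
    also have "\<dots> \<le> c1 * e"
    proof -
      have "(1 + 1/8 * real d1 - real d1) * ?l \<le> (- (1 / 2)) * ?l" using d lq by (intro mult_right_mono) auto
      then show ?thesis using pos by (simp add: e_def mult_left_mono)
    qed
    finally show ?thesis .
  qed
  have b2: "(\<Sum>A\<in>C2 n d 1. w A) / real q ^ n \<le> C * 32 * e" if d: "1 \<le> d" "d \<le> 1" for d
  proof -
    have d1: "d = 1" using d by simp
    \<comment> \<open>At most two values of s, and for each of them two factors of at most 4: this
      is the constant 32.\<close>
    let ?S = "{s. s \<le> 1 * 1 \<and> 2 * d + s \<le> n}"
    have "(\<Sum>A\<in>C2 n d 1. w A) \<le> real (tau d) * (\<Sum>s\<in>?S. real q ^ (n - d) * smooth_bound s 1 * smooth_bound (n - 2 * d - s) d)"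
      by (rule sum_C2[OF d(1)])
    also have "(\<Sum>s\<in>?S. real q ^ (n - d) * smooth_bound s 1 * smooth_bound (n - 2 * d - s) d) \<le> of_nat (card ?S) * (real q ^ (n - d) * 16)"
    proof (rule sum_bounded_above)
      fix s
      have "smooth_bound s 1 \<le> 4" "smooth_bound (n - 2 * d - s) d \<le> 4" using smooth_bound_le[of s 1] smooth_bound_le[of "n - 2 * d - s" d] d1 by auto
      then have "smooth_bound s 1 * smooth_bound (n - 2 * d - s) d \<le> 4 * 4" using smooth_bound_nonneg by (intro mult_mono) auto
      then show "real q ^ (n - d) * smooth_bound s 1 * smooth_bound (n - 2 * d - s) d \<le> real q ^ (n - d) * 16" by (simp add: mult.assoc mult_left_mono)
    qed
    also have "real (card ?S) \<le> 2" using card_mono[of "{..1::nat}" ?S] by (simp add: subset_iff)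
    finally have "(\<Sum>A\<in>C2 n d 1. w A) \<le> real (tau d) * (2 * (real q ^ (n - d) * 16))"
      by (simp add: mult_left_mono mult_right_mono)
    then have "(\<Sum>A\<in>C2 n d 1. w A) / real q ^ n \<le> real (tau d) * (2 * (real q ^ (n - d) * 16)) / real q ^ n"
      by (intro divide_right_mono) auto
    also have "\<dots> = 32 * real (tau d) * (real q ^ (n - 1) / real q ^ n)" using d1 by simp
    also have "real q ^ (n - 1) / real q ^ n = exp (- ?l)"
      using n by (simp add: q_exp of_nat_diff algebra_simps flip: exp_diff)
    also have "32 * real (tau d) * exp (- ?l) \<le> 32 * (C * exp (1/8 * real d * ?l)) * exp (- ?l)"
      using tC[OF d(1)] by (intro mult_right_mono mult_left_mono) auto
    also have "\<dots> = C * 32 * exp (- (7/8 * ?l))" using d1 by (simp add: algebra_simps flip: exp_add)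
    also have "\<dots> \<le> C * 32 * e" using lq C1 by (intro mult_left_mono) (auto simp: e_def)
    finally show ?thesis .
  qed
  have main: "exp (- (real (n - m) / 2 * ?l)) * B m \<le> ((real n + 1) ^ 3 * c1 + C * 32 + (3 * real n + 1)) * e" if m: "m \<le> n" for m
  proof (cases "m = n")
    case True
    have "B n \<le> (real n + 1) ^ 3 * (c1 * e) + real 1 * (C * 32 * e)"
      using n pos by (intro B_decomposition b1 b2) auto
    also have "\<dots> \<le> ((real n + 1) ^ 3 * c1 + C * 32 + (3 * real n + 1)) * e" using pos by (simp add: algebra_simps)
    finally show ?thesis using True by simp
  next
    case False
    then have "real (n - m) \<ge> 1" using m by simp
    then have "1 / 2 * ?l \<le> real (n - m) / 2 * ?l" using lq by (intro mult_right_mono) auto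
    then have "exp (- (real (n - m) / 2 * ?l)) \<le> e" by (simp add: e_def)
    then have "exp (- (real (n - m) / 2 * ?l)) * B m \<le> e * (3 * real n + 1)"
      using B_trivial[OF m] B_nonneg pos by (intro mult_mono) auto
    also have "\<dots> \<le> ((real n + 1) ^ 3 * c1 + C * 32 + (3 * real n + 1)) * e"
      using pos C1 by (simp add: algebra_simps)
    finally show ?thesis .
  qed
  show ?thesis using Eb_le[OF main] unfolding c1_def e_def by (simp only: mult.assoc)
qed

end

section \<open>Polynomials over a finite field\<close>

locale finfield = field F for F :: "'a ring" (structure) +
  assumes fin: "finite (carrier F)"
begin

abbreviation P :: "'a list ring" where "P \<equiv> univ_poly F (carrier F)"
abbreviation q :: nat where "q \<equiv> card (carrier F)"
abbreviation Fx :: "'a set" where "Fx \<equiv> carrier F - {\<zero>}"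

sublocale UP: principal_domain P
  by (rule univ_poly_is_principal[OF carrier_is_subfield])

lemma q_ge_2: "q \<ge> 2"
proof -
  have "card {\<zero>,\<one>} \<le> q" by (intro card_mono fin) auto
  then show ?thesis using one_not_zero by simp
qed

lemma poly_carrier_iff: "p \<in> carrier P \<longleftrightarrow> set p \<subseteq> carrier F \<and> (p \<noteq> [] \<longrightarrow> hd p \<noteq> \<zero>)"
  by (auto simp: univ_poly_carrier[symmetric] polynomial_def)

lemma const_closed [simp, intro]: "c \<in> Fx \<Longrightarrow> [c] \<in> carrier P"
  by (auto simp: poly_carrier_iff)

lemma P_zero [simp]: "\<zero>\<^bsub>P\<^esub> = []" by (rule univ_poly_zero)
lemma P_one: "\<one>\<^bsub>P\<^esub> = [\<one>]" by (rule univ_poly_one)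

lemma const_unit [simp, intro]: "c \<in> Fx \<Longrightarrow> [c] \<in> Units P"
  using univ_poly_carrier_units by auto

lemma length_mult: "a \<in> carrier P \<Longrightarrow> b \<in> carrier P \<Longrightarrow> a \<noteq> [] \<Longrightarrow> b \<noteq> [] \<Longrightarrow>
   length (a \<otimes>\<^bsub>P\<^esub> b) = length a + length b - 1"
  and hd_mult: "a \<in> carrier P \<Longrightarrow> b \<in> carrier P \<Longrightarrow> a \<noteq> [] \<Longrightarrow> b \<noteq> [] \<Longrightarrow>
   hd (a \<otimes>\<^bsub>P\<^esub> b) = hd a \<otimes> hd b"
proof -
  assume a: "a \<in> carrier P" and b: "b \<in> carrier P" and n: "a \<noteq> []" "b \<noteq> []"
  have pa: "polynomial (carrier F) a" "polynomial (carrier F) b" using a b univ_poly_carrier by auto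
  have ab: "a \<otimes>\<^bsub>P\<^esub> b = ring.poly_mult F a b" by (simp add: univ_poly_mult)
  have ne: "a \<otimes>\<^bsub>P\<^esub> b \<noteq> []" using n UP.integral[OF _ a b] by auto
  have "length (a \<otimes>\<^bsub>P\<^esub> b) - 1 = (length a - 1) + (length b - 1)"
    using poly_mult_degree_eq[OF carrier_is_subring pa] n by (simp add: ab)
  then show "length (a \<otimes>\<^bsub>P\<^esub> b) = length a + length b - 1"
    using ne n by (cases a; cases b; cases "a \<otimes>\<^bsub>P\<^esub> b") auto
  show "hd (a \<otimes>\<^bsub>P\<^esub> b) = hd a \<otimes> hd b"
    using poly_mult_lead_coeff[OF carrier_is_subring pa n] by (simp add: ab)
qed

definition Mon :: "nat \<Rightarrow> 'a list set" where
  "Mon d = {p \<in> carrier P. length p = Suc d \<and> hd p = \<one>}"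

lemma MonD: "p \<in> Mon d \<Longrightarrow> p \<in> carrier P" "p \<in> Mon d \<Longrightarrow> length p = Suc d" "p \<in> Mon d \<Longrightarrow> p \<noteq> []" "p \<in> Mon d \<Longrightarrow> hd p = \<one>"
  by (auto simp: Mon_def)

lemma Mon_eq: "Mon d = (\<lambda>xs. \<one> # xs) ` {xs. set xs \<subseteq> carrier F \<and> length xs = d}"
proof (intro equalityI subsetI)
  fix p assume p: "p \<in> Mon d"
  then obtain y xs where "p = y # xs" using MonD(3) by (cases p) auto
  with p show "p \<in> (\<lambda>xs. \<one> # xs) ` {xs. set xs \<subseteq> carrier F \<and> length xs = d}"
    by (auto simp: Mon_def poly_carrier_iff)
qed (auto simp: Mon_def poly_carrier_iff)

lemma finite_Mon: "finite (Mon d)"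
  unfolding Mon_eq by (intro finite_imageI finite_lists_length_eq fin)

lemma card_Mon: "card (Mon d) = q ^ d"
  unfolding Mon_eq by (subst card_image) (auto intro!: inj_onI simp: card_lists_length_eq fin)

lemma Mon_0: "Mon 0 = {\<one>\<^bsub>P\<^esub>}"
  by (auto simp: Mon_eq P_one)

lemma Mon_mult:
  assumes a: "a \<in> Mon d" and b: "b \<in> Mon e" shows "a \<otimes>\<^bsub>P\<^esub> b \<in> Mon (d + e)"
proof -
  have ab: "a \<in> carrier P" "b \<in> carrier P" "a \<noteq> []" "b \<noteq> []" using a b MonD by blast+
  have "length (a \<otimes>\<^bsub>P\<^esub> b) = Suc (d + e)" "hd (a \<otimes>\<^bsub>P\<^esub> b) = \<one>"
    using length_mult[OF ab] hd_mult[OF ab] MonD(2,4)[OF a] MonD(2,4)[OF b] by simp_all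
  then show ?thesis using UP.m_closed[OF ab(1,2)] unfolding Mon_def by simp
qed

lemma Mon_finprod: "finite A \<Longrightarrow> (\<And>a. a \<in> A \<Longrightarrow> f a \<in> Mon (d a)) \<Longrightarrow> finprod P f A \<in> Mon (sum d A)"
proof (induction A rule: finite_induct)
  case empty then show ?case by (simp add: Mon_0)
next
  case (insert x A)
  have "f \<in> A \<rightarrow> carrier P" using insert.prems MonD(1) by blast
  moreover have "f x \<in> carrier P" using insert.prems MonD(1) by blast
  ultimately have "finprod P f (insert x A) = f x \<otimes>\<^bsub>P\<^esub> finprod P f A"
    using insert.hyps by simp
  then show ?case using insert Mon_mult[of "f x" "d x" "finprod P f A" "sum d A"] by auto
qed

lemma divides_deg: "a divides\<^bsub>P\<^esub> b \<Longrightarrow> a \<in> carrier P \<Longrightarrow> b \<in> carrier P \<Longrightarrow> b \<noteq> [] \<Longrightarrow> a \<noteq> [] \<and> length a \<le> length b"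
proof -
  assume d: "a divides\<^bsub>P\<^esub> b" and a: "a \<in> carrier P" and b: "b \<noteq> []"
  then obtain c where c: "c \<in> carrier P" "b = a \<otimes>\<^bsub>P\<^esub> c" unfolding factor_def by auto
  have an: "a \<noteq> []" using b c a UP.l_null by auto
  have cn: "c \<noteq> []" using b c a UP.r_null by auto
  show ?thesis using length_mult[OF a c(1) an cn] c(2) an cn by (cases c) auto
qed

lemma monic_assoc:
  assumes "p \<in> carrier P" "p \<noteq> []"
  obtains c m where "c \<in> Fx" "m \<in> Mon (length p - 1)" "p = [c] \<otimes>\<^bsub>P\<^esub> m"
proof -
  define c where "c = hd p"
  have c: "c \<in> Fx" using assms by (cases p) (auto simp: poly_carrier_iff c_def)
  have ic: "inv c \<in> Fx" "c \<otimes> inv c = \<one>" "inv c \<otimes> c = \<one>"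
    using c field_Units Units_inv_closed[of c] Units_r_inv[of c] Units_l_inv[of c] Units_inv_Units[of c] by auto
  define m where "m = [inv c] \<otimes>\<^bsub>P\<^esub> p"
  have mc: "m \<in> carrier P" unfolding m_def using assms ic by auto
  have "m \<in> Mon (length p - 1)"
    using length_mult[of "[inv c]" p] hd_mult[of "[inv c]" p] assms ic mc
    by (auto simp: Mon_def m_def c_def[symmetric] Suc_diff_le)
  moreover have "p = [c] \<otimes>\<^bsub>P\<^esub> m"
  proof -
    have "[c] \<otimes>\<^bsub>P\<^esub> [inv c] = \<one>\<^bsub>P\<^esub>"
      using c ic by (auto simp: univ_poly_mult univ_poly_one)
    then show ?thesis unfolding m_def using c ic assms by (simp add: UP.m_assoc[symmetric])
  qed
  ultimately show ?thesis using that c by blast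
qed

lemma Mon_divides_eq:
  assumes "a \<in> Mon d" "b \<in> Mon d" "a divides\<^bsub>P\<^esub> b" shows "a = b"
proof -
  obtain c where c: "c \<in> carrier P" "b = a \<otimes>\<^bsub>P\<^esub> c" using assms unfolding factor_def by auto
  have cn: "c \<noteq> []" using c assms MonD by (metis P_zero UP.r_null)
  have "length b = length a + length c - 1" "hd b = hd a \<otimes> hd c"
    using length_mult[of a c] hd_mult[of a c] c cn assms MonD by auto
  moreover have "length a = Suc d" "length b = Suc d" "hd a = \<one>" "hd b = \<one>" using assms MonD by auto
  moreover have "length c > 0" "hd c \<in> carrier F" using cn c(1) by (cases c; simp add: poly_carrier_iff)+
  ultimately have "length c = 1" "hd c = \<one>" by auto
  then have "c = \<one>\<^bsub>P\<^esub>" by (cases c) (auto simp: P_one)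
  then show ?thesis using c assms MonD by simp
qed

text \<open>X is left out because it divides no X^N - c with N >= 1 and c nonzero
  (\<open>R_X\<close>), so it has no order, not even up to scalars.\<close>

definition Irred :: "nat \<Rightarrow> 'a list set" where
  "Irred d = {p \<in> Mon d. ring_prime\<^bsub>P\<^esub> p \<and> p \<noteq> X}"

lemma IrredD: "p \<in> Irred d \<Longrightarrow> p \<in> Mon d" "p \<in> Irred d \<Longrightarrow> ring_prime\<^bsub>P\<^esub> p" "p \<in> Irred d \<Longrightarrow> p \<noteq> X"
  by (auto simp: Irred_def)

lemma prime_iff_irreducible: "p \<in> carrier P \<Longrightarrow> ring_prime\<^bsub>P\<^esub> p \<longleftrightarrow> ring_irreducible\<^bsub>P\<^esub> p"
  using pprime_iff_pirreducible[OF carrier_is_subfield] by simp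

lemma finite_Irred: "finite (Irred d)"
  using finite_Mon by (rule finite_subset[rotated]) (auto simp: Irred_def)

lemma X_Mon: "X \<in> Mon 1" by (auto simp: Mon_def var_def poly_carrier_iff)
lemma X_closed [simp]: "X \<in> carrier P" using X_Mon MonD by blast
lemma Xpow_Mon: "X [^]\<^bsub>P\<^esub> (n::nat) \<in> Mon n"
proof (induction n)
  case 0 show ?case by (simp add: Mon_0)
next
  case (Suc n) then show ?case using Mon_mult[OF _ X_Mon, of "X [^]\<^bsub>P\<^esub> n" n] by simp
qed

lemma Xpow_closed [simp]: "X [^]\<^bsub>P\<^esub> (n::nat) \<in> carrier P" by (rule UP.nat_pow_closed[OF X_closed])

lemma Irred_closed: "p \<in> Irred d \<Longrightarrow> p \<in> carrier P" using IrredD(1) MonD(1) by blast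

lemma Irred_deg: assumes "p \<in> Irred d" shows "d \<ge> 1"
proof -
  have p: "p \<in> carrier P" "length p = Suc d" using IrredD(1)[OF assms] MonD by blast+
  have "ring_irreducible\<^bsub>P\<^esub> p" using IrredD(2)[OF assms] prime_iff_irreducible[OF p(1)] by simp
  from pirreducible_degree[OF carrier_is_subfield p(1) this] p(2) show ?thesis by simp
qed

lemma prime_divides_mult:
  "ring_prime\<^bsub>P\<^esub> p \<Longrightarrow> a \<in> carrier P \<Longrightarrow> b \<in> carrier P \<Longrightarrow> p divides\<^bsub>P\<^esub> a \<otimes>\<^bsub>P\<^esub> b \<Longrightarrow> p divides\<^bsub>P\<^esub> a \<or> p divides\<^bsub>P\<^esub> b"
  unfolding ring_prime_def prime_def by blast

lemma Mon_add_lower: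
  assumes p: "p \<in> Mon d" and r: "r \<in> carrier P" and l: "length r \<le> d"
  shows "p \<oplus>\<^bsub>P\<^esub> r \<in> Mon d"
proof -
  have pc: "p \<in> carrier P" "length p = Suc d" "hd p = \<one>" "p \<noteq> []" using p MonD by blast+
  have sp: "set p \<subseteq> carrier F" "set r \<subseteq> carrier F" using pc(1) r poly_carrier_iff by auto
  obtain xs where xs: "p = \<one> # xs" using pc by (cases p) auto
  have "Suc d - length r = Suc (d - length r)" using l by simp
  then have "p \<oplus>\<^bsub>P\<^esub> r = normalize (map2 (\<oplus>) p (\<zero> # replicate (d - length r) \<zero> @ r))"
    using l pc by (simp add: univ_poly_add)
  also have "\<dots> = normalize (\<one> # map2 (\<oplus>) xs (replicate (d - length r) \<zero> @ r))"
    by (simp add: xs)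
  also have "\<dots> = \<one> # map2 (\<oplus>) xs (replicate (d - length r) \<zero> @ r)" by simp
  finally have "p \<oplus>\<^bsub>P\<^esub> r = \<one> # map2 (\<oplus>) xs (replicate (d - length r) \<zero> @ r)" .
  moreover have "p \<oplus>\<^bsub>P\<^esub> r \<in> carrier P" using pc r by simp
  ultimately show ?thesis using pc(2) l by (auto simp: Mon_def xs)
qed

section \<open>Divisors of X^N - c\<close>

definition XN :: "nat \<Rightarrow> 'a \<Rightarrow> 'a list" where
  "XN N c = X [^]\<^bsub>P\<^esub> N \<ominus>\<^bsub>P\<^esub> [c]"

lemma const_closed_minus: assumes "c \<in> Fx" shows "\<ominus>\<^bsub>P\<^esub> [c] \<in> carrier P" "length (\<ominus>\<^bsub>P\<^esub> [c]) = 1"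
  using univ_poly_a_inv_length[OF carrier_is_subring const_closed[OF assms]] UP.a_inv_closed[OF const_closed[OF assms]]
  by simp_all

lemma XN_closed: "c \<in> Fx \<Longrightarrow> XN N c \<in> carrier P"
  unfolding XN_def by (intro UP.minus_closed Xpow_closed const_closed)

lemma XN_Mon: assumes "c \<in> Fx" "N \<ge> 1" shows "XN N c \<in> Mon N"
  unfolding XN_def a_minus_def
  by (rule Mon_add_lower[OF Xpow_Mon]) (use const_closed_minus[OF assms(1)] assms(2) in simp_all)

lemma Fx_mult: assumes "a \<in> Fx" "b \<in> Fx" shows "a \<otimes> b \<in> Fx"
  using integral[of a b] assms by blast

lemma const_mult: assumes "a \<in> Fx" "b \<in> Fx" shows "[a] \<otimes>\<^bsub>P\<^esub> [b] = [a \<otimes> b]"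
  using Fx_mult[OF assms] assms by (simp add: univ_poly_mult)

lemma Fx_one: "\<one> \<in> Fx" by auto
lemma Fx_pow: "a \<in> Fx \<Longrightarrow> a [^] (n::nat) \<in> Fx" 
proof (induction n)
  case (Suc n) then show ?case using Fx_mult[of "a [^] n" a] by simp
qed simp
lemma Fx_inv: "a \<in> Fx \<Longrightarrow> inv a \<in> Fx \<and> a \<otimes> inv a = \<one> \<and> inv a \<otimes> a = \<one>"
  using field_Units Units_inv_closed[of a] Units_r_inv[of a] Units_l_inv[of a] Units_inv_Units[of a] by auto

lemma Fx_fermat: "a \<in> Fx \<Longrightarrow> a [^] (q - 1) = \<one>"
proof -
  assume a: "a \<in> Fx"
  interpret M: group "Multiplicative_Group.mult_of F" by (rule field_mult_group)
  have "order (Multiplicative_Group.mult_of F) = q - 1"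
    using order_mult_of[OF fin] by (simp add: order_def)
  then show ?thesis using M.pow_order_eq_1[of a] a by (simp add: Multiplicative_Group.nat_pow_mult_of)
qed

text \<open>The identity xy - ab = x(y - b) + b(x - a), which makes exponents and scalars
  multiplicative modulo a divisor.\<close>

lemma XN_add:
  assumes "c \<in> Fx" "c' \<in> Fx"
  shows "XN (N + N') (c \<otimes> c') = X [^]\<^bsub>P\<^esub> N \<otimes>\<^bsub>P\<^esub> XN N' c' \<oplus>\<^bsub>P\<^esub> [c'] \<otimes>\<^bsub>P\<^esub> XN N c"
proof -
  define x y a b where "x = X [^]\<^bsub>P\<^esub> N" and "y = X [^]\<^bsub>P\<^esub> N'" and "a = [c]" and "b = [c']"
  have cl: "x \<in> carrier P" "y \<in> carrier P" "a \<in> carrier P" "b \<in> carrier P"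
    using assms const_closed by (auto simp: x_def y_def a_def b_def)
  have "x \<otimes>\<^bsub>P\<^esub> y \<ominus>\<^bsub>P\<^esub> a \<otimes>\<^bsub>P\<^esub> b = x \<otimes>\<^bsub>P\<^esub> (y \<ominus>\<^bsub>P\<^esub> b) \<oplus>\<^bsub>P\<^esub> b \<otimes>\<^bsub>P\<^esub> (x \<ominus>\<^bsub>P\<^esub> a)"
    using cl by algebra
  then show ?thesis unfolding XN_def using assms
    by (simp add: x_def y_def a_def b_def const_mult UP.nat_pow_mult)
qed

text \<open>X^N acts as the scalar \<open>c\<close> modulo \<open>f\<close>. The least N >= 1
  admitting some nonzero \<open>c\<close> is the order of X modulo \<open>f\<close> up to
  scalars.\<close>

definition R :: "nat \<Rightarrow> 'a \<Rightarrow> 'a list \<Rightarrow> bool" where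
  "R N c f \<longleftrightarrow> f divides\<^bsub>P\<^esub> XN N c"

lemma divides_add: "f \<in> carrier P \<Longrightarrow> a \<in> carrier P \<Longrightarrow> b \<in> carrier P \<Longrightarrow> f divides\<^bsub>P\<^esub> a \<Longrightarrow> f divides\<^bsub>P\<^esub> b \<Longrightarrow> f divides\<^bsub>P\<^esub> (a \<oplus>\<^bsub>P\<^esub> b)"
proof -
  assume f: "f \<in> carrier P" "a \<in> carrier P" "b \<in> carrier P" "f divides\<^bsub>P\<^esub> a" "f divides\<^bsub>P\<^esub> b"
  then obtain x y where "x \<in> carrier P" "a = f \<otimes>\<^bsub>P\<^esub> x" "y \<in> carrier P" "b = f \<otimes>\<^bsub>P\<^esub> y"
    unfolding factor_def by auto
  then have "a \<oplus>\<^bsub>P\<^esub> b = f \<otimes>\<^bsub>P\<^esub> (x \<oplus>\<^bsub>P\<^esub> y)" "x \<oplus>\<^bsub>P\<^esub> y \<in> carrier P" using f by (auto simp: UP.r_distr)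
  then show ?thesis unfolding factor_def by blast
qed

lemma divides_minus: "f \<in> carrier P \<Longrightarrow> a \<in> carrier P \<Longrightarrow> f divides\<^bsub>P\<^esub> a \<Longrightarrow> f divides\<^bsub>P\<^esub> (\<ominus>\<^bsub>P\<^esub> a)"
proof -
  assume f: "f \<in> carrier P" "a \<in> carrier P" "f divides\<^bsub>P\<^esub> a"
  then obtain x where "x \<in> carrier P" "a = f \<otimes>\<^bsub>P\<^esub> x" unfolding factor_def by auto
  then have "\<ominus>\<^bsub>P\<^esub> a = f \<otimes>\<^bsub>P\<^esub> (\<ominus>\<^bsub>P\<^esub> x)" "\<ominus>\<^bsub>P\<^esub> x \<in> carrier P" using f by (auto simp: UP.r_minus)
  then show ?thesis unfolding factor_def by blast
qed

lemma divides_diff: "f \<in> carrier P \<Longrightarrow> a \<in> carrier P \<Longrightarrow> b \<in> carrier P \<Longrightarrow> f divides\<^bsub>P\<^esub> a \<Longrightarrow> f divides\<^bsub>P\<^esub> b \<Longrightarrow> f divides\<^bsub>P\<^esub> (a \<ominus>\<^bsub>P\<^esub> b)"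
  unfolding a_minus_def by (intro divides_add divides_minus) auto

lemma divides_mult_l: "f \<in> carrier P \<Longrightarrow> a \<in> carrier P \<Longrightarrow> b \<in> carrier P \<Longrightarrow> f divides\<^bsub>P\<^esub> b \<Longrightarrow> f divides\<^bsub>P\<^esub> (a \<otimes>\<^bsub>P\<^esub> b)"
  using UP.divides_prod_l[of a b f] by (metis UP.divides_prod_r UP.m_comm)

lemma divides_unit_cancel:
  assumes "f \<in> carrier P" "a \<in> carrier P" "u \<in> Units P" "f divides\<^bsub>P\<^esub> (u \<otimes>\<^bsub>P\<^esub> a)" shows "f divides\<^bsub>P\<^esub> a"
proof -
  have "f divides\<^bsub>P\<^esub> (inv\<^bsub>P\<^esub> u \<otimes>\<^bsub>P\<^esub> (u \<otimes>\<^bsub>P\<^esub> a))"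
    by (rule divides_mult_l[OF assms(1) UP.Units_inv_closed[OF assms(3)] UP.m_closed[OF UP.Units_closed[OF assms(3)] assms(2)] assms(4)])
  moreover have "inv\<^bsub>P\<^esub> u \<otimes>\<^bsub>P\<^esub> (u \<otimes>\<^bsub>P\<^esub> a) = a"
    using assms UP.Units_closed[of u] UP.m_assoc[of "inv\<^bsub>P\<^esub> u" u a] by simp
  ultimately show ?thesis by simp
qed

lemma R_divides: "R N c f \<Longrightarrow> g divides\<^bsub>P\<^esub> f \<Longrightarrow> g \<in> carrier P \<Longrightarrow> R N c g"
  unfolding R_def by (rule UP.divides_trans)

lemma R_add: "f \<in> carrier P \<Longrightarrow> c \<in> Fx \<Longrightarrow> c' \<in> Fx \<Longrightarrow> R N c f \<Longrightarrow> R N' c' f \<Longrightarrow> R (N + N') (c \<otimes> c') f"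
  unfolding R_def by (auto simp: XN_add intro!: divides_add divides_mult_l XN_closed UP.m_closed const_closed)

lemma R_zero: assumes "f \<in> carrier P" shows "R 0 \<one> f"
proof -
  have "XN 0 \<one> = \<zero>\<^bsub>P\<^esub>" unfolding XN_def using UP.r_right_minus_eq[of "\<one>\<^bsub>P\<^esub>" "\<one>\<^bsub>P\<^esub>"] by (simp add: P_one)
  then show ?thesis unfolding R_def using UP.divides_zero[OF assms] by simp
qed

lemma R_mult: "f \<in> carrier P \<Longrightarrow> c \<in> Fx \<Longrightarrow> R N c f \<Longrightarrow> R (N * k) (c [^] k) f"
proof (induction k)
  case 0 then show ?case by (simp add: R_zero)
next
  case (Suc k)
  then have "R (N * k + N) (c [^] k \<otimes> c) f" by (intro R_add Fx_pow) auto
  then show ?case by (simp add: add.commute)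
qed

text \<open>In \<open>XN_add\<close> for (N' - N) + N the sum and one summand are divisible by
  \<open>f\<close>; in the other summand the constant c is a unit and cancels.\<close>

lemma R_diff:
  assumes f: "f \<in> carrier P" and c: "c \<in> Fx" "c' \<in> Fx" and R: "R N c f" "R N' c' f" and le: "N \<le> N'"
  shows "R (N' - N) (c' \<otimes> inv c) f"
proof -
  define e where "e = c' \<otimes> inv c"
  have e: "e \<in> Fx" "e \<otimes> c = c'" using c Fx_inv[OF c(1)] Fx_mult[of c' "inv c"] by (auto simp: e_def m_assoc)
  have "XN ((N' - N) + N) (e \<otimes> c) = X [^]\<^bsub>P\<^esub> (N' - N) \<otimes>\<^bsub>P\<^esub> XN N c \<oplus>\<^bsub>P\<^esub> [c] \<otimes>\<^bsub>P\<^esub> XN (N' - N) e"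
    by (rule XN_add[OF e(1) c(1)])
  then have eq: "XN N' c' = X [^]\<^bsub>P\<^esub> (N' - N) \<otimes>\<^bsub>P\<^esub> XN N c \<oplus>\<^bsub>P\<^esub> [c] \<otimes>\<^bsub>P\<^esub> XN (N' - N) e"
    using e le by simp
  define a b where "a = X [^]\<^bsub>P\<^esub> (N' - N) \<otimes>\<^bsub>P\<^esub> XN N c" and "b = [c] \<otimes>\<^bsub>P\<^esub> XN (N' - N) e"
  have ab: "a \<in> carrier P" "b \<in> carrier P" unfolding a_def b_def using c e by (auto intro!: UP.m_closed XN_closed const_closed)
  have "f divides\<^bsub>P\<^esub> a" unfolding a_def using R(1) f c by (intro divides_mult_l XN_closed) (auto simp: R_def)
  moreover have "f divides\<^bsub>P\<^esub> (a \<oplus>\<^bsub>P\<^esub> b)" using R(2) eq by (simp add: R_def a_def b_def)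
  moreover have "b = (a \<oplus>\<^bsub>P\<^esub> b) \<ominus>\<^bsub>P\<^esub> a" using ab by algebra
  ultimately have "f divides\<^bsub>P\<^esub> b" using divides_diff[OF f _ ab(1)] ab by (metis UP.a_closed)
  then show ?thesis unfolding b_def R_def e_def[symmetric]
    using divides_unit_cancel[OF f XN_closed[OF e(1)] const_unit[OF c(1)]] by simp
qed

lemma const_not_divisible: "f \<in> carrier P \<Longrightarrow> length f \<ge> 2 \<Longrightarrow> c \<in> Fx \<Longrightarrow> \<not> f divides\<^bsub>P\<^esub> [c]"
  using divides_deg[of f "[c]"] const_closed[of c] by (metis One_nat_def Suc_1 Suc_n_not_le_n le_trans length_Cons list.size(3) list.distinct(1))

text \<open>Otherwise \<open>R_diff\<close> with equal exponents makes \<open>f\<close> divide the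
  nonzero constant 1 - c'/c.\<close>

lemma R_unique:
  assumes f: "f \<in> carrier P" "length f \<ge> 2" and c: "c \<in> Fx" "c' \<in> Fx" and R: "R N c f" "R N c' f"
  shows "c = c'"
proof (rule ccontr)
  assume ne: "c \<noteq> c'"
  define e where "e = c' \<otimes> inv c"
  have e: "e \<in> Fx" "e \<otimes> c = c'" using c Fx_inv[OF c(1)] Fx_mult[of c' "inv c"] by (auto simp: e_def m_assoc)
  have "e \<noteq> \<one>" using e ne c by auto
  have "R 0 e f" using R_diff[OF f(1) c R] by (simp add: e_def)
  moreover have "XN 0 e = [\<one> \<ominus> e]"
  proof -
    have "\<one> \<ominus> e \<in> Fx" using e \<open>e \<noteq> \<one>\<close> by (auto simp: r_right_minus_eq)
    moreover have "\<ominus>\<^bsub>P\<^esub> [e] = [\<ominus> e]"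
      using univ_poly_a_inv_def'[OF carrier_is_subring const_closed[OF e(1)]] by simp
    ultimately show ?thesis unfolding XN_def a_minus_def
      by (auto simp: P_one univ_poly_add a_minus_def)
  qed
  moreover have "\<one> \<ominus> e \<in> Fx" using e \<open>e \<noteq> \<one>\<close> by (auto simp: r_right_minus_eq)
  ultimately show False using const_not_divisible[OF f] by (auto simp: R_def)
qed

lemma R_X: assumes "c \<in> Fx" "R N c X" "N \<ge> 1" shows False
proof -
  have "X divides\<^bsub>P\<^esub> X [^]\<^bsub>P\<^esub> N" using assms(3)
    by (cases N) (auto simp: intro!: divides_mult_l)
  then have "X divides\<^bsub>P\<^esub> (X [^]\<^bsub>P\<^esub> N \<ominus>\<^bsub>P\<^esub> XN N c)"
    using assms by (intro divides_diff XN_closed) (auto simp: R_def)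
  moreover have "X [^]\<^bsub>P\<^esub> N \<ominus>\<^bsub>P\<^esub> XN N c = [c]"
  proof -
    have "x \<ominus>\<^bsub>P\<^esub> (x \<ominus>\<^bsub>P\<^esub> a) = a" if "x \<in> carrier P" "a \<in> carrier P" for x a using that by algebra
    then show ?thesis unfolding XN_def using assms const_closed by auto
  qed
  moreover have "length X \<ge> 2" using X_Mon MonD(2) by fastforce
  ultimately show False using const_not_divisible[OF X_closed _ assms(1)] by simp
qed

text \<open>Distinct monic primes are pairwise non-associated, so divisibility by each of them
  gives divisibility by the product.\<close>
lemma prod_primes_divides:
  assumes "finite A" "\<And>a. a \<in> A \<Longrightarrow> ring_prime\<^bsub>P\<^esub> a \<and> (\<exists>d. a \<in> Mon d)" "h \<in> carrier P" "\<And>a. a \<in> A \<Longrightarrow> a divides\<^bsub>P\<^esub> h"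
  shows "(\<Otimes>\<^bsub>P\<^esub>a\<in>A. a) divides\<^bsub>P\<^esub> h"
  using assms
proof (induction A arbitrary: h rule: finite_induct)
  case empty then show ?case using UP.one_divides by simp
next
  case (insert x A)
  have xc: "x \<in> carrier P" "ring_prime\<^bsub>P\<^esub> x" using insert.prems(1) MonD by blast+
  have Ac: "(\<lambda>a. a) \<in> A \<rightarrow> carrier P" using insert.prems(1) MonD by blast
  obtain k where k: "k \<in> carrier P" "h = x \<otimes>\<^bsub>P\<^esub> k" using insert.prems(3)[of x] unfolding factor_def by auto
  have "a divides\<^bsub>P\<^esub> k" if a: "a \<in> A" for a
  proof -
    have ac: "a \<in> carrier P" "ring_prime\<^bsub>P\<^esub> a" using insert.prems(1) a MonD by blast+
    have "\<not> a divides\<^bsub>P\<^esub> x"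
    proof
      assume d: "a divides\<^bsub>P\<^esub> x"
      then obtain z where z: "z \<in> carrier P" "x = a \<otimes>\<^bsub>P\<^esub> z" unfolding factor_def by auto
      have irr: "ring_irreducible\<^bsub>P\<^esub> x" "ring_irreducible\<^bsub>P\<^esub> a" using xc ac prime_iff_irreducible by auto
      from z irr xc ac have "a \<in> Units P \<or> z \<in> Units P"
        using UP.ring_irreducibleE(5)[OF xc(1) irr(1) ac(1) z(1)] by simp
      moreover have "a \<notin> Units P" using UP.ring_irreducibleE(4)[OF ac(1) irr(2)] .
      ultimately have "z \<in> Units P" by simp
      then obtain k where "z = [k]" unfolding univ_poly_carrier_units by blast
      then have lz: "length z = 1" by simp
      then have zn: "z \<noteq> []" by auto
      have an: "a \<noteq> []" using UP.ring_irreducibleE(1)[OF ac(1) irr(2)] by simp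
      have l: "length x = length a" using length_mult[OF ac(1) z(1) an zn] z(2) lz by simp
      obtain d e where de: "a \<in> Mon d" "x \<in> Mon e" using insert.prems(1) a by blast
      have "e = d" using l MonD(2)[OF de(1)] MonD(2)[OF de(2)] by simp
      then have "a = x" using Mon_divides_eq[OF de(1) _ d] de(2) by simp
      then show False using a insert.hyps by simp
    qed
    moreover have "a divides\<^bsub>P\<^esub> x \<otimes>\<^bsub>P\<^esub> k" using insert.prems(3)[of a] k(2) a by simp
    ultimately show ?thesis using prime_divides_mult[OF ac(2) xc(1) k(1)] by blast
  qed
  then have "(\<Otimes>\<^bsub>P\<^esub>a\<in>A. a) divides\<^bsub>P\<^esub> k" using insert.IH[OF _ k(1)] insert.prems(1) by blast
  then have "x \<otimes>\<^bsub>P\<^esub> (\<Otimes>\<^bsub>P\<^esub>a\<in>A. a) divides\<^bsub>P\<^esub> h"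
    unfolding k(2) using xc Ac k by (intro UP.divides_mult_lI) auto
  then show ?case using insert.hyps Ac xc by simp
qed

lemma Irred_R_sum_deg:
  assumes A: "finite A" "\<And>a. a \<in> A \<Longrightarrow> a \<in> Irred (d a)" and R: "\<And>a. a \<in> A \<Longrightarrow> R N c a" and c: "c \<in> Fx" and N: "N \<ge> 1"
  shows "sum d A \<le> N"
proof -
  have "(\<Otimes>\<^bsub>P\<^esub>a\<in>A. a) divides\<^bsub>P\<^esub> XN N c"
  proof (rule prod_primes_divides[OF A(1)])
    show "ring_prime\<^bsub>P\<^esub> a \<and> (\<exists>d. a \<in> Mon d)" if "a \<in> A" for a using A(2)[OF that] IrredD by blast
    show "XN N c \<in> carrier P" by (rule XN_closed[OF c])
    show "a divides\<^bsub>P\<^esub> XN N c" if "a \<in> A" for a using R[OF that] by (simp add: R_def)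
  qed
  moreover have M: "(\<Otimes>\<^bsub>P\<^esub>a\<in>A. a) \<in> Mon (sum d A)" using A IrredD(1) by (intro Mon_finprod) auto
  ultimately have "length (\<Otimes>\<^bsub>P\<^esub>a\<in>A. a) \<le> length (XN N c)"
    using divides_deg[OF _ MonD(1)[OF M] XN_closed[OF c] MonD(3)[OF XN_Mon[OF c N]]] by simp
  then show ?thesis using MonD(2)[OF M] MonD(2)[OF XN_Mon[OF c N]] by simp
qed

text \<open>The polynomials counted are distinct monic primes, so their product divides X^N - c,
  which has degree N. All counting bounds among the assumptions of \<open>irr_system\<close> are
  derived from this.\<close>

lemma card_Irred_R:
  assumes c: "c \<in> Fx" and N: "N \<ge> 1" shows "d * card {a \<in> Irred d. R N c a} \<le> N"
proof -
  have "(\<Sum>a\<in>{a \<in> Irred d. R N c a}. d) \<le> N"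
    using finite_Irred[of d] c N by (intro Irred_R_sum_deg[of _ "\<lambda>_. d" N c]) auto
  then show ?thesis by (simp add: mult.commute)
qed

end

text \<open>\<open>S\<close> is the nonnegative half of a subgroup of the integers. It is applied to
  the exponents N with X^N = 1 modulo one polynomial and to those with X^N equal to a common scalar
  modulo two.\<close>

lemma nat_subgroup_cyclic:
  fixes S :: "nat set"
  assumes add: "\<And>a b. a \<in> S \<Longrightarrow> b \<in> S \<Longrightarrow> a + b \<in> S"
    and diff: "\<And>a b. a \<in> S \<Longrightarrow> b \<in> S \<Longrightarrow> a \<le> b \<Longrightarrow> b - a \<in> S"
    and n: "n \<in> S" "n \<ge> 1"
  defines "k \<equiv> (LEAST N. N \<ge> 1 \<and> N \<in> S)"
  shows "k \<ge> 1" "\<And>N. N \<in> S \<longleftrightarrow> k dvd N"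
proof -
  have k: "k \<ge> 1" "k \<in> S" using LeastI[of "\<lambda>N. N \<ge> 1 \<and> N \<in> S" n] n unfolding k_def by auto
  show "k \<ge> 1" by (rule k(1))
  have mult: "k * j \<in> S" for j
  proof (induction j)
    case 0 show ?case using diff[OF n(1) n(1)] by simp
  next
    case (Suc j) then show ?case using add[OF k(2)] by simp
  qed
  fix N
  show "N \<in> S \<longleftrightarrow> k dvd N"
  proof
    assume N: "N \<in> S"
    have "N - k * (N div k) \<in> S" using diff[OF mult N] by simp
    then have "N mod k \<in> S" by (simp add: minus_mult_div_eq_mod)
    then have "N mod k = 0"
      using not_less_Least[of "N mod k" "\<lambda>N. N \<ge> 1 \<and> N \<in> S"] k(1) unfolding k_def[symmetric]
      by (metis less_one linorder_not_le mod_less_divisor zero_less_iff_neq_zero)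
    then show "k dvd N" by auto
  qed (use mult in auto)
qed

context finfield
begin

text \<open>Padding with leading zeros is a bijection onto all coefficient lists of length d, with
  inverse \<open>normalize\<close>.\<close>

lemma card_lower: "card {r \<in> carrier P. length r \<le> d} = q ^ d"
proof -
  define pad where "pad r = replicate (d - length r) \<zero> @ r" for r
  have np: "normalize (pad r) = r" if "r \<in> carrier P" for r
    using that normalize_replicate_zero normalize_polynomial[of "carrier F" r] unfolding pad_def univ_poly_carrier by auto
  have "bij_betw pad {r \<in> carrier P. length r \<le> d} {xs. set xs \<subseteq> carrier F \<and> length xs = d}"
  proof (rule bij_betwI[where g = normalize])
    show "pad \<in> {r \<in> carrier P. length r \<le> d} \<rightarrow> {xs. set xs \<subseteq> carrier F \<and> length xs = d}"
      by (auto simp: pad_def poly_carrier_iff)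
    show "normalize \<in> {xs. set xs \<subseteq> carrier F \<and> length xs = d} \<rightarrow> {r \<in> carrier P. length r \<le> d}"
      using normalize_gives_polynomial normalize_length_le by (auto simp: univ_poly_carrier[symmetric])
    show "normalize (pad r) = r" if "r \<in> {r \<in> carrier P. length r \<le> d}" for r using np that by auto
    show "pad (normalize xs) = xs" if "xs \<in> {xs. set xs \<subseteq> carrier F \<and> length xs = d}" for xs
      using that normalize_trick[of xs] by (auto simp: pad_def)
  qed
  then have "card {r \<in> carrier P. length r \<le> d} = card {xs. set xs \<subseteq> carrier F \<and> length xs = d}"
    by (rule bij_betw_same_card)
  then show ?thesis by (simp add: card_lists_length_eq fin)
qed

section \<open>Residue fields modulo irreducible polynomials\<close>

abbreviation Kf :: "'a list \<Rightarrow> 'a list set ring" where "Kf f \<equiv> Rupt\<^bsub>F\<^esub> (carrier F) f"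
abbreviation proj :: "'a list \<Rightarrow> 'a list \<Rightarrow> 'a list set" where "proj f \<equiv> rupture_surj (carrier F) f"

lemma Irred_irreducible: "p \<in> Irred d \<Longrightarrow> ring_irreducible\<^bsub>P\<^esub> p"
  using IrredD(2)[of p d] prime_iff_irreducible[OF Irred_closed[of p d]] by simp

lemma Kf_field: "p \<in> Irred d \<Longrightarrow> field (Kf p)"
  using rupture_is_field_iff_pirreducible[OF carrier_is_subfield Irred_closed[of p d]] Irred_irreducible[of p d] by simp

lemma pmod_image: assumes "p \<in> Irred d" shows "(\<lambda>r. pmod r p) ` carrier P = {r \<in> carrier P. length r \<le> d}"
proof -
  have p: "p \<in> carrier P" "p \<noteq> []" "length p = Suc d" using IrredD(1)[OF assms] MonD by auto
  note d = Irred_deg[OF assms]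
  show ?thesis
  proof (intro equalityI subsetI)
    fix r assume "r \<in> (\<lambda>r. pmod r p) ` carrier P"
    then obtain s where s: "s \<in> carrier P" "r = pmod s p" by auto
    have "r = [] \<or> length r - 1 < length p - 1" using pmod_degree[OF carrier_is_subfield s(1) p(1,2)] s(2) by simp
    moreover have "r \<in> carrier P" using long_division_closed(2)[OF carrier_is_subfield s(1) p(1)] s(2) by simp
    ultimately show "r \<in> {r \<in> carrier P. length r \<le> d}" using p(3) by auto
  next
    fix r assume r: "r \<in> {r \<in> carrier P. length r \<le> d}"
    then have "length r - 1 < length p - 1" using p(3) d by auto
    then have "pmod r p = r" using pmod_const(2)[OF carrier_is_subfield _ p(1)] r by auto
    then show "r \<in> (\<lambda>r. pmod r p) ` carrier P" using r by force
  qed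
qed

lemma card_Kf: assumes "p \<in> Irred d" shows "card (carrier (Kf p)) = q ^ d" "finite (carrier (Kf p))"
proof -
  have p: "p \<in> carrier P" by (rule Irred_closed[OF assms])
  note eq = rupture_carrier_as_pmod_image[OF carrier_is_subfield p, symmetric]
  show c: "card (carrier (Kf p)) = q ^ d"
    unfolding eq using card_image[OF rupture_surj_inj_on[OF carrier_is_subfield p]] card_lower pmod_image[OF assms] by simp
  then have "card (carrier (Kf p)) > 0" using q_ge_2 by simp
  then show "finite (carrier (Kf p))" by (rule card_ge_0_finite)
qed

lemma proj_hom: "p \<in> carrier P \<Longrightarrow> ring_hom_ring P (Kf p) (proj p)"
  using rupture_surj_hom(2)[OF carrier_is_subring] by simp

lemma proj_surj: "p \<in> carrier P \<Longrightarrow> y \<in> carrier (Kf p) \<Longrightarrow> \<exists>r\<in>carrier P. y = proj p r"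
proof -
  assume p: "p \<in> carrier P" and y: "y \<in> carrier (Kf p)"
  then have "y \<in> proj p ` ((\<lambda>r. pmod r p) ` carrier P)" using rupture_carrier_as_pmod_image[OF carrier_is_subfield p] by simp
  then show ?thesis using long_division_closed(2)[OF carrier_is_subfield _ p] by auto
qed

lemma proj_zero_iff: assumes p: "p \<in> carrier P" and a: "a \<in> carrier P"
  shows "proj p a = \<zero>\<^bsub>Kf p\<^esub> \<longleftrightarrow> p divides\<^bsub>P\<^esub> a"
proof -
  interpret h: ring_hom_ring P "Kf p" "proj p" by (rule proj_hom[OF p])
  have z: "proj p [] = \<zero>\<^bsub>Kf p\<^esub>" using h.hom_zero by simp
  have "proj p a = proj p [] \<longleftrightarrow> a \<ominus>\<^bsub>P\<^esub> \<zero>\<^bsub>P\<^esub> \<in> PIdl\<^bsub>P\<^esub> p"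
    using UP.quotient_eq_iff_same_a_r_cos[OF UP.cgenideal_ideal[OF p] a UP.zero_closed] by auto
  also have "a \<ominus>\<^bsub>P\<^esub> \<zero>\<^bsub>P\<^esub> = a" using a UP.minus_zero UP.r_zero unfolding a_minus_def by simp
  also have "a \<in> PIdl\<^bsub>P\<^esub> p \<longleftrightarrow> p divides\<^bsub>P\<^esub> a"
    unfolding cgenideal_def factor_def using p UP.m_comm by auto
  finally show ?thesis using z by simp
qed

text \<open>Lagrange's theorem in the unit group of the residue field, which has q^d - 1
  elements.\<close>

lemma Irred_fermat:
  assumes p: "p \<in> Irred d" and a: "a \<in> carrier P" and nd: "\<not> p divides\<^bsub>P\<^esub> a"
  shows "p divides\<^bsub>P\<^esub> (a [^]\<^bsub>P\<^esub> (q ^ d - 1) \<ominus>\<^bsub>P\<^esub> \<one>\<^bsub>P\<^esub>)"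
proof -
  note pc = Irred_closed[OF p]
  interpret h: ring_hom_ring P "Kf p" "proj p" by (rule proj_hom[OF pc])
  interpret K: field "Kf p" by (rule Kf_field[OF p])
  interpret M: group "Multiplicative_Group.mult_of (Kf p)" by (rule K.field_mult_group)
  have h0: "proj p a \<noteq> \<zero>\<^bsub>Kf p\<^esub>" "proj p a \<in> carrier (Kf p)" using proj_zero_iff[OF pc a] nd a by auto
  have "order (Multiplicative_Group.mult_of (Kf p)) = q ^ d - 1"
    using K.order_mult_of[OF card_Kf(2)[OF p]] card_Kf(1)[OF p] by (simp add: order_def)
  then have "proj p a [^]\<^bsub>Kf p\<^esub> (q ^ d - 1) = \<one>\<^bsub>Kf p\<^esub>"
    using M.pow_order_eq_1[of "proj p a"] h0 by (simp add: Multiplicative_Group.nat_pow_mult_of)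
  then have "proj p (a [^]\<^bsub>P\<^esub> (q ^ d - 1) \<ominus>\<^bsub>P\<^esub> \<one>\<^bsub>P\<^esub>) = \<zero>\<^bsub>Kf p\<^esub>"
    using a h.S.r_right_minus_eq[OF h.S.one_closed h.S.one_closed]
    by (simp add: a_minus_def h.hom_nat_pow)
  then show ?thesis using proj_zero_iff[OF pc] a by simp
qed

lemma Irred_not_X: assumes p: "p \<in> Irred d" shows "\<not> p divides\<^bsub>P\<^esub> X"
proof
  assume d: "p divides\<^bsub>P\<^esub> X"
  have "length p \<le> length X" using divides_deg[OF d Irred_closed[OF p] X_closed MonD(3)[OF X_Mon]] by simp
  then have "d = 1" using Irred_deg[OF p] MonD(2)[OF X_Mon] MonD(2)[OF IrredD(1)[OF p]] by simp
  then have "p = X" using Mon_divides_eq[OF _ X_Mon d] IrredD(1)[OF p] by simp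
  then show False using IrredD(3)[OF p] by simp
qed

lemma R_fermat: "p \<in> Irred d \<Longrightarrow> R (q ^ d - 1) \<one> p"
  using Irred_fermat[OF _ X_closed Irred_not_X] by (simp add: R_def XN_def P_one)

section \<open>Orders and weights of polynomials\<close>

definition ordr :: "'a list \<Rightarrow> nat" where
  "ordr f = (LEAST N. N \<ge> 1 \<and> N \<in> {N. R N \<one> f})"

lemma qpow_minus_one_ge: "d \<ge> 1 \<Longrightarrow> q ^ d - 1 \<ge> 1"
  using q_ge_2 one_less_power[of q d] by simp

lemma ordr: assumes p: "p \<in> Irred d"
  shows "ordr p \<ge> 1" "R N \<one> p \<longleftrightarrow> ordr p dvd N"
proof -
  note pc = Irred_closed[OF p]
  have add: "a + b \<in> {N. R N \<one> p}" if "a \<in> {N. R N \<one> p}" "b \<in> {N. R N \<one> p}" for a b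
    using R_add[OF pc Fx_one Fx_one, of a b] that by simp
  have diff: "b - a \<in> {N. R N \<one> p}" if "a \<in> {N. R N \<one> p}" "b \<in> {N. R N \<one> p}" "a \<le> b" for a b
    using R_diff[OF pc Fx_one Fx_one, of a b] that Fx_inv[OF Fx_one] by simp
  have n: "q ^ d - 1 \<in> {N. R N \<one> p}" using R_fermat[OF p] by simp
  note * = nat_subgroup_cyclic[OF add diff n qpow_minus_one_ge[OF Irred_deg[OF p]], folded ordr_def]
  show "ordr p \<ge> 1" using *(1) by simp
  show "R N \<one> p \<longleftrightarrow> ordr p dvd N" using *(2)[of N] by simp
qed

lemma ordr_dvd: "p \<in> Irred d \<Longrightarrow> ordr p dvd q ^ d - 1"
  using R_fermat ordr(2) by blast

lemma card_ordr: assumes "N \<ge> 1" shows "d * card {p \<in> Irred d. ordr p = N} \<le> N"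
proof -
  have "card {p \<in> Irred d. ordr p = N} \<le> card {p \<in> Irred d. R N \<one> p}"
    using ordr(2) finite_Irred[of d] by (intro card_mono) auto
  then show ?thesis using card_Irred_R[OF Fx_one assms, of d] by (meson le_trans mult_le_mono2)
qed

lemma card_Irred_le: "d * card (Irred d) \<le> q ^ d"
proof (cases "d = 0")
  case False
  then have "{p \<in> Irred d. R (q ^ d - 1) \<one> p} = Irred d" using R_fermat by auto
  then show ?thesis using card_Irred_R[OF Fx_one qpow_minus_one_ge[of d], of d] False by simp
qed simp

definition pairord :: "'a list \<Rightarrow> 'a list \<Rightarrow> nat" where
  "pairord f g = (LEAST N. N \<ge> 1 \<and> N \<in> {N. \<exists>c\<in>Fx. R N c f \<and> R N c g})"

lemma pairord: assumes p: "p \<in> Irred d" and p': "p' \<in> Irred d"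
  shows "pairord p p' \<ge> 1" "(\<exists>c\<in>Fx. R N c p \<and> R N c p') \<longleftrightarrow> pairord p p' dvd N"
proof -
  note pc = Irred_closed[OF p] Irred_closed[OF p']
  let ?S = "{N. \<exists>c\<in>Fx. R N c p \<and> R N c p'}"
  have add: "a + b \<in> ?S" if "a \<in> ?S" "b \<in> ?S" for a b
  proof -
    obtain c c' where "c \<in> Fx" "R a c p" "R a c p'" "c' \<in> Fx" "R b c' p" "R b c' p'" using \<open>a \<in> ?S\<close> \<open>b \<in> ?S\<close> by auto
    then show ?thesis using R_add[OF pc(1), of c c' a b] R_add[OF pc(2), of c c' a b] Fx_mult[of c c'] by blast
  qed
  have diff: "b - a \<in> ?S" if "a \<in> ?S" "b \<in> ?S" "a \<le> b" for a b
  proof -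
    obtain c c' where "c \<in> Fx" "R a c p" "R a c p'" "c' \<in> Fx" "R b c' p" "R b c' p'" using \<open>a \<in> ?S\<close> \<open>b \<in> ?S\<close> by auto
    then show ?thesis using R_diff[OF pc(1), of c c' a b] R_diff[OF pc(2), of c c' a b] Fx_mult[of c' "inv c"] Fx_inv[of c] \<open>a \<le> b\<close> by blast
  qed
  have n: "q ^ d - 1 \<in> ?S" using R_fermat[OF p] R_fermat[OF p'] Fx_one by blast
  note * = nat_subgroup_cyclic[OF add diff n qpow_minus_one_ge[OF Irred_deg[OF p]], folded pairord_def]
  show "pairord p p' \<ge> 1" using *(1) by simp
  show "(\<exists>c\<in>Fx. R N c p \<and> R N c p') \<longleftrightarrow> pairord p p' dvd N" using *(2)[of N] by simp
qed

lemma pairord_dvd: "p \<in> Irred d \<Longrightarrow> p' \<in> Irred d \<Longrightarrow> pairord p p' dvd q ^ d - 1"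
  using R_fermat[of p d] R_fermat[of p' d] pairord(2)[of p d p' "q ^ d - 1"] Fx_one by blast

text \<open>By \<open>R_unique\<close> the scalar is determined by N and \<open>p\<close>, so all
  \<open>p'\<close> counted here divide one and the same X^N - c.\<close>

lemma card_pairord: assumes p: "p \<in> Irred d" and N: "N \<ge> 1"
  shows "d * card {p' \<in> Irred d. pairord p p' = N} \<le> N"
proof (cases "{p' \<in> Irred d. pairord p p' = N} = {}")
  case True then show ?thesis by (simp only: True) simp
next
  case False
  have R: "\<exists>c\<in>Fx. R N c p \<and> R N c p'" if "p' \<in> Irred d" "pairord p p' = N" for p'
    using pairord(2)[OF p that(1), of N] that(2) by simp
  with False obtain c where c: "c \<in> Fx" "R N c p" by blast
  have l: "length p \<ge> 2" using Irred_deg[OF p] MonD(2)[OF IrredD(1)[OF p]] by simp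
  have "{p' \<in> Irred d. pairord p p' = N} \<subseteq> {p' \<in> Irred d. R N c p'}"
    using R R_unique[OF Irred_closed[OF p] l] c by blast
  then have "card {p' \<in> Irred d. pairord p p' = N} \<le> card {p' \<in> Irred d. R N c p'}"
    using finite_Irred[of d] by (intro card_mono) auto
  then show ?thesis using card_Irred_R[OF c(1) N, of d] by (meson le_trans mult_le_mono2)
qed

text \<open>The weight is \<open>0\<close> if no \<open>N\<close> exists, that is, if \<open>X\<close> divides a member of \<open>A\<close>.\<close>
definition wt :: "'a list set \<Rightarrow> real" where
  "wt A = (if \<exists>N\<ge>1. \<exists>c\<in>Fx. \<forall>a\<in>A. R N c a
           then 1 / real (LEAST N. N \<ge> 1 \<and> (\<exists>c\<in>Fx. \<forall>a\<in>A. R N c a)) else 0)"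

lemma wt_nonneg: "wt A \<ge> 0" by (simp add: wt_def)

lemma wt_cases:
  obtains "wt A = 0" | N c where "N \<ge> 1" "c \<in> Fx" "\<forall>a\<in>A. R N c a" "wt A = 1 / real N"
proof (cases "\<exists>N\<ge>1. \<exists>c\<in>Fx. \<forall>a\<in>A. R N c a")
  case True
  let ?N = "LEAST N. N \<ge> 1 \<and> (\<exists>c\<in>Fx. \<forall>a\<in>A. R N c a)"
  have "\<exists>N. N \<ge> 1 \<and> (\<exists>c\<in>Fx. \<forall>a\<in>A. R N c a)" using True by blast
  note this[THEN LeastI_ex]
  moreover have "wt A = 1 / real ?N" using True unfolding wt_def by simp
  ultimately show ?thesis using that(2)[of ?N] by blast
next
  case False
  then have "wt A = 0" unfolding wt_def by (rule if_not_P)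
  then show ?thesis by (rule that(1))
qed

lemma wt_ge: assumes "N \<ge> 1" "c \<in> Fx" "\<forall>a\<in>A. R N c a" shows "1 / real N \<le> wt A"
proof -
  let ?Q = "\<lambda>N. N \<ge> 1 \<and> (\<exists>c\<in>Fx. \<forall>a\<in>A. R N c a)"
  have "?Q N" using assms by blast
  then have "?Q (Least ?Q)" "Least ?Q \<le> N" by (rule LeastI, rule Least_le)
  moreover have "wt A = 1 / real (Least ?Q)" using assms unfolding wt_def by meson
  ultimately show ?thesis by (simp add: frac_le)
qed

text \<open>An exponent that works for \<open>f\<close> works for all its divisors. This allows
  \<open>f\<close> to be replaced by the set of its prime factors of odd multiplicity.\<close>

lemma wt_mono: assumes "f \<in> carrier P" "\<And>a. a \<in> A \<Longrightarrow> a \<in> carrier P \<and> a divides\<^bsub>P\<^esub> f"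
  shows "wt {f} \<le> wt A"
proof (rule wt_cases[of "{f}"])
  fix N c assume N: "N \<ge> 1" "c \<in> Fx" "\<forall>a\<in>{f}. R N c a" "wt {f} = 1 / real N"
  then have "\<forall>a\<in>A. R N c a" using assms R_divides[of N c f] by blast
  then show ?thesis using wt_ge[OF N(1,2)] N(4) by simp
qed (use wt_nonneg in simp)

lemma wt_le_one: "wt A \<le> 1"
  by (rule wt_cases[of A]) auto

text \<open>Since c^(q-1) = 1, an exponent N giving a scalar becomes an exponent N(q - 1) giving
  one, which is a common multiple of both orders. This is the origin of the factor q - 1.\<close>

lemma wt_ordr:
  assumes p: "p \<in> Irred d" "p \<in> A" and p': "p' \<in> Irred d'" "p' \<in> A"
  shows "wt A \<le> (q - 1) / lcm (ordr p) (ordr p')"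
proof (rule wt_cases[of A])
  fix N c assume N: "N \<ge> 1" "c \<in> Fx" "\<forall>a\<in>A. R N c a" "wt A = 1 / real N"
  have "R (N * (q - 1)) (c [^] (q - 1)) p" "R (N * (q - 1)) (c [^] (q - 1)) p'"
    using N p p' by (intro R_mult Irred_closed; simp)+
  then have "R (N * (q - 1)) \<one> p" "R (N * (q - 1)) \<one> p'" by (simp_all only: Fx_fermat[OF N(2)])
  then have "lcm (ordr p) (ordr p') dvd N * (q - 1)" using ordr(2)[OF p(1)] ordr(2)[OF p'(1)] by simp
  moreover have "N * (q - 1) > 0" using N(1) q_ge_2 by simp
  ultimately have "lcm (ordr p) (ordr p') \<le> N * (q - 1)" by (rule dvd_imp_le)
  moreover have "lcm (ordr p) (ordr p') > 0" using ordr(1)[OF p(1)] ordr(1)[OF p'(1)] by (simp add: lcm_pos_nat)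
  moreover have "real (lcm (ordr p) (ordr p')) \<le> real N * real (q - 1)"
    using \<open>lcm (ordr p) (ordr p') \<le> N * (q - 1)\<close> by (metis of_nat_le_iff of_nat_mult)
  ultimately show ?thesis unfolding N(4) using N(1) by (simp add: divide_simps mult.commute)
qed simp

lemma wt_pairord:
  assumes p: "p \<in> Irred d" "p \<in> A" and p': "p' \<in> Irred d" "p' \<in> A"
  shows "wt A \<le> 1 / pairord p p'"
proof (rule wt_cases[of A])
  fix N c assume N: "N \<ge> 1" "c \<in> Fx" "\<forall>a\<in>A. R N c a" "wt A = 1 / real N"
  then have "pairord p p' dvd N" using pairord(2)[OF p(1) p'(1), of N] p p' by blast
  then have "pairord p p' \<le> N" using N(1) by (auto intro: dvd_imp_le)
  then show ?thesis unfolding N(4) using N(1) pairord(1)[OF p(1) p'(1)] by (simp add: divide_simps)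
qed simp

end

section \<open>The Frobenius map\<close>

lemma (in cring) binomial_expansion:
  assumes a: "a \<in> carrier R" and b: "b \<in> carrier R"
  shows "(a \<oplus> b) [^] (n::nat) = (\<Oplus>k\<in>{..n}. add_pow R (n choose k) (a [^] k \<otimes> b [^] (n - k)))"
proof (induction n)
  case 0 show ?case using a b by simp
next
  case (Suc n)
  define f where "f k = a [^] k \<otimes> b [^] (n - k)" for k
  define g where "g k = a [^] k \<otimes> b [^] (Suc n - k)" for k
  have fc: "f k \<in> carrier R" and gc: "g k \<in> carrier R" for k using a b by (auto simp: f_def g_def)
  have fa: "a \<otimes> f k = g (Suc k)" for k using a b by (simp add: f_def g_def nat_pow_Suc2 m_ac)
  have fb: "b \<otimes> f k = g k" if "k \<le> n" for k
  proof -
    have "Suc n - k = Suc (n - k)" using that by simp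
    then show ?thesis using a b by (simp add: f_def g_def m_ac)
  qed
  have "(a \<oplus> b) [^] Suc n = (a \<oplus> b) \<otimes> (\<Oplus>k\<in>{..n}. add_pow R (n choose k) (f k))"
    using Suc a b by (simp add: f_def m_comm)
  also have "\<dots> = a \<otimes> (\<Oplus>k\<in>{..n}. add_pow R (n choose k) (f k)) \<oplus> b \<otimes> (\<Oplus>k\<in>{..n}. add_pow R (n choose k) (f k))"
    using a b fc by (intro l_distr) auto
  also have "a \<otimes> (\<Oplus>k\<in>{..n}. add_pow R (n choose k) (f k)) = (\<Oplus>k\<in>{..n}. add_pow R (n choose k) (g (Suc k)))"
    using a fc by (subst finsum_rdistr) (auto simp: add_pow_rdistr fa[symmetric] intro!: finsum_cong')
  also have "b \<otimes> (\<Oplus>k\<in>{..n}. add_pow R (n choose k) (f k)) = (\<Oplus>k\<in>{..n}. add_pow R (n choose k) (g k))"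
    using b fc gc by (subst finsum_rdistr) (auto simp: add_pow_rdistr fb[symmetric] intro!: finsum_cong')
  also have "\<dots> = (\<Oplus>k\<in>{..Suc n}. add_pow R (n choose k) (g k))"
    using gc by (simp add: finsum_Suc binomial_eq_0)
  also have "\<dots> = (\<Oplus>k\<in>{..n}. add_pow R (n choose (Suc k)) (g (Suc k))) \<oplus> g 0"
    using gc by (subst finsum_Suc2) auto
  also have "(\<Oplus>k\<in>{..n}. add_pow R (n choose k) (g (Suc k))) \<oplus> ((\<Oplus>k\<in>{..n}. add_pow R (n choose (Suc k)) (g (Suc k))) \<oplus> g 0)
    = (\<Oplus>k\<in>{..n}. add_pow R (n choose k) (g (Suc k)) \<oplus> add_pow R (n choose (Suc k)) (g (Suc k))) \<oplus> g 0"
    using gc by (subst finsum_addf) (auto simp: a_assoc)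
  also have "\<dots> = (\<Oplus>k\<in>{..n}. add_pow R (Suc n choose (Suc k)) (g (Suc k))) \<oplus> g 0"
    using gc by (intro arg_cong2[where f = "(\<oplus>)"] finsum_cong') (auto simp: add.nat_pow_mult)
  also have "\<dots> = (\<Oplus>k\<in>{..Suc n}. add_pow R (Suc n choose k) (g k))"
    using gc by (subst finsum_Suc2) auto
  finally show ?case by (simp add: g_def)
qed

lemma (in cring) freshmans_dream:
  assumes a: "a \<in> carrier R" and b: "b \<in> carrier R" and p: "Factorial_Ring.prime p"
    and char: "\<And>x. x \<in> carrier R \<Longrightarrow> add_pow R p x = \<zero>"
  shows "(a \<oplus> b) [^] (p::nat) = a [^] p \<oplus> b [^] p"
proof -
  have p2: "p \<ge> 2" using prime_ge_2_nat[OF p] .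
  define g where "g k = add_pow R (p choose k) (a [^] k \<otimes> b [^] (p - k))" for k
  have gc: "g k \<in> carrier R" for k using a b by (auto simp: g_def)
  define m where "m = p - 2"
  have m: "p = Suc (Suc m)" using p2 by (simp add: m_def)
  have z: "g k = \<zero>" if "0 < k" "k < p" for k
  proof -
    have "p dvd (p choose k)" using dvd_choose_prime[of k p] that p by simp
    then obtain j where "p choose k = p * j" by (elim dvdE)
    then have "g k = add_pow R j (add_pow R p (a [^] k \<otimes> b [^] (p - k)))"
      unfolding g_def using a b by (simp add: add.nat_pow_pow mult.commute)
    then show ?thesis using char a b by simp
  qed
  have "(a \<oplus> b) [^] p = (\<Oplus>k\<in>{..Suc (Suc m)}. g k)"
    using binomial_expansion[OF a b, of p] by (simp add: g_def m)
  also have "\<dots> = g (Suc (Suc m)) \<oplus> (\<Oplus>k\<in>{..Suc m}. g k)" using gc by (subst finsum_Suc) auto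
  also have "(\<Oplus>k\<in>{..Suc m}. g k) = (\<Oplus>k\<in>{..m}. g (Suc k)) \<oplus> g 0" using gc by (subst finsum_Suc2) auto
  also have "(\<Oplus>k\<in>{..m}. g (Suc k)) = (\<Oplus>k\<in>{..m}. \<zero>)" by (intro finsum_cong') (auto simp: z m)
  finally show ?thesis using a b gc by (simp add: g_def m)
qed

lemma (in cring) freshmans_dream_pow:
  assumes a: "a \<in> carrier R" and b: "b \<in> carrier R" and p: "Factorial_Ring.prime p"
    and char: "\<And>x. x \<in> carrier R \<Longrightarrow> add_pow R p x = \<zero>"
  shows "(a \<oplus> b) [^] ((p::nat) ^ k) = a [^] (p ^ k) \<oplus> b [^] (p ^ k)"
proof (induction k)
  case 0 show ?case using a b by simp
next
  case (Suc k)
  have "(a \<oplus> b) [^] (p ^ Suc k) = ((a \<oplus> b) [^] (p ^ k)) [^] p"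
    using a b by (simp add: nat_pow_pow mult.commute)
  also have "\<dots> = (a [^] (p ^ k)) [^] p \<oplus> (b [^] (p ^ k)) [^] p"
    unfolding Suc by (rule freshmans_dream[OF _ _ p char]) (use a b in auto)
  finally show ?case using a b by (simp add: nat_pow_pow mult.commute)
qed

context finfield
begin

text \<open>The additive group has order q = p^e, so p^e times one vanishes; as p^e times one is a
  power of p times one and there are no zero divisors, p times one vanishes too.\<close>

lemma char_exists:
  assumes "primepow q"
  obtains p e where "Factorial_Ring.prime p" "e \<ge> 1" "q = p ^ e" "\<And>x. x \<in> carrier P \<Longrightarrow> add_pow P p x = \<zero>\<^bsub>P\<^esub>"
proof -
  obtain p e where pe: "Factorial_Ring.prime p" "e \<ge> 1" "q = p ^ e" using assms unfolding primepow_def by (auto simp: Suc_le_eq)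
  have "order (add_monoid F) = q" by (simp add: order_def)
  then have q0: "add_pow F q \<one> = \<zero>" using add.pow_order_eq_1[of \<one>] by (simp add: add_pow_def)
  have "add_pow F (p ^ k) \<one> = \<zero> \<Longrightarrow> add_pow F p \<one> = \<zero>" for k
  proof (induction k)
    case 0 then show ?case by simp
  next
    case (Suc k)
    have "(add_pow F p \<one>) \<otimes> (add_pow F (p ^ k) \<one>) = add_pow F p (add_pow F (p ^ k) \<one>)" by (subst add_pow_ldistr) auto
    also have "\<dots> = \<zero>" using Suc.prems by (simp add: add.nat_pow_pow mult.commute)
    finally show ?case using integral[of "add_pow F p \<one>" "add_pow F (p ^ k) \<one>"] Suc.IH by auto
  qed
  then have p0: "add_pow F p \<one> = \<zero>" using q0 pe by metis
  interpret h: ring_hom_ring F P poly_of_const using canonical_embedding_ring_hom[OF carrier_is_subring] by simp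
  have "poly_of_const (add_pow F k \<one>) = add_pow P k \<one>\<^bsub>P\<^esub>" for k :: nat
    by (induction k) (auto simp: h.hom_add)
  then have "add_pow P p \<one>\<^bsub>P\<^esub> = \<zero>\<^bsub>P\<^esub>" using p0 by (metis h.hom_zero)
  then have "add_pow P p x = \<zero>\<^bsub>P\<^esub>" if "x \<in> carrier P" for x
    using UP.add_pow_ldistr[of "\<one>\<^bsub>P\<^esub>" x p] that by (metis UP.l_null UP.l_one UP.one_closed)
  then show ?thesis using that pe by blast
qed

abbreviation cst :: "'a \<Rightarrow> 'a list" where "cst c \<equiv> (if c = \<zero> then [] else [c])"

lemma cst_closed: "c \<in> carrier F \<Longrightarrow> cst c \<in> carrier P" by (simp add: poly_carrier_iff)

lemma cst_add: "c \<in> carrier F \<Longrightarrow> d \<in> carrier F \<Longrightarrow> cst c \<oplus>\<^bsub>P\<^esub> cst d = cst (c \<oplus> d)"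
  by (simp add: univ_poly_add)

lemma cst_mult: "c \<in> carrier F \<Longrightarrow> d \<in> carrier F \<Longrightarrow> cst c \<otimes>\<^bsub>P\<^esub> cst d = cst (c \<otimes> d)"
  using integral[of c d] by (auto simp: univ_poly_mult)

lemma times_X_add_const: assumes p: "p \<in> carrier P" and c: "c \<in> carrier F"
  shows "p \<otimes>\<^bsub>P\<^esub> X \<oplus>\<^bsub>P\<^esub> cst c = (if p = [] then cst c else p @ [c])"
proof (cases "p = []")
  case True
  then show ?thesis using poly_mult_var[OF carrier_is_subring p] UP.l_zero[OF cst_closed[OF c]] by simp
next
  case False
  then have pX: "p \<otimes>\<^bsub>P\<^esub> X = p @ [\<zero>]" using poly_mult_var[OF carrier_is_subring p] by simp
  have pc: "p @ [d] \<in> carrier P" if "d \<in> carrier F" for d using p False that by (auto simp: poly_carrier_iff)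
  show ?thesis
  proof (cases "c = \<zero>")
    case True then show ?thesis using pX pc[OF c] UP.r_zero[of "p @ [\<zero>]"] False by simp
  next
    case c0: False
    have sp: "set p \<subseteq> carrier F" "hd p \<noteq> \<zero>" using p False poly_carrier_iff by auto
    have "map2 (\<oplus>) p (replicate (length p) \<zero>) = p" using sp(1) by (induction p) auto
    then have "ring.poly_add F (p @ [\<zero>]) [c] = normalize (p @ [c])" using c by simp
    also have "\<dots> = p @ [c]" using pc[OF c] normalize_polynomial univ_poly_carrier by blast
    finally show ?thesis using pX c0 False by (simp add: univ_poly_add)
  qed
qed

text \<open>Appending a coefficient to a list turns p into p X + c, so reverse induction on lists
  becomes induction along Horner's scheme.\<close>

lemma poly_induct [consumes 1, case_names zero step]:
  assumes "p \<in> carrier P" "Q []"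
    and "\<And>p c. p \<in> carrier P \<Longrightarrow> Q p \<Longrightarrow> c \<in> carrier F \<Longrightarrow> Q (p \<otimes>\<^bsub>P\<^esub> X \<oplus>\<^bsub>P\<^esub> cst c)"
  shows "Q p"
  using assms(1)
proof (induction p rule: rev_induct)
  case Nil show ?case by (rule assms(2))
next
  case (snoc c p)
  have p: "p \<in> carrier P" and c: "c \<in> carrier F" using snoc.prems by (cases p; auto simp: poly_carrier_iff)+
  have "Q (p \<otimes>\<^bsub>P\<^esub> X \<oplus>\<^bsub>P\<^esub> cst c)" by (rule assms(3)[OF p snoc.IH[OF p] c])
  moreover have "(if p = [] then cst c else p @ [c]) = p @ [c]" using snoc.prems by (auto simp: poly_carrier_iff)
  ultimately show ?case unfolding times_X_add_const[OF p c] by (simp only:)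
qed

text \<open>Frobenius: modulo a divisor of $X^Q-X$, with $Q$ a power of $q$, every polynomial is fixed
  by the $Q$-th power map.\<close>
lemma frobenius_fixed:
  assumes pq: "primepow q" and h: "h \<in> carrier P" "h divides\<^bsub>P\<^esub> (X [^]\<^bsub>P\<^esub> (q ^ m) \<ominus>\<^bsub>P\<^esub> X)" and y: "y \<in> carrier P"
  shows "h divides\<^bsub>P\<^esub> (y [^]\<^bsub>P\<^esub> (q ^ m) \<ominus>\<^bsub>P\<^esub> y)"
  using y
proof (induction y rule: poly_induct)
  case zero
  have "q ^ m \<noteq> 0" using q_ge_2 by simp
  then have "\<zero>\<^bsub>P\<^esub> [^]\<^bsub>P\<^esub> (q ^ m) = \<zero>\<^bsub>P\<^esub>" by (intro UP.nat_pow_zero)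
  then show ?case using UP.r_right_minus_eq[OF UP.zero_closed UP.zero_closed] UP.divides_zero[OF h(1)] by simp
next
  case (step p c)
  obtain r e where re: "Factorial_Ring.prime r" "e \<ge> 1" "q = r ^ e" "\<And>x. x \<in> carrier P \<Longrightarrow> add_pow P r x = \<zero>\<^bsub>P\<^esub>"
    using char_exists[OF pq] by metis
  have Q: "q ^ m = r ^ (e * m)" by (simp add: re(3) power_mult)
  define Q where "Q = q ^ m"
  define k where "k = (if c = \<zero> then [] else [c])"
  have kc: "k \<in> carrier P" using step.hyps(2) by (auto simp: k_def poly_carrier_iff)
  have kQ: "k [^]\<^bsub>P\<^esub> Q = k"
  proof (cases "c = \<zero>")
    case True
    have "Q \<noteq> 0" using q_ge_2 by (simp add: Q_def)
    then show ?thesis using True UP.nat_pow_zero[of Q] by (simp add: k_def)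
  next
    case False
    then have c: "c \<in> Fx" using step.hyps(2) by simp
    have cpow: "[c] [^]\<^bsub>P\<^esub> (n::nat) = [c [^] n]" for n
    proof (induction n)
      case (Suc n) then show ?case using const_mult[OF Fx_pow[OF c] c] by simp
    qed (simp add: P_one)
    have "c [^] (q ^ j) = c" for j
    proof (induction j)
      case (Suc j)
      have "c [^] (q ^ Suc j) = (c [^] (q ^ j)) [^] q" using c by (simp add: nat_pow_pow mult.commute)
      also have "\<dots> = c [^] (q - 1) \<otimes> c" using Suc q_ge_2 c
        by (metis (no_types, lifting) Suc_diff_1 less_le_trans nat_pow_Suc pos2)
      finally show ?case using Fx_fermat[OF c] c by simp
    qed (use c in simp)
    then show ?thesis using cpow False by (simp add: k_def Q_def)
  qed
  define pQ xQ where "pQ = p [^]\<^bsub>P\<^esub> Q" and "xQ = X [^]\<^bsub>P\<^esub> Q"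
  have cl: "pQ \<in> carrier P" "xQ \<in> carrier P" "p \<in> carrier P" "X \<in> carrier P" using step.hyps(1) by (auto simp: pQ_def xQ_def)
  have "(p \<otimes>\<^bsub>P\<^esub> X \<oplus>\<^bsub>P\<^esub> k) [^]\<^bsub>P\<^esub> Q = (p \<otimes>\<^bsub>P\<^esub> X) [^]\<^bsub>P\<^esub> Q \<oplus>\<^bsub>P\<^esub> k [^]\<^bsub>P\<^esub> Q"
    unfolding Q_def Q by (rule UP.freshmans_dream_pow[OF _ kc re(1) re(4)]) (use cl in auto)
  also have "\<dots> = pQ \<otimes>\<^bsub>P\<^esub> xQ \<oplus>\<^bsub>P\<^esub> k" using cl kQ by (simp add: pQ_def xQ_def UP.nat_pow_distrib)
  finally have "(p \<otimes>\<^bsub>P\<^esub> X \<oplus>\<^bsub>P\<^esub> k) [^]\<^bsub>P\<^esub> Q \<ominus>\<^bsub>P\<^esub> (p \<otimes>\<^bsub>P\<^esub> X \<oplus>\<^bsub>P\<^esub> k)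
     = (pQ \<otimes>\<^bsub>P\<^esub> xQ \<oplus>\<^bsub>P\<^esub> k) \<ominus>\<^bsub>P\<^esub> (p \<otimes>\<^bsub>P\<^esub> X \<oplus>\<^bsub>P\<^esub> k)" by simp
  also have "\<dots> = pQ \<otimes>\<^bsub>P\<^esub> (xQ \<ominus>\<^bsub>P\<^esub> X) \<oplus>\<^bsub>P\<^esub> X \<otimes>\<^bsub>P\<^esub> (pQ \<ominus>\<^bsub>P\<^esub> p)" using cl kc by algebra
  finally have eq: "(p \<otimes>\<^bsub>P\<^esub> X \<oplus>\<^bsub>P\<^esub> k) [^]\<^bsub>P\<^esub> Q \<ominus>\<^bsub>P\<^esub> (p \<otimes>\<^bsub>P\<^esub> X \<oplus>\<^bsub>P\<^esub> k)
     = pQ \<otimes>\<^bsub>P\<^esub> (xQ \<ominus>\<^bsub>P\<^esub> X) \<oplus>\<^bsub>P\<^esub> X \<otimes>\<^bsub>P\<^esub> (pQ \<ominus>\<^bsub>P\<^esub> p)" .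
  have "h divides\<^bsub>P\<^esub> (pQ \<otimes>\<^bsub>P\<^esub> (xQ \<ominus>\<^bsub>P\<^esub> X) \<oplus>\<^bsub>P\<^esub> X \<otimes>\<^bsub>P\<^esub> (pQ \<ominus>\<^bsub>P\<^esub> p))"
    using h step.IH cl unfolding Q_def[symmetric] pQ_def[symmetric] xQ_def[symmetric]
    by (intro divides_add divides_mult_l UP.m_closed UP.minus_closed) simp_all
  then show ?case unfolding eq[symmetric] Q_def k_def .
qed

end

lemma minus_one_dvd_pow_minus_one: "(x::nat) - 1 dvd x ^ k - 1"
proof (cases "x = 0")
  case False
  then have x: "x \<ge> 1" "x ^ k \<ge> 1" for k by auto
  show ?thesis
  proof (induction k)
    case (Suc k)
    have "x ^ Suc k - 1 = x * (x ^ k - 1) + (x - 1)"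
      using x(1) x(2)[of k] by (simp add: diff_mult_distrib2)
    then show ?case using Suc by (metis dvd_add dvd_mult dvd_refl)
  qed simp
qed (cases k; simp)

context finfield
begin

section \<open>Prime factorisation and the number of irreducibles\<close>

abbreviation dg :: "'a list \<Rightarrow> nat" where "dg a \<equiv> length a - 1"

lemma Mon_dg: "a \<in> Mon d \<Longrightarrow> dg a = d" using MonD(2) by simp

definition primes :: "'a list set" where "primes = {p. p \<in> Mon (dg p) \<and> ring_prime\<^bsub>P\<^esub> p}"

lemma primesD: "p \<in> primes \<Longrightarrow> p \<in> Mon (dg p)" "p \<in> primes \<Longrightarrow> ring_prime\<^bsub>P\<^esub> p" "p \<in> primes \<Longrightarrow> p \<in> carrier P"
  using MonD(1) by (auto simp: primes_def)

lemma primes_Irred: "p \<in> primes \<Longrightarrow> p \<noteq> X \<Longrightarrow> p \<in> Irred (dg p)"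
  unfolding Irred_def primes_def by simp

lemma monic_prime_divisor:
  assumes f: "f \<in> Mon m" and m: "m \<ge> 1"
  obtains p where "p \<in> primes" "p divides\<^bsub>P\<^esub> f" "dg p \<ge> 1"
proof -
  have fc: "f \<in> carrier P - {\<zero>\<^bsub>P\<^esub>}" using MonD(1,3)[OF f] by simp
  have "f \<notin> Units P" unfolding univ_poly_carrier_units using MonD(2)[OF f] m by auto
  then obtain b where b: "b \<in> carrier P" "ring_irreducible\<^bsub>P\<^esub> b" "b divides\<^bsub>P\<^esub> f"
    using UP.exists_irreducible_divisor[OF fc] by blast
  have pb: "ring_prime\<^bsub>P\<^esub> b" using b prime_iff_irreducible by simp
  have b0: "b \<noteq> []" using UP.ring_irreducibleE(1)[OF b(1,2)] by simp
  obtain c p where cp: "c \<in> Fx" "p \<in> Mon (dg b)" "b = [c] \<otimes>\<^bsub>P\<^esub> p" using monic_assoc[OF b(1) b0] by blast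
  have pc: "p \<in> carrier P" "p \<noteq> []" using MonD[OF cp(2)] by auto
  have cc: "[c] \<in> carrier P" using cp(1) by (rule const_closed)
  have pdb: "p divides\<^bsub>P\<^esub> b" unfolding cp(3) using cc pc by (intro divides_mult_l UP.divides_refl)
  have bdp: "b divides\<^bsub>P\<^esub> p"
    by (rule divides_unit_cancel[OF b(1) pc(1) const_unit[OF cp(1)]]) (simp add: cp(3)[symmetric] UP.divides_refl[OF b(1)])
  have "b \<notin> Units P" using UP.ring_irreducibleE(4)[OF b(1,2)] .
  then have lb: "dg b \<ge> 1" using univ_poly_units'[OF carrier_is_subfield, of b] b(1) b0 by auto
  have "ring_prime\<^bsub>P\<^esub> p"
  proof (rule UP.ring_primeI)
    show "p \<noteq> \<zero>\<^bsub>P\<^esub>" using pc by simp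
    show "Divisibility.prime P p"
    proof (rule primeI)
      show "p \<notin> Units P" unfolding univ_poly_carrier_units using MonD(2)[OF cp(2)] lb by auto
      fix x y assume xy: "x \<in> carrier P" "y \<in> carrier P" "p divides\<^bsub>P\<^esub> x \<otimes>\<^bsub>P\<^esub> y"
      then have "b divides\<^bsub>P\<^esub> x \<otimes>\<^bsub>P\<^esub> y" using UP.divides_trans[OF bdp _ b(1)] by blast
      then have "b divides\<^bsub>P\<^esub> x \<or> b divides\<^bsub>P\<^esub> y" using prime_divides_mult[OF pb xy(1,2)] by simp
      then show "p divides\<^bsub>P\<^esub> x \<or> p divides\<^bsub>P\<^esub> y" using UP.divides_trans[OF pdb _ pc(1)] by blast
    qed
  qed
  moreover have "dg p = dg b" using Mon_dg[OF cp(2)] .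
  ultimately have "p \<in> primes" "dg p \<ge> 1" using cp(2) lb by (auto simp: primes_def)
  moreover have "p divides\<^bsub>P\<^esub> f" using UP.divides_trans[OF pdb b(3) pc(1)] .
  ultimately show ?thesis using that by blast
qed

lemma Mon_quotient:
  assumes f: "f \<in> Mon m" and p: "p \<in> Mon d" and dv: "p divides\<^bsub>P\<^esub> f"
  obtains g where "g \<in> Mon (m - d)" "f = p \<otimes>\<^bsub>P\<^esub> g" "d \<le> m"
proof -
  obtain g where g: "g \<in> carrier P" "f = p \<otimes>\<^bsub>P\<^esub> g" using dv unfolding factor_def by auto
  have pc: "p \<in> carrier P" "p \<noteq> []" using MonD[OF p] by auto
  have g0: "g \<noteq> []" using g MonD(3)[OF f] UP.r_null[OF pc(1)] by auto
  have l: "Suc m = Suc d + length g - 1" using length_mult[OF pc(1) g(1) pc(2) g0] g(2) MonD(2)[OF f] MonD(2)[OF p] by simp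
  have "hd g \<in> carrier F" using g(1) g0 by (cases g) (simp_all add: poly_carrier_iff)
  then have h: "hd g = \<one>" using hd_mult[OF pc(1) g(1) pc(2) g0] g(2) MonD(4)[OF f] MonD(4)[OF p] by simp
  have "d \<le> m" "length g = Suc (m - d)" using l g0 by (cases g; simp)+
  then have "g \<in> Mon (m - d)" "d \<le> m" using g(1) h unfolding Mon_def by simp_all
  then show ?thesis using that g(2) by blast
qed

text \<open>Split off one monic prime \<open>p\<close> at a time: if \<open>p\<close> already occurs
  in \<open>A\<close>, both copies move into the square part, otherwise \<open>p\<close> joins
  \<open>A\<close>.\<close>

lemma squarefree_part:
  assumes "f \<in> Mon m"
  shows "\<exists>A b j. finite A \<and> A \<subseteq> primes \<and> b \<in> Mon j \<and> f = (\<Otimes>\<^bsub>P\<^esub>a\<in>A. a) \<otimes>\<^bsub>P\<^esub> (b \<otimes>\<^bsub>P\<^esub> b) \<and> m = sum dg A + 2 * j"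
  using assms
proof (induction m arbitrary: f rule: less_induct)
  case (less m)
  show ?case
  proof (cases "m = 0")
    case True
    then have "f = \<one>\<^bsub>P\<^esub>" using less.prems Mon_0 by simp
    then show ?thesis using True by (intro exI[of _ "{}"] exI[of _ "\<one>\<^bsub>P\<^esub>"] exI[of _ 0]) (simp add: Mon_0)
  next
    case False
    then obtain p where p: "p \<in> primes" "p divides\<^bsub>P\<^esub> f" "dg p \<ge> 1" using monic_prime_divisor[OF less.prems] by auto
    obtain g where g: "g \<in> Mon (m - dg p)" "f = p \<otimes>\<^bsub>P\<^esub> g" "dg p \<le> m"
      using Mon_quotient[OF less.prems primesD(1)[OF p(1)] p(2)] by blast
    have "m - dg p < m" using p(3) False by simp
    from less.IH[OF this g(1)] obtain A b j where A: "finite A" "A \<subseteq> primes" "b \<in> Mon j"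
      "g = (\<Otimes>\<^bsub>P\<^esub>a\<in>A. a) \<otimes>\<^bsub>P\<^esub> (b \<otimes>\<^bsub>P\<^esub> b)" "m - dg p = sum dg A + 2 * j" by blast
    have pc: "p \<in> carrier P" "b \<in> carrier P" using primesD(3)[OF p(1)] MonD(1)[OF A(3)] by auto
    have Ac: "(\<lambda>a. a) \<in> A \<rightarrow> carrier P" using A(2) primesD(3) by blast
    have cA: "(\<Otimes>\<^bsub>P\<^esub>a\<in>A. a) \<in> carrier P" by (rule UP.finprod_closed[OF Ac])
    show ?thesis
    proof (cases "p \<in> A")
      case False
      have "f = (\<Otimes>\<^bsub>P\<^esub>a\<in>insert p A. a) \<otimes>\<^bsub>P\<^esub> (b \<otimes>\<^bsub>P\<^esub> b)"
        using g(2) A(1,4) False pc cA Ac by (simp add: UP.m_assoc)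
      moreover have "m = sum dg (insert p A) + 2 * j" using A(1,5) False g(3) by simp
      ultimately show ?thesis using A p(1) by (intro exI[of _ "insert p A"] exI[of _ b] exI[of _ j]) simp
    next
      case True
      define B where "B = A - {p}"
      have B: "A = insert p B" "p \<notin> B" "finite B" "B \<subseteq> primes" using True A(1,2) by (auto simp: B_def)
      have Bc: "(\<lambda>a. a) \<in> B \<rightarrow> carrier P" using B(4) primesD(3) by blast
      have cB: "(\<Otimes>\<^bsub>P\<^esub>a\<in>B. a) \<in> carrier P" by (rule UP.finprod_closed[OF Bc])
      have "(\<Otimes>\<^bsub>P\<^esub>a\<in>A. a) = p \<otimes>\<^bsub>P\<^esub> (\<Otimes>\<^bsub>P\<^esub>a\<in>B. a)" unfolding B(1) using B pc Bc by simp
      then have "f = p \<otimes>\<^bsub>P\<^esub> ((p \<otimes>\<^bsub>P\<^esub> (\<Otimes>\<^bsub>P\<^esub>a\<in>B. a)) \<otimes>\<^bsub>P\<^esub> (b \<otimes>\<^bsub>P\<^esub> b))" using g(2) A(4) by simp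
      also have "\<dots> = (\<Otimes>\<^bsub>P\<^esub>a\<in>B. a) \<otimes>\<^bsub>P\<^esub> ((p \<otimes>\<^bsub>P\<^esub> b) \<otimes>\<^bsub>P\<^esub> (p \<otimes>\<^bsub>P\<^esub> b))"
        using pc cB by (simp add: UP.m_ac)
      finally have "f = (\<Otimes>\<^bsub>P\<^esub>a\<in>B. a) \<otimes>\<^bsub>P\<^esub> ((p \<otimes>\<^bsub>P\<^esub> b) \<otimes>\<^bsub>P\<^esub> (p \<otimes>\<^bsub>P\<^esub> b))" .
      moreover have "p \<otimes>\<^bsub>P\<^esub> b \<in> Mon (dg p + j)" by (rule Mon_mult[OF primesD(1)[OF p(1)] A(3)])
      moreover have "m = sum dg B + 2 * (dg p + j)" using A(5) g(3) B by simp
      ultimately show ?thesis using B by (intro exI[of _ B] exI[of _ "p \<otimes>\<^bsub>P\<^esub> b"] exI[of _ "dg p + j"]) simp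
    qed
  qed
qed

text \<open>If X is fixed by the q^g-th power map modulo \<open>a\<close>, then by
  \<open>frobenius_fixed\<close> so is every polynomial. Hence the q^d - 1 units of the residue
  field are all roots of Z^(q^g - 1) - 1, and q^d <= q^g.\<close>

lemma Irred_deg_le:
  assumes pq: "primepow q" and a: "a \<in> Irred d" and R: "R (q ^ g - 1) \<one> a" and g: "g \<ge> 1"
  shows "d \<le> g"
proof -
  note ac = Irred_closed[OF a]
  interpret h: ring_hom_ring P "Kf a" "proj a" by (rule proj_hom[OF ac])
  interpret K: field "Kf a" by (rule Kf_field[OF a])
  have Q: "q ^ g = Suc (q ^ g - 1)" using qpow_minus_one_ge[OF g] by simp
  have "X [^]\<^bsub>P\<^esub> (q ^ g) \<ominus>\<^bsub>P\<^esub> X = X \<otimes>\<^bsub>P\<^esub> (X [^]\<^bsub>P\<^esub> (q ^ g - 1) \<ominus>\<^bsub>P\<^esub> \<one>\<^bsub>P\<^esub>)"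
  proof -
    have "y \<otimes>\<^bsub>P\<^esub> x \<ominus>\<^bsub>P\<^esub> x = x \<otimes>\<^bsub>P\<^esub> (y \<ominus>\<^bsub>P\<^esub> \<one>\<^bsub>P\<^esub>)" if "x \<in> carrier P" "y \<in> carrier P" for x y using that by algebra
    from this[OF X_closed Xpow_closed] show ?thesis by (subst Q) simp
  qed
  moreover have "a divides\<^bsub>P\<^esub> X \<otimes>\<^bsub>P\<^esub> (X [^]\<^bsub>P\<^esub> (q ^ g - 1) \<ominus>\<^bsub>P\<^esub> \<one>\<^bsub>P\<^esub>)"
    using R unfolding R_def XN_def P_one[symmetric] by (intro divides_mult_l ac X_closed UP.minus_closed Xpow_closed UP.one_closed)
  ultimately have fixd: "a divides\<^bsub>P\<^esub> (y [^]\<^bsub>P\<^esub> (q ^ g) \<ominus>\<^bsub>P\<^esub> y)" if "y \<in> carrier P" for y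
    using frobenius_fixed[OF pq ac _ that] by simp
  have "z [^]\<^bsub>Kf a\<^esub> (q ^ g - 1) = \<one>\<^bsub>Kf a\<^esub>" if z: "z \<in> carrier (Kf a)" "z \<noteq> \<zero>\<^bsub>Kf a\<^esub>" for z
  proof -
    obtain y where y: "y \<in> carrier P" "z = proj a y" using proj_surj[OF ac z(1)] by blast
    have "\<not> a divides\<^bsub>P\<^esub> y" using proj_zero_iff[OF ac y(1)] z(2) y(2) by simp
    moreover have "y [^]\<^bsub>P\<^esub> (q ^ g) \<ominus>\<^bsub>P\<^esub> y = y \<otimes>\<^bsub>P\<^esub> (y [^]\<^bsub>P\<^esub> (q ^ g - 1) \<ominus>\<^bsub>P\<^esub> \<one>\<^bsub>P\<^esub>)"
    proof -
      have "w \<otimes>\<^bsub>P\<^esub> x \<ominus>\<^bsub>P\<^esub> x = x \<otimes>\<^bsub>P\<^esub> (w \<ominus>\<^bsub>P\<^esub> \<one>\<^bsub>P\<^esub>)" if "x \<in> carrier P" "w \<in> carrier P" for x w using that by algebra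
      from this[OF y(1) UP.nat_pow_closed[OF y(1)]] show ?thesis by (subst Q) simp
    qed
    ultimately have "a divides\<^bsub>P\<^esub> (y [^]\<^bsub>P\<^esub> (q ^ g - 1) \<ominus>\<^bsub>P\<^esub> \<one>\<^bsub>P\<^esub>)"
      using prime_divides_mult[OF IrredD(2)[OF a] y(1), of "y [^]\<^bsub>P\<^esub> (q ^ g - 1) \<ominus>\<^bsub>P\<^esub> \<one>\<^bsub>P\<^esub>"] fixd[OF y(1)] y(1) by simp
    then have "proj a (y [^]\<^bsub>P\<^esub> (q ^ g - 1) \<ominus>\<^bsub>P\<^esub> \<one>\<^bsub>P\<^esub>) = \<zero>\<^bsub>Kf a\<^esub>" using proj_zero_iff[OF ac] y(1) by simp
    then have "z [^]\<^bsub>Kf a\<^esub> (q ^ g - 1) \<ominus>\<^bsub>Kf a\<^esub> \<one>\<^bsub>Kf a\<^esub> = \<zero>\<^bsub>Kf a\<^esub>"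
      using y by (simp add: a_minus_def h.hom_nat_pow)
    then show ?thesis using h.S.r_right_minus_eq[of "z [^]\<^bsub>Kf a\<^esub> (q ^ g - 1)" "\<one>\<^bsub>Kf a\<^esub>"] z(1) by simp
  qed
  then have "carrier (Kf a) - {\<zero>\<^bsub>Kf a\<^esub>} \<subseteq> {z \<in> carrier (Kf a). z [^]\<^bsub>Kf a\<^esub> (q ^ g - 1) = \<one>\<^bsub>Kf a\<^esub>}" by auto
  then have "card (carrier (Kf a) - {\<zero>\<^bsub>Kf a\<^esub>}) \<le> card {z \<in> carrier (Kf a). z [^]\<^bsub>Kf a\<^esub> (q ^ g - 1) = \<one>\<^bsub>Kf a\<^esub>}"
    using card_Kf(2)[OF a] by (intro card_mono) auto
  also have "\<dots> \<le> q ^ g - 1" using K.num_roots_le_deg[OF card_Kf(2)[OF a]] qpow_minus_one_ge[OF g] by simp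
  finally have "q ^ d - 1 \<le> q ^ g - 1" using card_Kf[OF a] h.S.zero_closed by (simp add: card_Diff_singleton)
  then have "q ^ d \<le> q ^ g" using qpow_minus_one_ge[OF g] by simp
  then show ?thesis using q_ge_2 power_le_imp_le_exp[of q d g] by simp
qed

text \<open>With t = m mod d, the order of X divides q^m - 1 and, as d divides m - t, also q^(m-t) -
  1; hence it divides q^t - 1. Since t < d, \<open>Irred_deg_le\<close> leaves only t = 0.\<close>

lemma Irred_deg_dvd:
  assumes pq: "primepow q" and a: "a \<in> Irred d" and R: "R (q ^ m - 1) \<one> a"
  shows "d dvd m"
proof -
  define t where "t = m mod d"
  have d: "d \<ge> 1" by (rule Irred_deg[OF a])
  have pos: "q ^ k \<ge> 1" for k using q_ge_2 by simp
  have "ordr a dvd q ^ m - 1" using R ordr(2)[OF a] by simp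
  moreover have "ordr a dvd q ^ (d * (m div d)) - 1"
  proof -
    have "q ^ d - 1 dvd (q ^ d) ^ (m div d) - 1" by (rule minus_one_dvd_pow_minus_one)
    then show ?thesis using ordr_dvd[OF a] unfolding power_mult by (rule dvd_trans[rotated])
  qed
  moreover have "q ^ m - 1 = q ^ t * (q ^ (d * (m div d)) - 1) + (q ^ t - 1)"
  proof -
    have "q ^ m = q ^ t * q ^ (d * (m div d))" by (simp add: t_def power_add[symmetric] add.commute)
    then show ?thesis using pos[of t] pos[of "d * (m div d)"] by (simp add: diff_mult_distrib2)
  qed
  ultimately have "ordr a dvd q ^ t - 1" by (metis dvd_add_right_iff dvd_mult)
  then have Rt: "R (q ^ t - 1) \<one> a" using ordr(2)[OF a] by simp
  have "t = 0"
  proof (rule ccontr)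
    assume "t \<noteq> 0"
    then have "d \<le> t" using Irred_deg_le[OF pq a Rt] by simp
    then show False using d mod_less_divisor[of d m] unfolding t_def by linarith
  qed
  then show ?thesis unfolding t_def by auto
qed

lemma sum_dg_Irred: "sum dg (Irred d) = d * card (Irred d)"
proof -
  have "sum dg (Irred d) = (\<Sum>a\<in>Irred d. d)" by (rule sum.cong[OF refl]) (rule Mon_dg[OF IrredD(1)])
  then show ?thesis by (simp add: mult.commute)
qed

text \<open>X^(q^m - 1) - 1 is squarefree and all its prime factors have degree dividing m. Those of
  degree at most m/2 account for less than q^(m div 2 + 1) of the degree, which for m >= 3 is at
  most half of q^m.\<close>

lemma card_Irred_ge:
  assumes pq: "primepow q" and m: "m \<ge> 3"
  shows "q ^ m \<le> 2 * (m * card (Irred m))"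
proof -
  have m1: "m \<ge> 1" using m by simp
  define T where "T = XN (q ^ m - 1) \<one>"
  have T: "T \<in> Mon (q ^ m - 1)" unfolding T_def by (rule XN_Mon[OF Fx_one qpow_minus_one_ge[OF m1]])
  obtain A b j where A: "finite A" "A \<subseteq> primes" "b \<in> Mon j" "T = (\<Otimes>\<^bsub>P\<^esub>a\<in>A. a) \<otimes>\<^bsub>P\<^esub> (b \<otimes>\<^bsub>P\<^esub> b)" "q ^ m - 1 = sum dg A + 2 * j"
    using squarefree_part[OF T] by blast
  have Ac: "(\<lambda>a. a) \<in> A \<rightarrow> carrier P" using A(2) primesD(3) by blast
  have cA: "(\<Otimes>\<^bsub>P\<^esub>a\<in>A. a) \<in> carrier P" by (rule UP.finprod_closed[OF Ac])
  have bc: "b \<in> carrier P" by (rule MonD(1)[OF A(3)])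
  \<comment> \<open>If b^2 divides X^(q^m - 1) - 1, then it divides b^(q^m) - b by Frobenius and
    b^(q^m) trivially, hence b itself, which is impossible for reasons of degree.\<close>
  have "j = 0"
  proof (rule ccontr)
    assume j: "j \<noteq> 0"
    define h where "h = b \<otimes>\<^bsub>P\<^esub> b"
    have hc: "h \<in> carrier P" using bc by (simp add: h_def)
    have hT: "h divides\<^bsub>P\<^esub> T" unfolding A(4) h_def[symmetric] using hc cA by (intro divides_mult_l UP.divides_refl)
    have Q: "q ^ m = Suc (q ^ m - 1)" using qpow_minus_one_ge[OF m1] by simp
    have "X [^]\<^bsub>P\<^esub> (q ^ m) \<ominus>\<^bsub>P\<^esub> X = X \<otimes>\<^bsub>P\<^esub> T"
    proof -
      have "y \<otimes>\<^bsub>P\<^esub> x \<ominus>\<^bsub>P\<^esub> x = x \<otimes>\<^bsub>P\<^esub> (y \<ominus>\<^bsub>P\<^esub> \<one>\<^bsub>P\<^esub>)" if "x \<in> carrier P" "y \<in> carrier P" for x y using that by algebra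
      from this[OF X_closed Xpow_closed] show ?thesis by (subst Q) (simp add: T_def XN_def P_one)
    qed
    then have "h divides\<^bsub>P\<^esub> (X [^]\<^bsub>P\<^esub> (q ^ m) \<ominus>\<^bsub>P\<^esub> X)" using divides_mult_l[OF hc X_closed MonD(1)[OF T] hT] by simp
    from frobenius_fixed[OF pq hc this bc] have 1: "h divides\<^bsub>P\<^esub> (b [^]\<^bsub>P\<^esub> (q ^ m) \<ominus>\<^bsub>P\<^esub> b)" .
    have "q ^ m \<ge> 2" using q_ge_2 m1 self_le_power[of q m] by linarith
    then have "q ^ m = (q ^ m - 2) + 2" by simp
    then have "b [^]\<^bsub>P\<^esub> (q ^ m) = b [^]\<^bsub>P\<^esub> (q ^ m - 2) \<otimes>\<^bsub>P\<^esub> b [^]\<^bsub>P\<^esub> (2::nat)"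
      using UP.nat_pow_mult[OF bc, of "q ^ m - 2" 2] by simp
    also have "b [^]\<^bsub>P\<^esub> (2::nat) = h" using bc by (simp add: h_def numeral_2_eq_2)
    finally have 2: "h divides\<^bsub>P\<^esub> (b [^]\<^bsub>P\<^esub> (q ^ m))"
      using hc bc by (simp only:) (intro divides_mult_l UP.divides_refl UP.nat_pow_closed)
    have "u \<ominus>\<^bsub>P\<^esub> (u \<ominus>\<^bsub>P\<^esub> b) = b" if "u \<in> carrier P" for u using that bc by algebra
    then have "h divides\<^bsub>P\<^esub> b" using divides_diff[OF hc _ _ 2 1] bc by (metis UP.minus_closed UP.nat_pow_closed)
    then have "length h \<le> length b" using divides_deg[OF _ hc bc MonD(3)[OF A(3)]] by simp
    moreover have "length h = Suc (j + j)" unfolding h_def by (rule MonD(2)[OF Mon_mult[OF A(3) A(3)]])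
    ultimately show False using j MonD(2)[OF A(3)] by simp
  qed
  then have sumA: "q ^ m - 1 = sum dg A" using A(5) by simp
  have AI: "a \<in> Irred (dg a) \<and> dg a dvd m" if a: "a \<in> A" for a
  proof -
    have ac: "a \<in> primes" "a \<in> carrier P" using a A(2) primesD(3) by auto
    have "A = insert a (A - {a})" using a by auto
    then have "(\<Otimes>\<^bsub>P\<^esub>a\<in>A. a) = a \<otimes>\<^bsub>P\<^esub> (\<Otimes>\<^bsub>P\<^esub>a\<in>A - {a}. a)"
      using UP.finprod_insert[of "A - {a}" a "\<lambda>a. a"] A(1) Ac ac(2) by auto
    moreover have "(\<Otimes>\<^bsub>P\<^esub>a\<in>A - {a}. a) \<in> carrier P" using Ac by (intro UP.finprod_closed) auto
    ultimately have "T = a \<otimes>\<^bsub>P\<^esub> ((\<Otimes>\<^bsub>P\<^esub>a\<in>A - {a}. a) \<otimes>\<^bsub>P\<^esub> (b \<otimes>\<^bsub>P\<^esub> b))" using A(4) ac(2) bc by (simp add: UP.m_assoc)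
    moreover have "(\<Otimes>\<^bsub>P\<^esub>a\<in>A - {a}. a) \<otimes>\<^bsub>P\<^esub> (b \<otimes>\<^bsub>P\<^esub> b) \<in> carrier P"
      using \<open>(\<Otimes>\<^bsub>P\<^esub>a\<in>A - {a}. a) \<in> carrier P\<close> bc by simp
    ultimately have R: "R (q ^ m - 1) \<one> a" unfolding R_def T_def[symmetric] factor_def by blast
    then have "a \<noteq> X" using R_X[OF Fx_one _ qpow_minus_one_ge[OF m1]] by blast
    then have "a \<in> Irred (dg a)" using primes_Irred[OF ac(1)] by simp
    then show ?thesis using Irred_deg_dvd[OF pq _ R] by blast
  qed
  define D where "D = {1..m div 2}"
  have dD: "dg a = m \<or> dg a \<in> D" if a: "a \<in> A" for a
  proof -
    obtain k where k: "m = dg a * k" using AI[OF a] by blast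
    have "dg a \<ge> 1" using Irred_deg AI[OF a] by blast
    moreover have "k \<noteq> 0" using k m1 by (metis mult_0_right not_one_le_zero)
    moreover have "dg a * 2 \<le> m" if "k \<ge> 2" using k that mult_le_mono2[of 2 k "dg a"] by simp
    ultimately show ?thesis using k unfolding D_def by (cases "k = 1") (auto simp: less_eq_div_iff_mult_less_eq)
  qed
  have "sum dg A \<le> sum dg (Irred m \<union> (\<Union>d\<in>D. Irred d))"
  proof (rule sum_mono2)
    show "finite (Irred m \<union> (\<Union>d\<in>D. Irred d))" using finite_Irred by (simp add: D_def)
    show "A \<subseteq> Irred m \<union> (\<Union>d\<in>D. Irred d)" using AI dD by fastforce
  qed simp
  also have "\<dots> \<le> sum dg (Irred m) + sum dg (\<Union>d\<in>D. Irred d)"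
    using sum.union_inter[of "Irred m" "\<Union>d\<in>D. Irred d" dg] finite_Irred by (simp add: D_def)
  also have "sum dg (\<Union>d\<in>D. Irred d) \<le> (\<Sum>d\<in>D. sum dg (Irred d))"
    using finite_Irred by (intro sum_UN_le) (auto simp: D_def)
  also have "(\<Sum>d\<in>D. sum dg (Irred d)) \<le> (\<Sum>d\<in>D. q ^ d)"
    by (rule sum_mono) (simp only: sum_dg_Irred card_Irred_le)
  finally have "sum dg A \<le> m * card (Irred m) + (\<Sum>d\<in>D. q ^ d)" by (simp only: sum_dg_Irred)
  then have le: "sum dg A \<le> m * card (Irred m) + (\<Sum>d\<in>{1..m div 2}. q ^ d)" unfolding D_def .
  have geo: "(\<Sum>d\<in>{1..k}. q ^ d) + 1 \<le> q ^ (k + 1)" for k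
  proof (induction k)
    case (Suc k)
    have "(\<Sum>d\<in>{1..Suc k}. q ^ d) + 1 = ((\<Sum>d\<in>{1..k}. q ^ d) + 1) + q ^ Suc k" by simp
    also have "\<dots> \<le> 2 * q ^ Suc k" using Suc by simp
    also have "\<dots> \<le> q * q ^ Suc k" by (rule mult_le_mono1[OF q_ge_2])
    finally show ?case by simp
  qed (use q_ge_2 in simp)
  have "q ^ m - 1 + 1 \<le> m * card (Irred m) + q ^ (m div 2 + 1)"
    using le geo[of "m div 2"] unfolding sumA[symmetric] by linarith
  moreover have "2 * q ^ (m div 2 + 1) \<le> q ^ m"
  proof -
    have "2 * q ^ (m div 2 + 1) \<le> q * q ^ (m div 2 + 1)" by (rule mult_le_mono1[OF q_ge_2])
    also have "\<dots> = q ^ (m div 2 + 2)" by simp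
    also have "\<dots> \<le> q ^ m" using m q_ge_2 by (intro power_increasing) auto
    finally show ?thesis .
  qed
  ultimately show ?thesis using qpow_minus_one_ge[OF m1] by simp
qed

section \<open>Polynomials of small order with prescribed constant term\<close>

lemma const_term_mult: "a \<in> carrier P \<Longrightarrow> b \<in> carrier P \<Longrightarrow> const_term (a \<otimes>\<^bsub>P\<^esub> b) = const_term a \<otimes> const_term b"
  unfolding const_term_def
  by (rule ring_hom_memE(2)[OF eval_is_hom[OF carrier_is_subring zero_closed]])

lemma const_term_closed: "a \<in> carrier P \<Longrightarrow> const_term a \<in> carrier F"
  unfolding const_term_def by (rule ring_hom_memE(1)[OF eval_is_hom[OF carrier_is_subring zero_closed]])

lemma const_term_zero_iff: assumes "a \<in> carrier P" shows "const_term a = \<zero> \<longleftrightarrow> X divides\<^bsub>P\<^esub> a"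
proof
  assume "X divides\<^bsub>P\<^esub> a"
  then obtain b where b: "b \<in> carrier P" "a = X \<otimes>\<^bsub>P\<^esub> b" unfolding factor_def by auto
  have "const_term X = \<zero>" unfolding const_term_def by (rule eval_var) simp
  then show "const_term a = \<zero>" using const_term_mult[OF X_closed b(1)] const_term_closed[OF b(1)] b(2) by simp
next
  assume z: "const_term a = \<zero>"
  show "X divides\<^bsub>P\<^esub> a"
  proof (cases "a = []")
    case True then show ?thesis using UP.divides_zero[OF X_closed] by simp
  next
    case False
    then obtain b c where bc: "a = b @ [c]" by (metis rev_exhaust)
    have b: "b \<in> carrier P" "c \<in> carrier F" using assms bc by (cases b; simp add: poly_carrier_iff)+
    have "c = \<zero>" using const_term_eq_last[of b c] z bc b poly_carrier_iff by simp
    moreover have "b \<noteq> []" using assms bc calculation by (auto simp: poly_carrier_iff)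
    ultimately have "a = b \<otimes>\<^bsub>P\<^esub> X" using bc poly_mult_var[OF carrier_is_subring b(1)] by simp
    then show ?thesis using b divides_mult_l[OF X_closed b(1) X_closed] UP.divides_refl[OF X_closed] by simp
  qed
qed

lemma const_term_XN: assumes "c \<in> Fx" "N \<ge> 1" shows "const_term (XN N c) = \<ominus> c"
proof -
  interpret e: ring_hom_ring P F "\<lambda>p. eval p \<zero>" by (rule eval_ring_hom[OF carrier_is_subring zero_closed])
  have X0: "eval X \<zero> = \<zero>" by (rule eval_var) simp
  obtain k where k: "N = Suc k" using assms(2) by (cases N) auto
  have "eval (X [^]\<^bsub>P\<^esub> N) \<zero> = \<zero>" unfolding k by (simp add: X0)
  moreover have "eval [c] \<zero> = c" using assms by simp
  ultimately show ?thesis unfolding const_term_def XN_def a_minus_def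
    using assms const_closed[OF assms(1)] by (simp del: eval.simps)
qed

lemma Irred_divides_prod:
  assumes "finite A" "A \<subseteq> Irred m" "a \<in> Irred m" "a divides\<^bsub>P\<^esub> (\<Otimes>\<^bsub>P\<^esub>a\<in>A. a)"
  shows "a \<in> A"
  using assms
proof (induction A rule: finite_induct)
  case empty
  have "length a \<le> length (\<one>\<^bsub>P\<^esub>)"
    using divides_deg[OF _ Irred_closed[OF empty(2)] UP.one_closed] empty(3) by (simp add: P_one)
  then show ?case using Irred_deg[OF empty(2)] MonD(2)[OF IrredD(1)[OF empty(2)]] by (simp add: P_one)
next
  case (insert x A)
  have xc: "x \<in> Irred m" "A \<subseteq> Irred m" using insert.prems by auto
  have Ac: "(\<lambda>a. a) \<in> A \<rightarrow> carrier P" using xc Irred_closed by blast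
  have "a divides\<^bsub>P\<^esub> x \<otimes>\<^bsub>P\<^esub> (\<Otimes>\<^bsub>P\<^esub>a\<in>A. a)" using insert Ac Irred_closed[OF xc(1)] by simp
  then have "a divides\<^bsub>P\<^esub> x \<or> a divides\<^bsub>P\<^esub> (\<Otimes>\<^bsub>P\<^esub>a\<in>A. a)"
    using prime_divides_mult[OF IrredD(2)[OF insert.prems(2)] Irred_closed[OF xc(1)] UP.finprod_closed[OF Ac]] by simp
  then show ?case
  proof
    assume "a divides\<^bsub>P\<^esub> x"
    then show ?case using Mon_divides_eq[OF IrredD(1)[OF insert.prems(2)] IrredD(1)[OF xc(1)]] by simp
  next
    assume "a divides\<^bsub>P\<^esub> (\<Otimes>\<^bsub>P\<^esub>a\<in>A. a)"
    then show ?case using insert.IH[OF xc(2) insert.prems(2)] by simp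
  qed
qed

text \<open>Multiply \<open>k\<close> distinct irreducibles of degree \<open>m\<close> by a binomial \<open>X\<^sup>r - c\<close> that adjusts the constant term.\<close>
lemma many_small_order_polys:
  assumes r: "1 \<le> r" "r < m" and kap: "\<kappa> \<in> Fx"
  obtains S where "S \<subseteq> Mon (k * m + r)" "card S = card (Irred m) choose k"
    "\<And>f. f \<in> S \<Longrightarrow> const_term f = \<kappa> \<and> R (r * (q ^ m - 1)) \<one> f"
proof -
  define pA where "pA A = (\<Otimes>\<^bsub>P\<^esub>a\<in>A. a)" for A :: "'a list set"
  \<comment> \<open>X^r - c has constant term -c, so with this c the product has constant term
    \<kappa>.\<close>
  define c where "c A = \<ominus> (\<kappa> \<otimes> inv (const_term (pA A)))" for A
  define f where "f A = pA A \<otimes>\<^bsub>P\<^esub> XN r (c A)" for A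
  define AA where "AA = {A. A \<subseteq> Irred m \<and> card A = k}"
  have m1: "m \<ge> 1" using r by simp
  note dvd = minus_one_dvd_pow_minus_one[of q m]
  have key: "f A \<in> Mon (k * m + r) \<and> const_term (f A) = \<kappa> \<and> R (r * (q ^ m - 1)) \<one> (f A)
      \<and> {a \<in> Irred m. a divides\<^bsub>P\<^esub> f A} = A" if A: "A \<in> AA" for A
  proof -
    have fA: "finite A" "A \<subseteq> Irred m" "card A = k" using A finite_subset[OF _ finite_Irred] by (auto simp: AA_def)
    have Ac: "(\<lambda>a. a) \<in> A \<rightarrow> carrier P" using fA Irred_closed by blast
    have pc: "pA A \<in> carrier P" unfolding pA_def by (rule UP.finprod_closed[OF Ac])
    have "pA A \<in> Mon (\<Sum>a\<in>A. m)" unfolding pA_def using fA IrredD(1) by (intro Mon_finprod) auto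
    then have pM: "pA A \<in> Mon (k * m)" using fA by simp
    have Rp: "R (q ^ m - 1) \<one> (pA A)" unfolding R_def pA_def
    proof (rule prod_primes_divides[OF fA(1)])
      show "XN (q ^ m - 1) \<one> \<in> carrier P" by (rule XN_closed[OF Fx_one])
      fix a assume "a \<in> A"
      then have a: "a \<in> Irred m" using fA by auto
      show "ring_prime\<^bsub>P\<^esub> a \<and> (\<exists>d. a \<in> Mon d)" using IrredD(1,2)[OF a] by blast
      show "a divides\<^bsub>P\<^esub> XN (q ^ m - 1) \<one>" using R_fermat[OF a] by (simp add: R_def)
    qed
    have "\<not> X divides\<^bsub>P\<^esub> pA A"
      using R_divides[OF Rp _ X_closed] R_X[OF Fx_one _ qpow_minus_one_ge[OF m1]] by blast
    then have t: "const_term (pA A) \<in> Fx" using const_term_zero_iff[OF pc] const_term_closed[OF pc] by simp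
    have ki: "\<kappa> \<otimes> inv (const_term (pA A)) \<in> Fx" using Fx_mult[OF kap] Fx_inv[OF t] by simp
    then have c: "c A \<in> Fx" unfolding c_def by auto
    note hM = XN_Mon[OF c r(1)] and hc = XN_closed[OF c, of r]
    have fM: "f A \<in> Mon (k * m + r)" unfolding f_def by (rule Mon_mult[OF pM hM])
    have "const_term (f A) = const_term (pA A) \<otimes> (\<kappa> \<otimes> inv (const_term (pA A)))"
      unfolding f_def const_term_mult[OF pc hc] const_term_XN[OF c r(1)] using ki by (simp add: c_def)
    also have "\<dots> = \<kappa>" using t kap Fx_inv[OF t] by (simp add: m_lcomm)
    finally have ct: "const_term (f A) = \<kappa>" .
    \<comment> \<open>Because r < m, the binomial has no irreducible factor of degree m. Hence it is
      coprime to \<open>pA A\<close>, and \<open>A\<close> can be recovered from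
      \<open>f A\<close>.\<close>
    have ndiv: "\<not> a divides\<^bsub>P\<^esub> XN r (c A)" if a: "a \<in> Irred m" for a
    proof
      assume "a divides\<^bsub>P\<^esub> XN r (c A)"
      then have "length a \<le> length (XN r (c A))" using divides_deg[OF _ Irred_closed[OF a] hc MonD(3)[OF hM]] by simp
      then show False using MonD(2)[OF hM] MonD(2)[OF IrredD(1)[OF a]] r(2) by simp
    qed
    define T where "T = XN (r * (q ^ m - 1)) \<one>"
    have TR: "R (r * (q ^ m - 1)) \<one> g \<longleftrightarrow> g divides\<^bsub>P\<^esub> T" for g by (simp add: R_def T_def)
    have Tc: "T \<in> carrier P" unfolding T_def by (rule XN_closed[OF Fx_one])
    have "R r (c A) (XN r (c A))" unfolding R_def by (rule UP.divides_refl[OF hc])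
    \<comment> \<open>Modulo X^r - c the power X^(r(q-1)) equals c^(q-1) = 1, and q - 1 divides q^m
      - 1.\<close>
    from R_mult[OF hc c this, of "q - 1"] have "R (r * (q - 1)) \<one> (XN r (c A))" by (simp only: Fx_fermat[OF c])
    from R_mult[OF hc Fx_one this, of "(q ^ m - 1) div (q - 1)"] have "R (r * (q ^ m - 1)) \<one> (XN r (c A))"
      using dvd by (simp add: mult.assoc)
    then obtain kk where kk: "kk \<in> carrier P" "T = XN r (c A) \<otimes>\<^bsub>P\<^esub> kk" unfolding TR factor_def by auto
    have "pA A divides\<^bsub>P\<^esub> kk" unfolding pA_def
    proof (rule prod_primes_divides[OF fA(1) _ kk(1)])
      fix a assume aA: "a \<in> A"
      then have a: "a \<in> Irred m" using fA by auto
      show "ring_prime\<^bsub>P\<^esub> a \<and> (\<exists>d. a \<in> Mon d)" using IrredD(1,2)[OF a] by blast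
      have "R (r * (q ^ m - 1)) \<one> a"
        using R_mult[OF Irred_closed[OF a] Fx_one R_fermat[OF a], of r] by (simp add: mult.commute)
      then have "a divides\<^bsub>P\<^esub> XN r (c A) \<otimes>\<^bsub>P\<^esub> kk" unfolding TR kk(2) .
      then show "a divides\<^bsub>P\<^esub> kk" using prime_divides_mult[OF IrredD(2)[OF a] hc kk(1)] ndiv[OF a] by blast
    qed
    then have "XN r (c A) \<otimes>\<^bsub>P\<^esub> pA A divides\<^bsub>P\<^esub> T" unfolding kk(2) using hc pc kk(1) by (intro UP.divides_mult_lI) auto
    then have Rf: "R (r * (q ^ m - 1)) \<one> (f A)" unfolding TR f_def using UP.m_comm[OF hc pc] by simp
    have "a \<in> A \<longleftrightarrow> a divides\<^bsub>P\<^esub> f A" if a: "a \<in> Irred m" for a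
    proof
      assume "a divides\<^bsub>P\<^esub> f A"
      then have "a divides\<^bsub>P\<^esub> pA A" unfolding f_def using prime_divides_mult[OF IrredD(2)[OF a] pc hc] ndiv[OF a] by blast
      then show "a \<in> A" unfolding pA_def by (rule Irred_divides_prod[OF fA(1,2) a])
    next
      assume aA: "a \<in> A"
      then have "A = insert a (A - {a})" by auto
      then have "pA A = a \<otimes>\<^bsub>P\<^esub> pA (A - {a})"
        unfolding pA_def using UP.finprod_insert[of "A - {a}" a "\<lambda>a. a"] fA(1) Ac Irred_closed[OF a] by auto
      moreover have "pA (A - {a}) \<in> carrier P" unfolding pA_def using Ac by (intro UP.finprod_closed) auto
      ultimately have "f A = a \<otimes>\<^bsub>P\<^esub> (pA (A - {a}) \<otimes>\<^bsub>P\<^esub> XN r (c A))" "pA (A - {a}) \<otimes>\<^bsub>P\<^esub> XN r (c A) \<in> carrier P"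
        unfolding f_def using hc Irred_closed[OF a] by (simp_all add: UP.m_assoc)
      then show "a divides\<^bsub>P\<^esub> f A" unfolding factor_def by blast
    qed
    then have "{a \<in> Irred m. a divides\<^bsub>P\<^esub> f A} = A" using fA(2) by blast
    then show ?thesis using fM ct Rf by blast
  qed
  have "inj_on f AA" by (rule inj_on_inverseI[where g = "\<lambda>x. {a \<in> Irred m. a divides\<^bsub>P\<^esub> x}"]) (use key in blast)
  then have "card (f ` AA) = card AA" by (rule card_image)
  also have "\<dots> = card (Irred m) choose k" unfolding AA_def by (rule n_subsets[OF finite_Irred])
  finally have c: "card (f ` AA) = card (Irred m) choose k" .
  show ?thesis by (rule that[OF _ c]) (use key in blast)+
qed

end

text \<open>Two regimes. For n >= n0 the bound \<open>Eb_large\<close> works for all q; for the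
  finitely many smaller n the hypothesis on the maximum forces q to be large, and
  \<open>Eb_fixed\<close> applies. The factor 4n is the price of passing from \<open>Eb\<close> to
  the averages over the four groups.\<close>

lemma Eb_asymptotics:
  assumes \<epsilon>: "\<epsilon> > 0"
  obtains N0 where "\<And>n q (I :: 'i set) \<delta> od pr w. irr_system I \<delta> q od pr w \<Longrightarrow> n \<ge> 2 \<Longrightarrow> max n q \<ge> N0 \<Longrightarrow>
     4 * real n * irr_system.Eb I \<delta> q w n \<le> exp (- ((2 - \<epsilon>) * sz n q))"
proof -
  \<comment> \<open>The exponent loses 18 theta in \<open>Eb_large\<close> and one more theta to
    absorb the polynomial factor in n; 19 theta is at most epsilon.\<close>
  define \<theta> where "\<theta> = min (1/20) (\<epsilon> / 20)"
  have \<theta>: "0 < \<theta>" "\<theta> \<le> 1/20" "\<theta> \<le> \<epsilon> / 20" using \<epsilon> by (auto simp: \<theta>_def)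
  define K where "K = nat \<lceil>1 / \<theta>\<rceil>"
  have K: "real K \<ge> 1 / \<theta>" unfolding K_def by linarith
  moreover have "1 / \<theta> > 0" using \<theta> by simp
  ultimately have K1: "K \<ge> 1" by linarith
  obtain C where C: "C \<ge> 1" "\<And>n. n \<ge> 1 \<Longrightarrow> real (card {d. d dvd n}) \<le> C * real n powr \<theta>"
    using divisor_bound[OF \<theta>(1)] by blast
  obtain C' where C': "C' \<ge> 1" "\<And>n. n \<ge> 1 \<Longrightarrow> real (card {d. d dvd n}) \<le> C' * real n powr (1/8)"
    using divisor_bound[of "1/8"] by auto
  define D where "D = real K * (C * (real (K * K + 1) * ((3 * real K + 1) * (3 * real K + 1))))"
  have D0: "D \<ge> 0" using C(1) by (simp add: D_def)
  define Pn where "Pn n = 4 * real n * ((real n + 1)\<^sup>2 * ((real n + 1) ^ 3 * ((3 * real n + 1) * C\<^sup>2) + D + (3 * real n + 1)))" for n :: nat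
  have "eventually (\<lambda>n::nat. 4 * real n * ((real n + 1)\<^sup>2 * ((real n + 1) ^ 3 * ((3 * real n + 1) * C\<^sup>2) + D + (3 * real n + 1))) \<le> exp (\<theta> * sqrt (real n * ln (real n) * ln 2))) sequentially"
    using \<theta>(1) C(1) D0 by real_asymp
  then have ev: "eventually (\<lambda>n::nat. Pn n \<le> exp (\<theta> * sqrt (real n * ln (real n) * ln 2))) sequentially"
    by (simp add: Pn_def)
  have "eventually (\<lambda>n. large_enough \<theta> n \<and> large_for K \<theta> n \<and> Pn n \<le> exp (\<theta> * sqrt (real n * ln (real n) * ln 2))) sequentially"
    by (intro eventually_conj ev eventually_large_enough[OF \<theta>(1)] eventually_large_for[OF \<theta>(1,2) K1])
  then obtain n0 where n0: "\<And>n. n \<ge> n0 \<Longrightarrow> large_enough \<theta> n \<and> large_for K \<theta> n \<and> Pn n \<le> exp (\<theta> * sqrt (real n * ln (real n) * ln 2))"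
    unfolding eventually_sequentially by blast
  define Qn where "Qn n = 4 * real n * ((real n + 1)\<^sup>2 * ((real n + 1) ^ 3 * ((3 * real n + 1) * C'\<^sup>2) + C' * 32 + (3 * real n + 1)))" for n :: nat
  \<comment> \<open>For fixed n the exponent \<open>sz n q\<close> is a multiple of sqrt(ln q), so
    q^(-1/2) eventually wins against every constant.\<close>
  have "eventually (\<lambda>q::nat. \<forall>n\<in>{2..<n0}. Qn n * exp (- (ln (real q) / 2)) \<le> exp (- (2 * sz n q))) sequentially"
  proof (rule eventually_ball_finite)
    show "\<forall>n\<in>{2..<n0}. eventually (\<lambda>q. Qn n * exp (- (ln (real q) / 2)) \<le> exp (- (2 * sz n q))) sequentially"
    proof
      fix n assume "n \<in> {2..<n0}"
      then have n: "n \<ge> 2" by simp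
      define L where "L = sqrt (real n * ln (real n))"
      have L: "L > 0" using n by (simp add: L_def)
      have Q: "Qn n > 0" using n C'(1) unfolding Qn_def by (intro mult_pos_pos add_nonneg_pos add_nonneg_nonneg) auto
      define z where "z = Qn n"
      have "eventually (\<lambda>q::nat. z * exp (- (ln (real q) / 2)) \<le> exp (- (2 * (L * sqrt (ln (real q)))))) sequentially"
        using L Q unfolding z_def[symmetric] by real_asymp
      moreover have "sz n q = L * sqrt (ln (real q))" for q by (simp add: sz_def L_def real_sqrt_mult)
      ultimately show "eventually (\<lambda>q. Qn n * exp (- (ln (real q) / 2)) \<le> exp (- (2 * sz n q))) sequentially"
        by (simp add: z_def)
    qed
  qed simp
  then obtain q0 where q0: "\<And>q n. q \<ge> q0 \<Longrightarrow> n \<in> {2..<n0} \<Longrightarrow> Qn n * exp (- (ln (real q) / 2)) \<le> exp (- (2 * sz n q))"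
    unfolding eventually_sequentially by blast
  show ?thesis
  proof (rule that[of "n0 + q0"])
    fix n q :: nat and I :: "'i set" and \<delta> od pr w
    assume sys: "irr_system I \<delta> q od pr w" and n: "n \<ge> 2" and mx: "max n q \<ge> n0 + q0"
    interpret irr_system I \<delta> q od pr w by (rule sys)
    have "real n * ln (real n) \<ge> 0" using n by simp
    then have sz0: "sz n q \<ge> 0" "sqrt (real n * ln (real n) * ln 2) \<le> sz n q"
      using lq unfolding sz_def by (auto intro!: real_sqrt_le_mono mult_left_mono)
    have e2: "exp (- (2 * sz n q)) \<le> exp (- ((2 - \<epsilon>) * sz n q))"
      using sz0 \<epsilon> by (simp add: mult_right_mono)
    show "4 * real n * Eb n \<le> exp (- ((2 - \<epsilon>) * sz n q))"
    proof (cases "n \<ge> n0")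
      case True
      note big = n0[OF True]
      have "Eb n \<le> (real n + 1)\<^sup>2 * ((real n + 1) ^ 3 * ((3 * real n + 1) * C\<^sup>2) + D + (3 * real n + 1)) * exp (- ((2 - 18 * \<theta>) * sz n q))"
        unfolding D_def by (rule Eb_large[OF C(2,1) \<theta>(1,2) _ _ K]) (use big in auto)
      then have "4 * real n * Eb n \<le> 4 * real n * ((real n + 1)\<^sup>2 * ((real n + 1) ^ 3 * ((3 * real n + 1) * C\<^sup>2) + D + (3 * real n + 1)) * exp (- ((2 - 18 * \<theta>) * sz n q)))"
        by (intro mult_left_mono) auto
      also have "\<dots> = Pn n * exp (- ((2 - 18 * \<theta>) * sz n q))" by (simp add: Pn_def mult.assoc)
      also have "\<dots> \<le> exp (\<theta> * sz n q) * exp (- ((2 - 18 * \<theta>) * sz n q))"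
      proof -
        have "exp (\<theta> * sqrt (real n * ln (real n) * ln 2)) \<le> exp (\<theta> * sz n q)" using sz0(2) \<theta> by simp
        then have "Pn n \<le> exp (\<theta> * sz n q)" using big by (meson order_trans)
        then show ?thesis by (rule mult_right_mono) simp
      qed
      also have "\<dots> = exp (- ((2 - 19 * \<theta>) * sz n q))" by (simp add: algebra_simps flip: exp_add)
      also have "\<dots> \<le> exp (- ((2 - \<epsilon>) * sz n q))" using sz0 \<theta> by (simp add: mult_right_mono)
      finally show ?thesis .
    next
      case False
      then have nn: "n \<in> {2..<n0}" "q \<ge> q0" using n mx by auto
      have "Eb n \<le> (real n + 1)\<^sup>2 * ((real n + 1) ^ 3 * ((3 * real n + 1) * C'\<^sup>2) + C' * 32 + (3 * real n + 1)) * exp (- (ln (real q) / 2))"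
        by (rule Eb_fixed[OF C'(2,1) n])
      then have "4 * real n * Eb n \<le> 4 * real n * ((real n + 1)\<^sup>2 * ((real n + 1) ^ 3 * ((3 * real n + 1) * C'\<^sup>2) + C' * 32 + (3 * real n + 1)) * exp (- (ln (real q) / 2)))"
        by (intro mult_left_mono) auto
      also have "\<dots> = Qn n * exp (- (ln (real q) / 2))" by (simp add: Qn_def mult.assoc)
      also have "\<dots> \<le> exp (- (2 * sz n q))" by (rule q0[OF nn(2,1)])
      finally show ?thesis by (rule order_trans[OF _ e2])
    qed
  qed
qed

context finfield
begin

section \<open>The polynomials as an instance of the weighted system\<close>

definition IR :: "'a list set" where "IR = {p. p \<in> Irred (dg p)}"

lemma IR_deg: "{a \<in> IR. dg a = d} = Irred d"
  using Mon_dg IrredD(1) by (auto simp: IR_def)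

lemma irr_system_polys: "irr_system IR dg q ordr pairord wt"
proof
  show "q \<ge> 2" by (rule q_ge_2)
  show "finite {a \<in> IR. dg a = d}" for d unfolding IR_deg by (rule finite_Irred)
  show "dg a \<ge> 1" if "a \<in> IR" for a using Irred_deg that unfolding IR_def by blast
  show "d * card {a \<in> IR. dg a = d} \<le> q ^ d" for d unfolding IR_deg by (rule card_Irred_le)
  show "ordr a \<ge> 1" if "a \<in> IR" for a using ordr(1) that unfolding IR_def by blast
  show "ordr a dvd q ^ dg a - 1" if "a \<in> IR" for a using ordr_dvd that unfolding IR_def by blast
  show "d * card {a \<in> IR. dg a = d \<and> ordr a = N} \<le> N" if "N \<ge> 1" for N d
  proof -
    have "{a \<in> IR. dg a = d \<and> ordr a = N} = {a \<in> Irred d. ordr a = N}" using IR_deg[of d] by blast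
    then show ?thesis using card_ordr[OF that] by simp
  qed
  show "pairord a b \<ge> 1" if "a \<in> IR" "b \<in> IR" "dg a = dg b" for a b
    by (rule pairord(1)[of a "dg a"]) (use that in \<open>auto simp: IR_def\<close>)
  show "pairord a b dvd q ^ dg a - 1" if "a \<in> IR" "b \<in> IR" "dg a = dg b" for a b
    by (rule pairord_dvd[of a "dg a"]) (use that in \<open>auto simp: IR_def\<close>)
  show "dg a * card {b \<in> IR. dg b = dg a \<and> pairord a b = N} \<le> N" if "a \<in> IR" "N \<ge> 1" for a N
  proof -
    have "{b \<in> IR. dg b = dg a \<and> pairord a b = N} = {b \<in> Irred (dg a). pairord a b = N}" using IR_deg[of "dg a"] by blast
    then show ?thesis using card_pairord[of a "dg a" N] that by (simp add: IR_def)
  qed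
  show "0 \<le> wt A" "wt A \<le> 1" for A by (rule wt_nonneg, rule wt_le_one)
  show "wt A \<le> real (q - 1) / real (lcm (ordr a) (ordr b))" if "A \<subseteq> IR" "a \<in> A" "b \<in> A" for A a b
    using wt_ordr[of a "dg a" A b "dg b"] that by (auto simp: IR_def)
  show "wt A \<le> 1 / real (pairord a b)" if "A \<subseteq> IR" "a \<in> A" "b \<in> A" "dg a = dg b" for A a b
  proof -
    have ab: "a \<in> Irred (dg a)" "b \<in> Irred (dg b)" using that unfolding IR_def by blast+
    then have "b \<in> Irred (dg a)" using that(4) by (simp only:)
    then show ?thesis using wt_pairord[OF ab(1) that(2) _ that(3)] by blast
  qed
qed

sublocale sys: irr_system IR dg q ordr pairord wt by (rule irr_system_polys)

text \<open>Send \<open>f\<close> to the data (j, b, A) from \<open>squarefree_part\<close>, an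
  injective map because \<open>f\<close> is rebuilt from them. The weight of \<open>f\<close> is at
  most that of \<open>A\<close>, and each \<open>b\<close> of degree j contributes only through the
  count q^j.\<close>

lemma sum_wt_Mon: "(\<Sum>f\<in>Mon d. wt {f}) \<le> (\<Sum>j\<le>d div 2. real q ^ j * sys.T (d - 2 * j))"
proof -
  \<comment> \<open>Polynomials of weight 0 are set aside first: those divisible by X may have X in
    \<open>A\<close>, and X is not a member of \<open>IR\<close>.\<close>
  define good where "good = {f \<in> Mon d. wt {f} \<noteq> 0}"
  define ok where "ok f = (\<lambda>(j, b, A). finite A \<and> A \<subseteq> primes \<and> b \<in> Mon j \<and> f = (\<Otimes>\<^bsub>P\<^esub>a\<in>A. a) \<otimes>\<^bsub>P\<^esub> (b \<otimes>\<^bsub>P\<^esub> b) \<and> d = sum dg A + 2 * j)" for f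
  define g where "g f = (SOME x. ok f x)" for f
  have ok: "ok f (g f)" if "f \<in> Mon d" for f
    unfolding g_def by (rule someI_ex) (use squarefree_part[OF that] in \<open>unfold ok_def, auto\<close>)
  define Z where "Z = (SIGMA j:{..d div 2}. Mon j \<times> sys.FA (d - 2 * j))"
  have fZ: "finite Z" unfolding Z_def using finite_Mon sys.finite_FA by (intro finite_SigmaI finite_cartesian_product) auto
  have inj: "inj_on g good"
  proof (rule inj_onI)
    fix f f' assume f: "f \<in> good" "f' \<in> good" "g f = g f'"
    obtain j b A where x: "g f = (j, b, A)" by (cases "g f")
    have "ok f (j, b, A)" "ok f' (j, b, A)" using ok[of f] ok[of f'] f x by (auto simp: good_def)
    then show "f = f'" unfolding ok_def by auto
  qed
  have key: "g f \<in> Z \<and> wt {f} \<le> (case g f of (j, b, A) \<Rightarrow> wt A)" if f: "f \<in> good" for f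
  proof -
    have fM: "f \<in> Mon d" and nz: "wt {f} \<noteq> 0" using f by (auto simp: good_def)
    obtain j b A where x: "g f = (j, b, A)" by (cases "g f")
    have A: "finite A" "A \<subseteq> primes" "b \<in> Mon j" "f = (\<Otimes>\<^bsub>P\<^esub>a\<in>A. a) \<otimes>\<^bsub>P\<^esub> (b \<otimes>\<^bsub>P\<^esub> b)" "d = sum dg A + 2 * j"
      using ok[OF fM] unfolding x ok_def by auto
    have fc: "f \<in> carrier P" by (rule MonD(1)[OF fM])
    have Ac: "(\<lambda>a. a) \<in> A \<rightarrow> carrier P" using A(2) primesD(3) by blast
    have bc: "b \<otimes>\<^bsub>P\<^esub> b \<in> carrier P" using MonD(1)[OF A(3)] by simp
    have dv: "a \<in> carrier P \<and> a divides\<^bsub>P\<^esub> f" if a: "a \<in> A" for a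
    proof -
      have ac: "a \<in> carrier P" using a A(2) primesD(3) by blast
      have Aeq: "insert a (A - {a}) = A" using a by auto
      have "(\<Otimes>\<^bsub>P\<^esub>a\<in>insert a (A - {a}). a) = a \<otimes>\<^bsub>P\<^esub> (\<Otimes>\<^bsub>P\<^esub>a\<in>A - {a}. a)"
        using A(1) Ac ac by (intro UP.finprod_insert) auto
      moreover have pc: "(\<Otimes>\<^bsub>P\<^esub>a\<in>A - {a}. a) \<in> carrier P" using Ac by (intro UP.finprod_closed) auto
      ultimately have "f = a \<otimes>\<^bsub>P\<^esub> ((\<Otimes>\<^bsub>P\<^esub>a\<in>A - {a}. a) \<otimes>\<^bsub>P\<^esub> (b \<otimes>\<^bsub>P\<^esub> b))"
        using A(4) ac bc unfolding Aeq by (simp add: UP.m_assoc)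
      moreover have "(\<Otimes>\<^bsub>P\<^esub>a\<in>A - {a}. a) \<otimes>\<^bsub>P\<^esub> (b \<otimes>\<^bsub>P\<^esub> b) \<in> carrier P" using pc bc by simp
      ultimately show ?thesis using ac unfolding factor_def by blast
    qed
    have wle: "wt {f} \<le> wt A" by (rule wt_mono[OF fc dv])
    obtain N c where N: "N \<ge> 1" "c \<in> Fx" "R N c f" using wt_cases[of "{f}"] nz by (metis singletonI)
    have "A \<subseteq> IR"
    proof
      fix a assume a: "a \<in> A"
      have "R N c a" using R_divides[OF N(3)] dv[OF a] by blast
      then have "a \<noteq> X" using R_X[OF N(2) _ N(1)] by blast
      then show "a \<in> IR" using primes_Irred a A(2) by (auto simp: IR_def)
    qed
    then have "A \<in> sys.FA (d - 2 * j)" using A(1,5) unfolding sys.FA_def by simp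
    moreover have "j \<le> d div 2" using A(5) by simp
    ultimately show ?thesis using x A(3) wle by (simp add: Z_def)
  qed
  have "(\<Sum>f\<in>Mon d. wt {f}) = (\<Sum>f\<in>good. wt {f})"
    unfolding good_def using finite_Mon by (intro sum.mono_neutral_right) auto
  also have "\<dots> \<le> (\<Sum>f\<in>good. (case g f of (j, b, A) \<Rightarrow> wt A))" using key by (intro sum_mono) blast
  also have "\<dots> = (\<Sum>x\<in>g ` good. (case x of (j, b, A) \<Rightarrow> wt A))" using inj by (simp add: sum.reindex)
  also have "\<dots> \<le> (\<Sum>x\<in>Z. (case x of (j, b, A) \<Rightarrow> wt A))"
    using key fZ wt_nonneg by (intro sum_mono2) (auto split: prod.splits)
  also have "\<dots> = (\<Sum>j\<le>d div 2. \<Sum>(b, A)\<in>Mon j \<times> sys.FA (d - 2 * j). wt A)"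
    unfolding Z_def using finite_Mon sys.finite_FA by (subst sum.Sigma) (auto simp: split_def)
  also have "\<dots> = (\<Sum>j\<le>d div 2. real q ^ j * sys.T (d - 2 * j))"
  proof (rule sum.cong[OF refl])
    fix j
    have "(\<Sum>(b, A)\<in>Mon j \<times> sys.FA (d - 2 * j). wt A) = (\<Sum>b\<in>Mon j. sys.T (d - 2 * j))"
      unfolding sum.cartesian_product[symmetric] sys.T_def ..
    then show "(\<Sum>(b, A)\<in>Mon j \<times> sys.FA (d - 2 * j). wt A) = real q ^ j * sys.T (d - 2 * j)"
      by (simp add: card_Mon)
  qed
  finally show ?thesis .
qed

lemma sum_wt_le_Eb: "(\<Sum>d\<le>n. \<Sum>f\<in>Mon d. wt {f}) \<le> real q ^ n * sys.Eb n"
proof -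
  have "(\<Sum>d\<le>n. \<Sum>f\<in>Mon d. wt {f}) \<le> (\<Sum>d\<le>n. \<Sum>j\<le>d div 2. real q ^ j * sys.T (d - 2 * j))"
    by (rule sum_mono[OF sum_wt_Mon])
  also have "\<dots> = real q ^ n * sys.Eb n" unfolding sys.Eb_def using q_ge_2 by simp
  finally show ?thesis .
qed

section \<open>Matrices acting on vectors\<close>

definition vmod :: "nat \<Rightarrow> ('a, nat \<Rightarrow> 'a) module" where
  "vmod n = \<lparr>carrier = {..<n} \<rightarrow>\<^sub>E carrier F, mult = (\<lambda>v w. v), one = (\<lambda>i\<in>{..<n}. \<zero>),
     ring.zero = (\<lambda>i\<in>{..<n}. \<zero>), ring.add = (\<lambda>v w. \<lambda>i\<in>{..<n}. v i \<oplus> w i),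
     smult = (\<lambda>c v. \<lambda>i\<in>{..<n}. c \<otimes> v i)\<rparr>"

lemma vmod_simps:
  "carrier (vmod n) = ({..<n} \<rightarrow>\<^sub>E carrier F)" "\<zero>\<^bsub>vmod n\<^esub> = (\<lambda>i\<in>{..<n}. \<zero>)"
  "v \<oplus>\<^bsub>vmod n\<^esub> w = (\<lambda>i\<in>{..<n}. v i \<oplus> w i)" "c \<odot>\<^bsub>vmod n\<^esub> v = (\<lambda>i\<in>{..<n}. c \<otimes> v i)"
  by (simp_all add: vmod_def)

lemma vec_closed: "v \<in> carrier (vmod n) \<Longrightarrow> i < n \<Longrightarrow> v i \<in> carrier F"
  by (auto simp: vmod_simps)

lemma vec_eqI: "v \<in> carrier (vmod n) \<Longrightarrow> w \<in> carrier (vmod n) \<Longrightarrow> (\<And>i. i < n \<Longrightarrow> v i = w i) \<Longrightarrow> v = w"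
  by (rule PiE_ext[of _ "{..<n}" "\<lambda>_. carrier F"]) (auto simp: vmod_simps)

lemma vmod_module: "module F (vmod n)"
proof (rule moduleI[OF is_cring])
  show "abelian_group (vmod n)"
  proof (rule abelian_groupI)
    show "x \<oplus>\<^bsub>vmod n\<^esub> y \<in> carrier (vmod n)" if "x \<in> carrier (vmod n)" "y \<in> carrier (vmod n)" for x y
      using vec_closed[OF that(1)] vec_closed[OF that(2)] by (auto simp: vmod_simps)
    show "\<zero>\<^bsub>vmod n\<^esub> \<in> carrier (vmod n)" by (auto simp: vmod_simps)
    show "x \<oplus>\<^bsub>vmod n\<^esub> y \<oplus>\<^bsub>vmod n\<^esub> z = x \<oplus>\<^bsub>vmod n\<^esub> (y \<oplus>\<^bsub>vmod n\<^esub> z)"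
      if "x \<in> carrier (vmod n)" "y \<in> carrier (vmod n)" "z \<in> carrier (vmod n)" for x y z
      unfolding vmod_simps by (rule restrict_ext) (use that[THEN vec_closed] in \<open>simp add: a_assoc\<close>)
    show "x \<oplus>\<^bsub>vmod n\<^esub> y = y \<oplus>\<^bsub>vmod n\<^esub> x" if "x \<in> carrier (vmod n)" "y \<in> carrier (vmod n)" for x y
      unfolding vmod_simps by (rule restrict_ext) (use that[THEN vec_closed] in \<open>simp add: a_comm\<close>)
    show "\<zero>\<^bsub>vmod n\<^esub> \<oplus>\<^bsub>vmod n\<^esub> x = x" if "x \<in> carrier (vmod n)" for x
      by (rule vec_eqI[OF _ that]) (use vec_closed[OF that] that in \<open>auto simp: vmod_simps\<close>)
    show "\<exists>y\<in>carrier (vmod n). y \<oplus>\<^bsub>vmod n\<^esub> x = \<zero>\<^bsub>vmod n\<^esub>" if "x \<in> carrier (vmod n)" for x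
    proof
      show "(\<lambda>i\<in>{..<n}. \<ominus> x i) \<in> carrier (vmod n)" using vec_closed[OF that] by (auto simp: vmod_simps)
      show "(\<lambda>i\<in>{..<n}. \<ominus> x i) \<oplus>\<^bsub>vmod n\<^esub> x = \<zero>\<^bsub>vmod n\<^esub>"
        unfolding vmod_simps by (rule restrict_ext) (use vec_closed[OF that] in \<open>simp add: l_neg\<close>)
    qed
  qed
  show "a \<odot>\<^bsub>vmod n\<^esub> x \<in> carrier (vmod n)" if "a \<in> carrier F" "x \<in> carrier (vmod n)" for a x
    using that(1) vec_closed[OF that(2)] by (auto simp: vmod_simps)
  show "(a \<oplus> b) \<odot>\<^bsub>vmod n\<^esub> x = a \<odot>\<^bsub>vmod n\<^esub> x \<oplus>\<^bsub>vmod n\<^esub> b \<odot>\<^bsub>vmod n\<^esub> x"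
    if "a \<in> carrier F" "b \<in> carrier F" "x \<in> carrier (vmod n)" for a b x
    unfolding vmod_simps by (rule restrict_ext) (use that(1,2) vec_closed[OF that(3)] in \<open>simp add: l_distr\<close>)
  show "a \<odot>\<^bsub>vmod n\<^esub> (x \<oplus>\<^bsub>vmod n\<^esub> y) = a \<odot>\<^bsub>vmod n\<^esub> x \<oplus>\<^bsub>vmod n\<^esub> a \<odot>\<^bsub>vmod n\<^esub> y"
    if "a \<in> carrier F" "x \<in> carrier (vmod n)" "y \<in> carrier (vmod n)" for a x y
    unfolding vmod_simps by (rule restrict_ext) (use that(1) that(2,3)[THEN vec_closed] in \<open>simp add: r_distr\<close>)
  show "(a \<otimes> b) \<odot>\<^bsub>vmod n\<^esub> x = a \<odot>\<^bsub>vmod n\<^esub> (b \<odot>\<^bsub>vmod n\<^esub> x)"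
    if "a \<in> carrier F" "b \<in> carrier F" "x \<in> carrier (vmod n)" for a b x
    unfolding vmod_simps by (rule restrict_ext) (use that(1,2) vec_closed[OF that(3)] in \<open>simp add: m_assoc\<close>)
  show "\<one> \<odot>\<^bsub>vmod n\<^esub> x = x" if "x \<in> carrier (vmod n)" for x
    by (rule vec_eqI[OF _ that]) (use vec_closed[OF that] that in \<open>auto simp: vmod_simps\<close>)
qed

abbreviation mats :: "nat \<Rightarrow> 'a mat set" where "mats n \<equiv> carrier (mat_monoid n F)"

lemma mats_iff: "A \<in> mats n \<longleftrightarrow> dim_row A = n \<and> dim_col A = n \<and> (\<forall>i<n. \<forall>j<n. A $$ (i, j) \<in> carrier F)"
proof -
  have "elements_mat A = (\<lambda>(i, j). A $$ (i, j)) ` ({..<dim_row A} \<times> {..<dim_col A})"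
    unfolding elements_mat_def by auto
  then show ?thesis unfolding mat_monoid_def carrier_mat_def by auto
qed

lemma mats_closed: "A \<in> mats n \<Longrightarrow> i < n \<Longrightarrow> j < n \<Longrightarrow> A $$ (i, j) \<in> carrier F"
  by (simp add: mats_iff)

lemma mat_eqI: "A \<in> mats n \<Longrightarrow> B \<in> mats n \<Longrightarrow> (\<And>i j. i < n \<Longrightarrow> j < n \<Longrightarrow> A $$ (i, j) = B $$ (i, j)) \<Longrightarrow> A = B"
  by (rule eq_matI) (auto simp: mats_iff)

lemma mat_mult_entry: "A \<in> mats n \<Longrightarrow> B \<in> mats n \<Longrightarrow> i < n \<Longrightarrow> j < n \<Longrightarrow>
    (A \<otimes>\<^bsub>mat_monoid n F\<^esub> B) $$ (i, j) = (\<Oplus>k\<in>{..<n}. A $$ (i, k) \<otimes> B $$ (k, j))"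
  by (simp add: mat_monoid_def)

lemma mat_mult_closed: "A \<in> mats n \<Longrightarrow> B \<in> mats n \<Longrightarrow> A \<otimes>\<^bsub>mat_monoid n F\<^esub> B \<in> mats n"
  unfolding mats_iff by (simp add: mat_monoid_def)

lemma mat_one_entry: "i < n \<Longrightarrow> j < n \<Longrightarrow> \<one>\<^bsub>mat_monoid n F\<^esub> $$ (i, j) = (if i = j then \<one> else \<zero>)"
  by (simp add: mat_monoid_def)

lemma mat_one_closed: "\<one>\<^bsub>mat_monoid n F\<^esub> \<in> mats n"
  unfolding mats_iff by (simp add: mat_monoid_def)

lemma finite_mats: "finite (mats n)"
proof -
  define f where "f A = (\<lambda>x\<in>{..<n} \<times> {..<n}. A $$ x)" for A :: "'a mat"
  have b: "bij_betw f (mats n) (({..<n} \<times> {..<n}) \<rightarrow>\<^sub>E carrier F)"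
  proof (rule bij_betwI[where g = "\<lambda>h. mat n n h"])
    show "f \<in> mats n \<rightarrow> (({..<n} \<times> {..<n}) \<rightarrow>\<^sub>E carrier F)"
    proof (rule funcsetI, rule PiE_I)
      fix A x assume "A \<in> mats n"
      then show "x \<in> {..<n} \<times> {..<n} \<Longrightarrow> f A x \<in> carrier F" by (cases x) (simp add: f_def mats_iff)
    qed (simp add: f_def)
    show "(\<lambda>h. mat n n h) \<in> (({..<n} \<times> {..<n}) \<rightarrow>\<^sub>E carrier F) \<rightarrow> mats n" by (auto simp: mats_iff)
    show "mat n n (f A) = A" if "A \<in> mats n" for A using that by (intro eq_matI) (auto simp: f_def mats_iff)
    show "f (mat n n h) = h" if "h \<in> ({..<n} \<times> {..<n}) \<rightarrow>\<^sub>E carrier F" for h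
    proof
      show "f (mat n n h) x = h x" for x using PiE_arb[OF that, of x] by (cases x) (auto simp: f_def restrict_def)
    qed
  qed
  have "finite (({..<n} \<times> {..<n}) \<rightarrow>\<^sub>E carrier F)" using fin by (intro finite_PiE) auto
  then show ?thesis unfolding bij_betw_finite[OF b] .
qed

lemma finite_vecs: "finite (carrier (vmod n))" using fin by (simp add: vmod_simps finite_PiE)
lemma card_vecs: "card (carrier (vmod n)) = q ^ n" by (simp add: vmod_simps card_PiE)

definition act :: "nat \<Rightarrow> 'a mat \<Rightarrow> (nat \<Rightarrow> 'a) \<Rightarrow> nat \<Rightarrow> 'a" where
  "act n A v = (\<lambda>i\<in>{..<n}. \<Oplus>k\<in>{..<n}. A $$ (i, k) \<otimes> v k)"

lemma act_closed: "A \<in> mats n \<Longrightarrow> v \<in> carrier (vmod n) \<Longrightarrow> act n A v \<in> carrier (vmod n)"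
  unfolding vmod_simps act_def by (auto intro!: finsum_closed mats_closed)

lemma act_add: assumes A: "A \<in> mats n" and v: "v \<in> carrier (vmod n)" "w \<in> carrier (vmod n)"
  shows "act n A (v \<oplus>\<^bsub>vmod n\<^esub> w) = act n A v \<oplus>\<^bsub>vmod n\<^esub> act n A w"
proof -
  interpret V: module F "vmod n" by (rule vmod_module)
  show ?thesis
  proof (rule vec_eqI)
    fix i assume i: "i < n"
    have "(\<Oplus>k\<in>{..<n}. A $$ (i, k) \<otimes> (v k \<oplus> w k)) = (\<Oplus>k\<in>{..<n}. A $$ (i, k) \<otimes> v k \<oplus> A $$ (i, k) \<otimes> w k)"
      using i by (intro finsum_cong') (auto simp: r_distr mats_closed[OF A] vec_closed[OF v(1)] vec_closed[OF v(2)])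
    also have "\<dots> = (\<Oplus>k\<in>{..<n}. A $$ (i, k) \<otimes> v k) \<oplus> (\<Oplus>k\<in>{..<n}. A $$ (i, k) \<otimes> w k)"
      using i by (intro finsum_addf) (auto simp: mats_closed[OF A] vec_closed[OF v(1)] vec_closed[OF v(2)])
    finally have "(\<Oplus>k\<in>{..<n}. A $$ (i, k) \<otimes> (v k \<oplus> w k)) = (\<Oplus>k\<in>{..<n}. A $$ (i, k) \<otimes> v k) \<oplus> (\<Oplus>k\<in>{..<n}. A $$ (i, k) \<otimes> w k)" .
    moreover have "(\<Oplus>k\<in>{..<n}. A $$ (i, k) \<otimes> (v \<oplus>\<^bsub>vmod n\<^esub> w) k) = (\<Oplus>k\<in>{..<n}. A $$ (i, k) \<otimes> (v k \<oplus> w k))"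
      using i by (intro finsum_cong') (auto simp: vmod_simps mats_closed[OF A] vec_closed[OF v(1)] vec_closed[OF v(2)])
    ultimately show "act n A (v \<oplus>\<^bsub>vmod n\<^esub> w) i = (act n A v \<oplus>\<^bsub>vmod n\<^esub> act n A w) i"
      using i by (simp add: act_def vmod_simps(3))
  qed (use A v act_closed in auto)
qed

lemma act_smult: assumes A: "A \<in> mats n" and v: "v \<in> carrier (vmod n)" and c: "c \<in> carrier F"
  shows "act n A (c \<odot>\<^bsub>vmod n\<^esub> v) = c \<odot>\<^bsub>vmod n\<^esub> act n A v"
proof -
  interpret V: module F "vmod n" by (rule vmod_module)
  show ?thesis
  proof (rule vec_eqI)
    fix i assume i: "i < n"
    have "(\<Oplus>k\<in>{..<n}. A $$ (i, k) \<otimes> (c \<odot>\<^bsub>vmod n\<^esub> v) k) = (\<Oplus>k\<in>{..<n}. c \<otimes> (A $$ (i, k) \<otimes> v k))"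
      using i c by (intro finsum_cong') (auto simp: vmod_simps m_lcomm mats_closed[OF A] vec_closed[OF v])
    also have "\<dots> = c \<otimes> (\<Oplus>k\<in>{..<n}. A $$ (i, k) \<otimes> v k)"
      using i c by (intro finsum_rdistr[symmetric]) (auto simp: mats_closed[OF A] vec_closed[OF v])
    finally show "act n A (c \<odot>\<^bsub>vmod n\<^esub> v) i = (c \<odot>\<^bsub>vmod n\<^esub> act n A v) i"
      using i by (simp add: act_def vmod_simps(4))
  qed (use A v c act_closed in auto)
qed

lemma finsum_single: assumes "finite I" "i \<in> I" "x \<in> carrier F" shows "(\<Oplus>k\<in>I. if k = i then x else \<zero>) = x"
  using add.finprod_singleton[of i I "\<lambda>_. x"] assms by (simp add: eq_commute)

definition unitv :: "nat \<Rightarrow> nat \<Rightarrow> nat \<Rightarrow> 'a" where "unitv n j = (\<lambda>i\<in>{..<n}. if i = j then \<one> else \<zero>)"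

lemma unitv_closed: "unitv n j \<in> carrier (vmod n)" by (auto simp: unitv_def vmod_simps)

lemma act_unitv: assumes A: "A \<in> mats n" and ij: "i < n" "j < n" shows "act n A (unitv n j) i = A $$ (i, j)"
proof -
  have "(\<Oplus>k\<in>{..<n}. A $$ (i, k) \<otimes> unitv n j k) = (\<Oplus>k\<in>{..<n}. if k = j then A $$ (i, j) else \<zero>)"
    using ij by (intro finsum_cong') (auto simp: unitv_def mats_closed[OF A])
  then show ?thesis using ij finsum_single[of "{..<n}" j] by (simp add: act_def mats_closed[OF A])
qed

lemma act_faithful: assumes "A \<in> mats n" "B \<in> mats n" "\<And>v. v \<in> carrier (vmod n) \<Longrightarrow> act n A v = act n B v" shows "A = B"
  by (rule mat_eqI[OF assms(1,2)]) (metis assms act_unitv unitv_closed)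

lemma finsum_swap:
  assumes "finite I" "finite J" "\<And>i j. i \<in> I \<Longrightarrow> j \<in> J \<Longrightarrow> f i j \<in> carrier F"
  shows "(\<Oplus>i\<in>I. \<Oplus>j\<in>J. f i j) = (\<Oplus>j\<in>J. \<Oplus>i\<in>I. f i j)"
  using assms
proof (induction I rule: finite_induct)
  case empty
  have "(\<Oplus>j\<in>J. \<zero>) = \<zero>" by (rule finsum_zero)
  then show ?case by simp
next
  case (insert x I)
  have c: "(\<lambda>i. \<Oplus>j\<in>J. f i j) \<in> I \<rightarrow> carrier F" "(\<Oplus>j\<in>J. f x j) \<in> carrier F"
    using insert.prems by (auto intro!: finsum_closed)
  have "(\<Oplus>i\<in>insert x I. \<Oplus>j\<in>J. f i j) = (\<Oplus>j\<in>J. f x j) \<oplus> (\<Oplus>i\<in>I. \<Oplus>j\<in>J. f i j)"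
    using insert.hyps c by (intro finsum_insert) auto
  also have "\<dots> = (\<Oplus>j\<in>J. f x j) \<oplus> (\<Oplus>j\<in>J. \<Oplus>i\<in>I. f i j)" using insert by simp
  also have "\<dots> = (\<Oplus>j\<in>J. f x j \<oplus> (\<Oplus>i\<in>I. f i j))"
    using insert.prems by (intro finsum_addf[symmetric]) (auto intro!: finsum_closed)
  also have "\<dots> = (\<Oplus>j\<in>J. \<Oplus>i\<in>insert x I. f i j)"
    using insert.prems insert.hyps by (intro finsum_cong') (auto simp: Pi_def intro!: finsum_closed)
  finally show ?case .
qed

lemma act_mult: assumes A: "A \<in> mats n" and B: "B \<in> mats n" and v: "v \<in> carrier (vmod n)"
  shows "act n (A \<otimes>\<^bsub>mat_monoid n F\<^esub> B) v = act n A (act n B v)"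
proof (rule vec_eqI)
  fix i assume i: "i < n"
  note cl = mats_closed[OF A] mats_closed[OF B] vec_closed[OF v]
  have "(\<Oplus>k\<in>{..<n}. (A \<otimes>\<^bsub>mat_monoid n F\<^esub> B) $$ (i, k) \<otimes> v k) = (\<Oplus>k\<in>{..<n}. \<Oplus>l\<in>{..<n}. A $$ (i, l) \<otimes> B $$ (l, k) \<otimes> v k)"
  proof (intro finsum_cong')
    fix k assume k: "k \<in> {..<n}"
    show "(A \<otimes>\<^bsub>mat_monoid n F\<^esub> B) $$ (i, k) \<otimes> v k = (\<Oplus>l\<in>{..<n}. A $$ (i, l) \<otimes> B $$ (l, k) \<otimes> v k)"
      unfolding mat_mult_entry[OF A B i, of k] using i k by (subst mat_mult_entry[OF A B]) (auto simp: cl intro!: finsum_ldistr)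
  qed (use i in \<open>auto simp: cl intro!: finsum_closed\<close>)
  also have "\<dots> = (\<Oplus>l\<in>{..<n}. \<Oplus>k\<in>{..<n}. A $$ (i, l) \<otimes> B $$ (l, k) \<otimes> v k)"
    using i by (intro finsum_swap) (auto simp: cl)
  also have "\<dots> = (\<Oplus>l\<in>{..<n}. A $$ (i, l) \<otimes> act n B v l)"
  proof (intro finsum_cong')
    fix l assume l: "l \<in> {..<n}"
    have "(\<Oplus>k\<in>{..<n}. A $$ (i, l) \<otimes> B $$ (l, k) \<otimes> v k) = (\<Oplus>k\<in>{..<n}. A $$ (i, l) \<otimes> (B $$ (l, k) \<otimes> v k))"
      using i l by (intro finsum_cong') (auto simp: cl m_assoc)
    also have "\<dots> = A $$ (i, l) \<otimes> (\<Oplus>k\<in>{..<n}. B $$ (l, k) \<otimes> v k)"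
      using i l by (intro finsum_rdistr[symmetric]) (auto simp: cl)
    finally show "(\<Oplus>k\<in>{..<n}. A $$ (i, l) \<otimes> B $$ (l, k) \<otimes> v k) = A $$ (i, l) \<otimes> act n B v l" using l by (simp add: act_def)
  qed (use i vec_closed[OF act_closed[OF B v]] in \<open>auto simp: cl\<close>)
  finally show "act n (A \<otimes>\<^bsub>mat_monoid n F\<^esub> B) v i = act n A (act n B v) i" using i by (simp add: act_def)
qed (use assms act_closed mat_mult_closed in auto)

lemma act_one: assumes v: "v \<in> carrier (vmod n)" shows "act n \<one>\<^bsub>mat_monoid n F\<^esub> v = v"
proof (rule vec_eqI)
  fix i assume i: "i < n"
  have "(\<Oplus>k\<in>{..<n}. \<one>\<^bsub>mat_monoid n F\<^esub> $$ (i, k) \<otimes> v k) = (\<Oplus>k\<in>{..<n}. if k = i then v i else \<zero>)"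
    using i by (intro finsum_cong') (auto simp: mat_one_entry vec_closed[OF v])
  then show "act n \<one>\<^bsub>mat_monoid n F\<^esub> v i = v i" using i finsum_single[of "{..<n}" i] by (simp add: act_def vec_closed[OF v])
qed (use v act_closed mat_one_closed in auto)

text \<open>The laws are checked on vectors: the action is faithful and turns products into
  compositions of maps.\<close>

lemma mat_monoid: "monoid (mat_monoid n F)"
proof (rule monoidI)
  show "\<one>\<^bsub>mat_monoid n F\<^esub> \<in> mats n" by (rule mat_one_closed)
  fix A assume A: "A \<in> mats n"
  show "\<one>\<^bsub>mat_monoid n F\<^esub> \<otimes>\<^bsub>mat_monoid n F\<^esub> A = A" "A \<otimes>\<^bsub>mat_monoid n F\<^esub> \<one>\<^bsub>mat_monoid n F\<^esub> = A"
    by (rule act_faithful[of _ n]; use A mat_one_closed mat_mult_closed in \<open>auto simp: act_mult act_one act_closed\<close>)+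
  fix B assume B: "B \<in> mats n"
  show "A \<otimes>\<^bsub>mat_monoid n F\<^esub> B \<in> mats n" by (rule mat_mult_closed[OF A B])
  fix C assume C: "C \<in> mats n"
  show "A \<otimes>\<^bsub>mat_monoid n F\<^esub> B \<otimes>\<^bsub>mat_monoid n F\<^esub> C = A \<otimes>\<^bsub>mat_monoid n F\<^esub> (B \<otimes>\<^bsub>mat_monoid n F\<^esub> C)"
    by (rule act_faithful[of _ n]) (use A B C mat_mult_closed in \<open>auto simp: act_mult act_closed\<close>)
qed

lemma GL_group: "group (GL n F)" unfolding GL_def by (rule monoid.units_group[OF mat_monoid])

lemma GL_simps: "carrier (GL n F) = Units (mat_monoid n F)" "\<one>\<^bsub>GL n F\<^esub> = \<one>\<^bsub>mat_monoid n F\<^esub>"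
  "A \<otimes>\<^bsub>GL n F\<^esub> B = A \<otimes>\<^bsub>mat_monoid n F\<^esub> B"
  by (simp_all add: GL_def units_of_def)

lemma GL_mats: "A \<in> carrier (GL n F) \<Longrightarrow> A \<in> mats n" by (simp add: GL_simps Units_def)

lemma finite_GL: "finite (carrier (GL n F))" using finite_mats GL_mats by (meson finite_subset subsetI)

lemma act_zero: assumes "A \<in> mats n" shows "act n A \<zero>\<^bsub>vmod n\<^esub> = \<zero>\<^bsub>vmod n\<^esub>"
proof -
  interpret V: module F "vmod n" by (rule vmod_module)
  have "act n A (\<zero> \<odot>\<^bsub>vmod n\<^esub> \<zero>\<^bsub>vmod n\<^esub>) = \<zero> \<odot>\<^bsub>vmod n\<^esub> act n A \<zero>\<^bsub>vmod n\<^esub>"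
    by (rule act_smult[OF assms]) auto
  then show ?thesis using act_closed[OF assms V.zero_closed] by (simp add: V.smult_l_null)
qed

text \<open>In a finite monoid acting faithfully, an element acting surjectively can be cancelled on the
  right, hence is invertible.\<close>
lemma surj_act_GL: assumes A: "A \<in> mats n" and s: "act n A ` carrier (vmod n) = carrier (vmod n)" shows "A \<in> carrier (GL n F)"
proof -
  interpret M: monoid "mat_monoid n F" by (rule mat_monoid)
  let ?f = "\<lambda>B. B \<otimes>\<^bsub>mat_monoid n F\<^esub> A"
  have inj: "inj_on ?f (mats n)"
  proof (rule inj_onI)
    fix B C assume BC: "B \<in> mats n" "C \<in> mats n" "?f B = ?f C"
    show "B = C"
    proof (rule act_faithful[OF BC(1,2)])
      fix v assume "v \<in> carrier (vmod n)"
      then obtain w where "w \<in> carrier (vmod n)" "v = act n A w" using s by blast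
      then show "act n B v = act n C v" using act_mult[OF BC(1) A] act_mult[OF BC(2) A] BC(3) by simp
    qed
  qed
  have "?f ` mats n = mats n" by (rule endo_inj_surj[OF finite_mats _ inj]) (use A mat_mult_closed in auto)
  then obtain B where B: "B \<in> mats n" "B \<otimes>\<^bsub>mat_monoid n F\<^esub> A = \<one>\<^bsub>mat_monoid n F\<^esub>" using mat_one_closed by (metis imageE)
  have "?f (A \<otimes>\<^bsub>mat_monoid n F\<^esub> B) = ?f \<one>\<^bsub>mat_monoid n F\<^esub>" using A B by (simp add: M.m_assoc)
  then have "A \<otimes>\<^bsub>mat_monoid n F\<^esub> B = \<one>\<^bsub>mat_monoid n F\<^esub>" using inj_onD[OF inj _ mat_mult_closed[OF A B(1)] mat_one_closed] by simp
  then show ?thesis using A B unfolding GL_simps Units_def by auto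
qed

section \<open>Subspaces and the counting of matrices\<close>

abbreviation Vs :: "nat \<Rightarrow> (nat \<Rightarrow> 'a) set" where "Vs n \<equiv> carrier (vmod n)"

text \<open>Dimension is read off from the cardinality: a subspace of dimension d has q^d
  elements.\<close>

definition subsp :: "nat \<Rightarrow> (nat \<Rightarrow> 'a) set \<Rightarrow> bool" where
  "subsp n U \<longleftrightarrow> U \<subseteq> Vs n \<and> \<zero>\<^bsub>vmod n\<^esub> \<in> U \<and> (\<forall>u\<in>U. \<forall>v\<in>U. u \<oplus>\<^bsub>vmod n\<^esub> v \<in> U) \<and> (\<forall>c\<in>carrier F. \<forall>u\<in>U. c \<odot>\<^bsub>vmod n\<^esub> u \<in> U)"

definition adjoin :: "nat \<Rightarrow> (nat \<Rightarrow> 'a) set \<Rightarrow> (nat \<Rightarrow> 'a) \<Rightarrow> (nat \<Rightarrow> 'a) set" where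
  "adjoin n U w = (\<lambda>(u, c). u \<oplus>\<^bsub>vmod n\<^esub> c \<odot>\<^bsub>vmod n\<^esub> w) ` (U \<times> carrier F)"

lemma subsp_adjoin:
  assumes U: "subsp n U" and w: "w \<in> Vs n" "w \<notin> U"
  shows "subsp n (adjoin n U w)" "card (adjoin n U w) = q * card U" "U \<subseteq> adjoin n U w"
proof -
  interpret V: module F "vmod n" by (rule vmod_module)
  have UV: "u \<in> Vs n" if "u \<in> U" for u using U that by (auto simp: subsp_def)
  have U2: "\<zero>\<^bsub>vmod n\<^esub> \<in> U" "\<And>u v. u \<in> U \<Longrightarrow> v \<in> U \<Longrightarrow> u \<oplus>\<^bsub>vmod n\<^esub> v \<in> U" "\<And>c u. c \<in> carrier F \<Longrightarrow> u \<in> U \<Longrightarrow> c \<odot>\<^bsub>vmod n\<^esub> u \<in> U"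
    using U by (auto simp: subsp_def)
  have mem: "u \<oplus>\<^bsub>vmod n\<^esub> c \<odot>\<^bsub>vmod n\<^esub> w \<in> adjoin n U w" if "u \<in> U" "c \<in> carrier F" for u c
    using that unfolding adjoin_def by force
  have sub: "U \<subseteq> adjoin n U w"
  proof
    fix u assume u: "u \<in> U"
    have "u \<oplus>\<^bsub>vmod n\<^esub> \<zero> \<odot>\<^bsub>vmod n\<^esub> w = u" using UV[OF u] w by (simp add: V.smult_l_null)
    then show "u \<in> adjoin n U w" using mem[OF u zero_closed] by simp
  qed
  then show "U \<subseteq> adjoin n U w" .
  show "subsp n (adjoin n U w)" unfolding subsp_def
  proof (intro conjI ballI)
    show "adjoin n U w \<subseteq> Vs n" using UV w by (auto simp: adjoin_def)
    show "\<zero>\<^bsub>vmod n\<^esub> \<in> adjoin n U w" using sub U2(1) by blast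
    fix x assume "x \<in> adjoin n U w"
    then obtain u c where x: "u \<in> U" "c \<in> carrier F" "x = u \<oplus>\<^bsub>vmod n\<^esub> c \<odot>\<^bsub>vmod n\<^esub> w" by (auto simp: adjoin_def)
    note cl = UV[OF x(1)] w(1) x(2)
    {
      fix y assume "y \<in> adjoin n U w"
      then obtain v d where y: "v \<in> U" "d \<in> carrier F" "y = v \<oplus>\<^bsub>vmod n\<^esub> d \<odot>\<^bsub>vmod n\<^esub> w" by (auto simp: adjoin_def)
      have "x \<oplus>\<^bsub>vmod n\<^esub> y = (u \<oplus>\<^bsub>vmod n\<^esub> v) \<oplus>\<^bsub>vmod n\<^esub> (c \<oplus> d) \<odot>\<^bsub>vmod n\<^esub> w"
        unfolding x(3) y(3) using cl UV[OF y(1)] y(2) by (simp add: V.smult_l_distr V.a_ac)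
      then show "x \<oplus>\<^bsub>vmod n\<^esub> y \<in> adjoin n U w" using mem[OF U2(2)[OF x(1) y(1)]] x(2) y(2) by simp
    }
    fix a assume a: "a \<in> carrier F"
    have "a \<odot>\<^bsub>vmod n\<^esub> x = a \<odot>\<^bsub>vmod n\<^esub> u \<oplus>\<^bsub>vmod n\<^esub> (a \<otimes> c) \<odot>\<^bsub>vmod n\<^esub> w"
      unfolding x(3) using cl a by (simp add: V.smult_r_distr V.smult_assoc1)
    then show "a \<odot>\<^bsub>vmod n\<^esub> x \<in> adjoin n U w" using mem[OF U2(3)[OF a x(1)]] a x(2) by simp
  qed
  have "inj_on (\<lambda>(u, c). u \<oplus>\<^bsub>vmod n\<^esub> c \<odot>\<^bsub>vmod n\<^esub> w) (U \<times> carrier F)"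
  proof (rule inj_onI, clarify)
    fix u c v d assume uv: "u \<in> U" "c \<in> carrier F" "v \<in> U" "d \<in> carrier F"
      and eq: "u \<oplus>\<^bsub>vmod n\<^esub> c \<odot>\<^bsub>vmod n\<^esub> w = v \<oplus>\<^bsub>vmod n\<^esub> d \<odot>\<^bsub>vmod n\<^esub> w"
    note cl = UV[OF uv(1)] UV[OF uv(3)] w(1) uv(2,4)
    have cd: "c = d"
    proof (rule ccontr)
      assume ne: "c \<noteq> d"
      define a where "a = c \<ominus> d"
      have a: "a \<in> Fx" using ne uv by (auto simp: a_def r_right_minus_eq)
      have ac: "a \<oplus> d = c" unfolding a_def a_minus_def using uv by (simp add: a_assoc l_neg)
      have "u \<oplus>\<^bsub>vmod n\<^esub> (a \<odot>\<^bsub>vmod n\<^esub> w \<oplus>\<^bsub>vmod n\<^esub> d \<odot>\<^bsub>vmod n\<^esub> w) = v \<oplus>\<^bsub>vmod n\<^esub> d \<odot>\<^bsub>vmod n\<^esub> w"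
        using eq a cl unfolding ac[symmetric] by (simp add: V.smult_l_distr)
      then have "(u \<oplus>\<^bsub>vmod n\<^esub> a \<odot>\<^bsub>vmod n\<^esub> w) \<oplus>\<^bsub>vmod n\<^esub> d \<odot>\<^bsub>vmod n\<^esub> w = v \<oplus>\<^bsub>vmod n\<^esub> d \<odot>\<^bsub>vmod n\<^esub> w"
        using a cl by (simp add: V.a_assoc)
      then have e2: "u \<oplus>\<^bsub>vmod n\<^esub> a \<odot>\<^bsub>vmod n\<^esub> w = v" 
        by (rule V.add.r_cancel) (use a cl in simp_all)
      have "(\<ominus> \<one>) \<odot>\<^bsub>vmod n\<^esub> u \<oplus>\<^bsub>vmod n\<^esub> v = a \<odot>\<^bsub>vmod n\<^esub> w"
        unfolding e2[symmetric] using a cl by (simp add: V.smult_l_minus V.a_assoc[symmetric] V.l_neg)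
      then have "a \<odot>\<^bsub>vmod n\<^esub> w \<in> U" using U2(2)[OF U2(3)[OF _ uv(1)] uv(3), of "\<ominus> \<one>"] by simp
      then have "inv a \<odot>\<^bsub>vmod n\<^esub> (a \<odot>\<^bsub>vmod n\<^esub> w) \<in> U" using U2(3) Fx_inv[OF a] by blast
      moreover have "inv a \<odot>\<^bsub>vmod n\<^esub> (a \<odot>\<^bsub>vmod n\<^esub> w) = w"
        using Fx_inv[OF a] a cl by (simp add: V.smult_assoc1[symmetric])
      ultimately show False using w(2) by simp
    qed
    then have "u = v" using eq V.add.right_cancel[of "d \<odot>\<^bsub>vmod n\<^esub> w" u v] cl by simp
    then show "u = v \<and> c = d" using cd by simp
  qed
  then have "card (adjoin n U w) = card (U \<times> carrier F)" unfolding adjoin_def by (rule card_image)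
  then show "card (adjoin n U w) = q * card U" by (simp add: card_cartesian_product mult.commute)
qed

text \<open>\<open>U\<close> has codimension k. Adjoining a vector \<open>w\<close> and splitting
  \<open>S\<close> according to the q^n possible images of \<open>w\<close> lowers the codimension
  by one.\<close>

lemma card_agreeing:
  assumes "subsp n U" "card U * q ^ k = q ^ n" "S \<subseteq> mats n" "\<And>g g' u. g \<in> S \<Longrightarrow> g' \<in> S \<Longrightarrow> u \<in> U \<Longrightarrow> act n g u = act n g' u"
  shows "card S \<le> q ^ (n * k)"
  using assms
proof (induction k arbitrary: U S)
  case 0
  have "U \<subseteq> Vs n" "card U = card (Vs n)" using 0 by (auto simp: subsp_def card_vecs)
  then have "U = Vs n" using card_subset_eq[OF finite_vecs] by blast
  then have "g = g'" if "g \<in> S" "g' \<in> S" for g g' using act_faithful[of g n g'] 0(3,4) that by blast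
  then have "card S \<le> 1" by (intro card_le_Suc0_iff_eq[THEN iffD2, simplified One_nat_def[symmetric]]) (use finite_subset[OF 0(3) finite_mats] in auto)
  then show ?case by simp
next
  case (Suc k)
  have fU: "finite U" using Suc.prems(1) finite_vecs by (auto simp: subsp_def intro: finite_subset)
  have q1: "q ^ Suc k > 1" using q_ge_2 by (intro one_less_power) auto
  have "card U < q ^ n"
  proof -
    have "card U \<noteq> 0" using Suc.prems(2) q_ge_2 by (metis mult_0 not_numeral_le_zero power_not_zero)
    then show ?thesis using q1 Suc.prems(2) by (metis mult.right_neutral mult_less_cancel1 neq0_conv)
  qed
  then have "U \<noteq> Vs n" by (metis card_vecs less_irrefl)
  then obtain w where w: "w \<in> Vs n" "w \<notin> U" using Suc.prems(1) by (auto simp: subsp_def)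
  interpret V: module F "vmod n" by (rule vmod_module)
  define Sy where "Sy y = {g \<in> S. act n g w = y}" for y
  have fS: "finite S" using Suc.prems(3) finite_mats finite_subset by blast
  have "card (Sy y) \<le> q ^ (n * k)" for y
  proof (rule Suc.IH[of "adjoin n U w"])
    show "subsp n (adjoin n U w)" by (rule subsp_adjoin(1)[OF Suc.prems(1) w])
    show "card (adjoin n U w) * q ^ k = q ^ n" using subsp_adjoin(2)[OF Suc.prems(1) w] Suc.prems(2) by (simp add: mult_ac)
    show "Sy y \<subseteq> mats n" using Suc.prems(3) by (auto simp: Sy_def)
    fix g g' x assume g: "g \<in> Sy y" "g' \<in> Sy y" and "x \<in> adjoin n U w"
    then obtain u c where x: "u \<in> U" "c \<in> carrier F" "x = u \<oplus>\<^bsub>vmod n\<^esub> c \<odot>\<^bsub>vmod n\<^esub> w" by (auto simp: adjoin_def)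
    have uV: "u \<in> Vs n" using x Suc.prems(1) by (auto simp: subsp_def)
    have gm: "g \<in> S" "g' \<in> S" "g \<in> mats n" "g' \<in> mats n" "act n g w = act n g' w" using g Suc.prems(3) by (auto simp: Sy_def)
    show "act n g x = act n g' x" unfolding x(3) using gm uV w x(1,2) Suc.prems(4)[OF gm(1,2) x(1)]
      by (simp add: act_add act_smult)
  qed
  moreover have "S = (\<Union>y\<in>Vs n. Sy y)" using act_closed w(1) Suc.prems(3) by (auto simp: Sy_def)
  then have "card S \<le> (\<Sum>y\<in>Vs n. card (Sy y))" using card_UN_le[OF finite_vecs, of Sy] by simp
  ultimately have "card S \<le> (\<Sum>y\<in>Vs n. q ^ (n * k))" by (meson le_trans sum_mono)
  also have "\<dots> = q ^ (n * Suc k)" by (simp add: card_vecs power_add)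
  finally show ?case .
qed

fun Sp :: "nat \<Rightarrow> (nat \<Rightarrow> 'a) list \<Rightarrow> (nat \<Rightarrow> 'a) set" where
  "Sp n [] = {\<zero>\<^bsub>vmod n\<^esub>}" | "Sp n (w # ws) = adjoin n (Sp n ws) w"

fun indep :: "nat \<Rightarrow> (nat \<Rightarrow> 'a) list \<Rightarrow> bool" where
  "indep n [] = True" | "indep n (w # ws) = (indep n ws \<and> w \<in> Vs n \<and> w \<notin> Sp n ws)"

lemma Sp_indep: "indep n ws \<Longrightarrow> subsp n (Sp n ws) \<and> card (Sp n ws) = q ^ length ws"
proof (induction ws)
  case Nil
  interpret V: module F "vmod n" by (rule vmod_module)
  show ?case by (auto simp: subsp_def V.smult_r_null)
next
  case (Cons w ws) then show ?case using subsp_adjoin[of n "Sp n ws" w] by simp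
qed

lemma card_indep: "j \<le> n \<Longrightarrow> card {ws. indep n ws \<and> length ws = j} = (\<Prod>i<j. q ^ n - q ^ i) \<and> finite {ws. indep n ws \<and> length ws = j}"
proof (induction j)
  case 0
  have "{ws. indep n ws \<and> length ws = 0} = {[]}" by auto
  then show ?case by simp
next
  case (Suc j)
  let ?L = "{ws. indep n ws \<and> length ws = j}"
  have eq: "{ws. indep n ws \<and> length ws = Suc j} = (\<lambda>(ws, w). w # ws) ` (SIGMA ws:?L. Vs n - Sp n ws)"
    by (auto simp: length_Suc_conv image_iff)
  have inj: "inj_on (\<lambda>(ws, w). w # ws) (SIGMA ws:?L. Vs n - Sp n ws)" by (auto intro!: inj_onI)
  have c: "card (Vs n - Sp n ws) = q ^ n - q ^ j" if "ws \<in> ?L" for ws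
  proof -
    have "Sp n ws \<subseteq> Vs n" "card (Sp n ws) = q ^ j" using Sp_indep[of n ws] that by (auto simp: subsp_def)
    then show ?thesis using finite_vecs by (simp add: card_Diff_subset finite_subset card_vecs)
  qed
  have f: "finite ?L" "card ?L = (\<Prod>i<j. q ^ n - q ^ i)" using Suc by auto
  have "card (SIGMA ws:?L. Vs n - Sp n ws) = (\<Sum>ws\<in>?L. card (Vs n - Sp n ws))"
    using f finite_vecs by (intro card_SigmaI) auto
  also have "\<dots> = card ?L * (q ^ n - q ^ j)" using c by simp
  finally have "card {ws. indep n ws \<and> length ws = Suc j} = (\<Prod>i<Suc j. q ^ n - q ^ i)"
    unfolding eq card_image[OF inj] using f(2) by simp
  moreover have "finite {ws. indep n ws \<and> length ws = Suc j}" unfolding eq using f finite_vecs by (intro finite_imageI finite_SigmaI) auto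
  ultimately show ?case by simp
qed

text \<open>A basis written into the columns gives a matrix that acts surjectively, hence an
  invertible one.\<close>

lemma card_GL_ge_prod: "(\<Prod>i<n. q ^ n - q ^ i) \<le> card (carrier (GL n F))"
proof -
  let ?L = "{ws. indep n ws \<and> length ws = n}"
  define M where "M ws = mat n n (\<lambda>(i, j). (ws ! j) i)" for ws :: "(nat \<Rightarrow> 'a) list"
  have wsV: "set ws \<subseteq> Vs n" if "indep n ws" for ws using that by (induction ws) auto
  have Mm: "M ws \<in> mats n" if "ws \<in> ?L" for ws
    unfolding mats_iff
  proof (intro conjI allI impI)
    fix i j assume ij: "i < n" "j < n"
    have "ws ! j \<in> Vs n" using wsV[of ws] that ij(2) nth_mem[of j ws] by blast
    then show "M ws $$ (i, j) \<in> carrier F" using vec_closed ij by (simp add: M_def)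
  qed (simp_all add: M_def)
  have col: "act n (M ws) (unitv n j) = ws ! j" if ws: "ws \<in> ?L" and j: "j < n" for ws j
  proof (rule vec_eqI)
    show "act n (M ws) (unitv n j) \<in> Vs n" by (rule act_closed[OF Mm[OF ws] unitv_closed])
    show "ws ! j \<in> Vs n" using wsV[of ws] ws j by auto
    show "act n (M ws) (unitv n j) i = (ws ! j) i" if "i < n" for i
      using act_unitv[OF Mm[OF ws] that j] that j by (simp add: M_def)
  qed
  have "inj_on M ?L"
  proof (rule inj_onI)
    fix ws ws' assume w: "ws \<in> ?L" "ws' \<in> ?L" "M ws = M ws'"
    show "ws = ws'" by (rule nth_equalityI) (use w col[OF w(1)] col[OF w(2)] in auto)
  qed
  moreover have "M ` ?L \<subseteq> carrier (GL n F)"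
  proof (rule image_subsetI)
    fix ws assume ws: "ws \<in> ?L"
    interpret V: module F "vmod n" by (rule vmod_module)
    note m = Mm[OF ws]
    have im: "Sp n vs \<subseteq> act n (M ws) ` Vs n" if "set vs \<subseteq> set ws" for vs
      using that
    proof (induction vs)
      case Nil
      show ?case using act_zero[OF m] by (auto intro!: image_eqI[of _ _ "\<zero>\<^bsub>vmod n\<^esub>"])
    next
      case (Cons v vs)
      then obtain j where j: "j < n" "v = ws ! j" using ws by (auto simp: in_set_conv_nth)
      show ?case
      proof
        fix x assume "x \<in> Sp n (v # vs)"
        then obtain u c where x: "u \<in> Sp n vs" "c \<in> carrier F" "x = u \<oplus>\<^bsub>vmod n\<^esub> c \<odot>\<^bsub>vmod n\<^esub> v" by (auto simp: adjoin_def)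
        then obtain y where y: "y \<in> Vs n" "u = act n (M ws) y" using Cons by auto
        have "x = act n (M ws) (y \<oplus>\<^bsub>vmod n\<^esub> c \<odot>\<^bsub>vmod n\<^esub> unitv n j)"
          unfolding x(3) y(2) j(2) using y(1) x(2) unitv_closed[of n j] col[OF ws j(1)] by (simp add: act_add[OF m] act_smult[OF m])
        then show "x \<in> act n (M ws) ` Vs n" using y(1) x(2) unitv_closed by auto
      qed
    qed
    have "Sp n ws \<subseteq> Vs n" "card (Sp n ws) = card (Vs n)" using Sp_indep[of n ws] ws by (auto simp: subsp_def card_vecs)
    then have "Sp n ws = Vs n" using card_subset_eq[OF finite_vecs] by blast
    then have "act n (M ws) ` Vs n = Vs n" using im[of ws] act_closed[OF m] by auto
    then show "M ws \<in> carrier (GL n F)" by (rule surj_act_GL[OF m])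
  qed
  ultimately have "card ?L \<le> card (carrier (GL n F))" using finite_GL by (intro card_inj_on_le) auto
  then show ?thesis using card_indep[of n n] by simp
qed

lemma card_GL_ge: "real q ^ (n * n) / 4 \<le> real (card (carrier (GL n F)))"
proof -
  \<comment> \<open>The surplus (1/2)^(j+1) carries the induction; the bound 1/4 alone is not
    inherited. For q = 2 and j = 1 equality holds.\<close>
  have key: "(1::real) / 4 + (1/2) ^ (j + 1) \<le> (\<Prod>i\<in>{1..j}. 1 - 1 / real q ^ i)" if "j \<ge> 1" for j
    using that
  proof (induction j rule: dec_induct)
    case base
    show ?case using q_ge_2 by (simp add: field_simps)
  next
    case (step j)
    have "1 / real q ^ Suc j \<le> 1 / 2 ^ Suc j" using q_ge_2 by (intro divide_left_mono power_mono) auto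
    then have "1 - (1/2) ^ Suc j \<le> 1 - 1 / real q ^ Suc j" by (simp add: power_one_over)
    moreover have "(1/2::real) ^ Suc j \<le> 1/2" using power_decreasing[of 1 "Suc j" "1/2::real"] by simp
    ultimately have "((1::real) / 4 + (1/2) ^ (j + 1)) * (1 - (1/2) ^ Suc j) \<le> (\<Prod>i\<in>{1..j}. 1 - 1 / real q ^ i) * (1 - 1 / real q ^ Suc j)"
      using step.IH by (intro mult_mono) (auto intro: order_trans[of 0 "1/4 + (1/2) ^ (j + 1)"])
    moreover have "(1::real) / 4 + (1/2) ^ (Suc j + 1) \<le> (1 / 4 + (1/2) ^ (j + 1)) * (1 - (1/2) ^ Suc j)"
    proof -
      define t where "t = (1/2::real) ^ Suc j"
      have "0 \<le> t" "t \<le> 1/4" using step power_decreasing[of 2 "Suc j" "1/2::real"] by (auto simp: t_def power2_eq_square)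
      then have "t * t \<le> t * (1/4)" by (intro mult_left_mono) auto
      moreover have "(1/4 + t) * (1 - t) = 1/4 + 3/4 * t - t * t" by (simp add: field_simps)
      ultimately have "1/4 + t / 2 \<le> (1/4 + t) * (1 - t)" by linarith
      then show ?thesis by (simp add: t_def)
    qed
    ultimately show ?case by simp
  qed
  have "(\<Prod>i<n. real (q ^ n - q ^ i)) = (\<Prod>i<n. real q ^ n * (1 - 1 / real q ^ (n - i)))"
  proof (rule prod.cong[OF refl])
    fix i assume i: "i \<in> {..<n}"
    then have "q ^ i \<le> q ^ n" using q_ge_2 by (intro power_increasing) auto
    then have "real (q ^ n - q ^ i) = real q ^ n - real q ^ i" by (simp add: of_nat_diff)
    also have "real q ^ i = real q ^ n / real q ^ (n - i)" using i q_ge_2 by (simp add: power_diff)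
    finally show "real (q ^ n - q ^ i) = real q ^ n * (1 - 1 / real q ^ (n - i))" by (simp add: algebra_simps)
  qed
  also have "\<dots> = real q ^ (n * n) * (\<Prod>i<n. 1 - 1 / real q ^ (n - i))" by (simp add: prod.distrib power_mult)
  also have "(\<Prod>i<n. 1 - 1 / real q ^ (n - i)) = (\<Prod>i\<in>{1..n}. 1 - 1 / real q ^ i)"
    by (rule prod.reindex_bij_witness[of _ "\<lambda>i. n - i" "\<lambda>i. n - i"]) auto
  finally have eq: "(\<Prod>i<n. real (q ^ n - q ^ i)) = real q ^ (n * n) * (\<Prod>i\<in>{1..n}. 1 - 1 / real q ^ i)" .
  have "1 / 4 \<le> (\<Prod>i\<in>{1..n}. 1 - 1 / real q ^ i)"
  proof (cases "n = 0")
    case False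
    have "(0::real) \<le> (1/2) ^ (n + 1)" by simp
    then show ?thesis using key[of n] False by linarith
  qed simp
  then have "real q ^ (n * n) * (1 / 4) \<le> (\<Prod>i<n. real (q ^ n - q ^ i))" unfolding eq by (rule mult_left_mono) simp
  also have "\<dots> \<le> real (card (carrier (GL n F)))" using card_GL_ge_prod[of n] by (simp flip: of_nat_prod)
  finally show ?thesis by simp
qed

section \<open>The minimal polynomial of a vector\<close>

text \<open>Horner's scheme for the vector \<open>p(g) e\<^sub>0\<close>.\<close>
definition ev :: "nat \<Rightarrow> 'a mat \<Rightarrow> 'a list \<Rightarrow> nat \<Rightarrow> 'a" where
  "ev n g p = foldl (\<lambda>v a. act n g v \<oplus>\<^bsub>vmod n\<^esub> a \<odot>\<^bsub>vmod n\<^esub> unitv n 0) \<zero>\<^bsub>vmod n\<^esub> p"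

lemma ev_Nil: "ev n g [] = \<zero>\<^bsub>vmod n\<^esub>" by (simp add: ev_def)
lemma ev_snoc: "ev n g (p @ [a]) = act n g (ev n g p) \<oplus>\<^bsub>vmod n\<^esub> a \<odot>\<^bsub>vmod n\<^esub> unitv n 0" by (simp add: ev_def)

context
  fixes n :: nat and g :: "'a mat"
  assumes g: "g \<in> mats n"
begin

interpretation V: module F "vmod n" by (rule vmod_module)

lemma ev_list_closed: "set p \<subseteq> carrier F \<Longrightarrow> ev n g p \<in> Vs n"
  by (induction p rule: rev_induct) (auto simp: ev_Nil ev_snoc act_closed[OF g] unitv_closed)

lemma ev_closed: "p \<in> carrier P \<Longrightarrow> ev n g p \<in> Vs n"
  using ev_list_closed poly_carrier_iff by blast

lemma pow_act_closed: "(act n g ^^ i) (unitv n 0) \<in> Vs n"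
  by (induction i) (auto simp: unitv_closed act_closed[OF g])

text \<open>Horner's recursion appends the constant term. Peeling off the leading term instead
  exposes the iterates of e_0 under \<open>g\<close>.\<close>

lemma ev_Cons: "set p \<subseteq> carrier F \<Longrightarrow> a \<in> carrier F \<Longrightarrow>
    ev n g (a # p) = a \<odot>\<^bsub>vmod n\<^esub> (act n g ^^ length p) (unitv n 0) \<oplus>\<^bsub>vmod n\<^esub> ev n g p"
proof (induction p rule: rev_induct)
  case Nil
  then show ?case using ev_snoc[of n g "[]" a] unitv_closed[of n 0] by (simp add: ev_Nil act_zero[OF g])
next
  case (snoc b p)
  have "ev n g (a # p @ [b]) = act n g (ev n g (a # p)) \<oplus>\<^bsub>vmod n\<^esub> b \<odot>\<^bsub>vmod n\<^esub> unitv n 0"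
    using ev_snoc[of n g "a # p" b] by simp
  also have "ev n g (a # p) = a \<odot>\<^bsub>vmod n\<^esub> (act n g ^^ length p) (unitv n 0) \<oplus>\<^bsub>vmod n\<^esub> ev n g p" using snoc by simp
  finally show ?case
    using snoc.prems pow_act_closed[of "length p"] ev_list_closed[of p] unitv_closed[of n 0]
    by (simp add: ev_snoc act_add[OF g] act_smult[OF g] act_closed[OF g] V.a_assoc)
qed

lemma ev_step: assumes p: "p \<in> carrier P" and c: "c \<in> carrier F"
  shows "ev n g (p \<otimes>\<^bsub>P\<^esub> X \<oplus>\<^bsub>P\<^esub> cst c) = act n g (ev n g p) \<oplus>\<^bsub>vmod n\<^esub> c \<odot>\<^bsub>vmod n\<^esub> unitv n 0"
proof (cases "p = []")
  case True
  have "ev n g (cst c) = c \<odot>\<^bsub>vmod n\<^esub> unitv n 0"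
    using ev_snoc[of n g "[]" c] c unitv_closed[of n 0] by (simp add: ev_Nil act_zero[OF g] V.smult_l_null)
  then show ?thesis using times_X_add_const[OF p c] True c unitv_closed[of n 0] by (simp add: ev_Nil act_zero[OF g])
next
  case False
  then show ?thesis using times_X_add_const[OF p c] by (simp add: ev_snoc)
qed

lemma ev_times_X: assumes p: "p \<in> carrier P" shows "ev n g (p \<otimes>\<^bsub>P\<^esub> X) = act n g (ev n g p)"
  using ev_step[OF p zero_closed] UP.r_zero[OF UP.m_closed[OF p X_closed]] ev_closed[OF p] unitv_closed[of n 0]
  by (simp add: V.smult_l_null act_closed[OF g])

lemma ev_cst: assumes c: "c \<in> carrier F" shows "ev n g (cst c) = c \<odot>\<^bsub>vmod n\<^esub> unitv n 0"
  using ev_snoc[of n g "[]" c] c unitv_closed[of n 0] by (simp add: ev_Nil act_zero[OF g] V.smult_l_null)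

lemma ev_add: assumes "p \<in> carrier P" "r \<in> carrier P" shows "ev n g (p \<oplus>\<^bsub>P\<^esub> r) = ev n g p \<oplus>\<^bsub>vmod n\<^esub> ev n g r"
  using assms
proof (induction p arbitrary: r rule: poly_induct)
  case zero
  then show ?case using UP.l_zero[OF zero] ev_closed[OF zero] by (simp add: ev_Nil)
next
  case (step p c)
  note p = step.hyps(1) and c = step.hyps(2) and IH = step.IH
  show ?case using step.prems
  proof (induction r rule: poly_induct)
    case zero
    have cl: "p \<otimes>\<^bsub>P\<^esub> X \<oplus>\<^bsub>P\<^esub> cst c \<in> carrier P" using p cst_closed[OF c] by (intro UP.a_closed UP.m_closed X_closed)
    show ?case using UP.r_zero[OF cl] ev_closed[OF cl] by (simp add: ev_Nil)
  next
    case (step r d)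
    note r = step.hyps(1) and d = step.hyps(2)
    note cl = p r cst_closed[OF c] cst_closed[OF d] X_closed UP.m_closed UP.a_closed
    have "(p \<otimes>\<^bsub>P\<^esub> X \<oplus>\<^bsub>P\<^esub> cst c) \<oplus>\<^bsub>P\<^esub> (r \<otimes>\<^bsub>P\<^esub> X \<oplus>\<^bsub>P\<^esub> cst d) = (p \<otimes>\<^bsub>P\<^esub> X \<oplus>\<^bsub>P\<^esub> r \<otimes>\<^bsub>P\<^esub> X) \<oplus>\<^bsub>P\<^esub> (cst c \<oplus>\<^bsub>P\<^esub> cst d)"
      by (rule UP.add.m_lcomm[THEN trans]; use cl in \<open>simp only: UP.a_ac\<close>)
    also have "\<dots> = (p \<oplus>\<^bsub>P\<^esub> r) \<otimes>\<^bsub>P\<^esub> X \<oplus>\<^bsub>P\<^esub> cst (c \<oplus> d)"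
      using UP.l_distr[OF p r X_closed] cst_add[OF c d] by simp
    finally have e: "(p \<otimes>\<^bsub>P\<^esub> X \<oplus>\<^bsub>P\<^esub> cst c) \<oplus>\<^bsub>P\<^esub> (r \<otimes>\<^bsub>P\<^esub> X \<oplus>\<^bsub>P\<^esub> cst d) = (p \<oplus>\<^bsub>P\<^esub> r) \<otimes>\<^bsub>P\<^esub> X \<oplus>\<^bsub>P\<^esub> cst (c \<oplus> d)" .
    note vcl = ev_closed[OF p] ev_closed[OF r] unitv_closed[of n 0] c d act_closed[OF g]
    show ?case unfolding e ev_step[OF UP.a_closed[OF p r] a_closed[OF c d]] ev_step[OF p c] ev_step[OF r d] IH[OF r]
      using vcl by (simp add: act_add[OF g] V.smult_l_distr V.a_ac)
  qed
qed

lemma ev_cst_mult: assumes "p \<in> carrier P" and c: "c \<in> carrier F" shows "ev n g (cst c \<otimes>\<^bsub>P\<^esub> p) = c \<odot>\<^bsub>vmod n\<^esub> ev n g p"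
  using assms(1)
proof (induction p rule: poly_induct)
  case zero
  have "cst c \<otimes>\<^bsub>P\<^esub> [] = []" using UP.r_null[OF cst_closed[OF c]] by simp
  then show ?case using c by (simp add: ev_Nil V.smult_r_null)
next
  case (step p d)
  note p = step.hyps(1) and d = step.hyps(2)
  have "cst c \<otimes>\<^bsub>P\<^esub> (p \<otimes>\<^bsub>P\<^esub> X \<oplus>\<^bsub>P\<^esub> cst d) = cst c \<otimes>\<^bsub>P\<^esub> (p \<otimes>\<^bsub>P\<^esub> X) \<oplus>\<^bsub>P\<^esub> cst c \<otimes>\<^bsub>P\<^esub> cst d"
    by (rule UP.r_distr[OF UP.m_closed[OF p X_closed] cst_closed[OF d] cst_closed[OF c]])
  also have "\<dots> = (cst c \<otimes>\<^bsub>P\<^esub> p) \<otimes>\<^bsub>P\<^esub> X \<oplus>\<^bsub>P\<^esub> cst (c \<otimes> d)"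
    unfolding cst_mult[OF c d] UP.m_assoc[OF cst_closed[OF c] p X_closed] ..
  finally have e: "cst c \<otimes>\<^bsub>P\<^esub> (p \<otimes>\<^bsub>P\<^esub> X \<oplus>\<^bsub>P\<^esub> cst d) = (cst c \<otimes>\<^bsub>P\<^esub> p) \<otimes>\<^bsub>P\<^esub> X \<oplus>\<^bsub>P\<^esub> cst (c \<otimes> d)" .
  note vcl = ev_closed[OF p] unitv_closed[of n 0] c d act_closed[OF g]
  show ?case unfolding e ev_step[OF UP.m_closed[OF cst_closed[OF c] p] m_closed[OF c d]] ev_step[OF p d] step.IH
    using vcl by (simp add: act_smult[OF g] V.smult_r_distr V.smult_assoc1)
qed

text \<open>Makes the annihilator of e_0 an ideal. By Horner induction on the cofactor only
  multiplication by X and by constants has to be checked.\<close>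

lemma ev_mult_zero: assumes "r \<in> carrier P" and p: "p \<in> carrier P" "ev n g p = \<zero>\<^bsub>vmod n\<^esub>" shows "ev n g (r \<otimes>\<^bsub>P\<^esub> p) = \<zero>\<^bsub>vmod n\<^esub>"
  using assms(1)
proof (induction r rule: poly_induct)
  case zero
  then show ?case using UP.l_null[OF p(1)] by (simp add: ev_Nil)
next
  case (step r c)
  note r = step.hyps(1) and c = step.hyps(2)
  have "(r \<otimes>\<^bsub>P\<^esub> X \<oplus>\<^bsub>P\<^esub> cst c) \<otimes>\<^bsub>P\<^esub> p = (r \<otimes>\<^bsub>P\<^esub> X) \<otimes>\<^bsub>P\<^esub> p \<oplus>\<^bsub>P\<^esub> cst c \<otimes>\<^bsub>P\<^esub> p"
    by (rule UP.l_distr[OF UP.m_closed[OF r X_closed] cst_closed[OF c] p(1)])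
  also have "(r \<otimes>\<^bsub>P\<^esub> X) \<otimes>\<^bsub>P\<^esub> p = (r \<otimes>\<^bsub>P\<^esub> p) \<otimes>\<^bsub>P\<^esub> X"
    using UP.m_assoc[OF r X_closed p(1)] UP.m_assoc[OF r p(1) X_closed] UP.m_comm[OF X_closed p(1)] by simp
  finally have e: "(r \<otimes>\<^bsub>P\<^esub> X \<oplus>\<^bsub>P\<^esub> cst c) \<otimes>\<^bsub>P\<^esub> p = (r \<otimes>\<^bsub>P\<^esub> p) \<otimes>\<^bsub>P\<^esub> X \<oplus>\<^bsub>P\<^esub> cst c \<otimes>\<^bsub>P\<^esub> p" .
  note rp = UP.m_closed[OF r p(1)]
  show ?case unfolding e ev_add[OF UP.m_closed[OF rp X_closed] UP.m_closed[OF cst_closed[OF c] p(1)]]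
      ev_times_X[OF rp] ev_cst_mult[OF p(1) c] step.IH p(2)
    using c by (simp add: act_zero[OF g] V.smult_r_null)
qed

lemma ev_diff_zero: assumes p: "p \<in> carrier P" "r \<in> carrier P" "ev n g p = ev n g r" shows "ev n g (p \<ominus>\<^bsub>P\<^esub> r) = \<zero>\<^bsub>vmod n\<^esub>"
proof -
  have d: "p \<ominus>\<^bsub>P\<^esub> r \<in> carrier P" by (rule UP.minus_closed[OF p(1,2)])
  have "(p \<ominus>\<^bsub>P\<^esub> r) \<oplus>\<^bsub>P\<^esub> r = p"
    unfolding a_minus_def using UP.a_assoc[OF p(1) UP.a_inv_closed[OF p(2)] p(2)] UP.l_neg[OF p(2)] UP.r_zero[OF p(1)] by simp
  then have "ev n g (p \<ominus>\<^bsub>P\<^esub> r) \<oplus>\<^bsub>vmod n\<^esub> ev n g r = \<zero>\<^bsub>vmod n\<^esub> \<oplus>\<^bsub>vmod n\<^esub> ev n g r"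
    using ev_add[OF d p(2)] p(3) ev_closed[OF p(2)] by simp
  then show ?thesis by (rule V.add.r_cancel) (use ev_closed[OF d] ev_closed[OF p(2)] in simp_all)
qed

lemma ev_Xpow: "ev n g (X [^]\<^bsub>P\<^esub> (N::nat)) = (act n g ^^ N) (unitv n 0)"
proof (induction N)
  case 0
  have "ev n g [\<one>] = unitv n 0" using ev_cst[OF one_closed] unitv_closed[of n 0] by simp
  then show ?case by (simp add: P_one)
next
  case (Suc N)
  then show ?case using ev_times_X[OF Xpow_closed[of N]] by simp
qed

lemma diff_length_le: assumes p: "p \<in> carrier P" "r \<in> carrier P" "length p \<le> d" "length r \<le> d" shows "length (p \<ominus>\<^bsub>P\<^esub> r) \<le> d"
proof -
  have "length (\<ominus>\<^bsub>P\<^esub> r) = length r" by (rule univ_poly_a_inv_length[OF carrier_is_subring p(2)])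
  then show ?thesis unfolding a_minus_def univ_poly_add using poly_add_length_le[of p "\<ominus>\<^bsub>P\<^esub> r"] p(3,4) by linarith
qed

lemma division: assumes p: "p \<in> carrier P" and f: "f \<in> Mon d"
  obtains s r where "s \<in> carrier P" "r \<in> carrier P" "p = f \<otimes>\<^bsub>P\<^esub> s \<oplus>\<^bsub>P\<^esub> r" "length r \<le> d"
proof -
  obtain s r where sr: "s \<in> carrier P" "r \<in> carrier P" "p = f \<otimes>\<^bsub>P\<^esub> s \<oplus>\<^bsub>P\<^esub> r" "r = [] \<or> length r - 1 < length f - 1"
    using field_long_division_theorem_shell[OF carrier_is_subfield p MonD(1)[OF f]] MonD(3)[OF f] by auto
  then have "length r \<le> d" using MonD(2)[OF f] by auto
  then show ?thesis using sr that by blast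
qed

text \<open>By the pigeonhole principle some nonzero polynomial of degree at most \<open>n\<close> annihilates \<open>e\<^sub>0\<close>;
  one of least degree generates all of them.\<close>
lemma min_poly_ex: assumes n: "n \<ge> 1"
  shows "\<exists>d f. 1 \<le> d \<and> d \<le> n \<and> f \<in> Mon d \<and> (\<forall>p\<in>carrier P. ev n g p = \<zero>\<^bsub>vmod n\<^esub> \<longleftrightarrow> f divides\<^bsub>P\<^esub> p)"
proof -
  let ?K = "\<lambda>p. p \<in> carrier P \<and> p \<noteq> [] \<and> ev n g p = \<zero>\<^bsub>vmod n\<^esub>"
  let ?L = "{r \<in> carrier P. length r \<le> Suc n}"
  have "\<not> inj_on (ev n g) ?L"
  proof
    assume "inj_on (ev n g) ?L"
    then have "card ?L \<le> card (Vs n)" using ev_closed finite_vecs by (intro card_inj_on_le) auto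
    then have "q ^ Suc n \<le> q ^ n" unfolding card_lower card_vecs .
    then show False using q_ge_2 power_strict_increasing[of n "Suc n" q] by simp
  qed
  then obtain p r where pr: "p \<in> ?L" "r \<in> ?L" "p \<noteq> r" "ev n g p = ev n g r" unfolding inj_on_def by blast
  have "?K (p \<ominus>\<^bsub>P\<^esub> r)" "length (p \<ominus>\<^bsub>P\<^esub> r) \<le> Suc n"
    using pr ev_diff_zero[of p r] diff_length_le[of p r "Suc n"] UP.minus_closed[of p r] UP.r_right_minus_eq[of p r] by auto
  note K0 = this
  define h where "h = arg_min length ?K"
  have h: "?K h" "length h \<le> Suc n" "\<And>p. ?K p \<Longrightarrow> length h \<le> length p"
    using arg_min_natI[of ?K, OF K0(1), of length] order_trans[OF arg_min_nat_le[of ?K, OF K0(1), of length] K0(2)]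
      arg_min_nat_le[of ?K _ length] unfolding h_def by blast+
  obtain c f where c: "c \<in> Fx" "f \<in> Mon (length h - 1)" "h = [c] \<otimes>\<^bsub>P\<^esub> f" using monic_assoc[of h] h(1) by metis
  define d where "d = length h - 1"
  have f: "f \<in> Mon d" "f \<in> carrier P" using c(2) MonD(1) by (auto simp: d_def)
  have "[inv c] \<otimes>\<^bsub>P\<^esub> h = ([inv c] \<otimes>\<^bsub>P\<^esub> [c]) \<otimes>\<^bsub>P\<^esub> f" unfolding c(3)
    using UP.m_assoc[OF const_closed const_closed f(2)] c(1) Fx_inv[OF c(1)] by simp
  also have "\<dots> = f" using const_mult[of "inv c" c] Fx_inv[OF c(1)] c(1) UP.l_one[OF f(2)] by (simp add: P_one)
  finally have "ev n g f = \<zero>\<^bsub>vmod n\<^esub>" using ev_mult_zero[of "[inv c]" h] h(1) Fx_inv[OF c(1)] const_closed[of "inv c"] by simp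
  then have dv0: "ev n g p = \<zero>\<^bsub>vmod n\<^esub>" if "p \<in> carrier P" "f divides\<^bsub>P\<^esub> p" for p
    using that ev_mult_zero[OF _ f(2)] UP.m_comm[OF f(2)] unfolding factor_def by metis
  have dv: "f divides\<^bsub>P\<^esub> p" if p: "p \<in> carrier P" "ev n g p = \<zero>\<^bsub>vmod n\<^esub>" for p
  proof -
    obtain s r where sr: "s \<in> carrier P" "r \<in> carrier P" "p = f \<otimes>\<^bsub>P\<^esub> s \<oplus>\<^bsub>P\<^esub> r" "length r \<le> d" using division[OF p(1) f(1)] .
    have fs: "f \<otimes>\<^bsub>P\<^esub> s \<in> carrier P" by (rule UP.m_closed[OF f(2) sr(1)])
    have "ev n g (f \<otimes>\<^bsub>P\<^esub> s) = \<zero>\<^bsub>vmod n\<^esub>" using dv0[OF fs] sr(1) unfolding factor_def by blast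
    then have "ev n g r = \<zero>\<^bsub>vmod n\<^esub>" using ev_add[OF fs sr(2)] p(2) ev_closed[OF sr(2)] unfolding sr(3) by simp
    then have "r = []" using h(3)[of r] sr(2,4) h(1) by (cases h) (auto simp: d_def)
    then have "p = f \<otimes>\<^bsub>P\<^esub> s" using sr(3) UP.r_zero[OF fs] by simp
    then show ?thesis using sr(1) unfolding factor_def by blast
  qed
  have "d \<noteq> 0"
  proof
    assume "d = 0"
    then have "f = [\<one>]" using f(1) Mon_0 P_one by auto
    then have "\<one> \<odot>\<^bsub>vmod n\<^esub> unitv n 0 = \<zero>\<^bsub>vmod n\<^esub>" using \<open>ev n g f = _\<close> ev_cst[OF one_closed] by simp
    then have "unitv n 0 0 = \<zero>\<^bsub>vmod n\<^esub> 0" using unitv_closed[of n 0] by simp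
    then show False using n by (simp add: unitv_def vmod_simps)
  qed
  then show ?thesis using dv dv0 f(1) h(2) d_def by (intro exI[of _ d] exI[of _ f]) auto
qed

end

text \<open>The matrices whose minimal polynomial at e_0 is \<open>f\<close>. For different monic
  \<open>f\<close> these sets are disjoint, as two minimal polynomials of one matrix would divide
  each other.\<close>

definition Sf :: "nat \<Rightarrow> 'a list \<Rightarrow> 'a mat set" where
  "Sf n f = {g \<in> mats n. \<forall>p\<in>carrier P. ev n g p = \<zero>\<^bsub>vmod n\<^esub> \<longleftrightarrow> f divides\<^bsub>P\<^esub> p}"

lemma ev_agree: assumes g: "g \<in> mats n" "g' \<in> mats n"
  shows "set p \<subseteq> carrier F \<Longrightarrow> (\<And>i. i < length p \<Longrightarrow> (act n g ^^ i) (unitv n 0) = (act n g' ^^ i) (unitv n 0)) \<Longrightarrow> ev n g p = ev n g' p"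
proof (induction p)
  case (Cons a p)
  then show ?case using ev_Cons[OF g(1), of p a] ev_Cons[OF g(2), of p a] by simp
qed (simp add: ev_Nil)

text \<open>The difference of two such polynomials is shorter than \<open>f\<close>, so it
  annihilates e_0 only if it is zero.\<close>

lemma ev_inj: assumes f: "f \<in> Mon d" and g: "g \<in> Sf n f" shows "inj_on (ev n g) {r \<in> carrier P. length r \<le> d}"
proof (rule inj_onI)
  have gm: "g \<in> mats n" and fP: "f \<in> carrier P" using g MonD(1)[OF f] by (auto simp: Sf_def)
  fix p r assume pr: "p \<in> {r \<in> carrier P. length r \<le> d}" "r \<in> {r \<in> carrier P. length r \<le> d}" "ev n g p = ev n g r"
  have d: "p \<ominus>\<^bsub>P\<^esub> r \<in> carrier P" "length (p \<ominus>\<^bsub>P\<^esub> r) \<le> d" using pr UP.minus_closed[of p r] diff_length_le[OF gm, of p r d] by auto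
  have "f divides\<^bsub>P\<^esub> (p \<ominus>\<^bsub>P\<^esub> r)" using g d(1) ev_diff_zero[OF gm _ _ pr(3)] pr by (simp add: Sf_def)
  then have "p \<ominus>\<^bsub>P\<^esub> r = []" using divides_deg[OF _ fP d(1)] d(2) MonD(2)[OF f] by force
  then show "p = r" using UP.r_right_minus_eq[of p r] pr by simp
qed

text \<open>Division by \<open>f\<close> shows that the first d iterates of e_0 determine the action
  on the whole cyclic subspace \<open>U\<close> generated by e_0. As \<open>U\<close> has q^d
  elements, \<open>card_agreeing\<close> counts the extensions.\<close>

lemma card_Sf_fibre:
  assumes f: "f \<in> Mon d" "d \<le> n" and S: "S \<subseteq> Sf n f"
    and agree: "\<And>g g' i. g \<in> S \<Longrightarrow> g' \<in> S \<Longrightarrow> i < d \<Longrightarrow> (act n g ^^ i) (unitv n 0) = (act n g' ^^ i) (unitv n 0)"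
  shows "card S \<le> q ^ (n * (n - d))"
proof (cases "S = {}")
  case False
  then obtain g where g: "g \<in> S" by blast
  interpret V: module F "vmod n" by (rule vmod_module)
  have m: "h \<in> mats n" "\<And>p. p \<in> carrier P \<Longrightarrow> ev n h p = \<zero>\<^bsub>vmod n\<^esub> \<longleftrightarrow> f divides\<^bsub>P\<^esub> p" if "h \<in> S" for h using S that by (auto simp: Sf_def)
  note gm = m(1)[OF g] and fP = MonD(1)[OF f(1)]
  have red: "\<exists>r\<in>carrier P. length r \<le> d \<and> (\<forall>h\<in>S. ev n h p = ev n h r)" if p: "p \<in> carrier P" for p
  proof -
    obtain s r where sr: "s \<in> carrier P" "r \<in> carrier P" "p = f \<otimes>\<^bsub>P\<^esub> s \<oplus>\<^bsub>P\<^esub> r" "length r \<le> d" using division[OF gm p f(1)] .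
    have fs: "f \<otimes>\<^bsub>P\<^esub> s \<in> carrier P" by (rule UP.m_closed[OF fP sr(1)])
    have "ev n h p = ev n h r" if h: "h \<in> S" for h
    proof -
      have "ev n h (f \<otimes>\<^bsub>P\<^esub> s) = \<zero>\<^bsub>vmod n\<^esub>" using m(2)[OF h fs] sr(1) unfolding factor_def by blast
      then show ?thesis using ev_add[OF m(1)[OF h] fs sr(2)] ev_closed[OF m(1)[OF h] sr(2)] unfolding sr(3) by simp
    qed
    then show ?thesis using sr by blast
  qed
  have agree': "ev n h p = ev n h' p" if h: "h \<in> S" "h' \<in> S" and p: "p \<in> carrier P" for h h' p
  proof -
    obtain r where r: "r \<in> carrier P" "length r \<le> d" "\<forall>h\<in>S. ev n h p = ev n h r" using red[OF p] by blast
    have "ev n h r = ev n h' r" using r(1,2) agree[OF h] poly_carrier_iff by (intro ev_agree[OF m(1)[OF h(1)] m(1)[OF h(2)]]) auto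
    then show ?thesis using r(3) h by simp
  qed
  define U where "U = ev n g ` carrier P"
  have "subsp n U" unfolding subsp_def U_def
  proof (intro conjI ballI)
    show "ev n g ` carrier P \<subseteq> Vs n" using ev_closed[OF gm] by blast
    show "\<zero>\<^bsub>vmod n\<^esub> \<in> ev n g ` carrier P" using UP.zero_closed ev_Nil[of n g] by (metis P_zero image_eqI)
    show "u \<oplus>\<^bsub>vmod n\<^esub> v \<in> ev n g ` carrier P" if "u \<in> ev n g ` carrier P" "v \<in> ev n g ` carrier P" for u v
    proof -
      from that obtain p r where "p \<in> carrier P" "u = ev n g p" "r \<in> carrier P" "v = ev n g r" by (elim imageE)
      then show ?thesis by (intro image_eqI[of _ "ev n g" "p \<oplus>\<^bsub>P\<^esub> r"]) (simp_all add: ev_add[OF gm])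
    qed
    show "c \<odot>\<^bsub>vmod n\<^esub> u \<in> ev n g ` carrier P" if "c \<in> carrier F" "u \<in> ev n g ` carrier P" for c u
    proof -
      from that(2) obtain p where "p \<in> carrier P" "u = ev n g p" by (elim imageE)
      then show ?thesis
        by (intro image_eqI[of _ "ev n g" "cst c \<otimes>\<^bsub>P\<^esub> p"])
          (simp_all only: ev_cst_mult[OF gm _ that(1)] UP.m_closed[OF cst_closed[OF that(1)]])
    qed
  qed
  moreover have "card U * q ^ (n - d) = q ^ n"
  proof -
    have "U = ev n g ` {r \<in> carrier P. length r \<le> d}" unfolding U_def
    proof (intro equalityI subsetI)
      fix u assume "u \<in> ev n g ` carrier P"
      then obtain p where p: "p \<in> carrier P" "u = ev n g p" by (elim imageE)
      obtain r where "r \<in> carrier P" "length r \<le> d" "\<forall>h\<in>S. ev n h p = ev n h r" using red[OF p(1)] by blast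
      then show "u \<in> ev n g ` {r \<in> carrier P. length r \<le> d}" using p(2) g by (intro image_eqI[of _ "ev n g" r]) auto
    qed auto
    moreover have "inj_on (ev n g) {r \<in> carrier P. length r \<le> d}" by (rule ev_inj[OF f(1) subsetD[OF S g]])
    ultimately have "card U = q ^ d" using card_image card_lower by metis
    then show ?thesis using f(2) by (simp flip: power_add)
  qed
  ultimately show ?thesis
  proof (rule card_agreeing)
    show "S \<subseteq> mats n" using m(1) by blast
    fix h h' u assume h: "h \<in> S" "h' \<in> S" and "u \<in> U"
    then obtain p where p: "p \<in> carrier P" "u = ev n g p" by (auto simp: U_def)
    have "act n h u = ev n h (p \<otimes>\<^bsub>P\<^esub> X)" using agree'[OF g h(1) p(1)] ev_times_X[OF m(1)[OF h(1)] p(1)] p(2) by simp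
    also have "\<dots> = ev n h' (p \<otimes>\<^bsub>P\<^esub> X)" by (rule agree'[OF h UP.m_closed[OF p(1) X_closed]])
    also have "\<dots> = act n h' u" using agree'[OF g h(2) p(1)] ev_times_X[OF m(1)[OF h(2)] p(1)] p(2) by simp
    finally show "act n h u = act n h' u" .
  qed
qed simp

text \<open>The iterates number 1 to d - 1 of e_0 leave q^(n(d-1)) possibilities, and each fibre has
  at most q^(n(n-d)) elements. The product does not depend on d.\<close>

lemma card_Sf: assumes f: "f \<in> Mon d" "1 \<le> d" "d \<le> n" shows "card (Sf n f) \<le> q ^ (n * (n - 1))"
proof -
  let ?E = "{1..<d} \<rightarrow>\<^sub>E Vs n"
  define h where "h g = (\<lambda>i\<in>{1..<d}. (act n g ^^ i) (unitv n 0))" for g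
  define S where "S y = {g \<in> Sf n f. h g = y}" for y
  have fE: "finite ?E" using finite_vecs by (intro finite_PiE) auto
  have "Sf n f = (\<Union>y\<in>?E. S y)"
    using pow_act_closed[of _ n] by (auto simp: S_def h_def Sf_def)
  then have "card (Sf n f) \<le> (\<Sum>y\<in>?E. card (S y))" using card_UN_le[OF fE, of S] by simp
  also have "\<dots> \<le> (\<Sum>y\<in>?E. q ^ (n * (n - d)))"
  proof (rule sum_mono)
    fix y
    show "card (S y) \<le> q ^ (n * (n - d))"
    proof (rule card_Sf_fibre[OF f(1,3)])
      show "S y \<subseteq> Sf n f" by (auto simp: S_def)
      fix g g' i assume gg: "g \<in> S y" "g' \<in> S y" and i: "i < d"
      have eq: "h g = h g'" using gg by (simp add: S_def)
      show "(act n g ^^ i) (unitv n 0) = (act n g' ^^ i) (unitv n 0)"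
      proof (cases "i = 0")
        case False
        then show ?thesis using fun_cong[OF eq, of i] i by (simp add: h_def)
      qed simp
    qed
  qed
  also have "\<dots> = q ^ (n * (d - 1)) * q ^ (n * (n - d))"
    by (simp add: card_PiE card_vecs power_mult)
  also have "\<dots> = q ^ (n * (n - 1))"
  proof -
    have "n * (d - 1) + n * (n - d) = n * (n - 1)" using f by (simp flip: distrib_left)
    then show ?thesis by (simp flip: power_add)
  qed
  finally show ?thesis .
qed

section \<open>Scalar matrices and the sum over the general linear group\<close>

definition smat :: "nat \<Rightarrow> 'a \<Rightarrow> 'a mat" where "smat n c = mat n n (\<lambda>(i, j). if i = j then c else \<zero>)"

lemma smat_mats: "c \<in> carrier F \<Longrightarrow> smat n c \<in> mats n" by (simp add: smat_def mats_iff)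

lemma act_smat: assumes c: "c \<in> carrier F" and v: "v \<in> Vs n" shows "act n (smat n c) v = c \<odot>\<^bsub>vmod n\<^esub> v"
proof (rule vec_eqI)
  interpret V: module F "vmod n" by (rule vmod_module)
  show "c \<odot>\<^bsub>vmod n\<^esub> v \<in> Vs n" using c v by simp
  fix i assume i: "i < n"
  have "(\<Oplus>k\<in>{..<n}. smat n c $$ (i, k) \<otimes> v k) = (\<Oplus>k\<in>{..<n}. if k = i then c \<otimes> v i else \<zero>)"
    using i c by (intro finsum_cong') (auto simp: smat_def vec_closed[OF v])
  then show "act n (smat n c) v i = (c \<odot>\<^bsub>vmod n\<^esub> v) i"
    using i c finsum_single[of "{..<n}" i "c \<otimes> v i"] by (simp add: act_def vmod_simps vec_closed[OF v])
qed (rule act_closed[OF smat_mats[OF c] v])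

lemma act_pow: assumes g: "g \<in> carrier (GL n F)" and v: "v \<in> Vs n"
  shows "act n (g [^]\<^bsub>GL n F\<^esub> (N::nat)) v = (act n g ^^ N) v"
proof -
  interpret G: group "GL n F" by (rule GL_group)
  show ?thesis using v
  proof (induction N arbitrary: v)
    case 0 then show ?case by (simp add: GL_simps act_one)
  next
    case (Suc N)
    have "act n (g [^]\<^bsub>GL n F\<^esub> Suc N) v = act n (g [^]\<^bsub>GL n F\<^esub> N) (act n g v)"
      using act_mult[OF GL_mats[OF G.nat_pow_closed[OF g]] GL_mats[OF g] Suc.prems] by (simp add: GL_simps(3))
    then show ?case using Suc.IH[OF act_closed[OF GL_mats[OF g] Suc.prems]] by (simp add: funpow_swap1)
  qed
qed

lemma scalar_pow_R:
  assumes g: "g \<in> carrier (GL n F)" and f: "g \<in> Sf n f" and c: "c \<in> Fx" "g [^]\<^bsub>GL n F\<^esub> (N::nat) = smat n c"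
  shows "R N c f"
proof -
  interpret V: module F "vmod n" by (rule vmod_module)
  note gm = GL_mats[OF g]
  have cc: "c \<in> carrier F" using c by simp
  have XN: "XN N c \<in> carrier P" by (rule XN_closed[OF c(1)])
  have "XN N c \<oplus>\<^bsub>P\<^esub> [c] = X [^]\<^bsub>P\<^esub> N" unfolding XN_def a_minus_def
    using UP.a_assoc[OF Xpow_closed UP.a_inv_closed[OF const_closed[OF c(1)]] const_closed[OF c(1)]]
      UP.l_neg[OF const_closed[OF c(1)]] UP.r_zero[OF Xpow_closed] by simp
  then have "ev n g (XN N c) \<oplus>\<^bsub>vmod n\<^esub> ev n g [c] = (act n g ^^ N) (unitv n 0)"
    using ev_add[OF gm XN const_closed[OF c(1)]] ev_Xpow[OF gm] by simp
  also have "\<dots> = c \<odot>\<^bsub>vmod n\<^esub> unitv n 0" using act_pow[OF g unitv_closed[of n 0], of N] act_smat[OF cc unitv_closed] c(2) by simp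
  also have "\<dots> = \<zero>\<^bsub>vmod n\<^esub> \<oplus>\<^bsub>vmod n\<^esub> ev n g [c]" using ev_cst[OF gm cc] c(1) unitv_closed[of n 0] by simp
  finally have "ev n g (XN N c) = \<zero>\<^bsub>vmod n\<^esub>"
    by (rule V.add.r_cancel) (use ev_closed[OF gm XN] ev_closed[OF gm const_closed[OF c(1)]] in simp_all)
  then show ?thesis using f XN by (simp add: Sf_def R_def)
qed

text \<open>Intended for \<rho> g the reciprocal of the order of \<open>g\<close> modulo scalars.
  Group the matrices by their minimal polynomial \<open>f\<close> at e_0: on at most q^(n(n-1))
  matrices the value is at most \<open>wt {f}\<close>, and \<open>sum_wt_le_Eb\<close> sums over
  \<open>f\<close>.\<close>

lemma sum_GL_le:
  assumes n: "n \<ge> 1" and \<rho>: "\<And>g. g \<in> carrier (GL n F) \<Longrightarrow> \<exists>N c. N \<ge> (1::nat) \<and> c \<in> Fx \<and> g [^]\<^bsub>GL n F\<^esub> N = smat n c \<and> \<rho> g = 1 / real N"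
  shows "(\<Sum>g\<in>carrier (GL n F). \<rho> g) \<le> real q ^ (n * n) * sys.Eb n"
proof -
  let ?M = "\<Union>d\<in>{1..n}. Mon d"
  have fM: "finite ?M" using finite_Mon by blast
  define G where "G f = {g \<in> carrier (GL n F). g \<in> Sf n f}" for f
  have cov: "carrier (GL n F) = (\<Union>f\<in>?M. G f)"
  proof (intro equalityI subsetI)
    fix g assume g: "g \<in> carrier (GL n F)"
    obtain d f where "1 \<le> d" "d \<le> n" "f \<in> Mon d" "\<forall>p\<in>carrier P. ev n g p = \<zero>\<^bsub>vmod n\<^esub> \<longleftrightarrow> f divides\<^bsub>P\<^esub> p"
      using min_poly_ex[OF GL_mats[OF g] n] by blast
    then show "g \<in> (\<Union>f\<in>?M. G f)" using g GL_mats[OF g] by (auto simp: G_def Sf_def)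
  qed (auto simp: G_def)
  have fG: "finite (G f)" for f using finite_GL by (auto simp: G_def)
  \<comment> \<open>Absolute values, because \<open>sum_UN_le\<close> wants nonnegativity everywhere
    while \<rho> is controlled only on the group.\<close>
  have bd: "(\<Sum>g\<in>G f. \<bar>\<rho> g\<bar>) \<le> real q ^ (n * (n - 1)) * wt {f}" if f: "f \<in> Mon d" "1 \<le> d" "d \<le> n" for f d
  proof -
    have "(\<Sum>g\<in>G f. \<bar>\<rho> g\<bar>) \<le> (\<Sum>g\<in>G f. wt {f})"
    proof (rule sum_mono)
      fix g assume "g \<in> G f"
      then have g: "g \<in> carrier (GL n F)" "g \<in> Sf n f" by (auto simp: G_def)
      obtain N c where N: "N \<ge> 1" "c \<in> Fx" "g [^]\<^bsub>GL n F\<^esub> N = smat n c" "\<rho> g = 1 / real N" using \<rho>[OF g(1)] by blast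
      have "R N c f" by (rule scalar_pow_R[OF g N(2,3)])
      then show "\<bar>\<rho> g\<bar> \<le> wt {f}" using wt_ge[OF N(1,2), of "{f}"] N(4) by simp
    qed
    also have "\<dots> = real (card (G f)) * wt {f}" by simp
    also have "\<dots> \<le> real (q ^ (n * (n - 1))) * wt {f}"
    proof (intro mult_right_mono wt_nonneg)
      have "card (G f) \<le> card (Sf n f)" using finite_mats by (intro card_mono) (auto simp: G_def Sf_def)
      then show "real (card (G f)) \<le> real (q ^ (n * (n - 1)))" using card_Sf[OF f] by (simp only: of_nat_le_iff)
    qed
    finally show ?thesis by simp
  qed
  have "(\<Sum>g\<in>carrier (GL n F). \<rho> g) \<le> (\<Sum>g\<in>carrier (GL n F). \<bar>\<rho> g\<bar>)" by (intro sum_mono) auto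
  also have "\<dots> \<le> (\<Sum>f\<in>?M. \<Sum>g\<in>G f. \<bar>\<rho> g\<bar>)"
    unfolding cov by (rule sum_UN_le[OF fM fG]) simp
  also have "\<dots> \<le> (\<Sum>f\<in>?M. real q ^ (n * (n - 1)) * wt {f})" using bd by (intro sum_mono) auto
  also have "\<dots> = real q ^ (n * (n - 1)) * (\<Sum>f\<in>?M. wt {f})" by (simp add: sum_distrib_left)
  also have "(\<Sum>f\<in>?M. wt {f}) \<le> (\<Sum>d\<in>{1..n}. \<Sum>f\<in>Mon d. wt {f})"
    by (rule sum_UN_le) (use finite_Mon wt_nonneg in auto)
  also have "\<dots> \<le> (\<Sum>d\<le>n. \<Sum>f\<in>Mon d. wt {f})" by (rule sum_mono2) (auto intro!: sum_nonneg wt_nonneg)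
  also have "\<dots> \<le> real q ^ n * sys.Eb n" by (rule sum_wt_le_Eb)
  also have "real q ^ (n * (n - 1)) * (real q ^ n * sys.Eb n) = real q ^ (n * n) * sys.Eb n"
  proof -
    have "n * (n - 1) + n = n * n" using n by (cases n) auto
    then have "real q ^ (n * n) = real q ^ (n * (n - 1)) * real q ^ n" by (metis power_add)
    then show ?thesis by simp
  qed
  finally show ?thesis by (simp add: mult_left_mono)
qed

section \<open>Determinants\<close>

abbreviation perms :: "nat \<Rightarrow> (nat \<Rightarrow> nat) set" where "perms n \<equiv> {p. p permutes {..<n}}"

definition sg :: "(nat \<Rightarrow> nat) \<Rightarrow> 'a" where "sg p = (if evenperm p then \<one> else \<ominus> \<one>)"

lemma sg_closed [simp]: "sg p \<in> carrier F" by (simp add: sg_def)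

lemma add_pow_sign: assumes x: "x \<in> carrier F" shows "add_pow F (sign p) x = sg p \<otimes> x"
proof -
  have "add_pow F (1::int) x = x" "add_pow F (- 1::int) x = \<ominus> x"
    using x by (simp_all add: add_pow_def int_pow_def nat_pow_def a_inv_def)
  then show ?thesis using x by (simp add: sg_def sign_def l_minus)
qed

lemma sg_sq: "sg p \<otimes> sg p = \<one>" by (simp add: sg_def l_minus r_minus)

lemma sg_compose: assumes "p \<in> perms n" "r \<in> perms n" shows "sg (p \<circ> r) = sg p \<otimes> sg r"
proof -
  have "permutation p" "permutation r" using assms by (auto intro: permutation_permutes[THEN iffD2] exI[of _ "{..<n}"])
  then have "evenperm (p \<circ> r) = (evenperm p = evenperm r)" by (rule evenperm_comp)
  then show ?thesis by (simp add: sg_def l_minus r_minus)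
qed

lemma mat_det_eq: assumes "A \<in> mats n" shows "mat_det n F A = (\<Oplus>p\<in>perms n. sg p \<otimes> (\<Otimes>i\<in>{..<n}. A $$ (i, p i)))"
proof -
  have cl: "(\<Otimes>i\<in>{..<n}. A $$ (i, p i)) \<in> carrier F" if "p \<in> perms n" for p
    using that mats_closed[OF assms] permutes_in_image[of p "{..<n}"] by (intro finprod_closed) auto
  show ?thesis unfolding mat_det_def by (intro finsum_cong') (use cl add_pow_sign in auto)
qed

lemma finprod_zero_factor: assumes "finite I" "i \<in> I" "f \<in> I \<rightarrow> carrier F" "f i = \<zero>" shows "finprod F f I = \<zero>"
proof -
  have "finprod F f (insert i (I - {i})) = f i \<otimes> finprod F f (I - {i})" using assms by (intro finprod_insert) auto
  moreover have "insert i (I - {i}) = I" using assms by auto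
  moreover have "finprod F f (I - {i}) \<in> carrier F" using assms by (intro finprod_closed) auto
  ultimately show ?thesis using assms(4) by simp
qed

lemma finsum_cartesian:
  assumes "finite J" "finite S" "\<And>j s. j \<in> J \<Longrightarrow> s \<in> S \<Longrightarrow> f j s \<in> carrier F"
  shows "(\<Oplus>x\<in>J \<times> S. f (fst x) (snd x)) = (\<Oplus>j\<in>J. \<Oplus>s\<in>S. f j s)"
  using assms
proof (induction J rule: finite_induct)
  case empty then show ?case by simp
next
  case (insert y J)
  have eq: "insert y J \<times> S = Pair y ` S \<union> J \<times> S" by auto
  have "(\<Oplus>x\<in>insert y J \<times> S. f (fst x) (snd x)) = (\<Oplus>x\<in>Pair y ` S. f (fst x) (snd x)) \<oplus> (\<Oplus>x\<in>J \<times> S. f (fst x) (snd x))"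
    unfolding eq using insert by (intro finsum_Un_disjoint) auto
  also have "(\<Oplus>x\<in>Pair y ` S. f (fst x) (snd x)) = (\<Oplus>s\<in>S. f y s)"
    using insert.prems by (subst finsum_reindex) (auto intro: inj_onI)
  also have "(\<Oplus>x\<in>J \<times> S. f (fst x) (snd x)) = (\<Oplus>j\<in>J. \<Oplus>s\<in>S. f j s)" using insert by simp
  also have "(\<Oplus>s\<in>S. f y s) \<oplus> (\<Oplus>j\<in>J. \<Oplus>s\<in>S. f j s) = (\<Oplus>j\<in>insert y J. \<Oplus>s\<in>S. f j s)"
    using insert by (intro finsum_insert[symmetric]) (auto intro!: finsum_closed)
  finally show ?case .
qed

lemma finprod_finsum:
  assumes "finite I" "finite J" "\<And>i j. i \<in> I \<Longrightarrow> j \<in> J \<Longrightarrow> a i j \<in> carrier F"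
  shows "(\<Otimes>i\<in>I. \<Oplus>j\<in>J. a i j) = (\<Oplus>f\<in>I \<rightarrow>\<^sub>E J. \<Otimes>i\<in>I. a i (f i))"
  using assms
proof (induction I rule: finite_induct)
  case empty
  then show ?case by simp
next
  case (insert x I)
  let ?c = "\<lambda>(y, g). g(x := y)"
  let ?E = "I \<rightarrow>\<^sub>E J"
  have fE: "finite ?E" using insert by (intro finite_PiE) auto
  have cl: "(\<Otimes>i\<in>I. a i (f i)) \<in> carrier F" if "f \<in> ?E" for f using that insert.prems by (intro finprod_closed) auto
  have inj: "inj_on ?c (J \<times> ?E)" by (rule inj_combinator[OF insert.hyps(2)])
  have "(\<Oplus>f\<in>insert x I \<rightarrow>\<^sub>E J. \<Otimes>i\<in>insert x I. a i (f i)) = (\<Oplus>z\<in>J \<times> ?E. \<Otimes>i\<in>insert x I. a i (?c z i))"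
    unfolding PiE_insert_eq using insert.prems inj by (subst finsum_reindex) (auto intro!: finprod_closed simp: PiE_iff)
  also have "\<dots> = (\<Oplus>z\<in>J \<times> ?E. a x (fst z) \<otimes> (\<Otimes>i\<in>I. a i (snd z i)))"
  proof (intro finsum_cong')
    fix z assume z: "z \<in> J \<times> ?E"
    then obtain y g where yg: "z = (y, g)" "y \<in> J" "g \<in> ?E" by auto
    have "(\<Otimes>i\<in>insert x I. a i ((g(x := y)) i)) = a x ((g(x := y)) x) \<otimes> (\<Otimes>i\<in>I. a i ((g(x := y)) i))"
      using insert yg by (intro finprod_insert) (auto simp: PiE_iff)
    also have "(\<Otimes>i\<in>I. a i ((g(x := y)) i)) = (\<Otimes>i\<in>I. a i (g i))"
      using insert yg by (intro finprod_cong') (auto simp: PiE_iff)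
    finally show "(\<Otimes>i\<in>insert x I. a i (?c z i)) = a x (fst z) \<otimes> (\<Otimes>i\<in>I. a i (snd z i))" using yg by simp
  qed (use insert.prems cl in auto)
  also have "\<dots> = (\<Oplus>y\<in>J. \<Oplus>g\<in>?E. a x y \<otimes> (\<Otimes>i\<in>I. a i (g i)))"
    using insert.prems cl fE by (intro finsum_cartesian) auto
  also have "\<dots> = (\<Oplus>y\<in>J. a x y \<otimes> (\<Oplus>g\<in>?E. \<Otimes>i\<in>I. a i (g i)))"
    using insert.prems cl fE by (intro finsum_cong') (auto intro!: finsum_rdistr[symmetric] finsum_closed)
  also have "\<dots> = (\<Oplus>y\<in>J. a x y) \<otimes> (\<Oplus>g\<in>?E. \<Otimes>i\<in>I. a i (g i))"
    using insert.prems cl fE by (intro finsum_ldistr[symmetric]) (auto intro!: finsum_closed)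
  also have "(\<Oplus>g\<in>?E. \<Otimes>i\<in>I. a i (g i)) = (\<Otimes>i\<in>I. \<Oplus>j\<in>J. a i j)" using insert by simp
  also have "(\<Oplus>y\<in>J. a x y) \<otimes> \<dots> = (\<Otimes>i\<in>insert x I. \<Oplus>j\<in>J. a i j)"
    using insert by (intro finprod_insert[symmetric]) (auto intro!: finsum_closed)
  finally show ?case ..
qed

lemma row_sum_reindex:
  assumes B: "B \<in> mats n" and f: "f \<in> perms n"
  shows "(\<Oplus>p\<in>perms n. sg p \<otimes> (\<Otimes>i\<in>{..<n}. B $$ (f i, p i))) = sg f \<otimes> mat_det n F B"
proof -
  have fp: "f permutes {..<n}" using f by simp
  have im: "p i < n" if "p \<in> perms n" "i < n" for p i using that permutes_in_image[of p "{..<n}" i] by simp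
  have cl: "(\<Otimes>i\<in>{..<n}. B $$ (h i, p i)) \<in> carrier F" if "p \<in> perms n" "h \<in> perms n" for p h
    using im[OF that(1)] im[OF that(2)] by (intro finprod_closed) (auto intro: mats_closed[OF B])
  have clid: "(\<Otimes>i\<in>{..<n}. B $$ (i, p i)) \<in> carrier F" if "p \<in> perms n" for p
    using im[OF that] by (intro finprod_closed) (auto intro: mats_closed[OF B])
  have inj: "inj_on (\<lambda>r. r \<circ> f) (perms n)"
  proof (rule inj_onI)
    fix r s assume "r \<circ> f = s \<circ> f"
    then have "r \<circ> f \<circ> inv_into UNIV f = s \<circ> f \<circ> inv_into UNIV f" by simp
    then show "r = s" using permutes_inv_o(1)[OF fp] by (simp add: comp_assoc)
  qed
  have sub: "(\<lambda>r. r \<circ> f) ` perms n \<subseteq> perms n" using permutes_compose[OF fp] by auto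
  have img: "(\<lambda>r. r \<circ> f) ` perms n = perms n"
    by (rule endo_inj_surj[OF _ sub inj]) (simp add: finite_permutations)
  have "(\<Oplus>p\<in>perms n. sg p \<otimes> (\<Otimes>i\<in>{..<n}. B $$ (f i, p i))) = (\<Oplus>p\<in>(\<lambda>r. r \<circ> f) ` perms n. sg p \<otimes> (\<Otimes>i\<in>{..<n}. B $$ (f i, p i)))"
    unfolding img ..
  also have "\<dots> = (\<Oplus>r\<in>perms n. sg (r \<circ> f) \<otimes> (\<Otimes>i\<in>{..<n}. B $$ (f i, (r \<circ> f) i)))"
    by (rule finsum_reindex[OF _ inj]) (use sub cl f in \<open>auto intro!: m_closed\<close>)
  also have "\<dots> = (\<Oplus>r\<in>perms n. sg f \<otimes> (sg r \<otimes> (\<Otimes>i\<in>{..<n}. B $$ (i, r i))))"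
  proof (intro finsum_cong')
    fix r assume r: "r \<in> perms n"
    have fi: "f ` {..<n} = {..<n}" by (rule permutes_image[OF fp])
    have "(\<Otimes>i\<in>f ` {..<n}. B $$ (i, r i)) = (\<Otimes>i\<in>{..<n}. B $$ (f i, r (f i)))"
      by (rule finprod_reindex) (use permutes_inj_on[OF fp] im[OF r] in \<open>auto simp: fi intro: mats_closed[OF B]\<close>)
    then have "(\<Otimes>i\<in>{..<n}. B $$ (f i, (r \<circ> f) i)) = (\<Otimes>i\<in>{..<n}. B $$ (i, r i))" by (simp add: fi)
    then show "sg (r \<circ> f) \<otimes> (\<Otimes>i\<in>{..<n}. B $$ (f i, (r \<circ> f) i)) = sg f \<otimes> (sg r \<otimes> (\<Otimes>i\<in>{..<n}. B $$ (i, r i)))"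
      using clid[OF r] by (simp add: sg_compose[OF r f] m_assoc m_lcomm)
  qed (use clid in auto)
  also have "\<dots> = sg f \<otimes> (\<Oplus>r\<in>perms n. sg r \<otimes> (\<Otimes>i\<in>{..<n}. B $$ (i, r i)))"
    using clid by (intro finsum_rdistr[symmetric]) (auto simp: finite_permutations)
  finally show ?thesis by (simp add: mat_det_eq[OF B])
qed

text \<open>Composition with the transposition of i and j pairs even with odd permutations and
  preserves the product. The pairing cancels terms also in characteristic 2, where D = -D would say
  nothing.\<close>

lemma repeated_row_sum:
  assumes B: "B \<in> mats n" and f: "\<And>k. k < n \<Longrightarrow> f k < n" and ij: "i < n" "j < n" "i \<noteq> j" "f i = f j"
  shows "(\<Oplus>p\<in>perms n. sg p \<otimes> (\<Otimes>k\<in>{..<n}. B $$ (f k, p k))) = \<zero>"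
proof -
  define t where "t = Transposition.transpose i j"
  have t: "t permutes {..<n}" unfolding t_def using ij by (intro permutes_swap_id) auto
  have tt: "t \<circ> t = id" by (simp add: t_def)
  define x where "x p = (\<Otimes>k\<in>{..<n}. B $$ (f k, p k))" for p
  have im: "p k < n" if "p permutes {..<n}" "k < n" for p k using that permutes_in_image[of p "{..<n}" k] by simp
  have cl: "x p \<in> carrier F" if "p permutes {..<n}" for p
    unfolding x_def using im[OF that] f by (intro finprod_closed) (auto intro: mats_closed[OF B])
  have ft: "f (t k) = f k" for k using ij(4) by (auto simp: t_def Transposition.transpose_def)
  have xt: "x (p \<circ> t) = x p" if p: "p permutes {..<n}" for p
  proof -
    have ti: "t ` {..<n} = {..<n}" by (rule permutes_image[OF t])
    have "(\<Otimes>k\<in>t ` {..<n}. B $$ (f k, p k)) = (\<Otimes>k\<in>{..<n}. B $$ (f (t k), p (t k)))"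
      by (rule finprod_reindex) (use permutes_inj_on[OF t] im[OF p] f in \<open>auto simp: ti intro: mats_closed[OF B]\<close>)
    then show ?thesis by (simp add: ti ft x_def)
  qed
  let ?E = "{p. p permutes {..<n} \<and> evenperm p}" and ?O = "{p. p permutes {..<n} \<and> \<not> evenperm p}"
  have perm: "permutation p" if "p permutes {..<n}" for p using that by (auto intro: permutation_permutes[THEN iffD2] exI[of _ "{..<n}"])
  have ev: "evenperm (p \<circ> t) \<longleftrightarrow> \<not> evenperm p" if "p permutes {..<n}" for p
    using evenperm_comp[OF perm[OF that] perm[OF t]] ij(3) by (auto simp: t_def evenperm_swap)
  have O: "?O = (\<lambda>p. p \<circ> t) ` ?E"
  proof (intro equalityI subsetI)
    fix p assume p: "p \<in> ?O"
    then have "p \<circ> t \<in> ?E" "p = (p \<circ> t) \<circ> t" using ev[of p] permutes_compose[OF t, of p] tt by (auto simp: comp_assoc)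
    then show "p \<in> (\<lambda>p. p \<circ> t) ` ?E" by (rule image_eqI[of p "\<lambda>p. p \<circ> t" "p \<circ> t", rotated])
  qed (use ev permutes_compose[OF t] in auto)
  have inj: "inj_on (\<lambda>p. p \<circ> t) ?E"
  proof (rule inj_onI)
    fix r s assume "r \<circ> t = s \<circ> t"
    then have "r \<circ> t \<circ> t = s \<circ> t \<circ> t" by simp
    then show "r = s" using tt by (simp add: comp_assoc)
  qed
  have fin': "finite ?E" "finite ?O" by (rule finite_subset[OF _ finite_permutations[of "{..<n}"]]; auto)+
  have eq: "perms n = ?E \<union> ?O" by auto
  have "(\<Oplus>p\<in>perms n. sg p \<otimes> x p) = (\<Oplus>p\<in>?E. sg p \<otimes> x p) \<oplus> (\<Oplus>p\<in>?O. sg p \<otimes> x p)"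
    unfolding eq by (rule finsum_Un_disjoint[OF fin']) (use cl in auto)
  also have "(\<Oplus>p\<in>?E. sg p \<otimes> x p) = (\<Oplus>p\<in>?E. x p)" by (intro finsum_cong') (use cl in \<open>auto simp: sg_def\<close>)
  also have "(\<Oplus>p\<in>?O. sg p \<otimes> x p) = (\<Oplus>p\<in>?E. sg (p \<circ> t) \<otimes> x (p \<circ> t))"
    unfolding O by (rule finsum_reindex[OF _ inj]) (use cl permutes_compose[OF t] in \<open>auto intro!: m_closed\<close>)
  also have "\<dots> = (\<Oplus>p\<in>?E. (\<ominus> \<one>) \<otimes> x p)" by (intro finsum_cong') (use cl xt ev in \<open>auto simp: sg_def\<close>)
  also have "\<dots> = (\<ominus> \<one>) \<otimes> (\<Oplus>p\<in>?E. x p)" by (intro finsum_rdistr[symmetric] fin') (use cl in auto)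
  also have "(\<Oplus>p\<in>?E. x p) \<oplus> \<dots> = \<zero>"
  proof -
    have "(\<Oplus>p\<in>?E. x p) \<in> carrier F" using cl by (intro finsum_closed) auto
    then show ?thesis by (simp add: l_minus r_neg)
  qed
  finally show ?thesis by (simp add: x_def)
qed

lemma mat_det_closed: "A \<in> mats n \<Longrightarrow> mat_det n F A \<in> carrier F"
  unfolding mat_det_eq using permutes_in_image[of _ "{..<n}"]
  by (intro finsum_closed) (auto intro!: m_closed finprod_closed mats_closed)

text \<open>Expanding the product of the row sums gives a sum over all maps of the index set into
  itself. Maps that are not injective contribute zero by \<open>repeated_row_sum\<close>; the others
  are restrictions of permutations, which \<open>row_sum_reindex\<close> evaluates.\<close>

lemma mat_det_mult: assumes A: "A \<in> mats n" and B: "B \<in> mats n"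
  shows "mat_det n F (A \<otimes>\<^bsub>mat_monoid n F\<^esub> B) = mat_det n F A \<otimes> mat_det n F B"
proof -
  let ?E = "{..<n} \<rightarrow>\<^sub>E {..<n}"
  let ?r = "\<lambda>p. restrict p {..<n}"
  have fE: "finite ?E" by (intro finite_PiE) auto
  have fp: "finite (perms n)" by (rule finite_permutations) simp
  have im: "p k < n" if "p \<in> perms n" "k < n" for p k using that permutes_in_image[of p "{..<n}" k] by simp
  have fi: "f k < n" if "f \<in> ?E" "k < n" for f k using that by auto
  define a where "a f = (\<Otimes>i\<in>{..<n}. A $$ (i, f i))" for f
  define b where "b f p = (\<Otimes>i\<in>{..<n}. B $$ (f i, p i))" for f p
  have acl: "a f \<in> carrier F" if "\<And>k. k < n \<Longrightarrow> f k < n" for f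
    unfolding a_def using that by (intro finprod_closed) (auto intro: mats_closed[OF A])
  have bcl: "b f p \<in> carrier F" if "\<And>k. k < n \<Longrightarrow> f k < n" "p \<in> perms n" for f p
    unfolding b_def using that(1) im[OF that(2)] by (intro finprod_closed) (auto intro: mats_closed[OF B])
  define D where "D f = (\<Oplus>p\<in>perms n. sg p \<otimes> b f p)" for f
  have Dcl: "D f \<in> carrier F" if "\<And>k. k < n \<Longrightarrow> f k < n" for f
    unfolding D_def using bcl that by (intro finsum_closed) auto
  have aE: "a f \<in> carrier F" and DE: "D f \<in> carrier F" and bE: "p \<in> perms n \<Longrightarrow> b f p \<in> carrier F" if "f \<in> ?E" for f p
    using acl[of f] Dcl[of f] bcl[of f p] fi[OF that] by blast+
  have D0: "D f = \<zero>" if f: "f \<in> ?E" "\<not> inj_on f {..<n}" for f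
  proof -
    obtain i j where ij: "i < n" "j < n" "i \<noteq> j" "f i = f j" using f(2) by (auto simp: inj_on_def)
    show ?thesis unfolding D_def b_def by (rule repeated_row_sum[OF B fi[OF f(1)] ij])
  qed
  have "mat_det n F (A \<otimes>\<^bsub>mat_monoid n F\<^esub> B) = (\<Oplus>p\<in>perms n. \<Oplus>f\<in>?E. sg p \<otimes> (a f \<otimes> b f p))"
    unfolding mat_det_eq[OF mat_mult_closed[OF A B]]
  proof (intro finsum_cong')
    fix p assume p: "p \<in> perms n"
    have "(\<Otimes>i\<in>{..<n}. (A \<otimes>\<^bsub>mat_monoid n F\<^esub> B) $$ (i, p i)) = (\<Otimes>i\<in>{..<n}. \<Oplus>k\<in>{..<n}. A $$ (i, k) \<otimes> B $$ (k, p i))"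
      using im[OF p] by (intro finprod_cong') (auto simp: mat_mult_entry[OF A B] intro!: finsum_closed m_closed mats_closed[OF A] mats_closed[OF B])
    also have "\<dots> = (\<Oplus>f\<in>?E. \<Otimes>i\<in>{..<n}. A $$ (i, f i) \<otimes> B $$ (f i, p i))"
      using im[OF p] by (intro finprod_finsum) (auto intro: mats_closed[OF A] mats_closed[OF B])
    also have "\<dots> = (\<Oplus>f\<in>?E. a f \<otimes> b f p)"
    proof (intro finsum_cong')
      fix f assume f: "f \<in> ?E"
      show "(\<Otimes>i\<in>{..<n}. A $$ (i, f i) \<otimes> B $$ (f i, p i)) = a f \<otimes> b f p"
        unfolding a_def b_def using im[OF p] fi[OF f] by (intro finprod_multf) (auto intro: mats_closed[OF A] mats_closed[OF B])
    qed (use aE bE[OF _ p] in auto)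
    finally show "sg p \<otimes> (\<Otimes>i\<in>{..<n}. (A \<otimes>\<^bsub>mat_monoid n F\<^esub> B) $$ (i, p i)) = (\<Oplus>f\<in>?E. sg p \<otimes> (a f \<otimes> b f p))"
      using aE bE[OF _ p] by (simp add: finsum_rdistr[OF fE])
  qed (use aE bE in \<open>auto intro!: finsum_closed\<close>)
  also have "\<dots> = (\<Oplus>f\<in>?E. \<Oplus>p\<in>perms n. sg p \<otimes> (a f \<otimes> b f p))"
    by (rule finsum_swap[OF fp fE]) (use aE bE in auto)
  also have "\<dots> = (\<Oplus>f\<in>?E. a f \<otimes> D f)"
  proof (intro finsum_cong')
    fix f assume f: "f \<in> ?E"
    have "(\<Oplus>p\<in>perms n. sg p \<otimes> (a f \<otimes> b f p)) = (\<Oplus>p\<in>perms n. a f \<otimes> (sg p \<otimes> b f p))"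
      by (intro finsum_cong') (use aE[OF f] bE[OF f] in \<open>auto simp: m_lcomm\<close>)
    also have "\<dots> = a f \<otimes> D f" unfolding D_def
      by (intro finsum_rdistr[symmetric] fp) (use aE[OF f] bE[OF f] in auto)
    finally show "(\<Oplus>p\<in>perms n. sg p \<otimes> (a f \<otimes> b f p)) = a f \<otimes> D f" .
  qed (use aE DE in auto)
  also have "\<dots> = (\<Oplus>f\<in>?r ` perms n. a f \<otimes> D f)"
  proof (rule add.finprod_mono_neutral_cong_right[OF fE])
    show "?r ` perms n \<subseteq> ?E"
    proof (rule image_subsetI)
      fix p assume "p \<in> perms n"
      then show "?r p \<in> ?E" using im by (intro restrict_PiE_iff[THEN iffD2]) auto
    qed
    show "a f \<otimes> D f = \<zero>" if f: "f \<in> ?E - ?r ` perms n" for f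
    proof -
      have "\<not> inj_on f {..<n}"
      proof
        assume i: "inj_on f {..<n}"
        have "f ` {..<n} = {..<n}" by (rule endo_inj_surj[OF _ _ i]) (use f in auto)
        then have b: "bij_betw f {..<n} {..<n}" using i by (simp add: bij_betw_def)
        let ?p = "\<lambda>k. if k \<in> {..<n} then f k else k"
        have "bij_betw ?p {..<n} {..<n}" using b by (rule bij_betw_cong[THEN iffD1, rotated]) simp
        then have "?p permutes {..<n}" by (rule bij_imp_permutes) simp
        moreover have "f = ?r ?p" using f by (auto simp: restrict_def PiE_def extensional_def fun_eq_iff)
        ultimately show False using f by blast
      qed
      then show ?thesis using D0 f aE by simp
    qed
  qed (use aE DE in auto)
  also have "\<dots> = (\<Oplus>p\<in>perms n. a (?r p) \<otimes> D (?r p))"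
  proof (rule finsum_reindex)
    show "inj_on ?r (perms n)"
    proof (rule inj_onI)
      fix p s assume ps: "p \<in> perms n" "s \<in> perms n" "?r p = ?r s"
      show "p = s"
      proof
        fix k show "p k = s k"
          using fun_cong[OF ps(3), of k] permutes_not_in[of p "{..<n}" k] permutes_not_in[of s "{..<n}" k] ps(1,2) by (cases "k < n") auto
      qed
    qed
  qed (use im acl Dcl in auto)
  also have "\<dots> = (\<Oplus>p\<in>perms n. (sg p \<otimes> a p) \<otimes> mat_det n F B)"
  proof (intro finsum_cong')
    fix p assume p: "p \<in> perms n"
    have "a (?r p) = a p" unfolding a_def using im[OF p] by (intro finprod_cong') (auto intro: mats_closed[OF A])
    moreover have "D (?r p) = (\<Oplus>s\<in>perms n. sg s \<otimes> b p s)" unfolding D_def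
    proof (intro finsum_cong')
      fix s assume s: "s \<in> perms n"
      have "b (?r p) s = b p s" unfolding b_def using im[OF p] im[OF s] by (intro finprod_cong') (auto intro: mats_closed[OF B])
      then show "sg s \<otimes> b (?r p) s = sg s \<otimes> b p s" by simp
    qed (use bcl im[OF p] in auto)
    moreover have "\<dots> = sg p \<otimes> mat_det n F B" unfolding b_def by (rule row_sum_reindex[OF B p])
    ultimately show "a (?r p) \<otimes> D (?r p) = (sg p \<otimes> a p) \<otimes> mat_det n F B"
      using acl[OF im[OF p]] mat_det_closed[OF B] by (simp add: m_ac)
  qed (use im acl mat_det_closed[OF B] in auto)
  also have "\<dots> = (\<Oplus>p\<in>perms n. sg p \<otimes> a p) \<otimes> mat_det n F B"
    by (intro finsum_ldistr[symmetric] fp mat_det_closed[OF B]) (use im acl in auto)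
  finally show ?thesis by (simp add: mat_det_eq[OF A] a_def)
qed

lemma mat_det_single:
  assumes A: "A \<in> mats n" and r: "r \<in> perms n"
    and z: "\<And>p. p \<in> perms n \<Longrightarrow> p \<noteq> r \<Longrightarrow> \<exists>i<n. A $$ (i, p i) = \<zero>"
  shows "mat_det n F A = sg r \<otimes> (\<Otimes>i\<in>{..<n}. A $$ (i, r i))"
proof -
  have im: "p k < n" if "p \<in> perms n" "k < n" for p k using that permutes_in_image[of p "{..<n}" k] by simp
  have cl: "(\<Otimes>i\<in>{..<n}. A $$ (i, p i)) \<in> carrier F" if "p \<in> perms n" for p
    using im[OF that] by (intro finprod_closed) (auto intro: mats_closed[OF A])
  have "mat_det n F A = (\<Oplus>p\<in>perms n. if p = r then sg r \<otimes> (\<Otimes>i\<in>{..<n}. A $$ (i, r i)) else \<zero>)"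
    unfolding mat_det_eq[OF A]
  proof (intro finsum_cong')
    fix p assume p: "p \<in> perms n"
    have "(\<Otimes>i\<in>{..<n}. A $$ (i, p i)) = \<zero>" if ne: "p \<noteq> r"
    proof -
      obtain i where "i < n" "A $$ (i, p i) = \<zero>" using z[OF p ne] by blast
      then show ?thesis using im[OF p] by (intro finprod_zero_factor[of _ i]) (auto intro: mats_closed[OF A])
    qed
    then show "sg p \<otimes> (\<Otimes>i\<in>{..<n}. A $$ (i, p i)) = (if p = r then sg r \<otimes> (\<Otimes>i\<in>{..<n}. A $$ (i, r i)) else \<zero>)" by auto
  qed (use cl r in auto)
  also have "\<dots> = sg r \<otimes> (\<Otimes>i\<in>{..<n}. A $$ (i, r i))"
    by (rule finsum_single) (use r cl in \<open>auto simp: finite_permutations\<close>)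
  finally show ?thesis .
qed

section \<open>Companion matrices\<close>

text \<open>Multiplication by X modulo \<open>f\<close> in the basis 1, X, ..., X^(n-1). Coefficient
  lists start with the leading coefficient, so \<open>f ! (n - i)\<close> belongs to X^i.\<close>

definition companion :: "nat \<Rightarrow> 'a list \<Rightarrow> 'a mat" where
  "companion n f = mat n n (\<lambda>(i, j). if j = n - 1 then \<ominus> (f ! (n - i)) else if i = Suc j then \<one> else \<zero>)"

text \<open>The only permutation that contributes to the determinant of a companion matrix.\<close>
definition cyc :: "nat \<Rightarrow> nat \<Rightarrow> nat" where
  "cyc n i = (if i < n then (if i = 0 then n - 1 else i - 1) else i)"

lemma cyc_permutes: "cyc n permutes {..<n}"
proof (rule bij_imp_permutes)
  have "inj_on (cyc n) {..<n}" by (rule inj_onI) (auto simp: cyc_def split: if_splits)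
  moreover have "cyc n ` {..<n} \<subseteq> {..<n}" by (auto simp: cyc_def)
  ultimately show "bij_betw (cyc n) {..<n} {..<n}" using endo_inj_surj[of "{..<n}" "cyc n"] by (simp add: bij_betw_def)
qed (simp add: cyc_def)

context
  fixes n :: nat and f :: "'a list"
  assumes n: "n \<ge> 1" and f: "f \<in> Mon n"
begin

interpretation V: module F "vmod n" by (rule vmod_module)

lemma coeff_closed: "i \<le> n \<Longrightarrow> f ! i \<in> carrier F"
  using MonD(1,2)[OF f] poly_carrier_iff[of f] nth_mem[of i f] by auto

lemma companion_mats: "companion n f \<in> mats n"
  using coeff_closed by (simp add: companion_def mats_iff)

lemma act_companion_unitv: assumes j: "Suc j < n" shows "act n (companion n f) (unitv n j) = unitv n (Suc j)"
proof (rule vec_eqI[OF act_closed[OF companion_mats unitv_closed] unitv_closed])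
  fix i assume i: "i < n"
  have "act n (companion n f) (unitv n j) i = companion n f $$ (i, j)" using j by (intro act_unitv[OF companion_mats i]) simp
  also have "\<dots> = unitv n (Suc j) i" using i j by (auto simp: companion_def unitv_def)
  finally show "act n (companion n f) (unitv n j) i = unitv n (Suc j) i" .
qed

lemma pow_companion: "i < n \<Longrightarrow> (act n (companion n f) ^^ i) (unitv n 0) = unitv n i"
  by (induction i) (auto simp: act_companion_unitv)

text \<open>Because the i-th iterate of e_0 is e_i, evaluation returns the coefficients themselves,
  read from the constant term upwards.\<close>

lemma ev_companion: "set xs \<subseteq> carrier F \<Longrightarrow> length xs \<le> n \<Longrightarrow>
    ev n (companion n f) xs = (\<lambda>i\<in>{..<n}. if i < length xs then xs ! (length xs - 1 - i) else \<zero>)"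
proof (induction xs)
  case Nil then show ?case by (simp add: ev_Nil vmod_simps)
next
  case (Cons a xs)
  have "ev n (companion n f) (a # xs) = a \<odot>\<^bsub>vmod n\<^esub> unitv n (length xs) \<oplus>\<^bsub>vmod n\<^esub> (\<lambda>i\<in>{..<n}. if i < length xs then xs ! (length xs - 1 - i) else \<zero>)"
  proof -
    have xs: "set xs \<subseteq> carrier F" "a \<in> carrier F" "length xs < n" using Cons.prems by auto
    show ?thesis unfolding ev_Cons[OF companion_mats xs(1,2)] pow_companion[OF xs(3)] Cons.IH[OF xs(1) less_imp_le[OF xs(3)]] ..
  qed
  also have "\<dots> = (\<lambda>i\<in>{..<n}. if i < length (a # xs) then (a # xs) ! (length (a # xs) - 1 - i) else \<zero>)"
    unfolding vmod_simps
  proof (rule restrict_ext)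
    fix i assume i: "i \<in> {..<n}"
    have m: "i < length xs \<Longrightarrow> xs ! (length xs - Suc i) \<in> carrier F" using Cons.prems nth_mem[of "length xs - Suc i" xs] by auto
    have e: "i < length xs \<Longrightarrow> length xs - i = Suc (length xs - Suc i)" by simp
    consider "i < length xs" | "i = length xs" | "i > length xs" by linarith
    then show "(\<lambda>i\<in>{..<n}. a \<otimes> unitv n (length xs) i) i \<oplus> (\<lambda>i\<in>{..<n}. if i < length xs then xs ! (length xs - 1 - i) else \<zero>) i =
        (if i < length (a # xs) then (a # xs) ! (length (a # xs) - 1 - i) else \<zero>)"
    proof cases
      case 1
      then show ?thesis using i m Cons.prems e by (simp add: unitv_def)
    qed (use i Cons.prems in \<open>auto simp: unitv_def\<close>)
  qed
  finally show ?case .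
qed

lemma ev_companion_self: "ev n (companion n f) f = \<zero>\<^bsub>vmod n\<^esub>"
proof -
  obtain xs where xs: "f = \<one> # xs" using MonD(3,4)[OF f] by (cases f) auto
  have sx: "set xs \<subseteq> carrier F" "length xs = n" using MonD(1,2)[OF f] by (auto simp: xs poly_carrier_iff)
  have "(act n (companion n f) ^^ n) (unitv n 0) = act n (companion n f) (unitv n (n - 1))"
    using pow_companion[of "n - 1"] n by (cases n) auto
  then have "ev n (companion n f) f = act n (companion n f) (unitv n (n - 1)) \<oplus>\<^bsub>vmod n\<^esub> ev n (companion n f) xs"
    using ev_Cons[OF companion_mats sx(1) one_closed] sx(2) act_closed[OF companion_mats unitv_closed[of n "n - 1"]] by (simp add: xs)
  also have "\<dots> = \<zero>\<^bsub>vmod n\<^esub>" unfolding vmod_simps(2,3)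
  proof (rule restrict_ext)
    fix i assume i: "i \<in> {..<n}"
    then have "f ! (n - i) = xs ! (n - 1 - i)" by (simp add: xs nth_Cons')
    then show "act n (companion n f) (unitv n (n - 1)) i \<oplus> ev n (companion n f) xs i = \<zero>"
      using i n coeff_closed[of "n - i"] act_unitv[OF companion_mats, of i "n - 1"] ev_companion[OF sx(1)] sx(2)
      by (simp add: companion_def l_neg)
  qed
  finally show ?thesis .
qed

text \<open>A generator \<open>h\<close> of degree d < n would evaluate, by
  \<open>ev_companion\<close>, to a vector whose entry at place d is the leading coefficient 1 of
  \<open>h\<close>, so not to zero.\<close>

lemma companion_Sf: "companion n f \<in> Sf n f"
proof -
  obtain d h where h: "d \<le> n" "h \<in> Mon d" "\<forall>p\<in>carrier P. ev n (companion n f) p = \<zero>\<^bsub>vmod n\<^esub> \<longleftrightarrow> h divides\<^bsub>P\<^esub> p"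
    using min_poly_ex[OF companion_mats n] by blast
  have dv: "h divides\<^bsub>P\<^esub> f" using h(3) MonD(1)[OF f] ev_companion_self by blast
  have "d = n"
  proof (rule ccontr)
    assume "d \<noteq> n"
    then have dn: "d < n" using h(1) by simp
    have hh: "set h \<subseteq> carrier F" "length h = Suc d" "hd h = \<one>" using MonD[OF h(2)] poly_carrier_iff by auto
    have "h divides\<^bsub>P\<^esub> h" using UP.divides_refl[OF MonD(1)[OF h(2)]] .
    then have "ev n (companion n f) h = \<zero>\<^bsub>vmod n\<^esub>" using h(3) MonD(1)[OF h(2)] by blast
    then have "ev n (companion n f) h d = \<zero>\<^bsub>vmod n\<^esub> d" by simp
    then have "h ! 0 = \<zero>" using ev_companion[OF hh(1)] hh(2) dn by (simp add: vmod_simps)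
    then show False using hh(2,3) by (cases h) auto
  qed
  then have "h = f" using Mon_divides_eq[of h n f] h(2) f dv by simp
  then show ?thesis using h(3) companion_mats by (simp add: Sf_def)
qed

text \<open>Counting: evaluation is injective on the q^n polynomials of degree below n, so e_0 is a
  cyclic vector.\<close>

lemma companion_surj: assumes "v \<in> Vs n" shows "\<exists>p\<in>carrier P. v = ev n (companion n f) p"
proof -
  let ?L = "{r \<in> carrier P. length r \<le> n}"
  have "card (ev n (companion n f) ` ?L) = card (Vs n)"
    using card_image[OF ev_inj[OF f companion_Sf]] by (simp add: card_lower card_vecs)
  then have "ev n (companion n f) ` ?L = Vs n"
    by (intro card_subset_eq[OF finite_vecs]) (use ev_closed[OF companion_mats] in auto)
  then have "v \<in> ev n (companion n f) ` ?L" using assms by simp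
  then show ?thesis by (elim imageE) blast
qed

lemma companion_pow_act: assumes R: "R N \<one> f" and v: "v \<in> Vs n" shows "(act n (companion n f) ^^ N) v = v"
proof -
  obtain p where p: "p \<in> carrier P" "v = ev n (companion n f) p" using companion_surj[OF v] by blast
  note C = companion_mats
  have pw: "ev n (companion n f) (p \<otimes>\<^bsub>P\<^esub> X [^]\<^bsub>P\<^esub> M) = (act n (companion n f) ^^ M) v" for M :: nat
  proof (induction M)
    case 0 then show ?case using p UP.r_one[OF p(1)] by simp
  next
    case (Suc M)
    have "p \<otimes>\<^bsub>P\<^esub> X [^]\<^bsub>P\<^esub> Suc M = (p \<otimes>\<^bsub>P\<^esub> X [^]\<^bsub>P\<^esub> M) \<otimes>\<^bsub>P\<^esub> X"
      using UP.m_assoc[OF p(1) Xpow_closed[of M] X_closed] by simp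
    then show ?case using ev_times_X[OF C UP.m_closed[OF p(1) Xpow_closed[of M]]] Suc by simp
  qed
  have o: "[\<one>] \<in> carrier P" "XN N \<one> \<in> carrier P" using XN_closed by auto
  have "XN N \<one> \<oplus>\<^bsub>P\<^esub> [\<one>] = X [^]\<^bsub>P\<^esub> N" unfolding XN_def a_minus_def
    using UP.a_assoc[OF Xpow_closed UP.a_inv_closed[OF o(1)] o(1)] UP.l_neg[OF o(1)] UP.r_zero[OF Xpow_closed] by simp
  then have "p \<otimes>\<^bsub>P\<^esub> X [^]\<^bsub>P\<^esub> N = p \<otimes>\<^bsub>P\<^esub> XN N \<one> \<oplus>\<^bsub>P\<^esub> p"
    using UP.r_distr[OF o(2) o(1) p(1)] UP.r_one[OF p(1)] by (simp add: P_one)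
  moreover have "ev n (companion n f) (XN N \<one>) = \<zero>\<^bsub>vmod n\<^esub>" using companion_Sf R o(2) by (simp add: Sf_def R_def)
  then have "ev n (companion n f) (p \<otimes>\<^bsub>P\<^esub> XN N \<one>) = \<zero>\<^bsub>vmod n\<^esub>" by (rule ev_mult_zero[OF C p(1) o(2)])
  ultimately show ?thesis using pw[of N] ev_add[OF C UP.m_closed[OF p(1) o(2)] p(1)] p(2) ev_closed[OF C p(1)] by simp
qed

lemma companion_GL: assumes R: "R N \<one> f" "N \<ge> 1"
  shows "companion n f \<in> carrier (GL n F)" "companion n f [^]\<^bsub>GL n F\<^esub> N = \<one>\<^bsub>GL n F\<^esub>"
proof -
  note C = companion_mats
  have pcl: "(act n (companion n f) ^^ M) v \<in> Vs n" if "v \<in> Vs n" for M v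
    using that by (induction M) (auto simp: act_closed[OF C])
  have "act n (companion n f) ` Vs n = Vs n"
  proof (intro equalityI subsetI)
    fix v assume v: "v \<in> Vs n"
    have "v = act n (companion n f) ((act n (companion n f) ^^ (N - 1)) v)"
      using companion_pow_act[OF R(1) v] R(2) by (cases N) auto
    then show "v \<in> act n (companion n f) ` Vs n" using pcl[OF v] by (rule image_eqI)
  qed (use act_closed[OF C] in auto)
  then show G: "companion n f \<in> carrier (GL n F)" by (rule surj_act_GL[OF C])
  interpret G: group "GL n F" by (rule GL_group)
  show "companion n f [^]\<^bsub>GL n F\<^esub> N = \<one>\<^bsub>GL n F\<^esub>"
    by (rule act_faithful[OF GL_mats[OF G.nat_pow_closed[OF G]] GL_mats[OF G.one_closed]])
      (simp add: act_pow[OF G] companion_pow_act[OF R(1)] act_one GL_simps)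
qed

lemma companion_det: "mat_det n F (companion n f) = sg (cyc n) \<otimes> (\<ominus> (f ! n))"
proof -
  have entry: "companion n f $$ (i, j) = (if j = n - 1 then \<ominus> (f ! (n - i)) else if i = Suc j then \<one> else \<zero>)" if "i < n" "j < n" for i j
    using that by (simp add: companion_def)
  have "mat_det n F (companion n f) = sg (cyc n) \<otimes> (\<Otimes>i\<in>{..<n}. companion n f $$ (i, cyc n i))"
  proof (rule mat_det_single[OF companion_mats])
    show "cyc n \<in> perms n" using cyc_permutes by simp
    fix p assume p: "p \<in> perms n" "p \<noteq> cyc n"
    have im: "p i < n" if "i < n" for i using p(1) that permutes_in_image[of p "{..<n}" i] by simp
    have inj: "p i = p j \<Longrightarrow> i = j" for i j using p(1) permutes_inj[of p "{..<n}"] by (auto dest: injD)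
    show "\<exists>i<n. companion n f $$ (i, p i) = \<zero>"
    proof (rule ccontr)
      assume nz: "\<not> (\<exists>i<n. companion n f $$ (i, p i) = \<zero>)"
      \<comment> \<open>Nonzero entries of row i lie only in the columns n - 1 and i - 1. Row 0 must
        take n - 1, which leaves i - 1 for every other row.\<close>
      have A: "p i = n - 1 \<or> i = Suc (p i)" if "i < n" for i
        using nz that entry[OF that im[OF that]] by (metis (full_types))
      have p0: "p 0 = n - 1" using A[of 0] n by auto
      have "p i = cyc n i" for i
      proof (cases "i < n")
        case True
        then show ?thesis using A[OF True] p0 inj[of i 0] by (cases "i = 0") (auto simp: cyc_def)
      next
        case False
        then show ?thesis using p(1) permutes_not_in[of p "{..<n}" i] by (simp add: cyc_def)
      qed
      then show False using p(2) by blast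
    qed
  qed
  also have "(\<Otimes>i\<in>{..<n}. companion n f $$ (i, cyc n i)) = (\<Otimes>i\<in>insert 0 {1..<n}. companion n f $$ (i, cyc n i))"
    using n by (intro arg_cong[of _ _ "finprod F _"]) auto
  also have "\<dots> = companion n f $$ (0, cyc n 0) \<otimes> (\<Otimes>i\<in>{1..<n}. companion n f $$ (i, cyc n i))"
    using n by (intro finprod_insert) (auto simp: cyc_def intro!: mats_closed[OF companion_mats])
  also have "(\<Otimes>i\<in>{1..<n}. companion n f $$ (i, cyc n i)) = \<one>"
    by (rule finprod_one_eqI) (use n in \<open>auto simp: cyc_def entry\<close>)
  also have "companion n f $$ (0, cyc n 0) = \<ominus> (f ! n)" using n by (simp add: cyc_def entry)
  finally show ?thesis using coeff_closed[of n] by simp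
qed

end

lemma const_term_Mon: assumes f: "f \<in> Mon n" shows "const_term f = f ! n"
proof -
  have "length f = Suc n" "set f \<subseteq> carrier F" using MonD(1,2)[OF f] poly_carrier_iff by auto
  then obtain xs a where "f = xs @ [a]" "length xs = n" by (cases f rule: rev_cases) auto
  then show ?thesis using const_term_eq_last[of xs a] \<open>set f \<subseteq> carrier F\<close> by auto
qed

lemma mat_det_smat: assumes c: "c \<in> carrier F" shows "mat_det n F (smat n c) = c [^] n"
proof -
  have "mat_det n F (smat n c) = sg id \<otimes> (\<Otimes>i\<in>{..<n}. smat n c $$ (i, id i))"
  proof (rule mat_det_single[OF smat_mats[OF c]])
    show "id \<in> perms n" by (simp add: permutes_id)
    fix p assume p: "p \<in> perms n" "p \<noteq> id"
    then obtain i where i: "p i \<noteq> i" by (auto simp: fun_eq_iff)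
    then have "i < n" using p(1) permutes_not_in[of p "{..<n}" i] by auto
    moreover have "p i < n" using p(1) \<open>i < n\<close> permutes_in_image[of p "{..<n}" i] by simp
    ultimately show "\<exists>i<n. smat n c $$ (i, p i) = \<zero>" using i by (intro exI[of _ i]) (simp add: smat_def)
  qed
  also have "(\<Otimes>i\<in>{..<n}. smat n c $$ (i, id i)) = (\<Otimes>i\<in>{..<n}. c)"
    by (intro finprod_cong') (use c in \<open>auto simp: smat_def\<close>)
  also have "\<dots> = c [^] n" using c by (simp add: finprod_const)
  finally show ?thesis using c by (simp add: sg_def)
qed

lemma smat_one: "smat n \<one> = \<one>\<^bsub>mat_monoid n F\<^esub>" by (simp add: smat_def mat_monoid_def)

lemma mat_det_one: "mat_det n F \<one>\<^bsub>mat_monoid n F\<^esub> = \<one>"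
  using mat_det_smat[of \<one> n] by (simp add: smat_one)

section \<open>Conjugates of companion matrices\<close>

lemma GL_inv: assumes "h \<in> carrier (GL n F)" shows "inv\<^bsub>GL n F\<^esub> h \<otimes>\<^bsub>mat_monoid n F\<^esub> h = \<one>\<^bsub>mat_monoid n F\<^esub>"
    "h \<otimes>\<^bsub>mat_monoid n F\<^esub> inv\<^bsub>GL n F\<^esub> h = \<one>\<^bsub>mat_monoid n F\<^esub>" "inv\<^bsub>GL n F\<^esub> h \<in> carrier (GL n F)"
proof -
  interpret G: group "GL n F" by (rule GL_group)
  show "inv\<^bsub>GL n F\<^esub> h \<otimes>\<^bsub>mat_monoid n F\<^esub> h = \<one>\<^bsub>mat_monoid n F\<^esub>" "h \<otimes>\<^bsub>mat_monoid n F\<^esub> inv\<^bsub>GL n F\<^esub> h = \<one>\<^bsub>mat_monoid n F\<^esub>"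
    "inv\<^bsub>GL n F\<^esub> h \<in> carrier (GL n F)"
    using G.l_inv[OF assms] G.r_inv[OF assms] G.inv_closed[OF assms] by (simp_all add: GL_simps(2,3))
qed

lemma det_GL_mult: "A \<in> carrier (GL n F) \<Longrightarrow> B \<in> carrier (GL n F) \<Longrightarrow> mat_det n F (A \<otimes>\<^bsub>GL n F\<^esub> B) = mat_det n F A \<otimes> mat_det n F B"
  using mat_det_mult[OF GL_mats GL_mats] by (simp add: GL_simps(3))

lemma det_GL_inv: assumes "A \<in> carrier (GL n F)" shows "mat_det n F A \<otimes> mat_det n F (inv\<^bsub>GL n F\<^esub> A) = \<one>"
  using mat_det_mult[OF GL_mats[OF assms] GL_mats[OF GL_inv(3)[OF assms]]] GL_inv(2)[OF assms] mat_det_one by simp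

lemma det_GL_closed: "A \<in> carrier (GL n F) \<Longrightarrow> mat_det n F A \<in> carrier F" using mat_det_closed GL_mats by blast

lemma det_GL_Fx: assumes "A \<in> carrier (GL n F)" shows "mat_det n F A \<in> Fx"
proof -
  have "mat_det n F A \<noteq> \<zero>"
    using det_GL_inv[OF assms] det_GL_closed[OF GL_inv(3)[OF assms]] one_not_zero by (metis l_null)
  then show ?thesis using det_GL_closed[OF assms] by simp
qed

definition stab :: "nat \<Rightarrow> 'a mat set" where
  "stab n = {h \<in> carrier (GL n F). act n h (unitv n 0) = unitv n 0}"

lemma act_GL_inv: assumes h: "h \<in> carrier (GL n F)" and v: "v \<in> Vs n"
  shows "act n (inv\<^bsub>GL n F\<^esub> h) (act n h v) = v" "act n h (act n (inv\<^bsub>GL n F\<^esub> h) v) = v"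
  using act_mult[OF GL_mats[OF GL_inv(3)[OF h]] GL_mats[OF h] v] act_mult[OF GL_mats[OF h] GL_mats[OF GL_inv(3)[OF h]] v]
  by (simp_all add: GL_inv[OF h] act_one[OF v])

text \<open>The invertible matrices sending e_0 to a given vector are empty or a coset of the
  stabiliser, and there are q^n vectors.\<close>

lemma card_stab: "card (carrier (GL n F)) \<le> q ^ n * card (stab n)"
proof -
  interpret G: group "GL n F" by (rule GL_group)
  define S where "S v = {h \<in> carrier (GL n F). act n h (unitv n 0) = v}" for v
  have "carrier (GL n F) = (\<Union>v\<in>Vs n. S v)" using act_closed[OF GL_mats unitv_closed] by (auto simp: S_def)
  then have "card (carrier (GL n F)) \<le> (\<Sum>v\<in>Vs n. card (S v))" using card_UN_le[OF finite_vecs, of S] by simp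
  also have "\<dots> \<le> (\<Sum>v\<in>Vs n. card (stab n))"
  proof (rule sum_mono)
    fix v
    show "card (S v) \<le> card (stab n)"
    proof (cases "S v = {}")
      case False
      then obtain h where h: "h \<in> carrier (GL n F)" "act n h (unitv n 0) = v" by (auto simp: S_def)
      note hi = GL_inv(3)[OF h(1)]
      have "inj_on (\<lambda>x. inv\<^bsub>GL n F\<^esub> h \<otimes>\<^bsub>GL n F\<^esub> x) (S v)"
        by (rule inj_onI) (use hi in \<open>simp add: S_def G.l_cancel\<close>)
      moreover have "(\<lambda>x. inv\<^bsub>GL n F\<^esub> h \<otimes>\<^bsub>GL n F\<^esub> x) ` S v \<subseteq> stab n"
      proof (rule image_subsetI)
        fix x assume "x \<in> S v"
        then have x: "x \<in> carrier (GL n F)" "act n x (unitv n 0) = act n h (unitv n 0)" using h by (auto simp: S_def)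
        have "act n (inv\<^bsub>GL n F\<^esub> h \<otimes>\<^bsub>GL n F\<^esub> x) (unitv n 0) = unitv n 0"
          using act_mult[OF GL_mats[OF hi] GL_mats[OF x(1)] unitv_closed] act_GL_inv(1)[OF h(1) unitv_closed] x(2) by (simp add: GL_simps(3))
        then show "inv\<^bsub>GL n F\<^esub> h \<otimes>\<^bsub>GL n F\<^esub> x \<in> stab n" using G.m_closed[OF hi x(1)] by (simp add: stab_def)
      qed
      ultimately show ?thesis using finite_GL by (intro card_inj_on_le) (auto simp: stab_def)
    qed simp
  qed
  finally show ?thesis by (simp add: card_vecs)
qed

text \<open>Conjugating the companion matrix by the stabiliser of the cyclic vector \<open>e\<^sub>0\<close> gives pairwise
  distinct matrices with the same minimal polynomial at \<open>e\<^sub>0\<close>.\<close>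
lemma conjugates_of_companion:
  assumes n: "n \<ge> 1" and f: "f \<in> Mon n" and c: "const_term f = \<ominus> sg (cyc n)" and R: "R N \<one> f" "N \<ge> 1"
  obtains S where "S \<subseteq> Sf n f" "S \<subseteq> carrier (SL n F)" "card (carrier (GL n F)) \<le> q ^ n * card S"
    "\<And>g. g \<in> S \<Longrightarrow> g [^]\<^bsub>GL n F\<^esub> N = \<one>\<^bsub>GL n F\<^esub>"
proof -
  interpret G: group "GL n F" by (rule GL_group)
  let ?C = "companion n f"
  note C = companion_GL[OF n f R]
  have Cm: "?C \<in> mats n" by (rule companion_mats[OF n f])
  have detC: "mat_det n F ?C = \<one>"
  proof -
    have "f ! n = \<ominus> sg (cyc n)" using const_term_Mon[OF f] c by simp
    then show ?thesis by (simp add: companion_det[OF n f] sg_sq)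
  qed
  define \<phi> where "\<phi> h = h \<otimes>\<^bsub>GL n F\<^esub> ?C \<otimes>\<^bsub>GL n F\<^esub> inv\<^bsub>GL n F\<^esub> h" for h
  have hG: "h \<in> carrier (GL n F)" "act n h (unitv n 0) = unitv n 0" if "h \<in> stab n" for h using that by (auto simp: stab_def)
  have \<phi>G: "\<phi> h \<in> carrier (GL n F)" if "h \<in> stab n" for h unfolding \<phi>_def using hG[OF that] C by simp
  have \<phi>act: "act n (\<phi> h) (act n h v) = act n h (act n ?C v)" if h: "h \<in> stab n" and v: "v \<in> Vs n" for h v
  proof -
    note hm = GL_mats[OF hG(1)[OF h]] and him = GL_mats[OF GL_inv(3)[OF hG(1)[OF h]]]
    have "act n (\<phi> h) (act n h v) = act n (h \<otimes>\<^bsub>mat_monoid n F\<^esub> ?C) (act n (inv\<^bsub>GL n F\<^esub> h) (act n h v))"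
      unfolding \<phi>_def GL_simps(3) by (rule act_mult[OF mat_mult_closed[OF hm Cm] him act_closed[OF hm v]])
    also have "\<dots> = act n h (act n ?C v)" unfolding act_GL_inv(1)[OF hG(1)[OF h] v] by (rule act_mult[OF hm Cm v])
    finally show ?thesis .
  qed
  have \<phi>ev: "ev n (\<phi> h) p = act n h (ev n ?C p)" if h: "h \<in> stab n" and p: "set p \<subseteq> carrier F" for h p
    using p
  proof (induction p rule: rev_induct)
    case Nil
    show ?case using act_zero[OF GL_mats[OF hG(1)[OF h]]] by (simp add: ev_Nil)
  next
    case (snoc a p)
    interpret V: module F "vmod n" by (rule vmod_module)
    note hm = GL_mats[OF hG(1)[OF h]]
    have e: "ev n ?C p \<in> Vs n" "a \<in> carrier F" using ev_list_closed[OF Cm] snoc.prems by auto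
    show ?case using snoc e unitv_closed[of n 0] \<phi>act[OF h e(1)] act_closed[OF Cm e(1)] hG(2)[OF h]
      by (simp add: ev_snoc act_add[OF hm] act_smult[OF hm])
  qed
  show ?thesis
  proof (rule that)
    show "\<phi> ` stab n \<subseteq> Sf n f"
    proof (rule image_subsetI)
      fix h assume h: "h \<in> stab n"
      note hm = GL_mats[OF hG(1)[OF h]]
      have "ev n (\<phi> h) p = \<zero>\<^bsub>vmod n\<^esub> \<longleftrightarrow> ev n ?C p = \<zero>\<^bsub>vmod n\<^esub>" if p: "p \<in> carrier P" for p
      proof -
        have "set p \<subseteq> carrier F" using p poly_carrier_iff by blast
        then have e: "ev n (\<phi> h) p = act n h (ev n ?C p)" by (rule \<phi>ev[OF h])
        show ?thesis unfolding e using act_GL_inv(1)[OF hG(1)[OF h] ev_closed[OF Cm p]] act_zero[OF hm] act_zero[OF GL_mats[OF GL_inv(3)[OF hG(1)[OF h]]]] by metis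
      qed
      then show "\<phi> h \<in> Sf n f" using companion_Sf[OF n f] GL_mats[OF \<phi>G[OF h]] by (simp add: Sf_def)
    qed
    show "\<phi> ` stab n \<subseteq> carrier (SL n F)"
    proof (rule image_subsetI)
      fix h assume h: "h \<in> stab n"
      note hh = hG(1)[OF h] GL_inv(3)[OF hG(1)[OF h]]
      have "mat_det n F (\<phi> h) = mat_det n F h \<otimes> mat_det n F (inv\<^bsub>GL n F\<^esub> h)"
        unfolding \<phi>_def using det_GL_mult[OF G.m_closed[OF hh(1) C(1)] hh(2)] det_GL_mult[OF hh(1) C(1)] detC det_GL_closed[OF hh(1)] by simp
      then show "\<phi> h \<in> carrier (SL n F)" using det_GL_inv[OF hh(1)] \<phi>G[OF h] by (simp add: SL_def)
    qed
    \<comment> \<open>The conjugate determines h: \<open>ev n (\<phi> h) p\<close> is h applied to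
      \<open>ev n ?C p\<close>, and the latter runs through all vectors.\<close>
    have "inj_on \<phi> (stab n)"
    proof (rule inj_onI)
      fix h k assume hk: "h \<in> stab n" "k \<in> stab n" "\<phi> h = \<phi> k"
      show "h = k"
      proof (rule act_faithful[OF GL_mats[OF hG(1)[OF hk(1)]] GL_mats[OF hG(1)[OF hk(2)]]])
        fix v assume "v \<in> Vs n"
        then obtain p where p: "p \<in> carrier P" "v = ev n ?C p" using companion_surj[OF n f] by blast
        have "set p \<subseteq> carrier F" using p poly_carrier_iff by blast
        then show "act n h v = act n k v" using \<phi>ev[OF hk(1), of p] \<phi>ev[OF hk(2), of p] hk(3) p(2) by simp
      qed
    qed
    then show "card (carrier (GL n F)) \<le> q ^ n * card (\<phi> ` stab n)" using card_stab card_image by metis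
    fix g assume "g \<in> \<phi> ` stab n"
    then obtain h where h: "h \<in> stab n" "g = \<phi> h" by (elim imageE)
    note hh = hG(1)[OF h(1)]
    have "\<phi> h [^]\<^bsub>GL n F\<^esub> M = h \<otimes>\<^bsub>GL n F\<^esub> (?C [^]\<^bsub>GL n F\<^esub> M) \<otimes>\<^bsub>GL n F\<^esub> inv\<^bsub>GL n F\<^esub> h" for M :: nat
    proof (induction M)
      case 0 then show ?case using hh by simp
    next
      case (Suc M)
      have e: "inv\<^bsub>GL n F\<^esub> h \<otimes>\<^bsub>GL n F\<^esub> (h \<otimes>\<^bsub>GL n F\<^esub> x) = x" if "x \<in> carrier (GL n F)" for x
        using hh that by (simp flip: G.m_assoc)
      have "\<phi> h [^]\<^bsub>GL n F\<^esub> Suc M = h \<otimes>\<^bsub>GL n F\<^esub> (?C [^]\<^bsub>GL n F\<^esub> M) \<otimes>\<^bsub>GL n F\<^esub> inv\<^bsub>GL n F\<^esub> h \<otimes>\<^bsub>GL n F\<^esub> \<phi> h"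
        using Suc by simp
      then show ?case using hh C(1) e by (simp add: \<phi>_def G.m_assoc)
    qed
    then show "g [^]\<^bsub>GL n F\<^esub> N = \<one>\<^bsub>GL n F\<^esub>" using h hh C(2) by simp
  qed
qed

lemma many_small_order_matrices:
  assumes r: "1 \<le> r" "r < m" and n: "n = k * m + r"
  obtains T where "T \<subseteq> carrier (SL n F)" "card (carrier (GL n F)) * (card (Irred m) choose k) \<le> q ^ n * card T"
    "\<And>g. g \<in> T \<Longrightarrow> g [^]\<^bsub>GL n F\<^esub> (r * (q ^ m - 1)) = \<one>\<^bsub>GL n F\<^esub>"
proof -
  let ?N = "r * (q ^ m - 1)"
  have N: "?N \<ge> 1" using r qpow_minus_one_ge[of m] by (simp add: Suc_le_eq)
  have n1: "n \<ge> 1" using r n by simp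
  \<comment> \<open>The constant term for which \<open>companion_det\<close> becomes
    \<open>sg (cyc n) \<otimes> sg (cyc n)\<close>, that is, one.\<close>
  have \<kappa>: "\<ominus> sg (cyc n) \<in> Fx"
  proof -
    have "\<ominus> sg (cyc n) \<noteq> \<zero>" using sg_sq[of "cyc n"] one_not_zero by (metis a_inv_closed add.inv_eq_1_iff l_null sg_closed)
    then show ?thesis by simp
  qed
  obtain S where S: "S \<subseteq> Mon n" "card S = (card (Irred m) choose k)" "\<And>f. f \<in> S \<Longrightarrow> const_term f = \<ominus> sg (cyc n) \<and> R ?N \<one> f"
    using many_small_order_polys[OF r \<kappa>, of k] unfolding n by metis
  have "\<exists>Y. Y \<subseteq> Sf n f \<and> Y \<subseteq> carrier (SL n F) \<and> card (carrier (GL n F)) \<le> q ^ n * card Y \<and> (\<forall>g\<in>Y. g [^]\<^bsub>GL n F\<^esub> ?N = \<one>\<^bsub>GL n F\<^esub>)" if f: "f \<in> S" for f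
  proof -
    have fM: "f \<in> Mon n" using S(1) f by blast
    obtain Y where "Y \<subseteq> Sf n f" "Y \<subseteq> carrier (SL n F)" "card (carrier (GL n F)) \<le> q ^ n * card Y" "\<And>g. g \<in> Y \<Longrightarrow> g [^]\<^bsub>GL n F\<^esub> ?N = \<one>\<^bsub>GL n F\<^esub>"
      using conjugates_of_companion[OF n1 fM _ _ N] S(3)[OF f] by metis
    then show ?thesis by blast
  qed
  then obtain Y where Y: "\<And>f. f \<in> S \<Longrightarrow> Y f \<subseteq> Sf n f \<and> Y f \<subseteq> carrier (SL n F) \<and> card (carrier (GL n F)) \<le> q ^ n * card (Y f) \<and> (\<forall>g\<in>Y f. g [^]\<^bsub>GL n F\<^esub> ?N = \<one>\<^bsub>GL n F\<^esub>)"
    by metis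
  show ?thesis
  proof (rule that)
    show "(\<Union>f\<in>S. Y f) \<subseteq> carrier (SL n F)" using Y by blast
    show "g [^]\<^bsub>GL n F\<^esub> ?N = \<one>\<^bsub>GL n F\<^esub>" if "g \<in> (\<Union>f\<in>S. Y f)" for g using Y that by blast
    have fY: "finite (Y f)" if "f \<in> S" for f
      using Y[OF that] finite_mats finite_subset[of "Y f" "mats n"] by (auto simp: Sf_def)
    have "card (\<Union>f\<in>S. Y f) = (\<Sum>f\<in>S. card (Y f))"
    proof (rule card_UN_disjoint)
      show "finite S" using S(1) finite_Mon finite_subset by metis
      show "\<forall>f\<in>S. finite (Y f)" using fY by blast
      \<comment> \<open>A matrix determines its minimal polynomial at e_0, so sets belonging to
        different polynomials are disjoint.\<close>
      show "\<forall>f\<in>S. \<forall>h\<in>S. f \<noteq> h \<longrightarrow> Y f \<inter> Y h = {}"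
      proof (intro ballI impI)
        fix f h assume fh: "f \<in> S" "h \<in> S" "f \<noteq> h"
        have M: "f \<in> Mon n" "h \<in> Mon n" using fh S(1) by auto
        have "f = h" if g: "g \<in> Y f" "g \<in> Y h" for g
        proof -
          have g: "g \<in> Sf n f" "g \<in> Sf n h" using g Y fh by blast+
          have "h divides\<^bsub>P\<^esub> h" using UP.divides_refl[OF MonD(1)[OF M(2)]] .
          then have "f divides\<^bsub>P\<^esub> h" using g MonD(1)[OF M(2)] by (simp add: Sf_def)
          then show ?thesis by (rule Mon_divides_eq[OF M])
        qed
        then show "Y f \<inter> Y h = {}" using fh(3) by blast
      qed
    qed
    moreover have "card (carrier (GL n F)) * card S \<le> (\<Sum>f\<in>S. q ^ n * card (Y f))"
      using sum_mono[of S "\<lambda>_. card (carrier (GL n F))" "\<lambda>f. q ^ n * card (Y f)"] Y by (simp add: mult.commute)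
    ultimately show "card (carrier (GL n F)) * (card (Irred m) choose k) \<le> q ^ n * card (\<Union>f\<in>S. Y f)"
      by (simp add: S(2) sum_distrib_left)
  qed
qed

end

section \<open>Orders in central quotients\<close>

text \<open>True for arbitrary records: as 1/0 = 0, an element of order 0 contributes nothing, and
  an empty or infinite carrier gives the value 0.\<close>

lemma eta_le_one: "eta M \<le> 1"
proof (cases "card (carrier M) = 0")
  case True then show ?thesis by (simp add: eta_def)
next
  case False
  have "(\<Sum>g\<in>carrier M. 1 / real (group.ord M g)) \<le> (\<Sum>g\<in>carrier M. 1)"
  proof (rule sum_mono)
    show "1 / real (group.ord M g) \<le> 1" for g by (cases "group.ord M g") auto
  qed
  then show ?thesis using False by (simp add: eta_def field_simps)
qed

context group
begin

lemma eta_ge: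
  assumes fin: "finite (carrier G)" and T: "T \<subseteq> carrier G" and N: "N \<ge> 1" and pow: "\<And>g. g \<in> T \<Longrightarrow> g [^] N = \<one>"
  shows "real (card T) / (real N * real (card (carrier G))) \<le> eta G"
proof -
  have "real (card T) / real N = (\<Sum>g\<in>T. 1 / real N)" by simp
  also have "\<dots> \<le> (\<Sum>g\<in>T. 1 / real (ord g))"
  proof (rule sum_mono)
    fix g assume g: "g \<in> T"
    then have "ord g dvd N" using pow T pow_eq_id by blast
    then have "ord g \<le> N" "ord g \<ge> 1" using N by (auto intro: dvd_imp_le simp: Suc_le_eq dest: dvd_pos_nat[rotated])
    then show "1 / real N \<le> 1 / real (ord g)" by (intro divide_left_mono) auto
  qed
  also have "\<dots> \<le> (\<Sum>g\<in>carrier G. 1 / real (ord g))" by (rule sum_mono2[OF fin T]) simp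
  finally show ?thesis by (simp add: eta_def divide_right_mono flip: divide_divide_eq_left)
qed

lemma central_normal:
  assumes "subgroup H G" "\<And>h x. h \<in> H \<Longrightarrow> x \<in> carrier G \<Longrightarrow> h \<otimes> x = x \<otimes> h"
  shows "H \<lhd> G"
proof (rule normalI[OF assms(1)], rule ballI)
  fix x assume x: "x \<in> carrier G"
  show "H #> x = x <# H" unfolding r_coset_def l_coset_def using assms(2) x by (intro SUP_cong) auto
qed

end

context normal
begin

lemma pow_coset: assumes "g \<in> carrier G" shows "(H #> g) [^]\<^bsub>G Mod H\<^esub> (N::nat) = H #> (g [^] N)"
proof -
  interpret h: group_hom G "G Mod H" "\<lambda>a. H #> a"
    by (simp add: group_hom_def group_hom_axioms_def factorgroup_is_group r_coset_hom_Mod is_group)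
  show ?thesis using h.hom_nat_pow[OF assms, of N] by simp
qed

lemma coset_in_Mod: "g \<in> carrier G \<Longrightarrow> H #> g \<in> carrier (G Mod H)"
  unfolding FactGroup_def RCOSETS_def by auto

lemma coset_eq_iff: "x \<in> carrier G \<Longrightarrow> H #> x = H \<longleftrightarrow> x \<in> H"
  using coset_join1[OF _ _ is_subgroup] coset_join2[OF _ is_subgroup] subset by blast

lemma ord_Mod:
  assumes fin: "finite (carrier G)" and g: "g \<in> carrier G"
  shows "group.ord (G Mod H) (H #> g) \<ge> 1" "g [^] (group.ord (G Mod H) (H #> g)) \<in> H"
    "g [^] (M::nat) \<in> H \<Longrightarrow> group.ord (G Mod H) (H #> g) dvd M"
proof -
  interpret Q: group "G Mod H" by (rule factorgroup_is_group)
  have fQ: "finite (carrier (G Mod H))" using fin unfolding FactGroup_def RCOSETS_def by auto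
  note c = coset_in_Mod[OF g]
  show "group.ord (G Mod H) (H #> g) \<ge> 1" by (rule Q.ord_ge_1[OF fQ c])
  have "H #> (g [^] (Q.ord (H #> g))) = \<one>\<^bsub>G Mod H\<^esub>" using Q.pow_ord_eq_1[OF c] pow_coset[OF g] by simp
  then show "g [^] (Q.ord (H #> g)) \<in> H" using coset_eq_iff[of "g [^] (Q.ord (H #> g))"] g by (simp add: FactGroup_def)
  show "Q.ord (H #> g) dvd M" if "g [^] M \<in> H"
    using Q.pow_eq_id[OF c] pow_coset[OF g, of M] coset_eq_iff[of "g [^] M"] g that by (simp add: FactGroup_def)
qed

text \<open>All cosets have the same number of elements, so the average over the quotient is the
  average over the group of the value at the coset of \<open>g\<close>.\<close>

lemma eta_Mod:
  assumes fin: "finite (carrier G)"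
  shows "eta (G Mod H) = (\<Sum>g\<in>carrier G. 1 / real (group.ord (G Mod H) (H #> g))) / real (card (carrier G))"
proof -
  let ?\<phi> = "\<lambda>C. 1 / real (group.ord (G Mod H) C)"
  have car: "carrier (G Mod H) = (\<lambda>g. H #> g) ` carrier G" unfolding FactGroup_def RCOSETS_def by auto
  have fQ: "finite (carrier (G Mod H))" unfolding car using fin by simp
  have cell: "{x \<in> carrier G. H #> x = C} = C \<and> card C = card H" if C: "C \<in> carrier (G Mod H)" for C
  proof -
    obtain a where a: "a \<in> carrier G" "C = H #> a" using C unfolding car by blast
    have "C \<in> rcosets H" using a by (auto simp: RCOSETS_def)
    then have "card C = card H" using card_rcosets_equal subset by metis
    moreover have "H #> x = C \<longleftrightarrow> x \<in> C" if "x \<in> carrier G" for x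
      using repr_independence[OF _ a(1) is_subgroup] rcos_self[OF that is_subgroup] a(2) by blast
    moreover have "C \<subseteq> carrier G" using r_coset_subset_G[OF subset a(1)] a(2) by simp
    ultimately show ?thesis by blast
  qed
  have cnt: "(\<Sum>g\<in>carrier G. \<psi> (H #> g)) = real (card H) * (\<Sum>C\<in>carrier (G Mod H). \<psi> C)" for \<psi> :: "'a set \<Rightarrow> real"
  proof -
    have "(\<Sum>g\<in>carrier G. \<psi> (H #> g)) = (\<Sum>C\<in>carrier (G Mod H). \<Sum>g\<in>{x \<in> carrier G. H #> x = C}. \<psi> (H #> g))"
      unfolding car by (rule sum.image_gen[OF fin])
    also have "\<dots> = (\<Sum>C\<in>carrier (G Mod H). real (card H) * \<psi> C)"
    proof (rule sum.cong[OF refl])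
      fix C assume C: "C \<in> carrier (G Mod H)"
      have "(\<Sum>g\<in>{x \<in> carrier G. H #> x = C}. \<psi> (H #> g)) = (\<Sum>g\<in>{x \<in> carrier G. H #> x = C}. \<psi> C)" by (rule sum.cong) auto
      then show "(\<Sum>g\<in>{x \<in> carrier G. H #> x = C}. \<psi> (H #> g)) = real (card H) * \<psi> C" using cell[OF C] by simp
    qed
    finally show ?thesis by (simp add: sum_distrib_left)
  qed
  have "H \<noteq> {}" using subgroup.one_closed[OF is_subgroup] by blast
  then have H0: "card H > 0" using finite_subset[OF subset fin] by (simp add: card_gt_0_iff)
  have "real (card (carrier G)) = real (card H) * real (card (carrier (G Mod H)))" using cnt[of "\<lambda>_. 1"] by simp
  then show ?thesis using cnt[of ?\<phi>] H0 by (simp add: eta_def)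
qed

lemma eta_le_eta_Mod: assumes fin: "finite (carrier G)" shows "eta G \<le> eta (G Mod H)"
proof -
  have "(\<Sum>g\<in>carrier G. 1 / real (ord g)) \<le> (\<Sum>g\<in>carrier G. 1 / real (group.ord (G Mod H) (H #> g)))"
  proof (rule sum_mono)
    fix g assume g: "g \<in> carrier G"
    have "group.ord (G Mod H) (H #> g) dvd ord g" using ord_Mod(3)[OF fin g, of "ord g"] pow_ord_eq_1[OF g] one_closed by simp
    then have "group.ord (G Mod H) (H #> g) \<le> ord g" using ord_ge_1[OF fin g] by (intro dvd_imp_le) auto
    then show "1 / real (ord g) \<le> 1 / real (group.ord (G Mod H) (H #> g))"
      using ord_Mod(1)[OF fin g] by (intro divide_left_mono) auto
  qed
  then show ?thesis unfolding eta_Mod[OF fin] by (simp add: eta_def divide_right_mono)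
qed

end

context finfield
begin

section \<open>Comparison of the four groups\<close>

lemma smat_mult: assumes "c \<in> carrier F" "d \<in> carrier F" shows "smat n c \<otimes>\<^bsub>mat_monoid n F\<^esub> smat n d = smat n (c \<otimes> d)"
proof -
  interpret V: module F "vmod n" by (rule vmod_module)
  show ?thesis
    by (rule act_faithful[of _ n]) (use assms in \<open>auto simp: mat_mult_closed smat_mats act_mult act_smat V.smult_assoc1\<close>)
qed

lemma smat_GL: assumes c: "c \<in> Fx" shows "smat n c \<in> carrier (GL n F)"
proof -
  have "smat n (inv c) \<otimes>\<^bsub>mat_monoid n F\<^esub> smat n c = \<one>\<^bsub>mat_monoid n F\<^esub>" "smat n c \<otimes>\<^bsub>mat_monoid n F\<^esub> smat n (inv c) = \<one>\<^bsub>mat_monoid n F\<^esub>"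
    using smat_mult[of "inv c" c n] smat_mult[of c "inv c" n] Fx_inv[OF c] c by (simp_all add: smat_one)
  then show ?thesis unfolding GL_simps Units_def using smat_mats[of c n] smat_mats[of "inv c" n] Fx_inv[OF c] c by blast
qed

lemma smat_commute: assumes c: "c \<in> carrier F" and A: "A \<in> mats n"
  shows "smat n c \<otimes>\<^bsub>mat_monoid n F\<^esub> A = A \<otimes>\<^bsub>mat_monoid n F\<^esub> smat n c"
proof -
  interpret V: module F "vmod n" by (rule vmod_module)
  show ?thesis
    by (rule act_faithful[of _ n]) (use c A in \<open>auto simp: mat_mult_closed smat_mats act_mult act_smat act_closed act_smult\<close>)
qed

lemma scalar_mats_eq: "scalar_mats n F = smat n ` Fx" by (simp add: scalar_mats_def smat_def)

lemma scalar_subgroup: "subgroup (scalar_mats n F) (GL n F)"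
proof -
  interpret G: group "GL n F" by (rule GL_group)
  show ?thesis unfolding scalar_mats_eq
  proof (rule G.subgroupI)
    show "smat n ` Fx \<subseteq> carrier (GL n F)" using smat_GL by blast
    show "smat n ` Fx \<noteq> {}" using Fx_one by blast
    show "inv\<^bsub>GL n F\<^esub> a \<in> smat n ` Fx" if "a \<in> smat n ` Fx" for a
    proof -
      obtain c where c: "c \<in> Fx" "a = smat n c" using \<open>a \<in> _\<close> by blast
      have "smat n (inv c) \<otimes>\<^bsub>GL n F\<^esub> smat n c = \<one>\<^bsub>GL n F\<^esub>"
        using smat_mult[of "inv c" c n] Fx_inv[OF c(1)] c(1) by (simp add: smat_one GL_simps)
      then have "inv\<^bsub>GL n F\<^esub> (smat n c) = smat n (inv c)"
        using G.inv_equality[OF _ smat_GL[OF c(1)] smat_GL] Fx_inv[OF c(1)] by blast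
      then show ?thesis using c Fx_inv[OF c(1)] by blast
    qed
    show "a \<otimes>\<^bsub>GL n F\<^esub> b \<in> smat n ` Fx" if ab: "a \<in> smat n ` Fx" "b \<in> smat n ` Fx" for a b
    proof -
      obtain c d where cd: "c \<in> Fx" "a = smat n c" "d \<in> Fx" "b = smat n d" using ab by blast
      have "a \<otimes>\<^bsub>GL n F\<^esub> b = smat n (c \<otimes> d)" using smat_mult[of c d n] cd by (simp add: GL_simps)
      then show ?thesis using Fx_mult[OF cd(1,3)] by blast
    qed
  qed
qed

lemma scalar_central: "h \<in> scalar_mats n F \<Longrightarrow> x \<in> carrier (GL n F) \<Longrightarrow> h \<otimes>\<^bsub>GL n F\<^esub> x = x \<otimes>\<^bsub>GL n F\<^esub> h"
  using smat_commute[OF _ GL_mats] by (auto simp: scalar_mats_eq GL_simps(3))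

lemma scalar_normal: "scalar_mats n F \<lhd> GL n F"
  by (rule group.central_normal[OF GL_group scalar_subgroup scalar_central])

lemma SL_carrier: "carrier (SL n F) = {A \<in> carrier (GL n F). mat_det n F A = \<one>}" by (simp add: SL_def)

lemma SL_eq: "SL n F = (GL n F)\<lparr>carrier := carrier (SL n F)\<rparr>" by (simp add: SL_def)

lemma SL_subgroup: "subgroup (carrier (SL n F)) (GL n F)"
proof -
  interpret G: group "GL n F" by (rule GL_group)
  show ?thesis
  proof (rule G.subgroupI)
    show "carrier (SL n F) \<noteq> {}" using mat_det_one G.one_closed by (auto simp: SL_carrier GL_simps(2))
    show "inv\<^bsub>GL n F\<^esub> a \<in> carrier (SL n F)" if "a \<in> carrier (SL n F)" for a
      using det_GL_inv[of a n] that det_GL_closed[of "inv\<^bsub>GL n F\<^esub> a" n] by (simp add: SL_carrier)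
    show "a \<otimes>\<^bsub>GL n F\<^esub> b \<in> carrier (SL n F)" if "a \<in> carrier (SL n F)" "b \<in> carrier (SL n F)" for a b
      using det_GL_mult[of a n b] that by (simp add: SL_carrier)
  qed (simp add: SL_carrier)
qed

lemma SL_group: "group (SL n F)"
  using group.subgroup_imp_group[OF GL_group SL_subgroup] by (simp only: SL_eq[symmetric])

lemma SL_simps: "x \<otimes>\<^bsub>SL n F\<^esub> y = x \<otimes>\<^bsub>GL n F\<^esub> y" "\<one>\<^bsub>SL n F\<^esub> = \<one>\<^bsub>GL n F\<^esub>"
  by (simp_all add: SL_def)

lemma SL_pow: "x [^]\<^bsub>SL n F\<^esub> (N::nat) = x [^]\<^bsub>GL n F\<^esub> N"
  by (induction N) (simp_all add: SL_simps)

lemma finite_SL: "finite (carrier (SL n F))" using finite_GL by (simp add: SL_carrier)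

lemma scalar_SL_normal: "scalar_mats n F \<inter> carrier (SL n F) \<lhd> SL n F"
proof (rule group.central_normal[OF SL_group])
  interpret G: group "GL n F" by (rule GL_group)
  have "subgroup (scalar_mats n F \<inter> carrier (SL n F)) (GL n F)"
    by (rule G.subgroups_Inter_pair[OF scalar_subgroup SL_subgroup])
  then have "subgroup (scalar_mats n F \<inter> carrier (SL n F)) ((GL n F)\<lparr>carrier := carrier (SL n F)\<rparr>)"
    by (rule G.subgroup_incl[OF _ SL_subgroup]) simp
  then show "subgroup (scalar_mats n F \<inter> carrier (SL n F)) (SL n F)" by (simp only: SL_eq[symmetric])
  show "h \<otimes>\<^bsub>SL n F\<^esub> x = x \<otimes>\<^bsub>SL n F\<^esub> h" if "h \<in> scalar_mats n F \<inter> carrier (SL n F)" "x \<in> carrier (SL n F)" for h x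
    using scalar_central[of h n x] that by (simp add: SL_simps SL_carrier)
qed

lemma GL_le_SL: "card (carrier (GL n F)) \<le> (q - 1) * card (carrier (SL n F))"
proof -
  interpret G: group "GL n F" by (rule GL_group)
  define S where "S d = {A \<in> carrier (GL n F). mat_det n F A = d}" for d
  have fFx: "finite Fx" using fin by simp
  have "carrier (GL n F) = (\<Union>d\<in>Fx. S d)" using det_GL_Fx by (auto simp: S_def)
  then have "card (carrier (GL n F)) \<le> (\<Sum>d\<in>Fx. card (S d))" using card_UN_le[OF fFx, of S] by simp
  also have "\<dots> \<le> (\<Sum>d\<in>Fx. card (carrier (SL n F)))"
  proof (rule sum_mono)
    fix d
    show "card (S d) \<le> card (carrier (SL n F))"
    proof (cases "S d = {}")
      case False
      then obtain h where h: "h \<in> carrier (GL n F)" "mat_det n F h = d" by (auto simp: S_def)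
      note hi = G.inv_closed[OF h(1)]
      have "inj_on (\<lambda>x. inv\<^bsub>GL n F\<^esub> h \<otimes>\<^bsub>GL n F\<^esub> x) (S d)"
        by (rule inj_onI) (use hi in \<open>simp add: S_def G.l_cancel\<close>)
      moreover have "(\<lambda>x. inv\<^bsub>GL n F\<^esub> h \<otimes>\<^bsub>GL n F\<^esub> x) ` S d \<subseteq> carrier (SL n F)"
      proof (rule image_subsetI)
        fix x assume "x \<in> S d"
        then have x: "x \<in> carrier (GL n F)" "mat_det n F x = mat_det n F h" using h by (auto simp: S_def)
        have "mat_det n F (inv\<^bsub>GL n F\<^esub> h \<otimes>\<^bsub>GL n F\<^esub> x) = \<one>"
          using det_GL_mult[OF hi x(1)] x(2) det_GL_inv[OF h(1)] m_comm[OF det_GL_closed[OF h(1)] det_GL_closed[OF hi]] by simp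
        then show "inv\<^bsub>GL n F\<^esub> h \<otimes>\<^bsub>GL n F\<^esub> x \<in> carrier (SL n F)" using G.m_closed[OF hi x(1)] by (simp add: SL_carrier)
      qed
      ultimately show ?thesis using finite_SL by (intro card_inj_on_le)
    qed simp
  qed
  also have "\<dots> = (q - 1) * card (carrier (SL n F))" using fin by simp
  finally show ?thesis .
qed

text \<open>The quotient of two solutions is an n-th root of unity.\<close>

lemma card_roots: assumes n: "n \<ge> 1" shows "card {c \<in> Fx. c [^] n = d} \<le> n"
proof (cases "{c \<in> Fx. c [^] n = d} = {}")
  case False
  then obtain e where e: "e \<in> Fx" "e [^] n = d" by blast
  note ei = Fx_inv[OF e(1)]
  have "inj_on (\<lambda>c. inv e \<otimes> c) {c \<in> Fx. c [^] n = d}"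
  proof (rule inj_onI)
    fix c c' assume c: "c \<in> {c \<in> Fx. c [^] n = d}" "c' \<in> {c \<in> Fx. c [^] n = d}" "inv e \<otimes> c = inv e \<otimes> c'"
    then have "e \<otimes> (inv e \<otimes> c) = e \<otimes> (inv e \<otimes> c')" by simp
    then show "c = c'" using c(1,2) e(1) ei by (simp add: m_assoc[symmetric])
  qed
  moreover have "(\<lambda>c. inv e \<otimes> c) ` {c \<in> Fx. c [^] n = d} \<subseteq> {x \<in> carrier F. x [^] n = \<one>}"
  proof (rule image_subsetI)
    fix c assume "c \<in> {c \<in> Fx. c [^] n = d}"
    then have c: "c \<in> Fx" "c [^] n = e [^] n" using e by auto
    have "(inv e \<otimes> c) [^] n = inv e [^] n \<otimes> e [^] n" using nat_pow_distrib[of "inv e" c n] ei c by simp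
    also have "\<dots> = \<one>" using nat_pow_distrib[of "inv e" e n] ei e(1) by simp
    finally show "inv e \<otimes> c \<in> {x \<in> carrier F. x [^] n = \<one>}" using ei c(1) by simp
  qed
  ultimately have "card {c \<in> Fx. c [^] n = d} \<le> card {x \<in> carrier F. x [^] n = \<one>}" using fin by (intro card_inj_on_le) auto
  also have "\<dots> \<le> n" by (rule num_roots_le_deg[OF fin]) (use n in simp)
  finally show ?thesis .
next
  case True
  then show ?thesis by (simp only: card.empty)
qed

text \<open>The map (c, g) -> cg from scalars times SL to GL preserves \<rho>, and its fibres have
  at most n elements, since c^n is the determinant of the image. This is where the factor n between
  PSL and PGL arises.\<close>

lemma sum_SL_le:
  assumes n: "n \<ge> 1" and inv: "\<And>c g. c \<in> Fx \<Longrightarrow> g \<in> carrier (GL n F) \<Longrightarrow> \<rho> (smat n c \<otimes>\<^bsub>GL n F\<^esub> g) = \<rho> g" and \<rho>0: "\<And>g. \<rho> g \<ge> (0::real)"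
  shows "real (q - 1) * (\<Sum>g\<in>carrier (SL n F). \<rho> g) \<le> real n * (\<Sum>g\<in>carrier (GL n F). \<rho> g)"
proof -
  interpret G: group "GL n F" by (rule GL_group)
  let ?Z = "Fx \<times> carrier (SL n F)"
  let ?m = "\<lambda>(c, g). smat n c \<otimes>\<^bsub>GL n F\<^esub> g"
  have fZ: "finite ?Z" using fin finite_SL by simp
  have SG: "g \<in> carrier (GL n F)" if "g \<in> carrier (SL n F)" for g using that by (simp add: SL_carrier)
  have "real (q - 1) * (\<Sum>g\<in>carrier (SL n F). \<rho> g) = (\<Sum>c\<in>Fx. \<Sum>g\<in>carrier (SL n F). \<rho> g)" using fin by simp
  also have "\<dots> = (\<Sum>z\<in>?Z. \<rho> (?m z))"
    unfolding sum.cartesian_product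
  proof (rule sum.cong[OF refl])
    fix z assume "z \<in> ?Z"
    then obtain c g where z: "z = (c, g)" "c \<in> Fx" "g \<in> carrier (SL n F)" by (elim SigmaE)
    show "(case z of (c, g) \<Rightarrow> \<rho> g) = \<rho> (?m z)" using inv[OF z(2) SG[OF z(3)]] by (simp add: z(1))
  qed
  also have "\<dots> = (\<Sum>h\<in>?m ` ?Z. \<Sum>z\<in>{z \<in> ?Z. ?m z = h}. \<rho> (?m z))" by (rule sum.image_gen[OF fZ])
  also have "\<dots> \<le> (\<Sum>h\<in>?m ` ?Z. real n * \<rho> h)"
  proof (rule sum_mono)
    fix h
    have "inj_on fst {z \<in> ?Z. ?m z = h}"
    proof (rule inj_onI)
      fix z w assume zw: "z \<in> {z \<in> ?Z. ?m z = h}" "w \<in> {z \<in> ?Z. ?m z = h}" "fst z = fst w"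
      obtain c g d k where cg: "z = (c, g)" "w = (d, k)" by (cases z, cases w)
      have c: "c \<in> Fx" "g \<in> carrier (GL n F)" "k \<in> carrier (GL n F)" "d = c" "smat n c \<otimes>\<^bsub>GL n F\<^esub> g = smat n c \<otimes>\<^bsub>GL n F\<^esub> k"
        using zw SG[of g] SG[of k] unfolding cg by simp_all
      have "g = k" using G.l_cancel[of "smat n c" g k] c(2,3,5) smat_GL[OF c(1)] by blast
      then show "z = w" using cg c(4) by simp
    qed
    moreover have "fst ` {z \<in> ?Z. ?m z = h} \<subseteq> {c \<in> Fx. c [^] n = mat_det n F h}"
    proof (rule image_subsetI)
      fix z assume z: "z \<in> {z \<in> ?Z. ?m z = h}"
      obtain c g where cg: "z = (c, g)" by (cases z)
      have c: "c \<in> Fx" "g \<in> carrier (GL n F)" "mat_det n F g = \<one>" "h = smat n c \<otimes>\<^bsub>GL n F\<^esub> g" using z cg by (auto simp: SL_carrier)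
      have "mat_det n F h = c [^] n \<otimes> \<one>" unfolding c(4) using det_GL_mult[OF smat_GL[OF c(1)] c(2)] c(1,3) mat_det_smat[of c n] by simp
      then show "fst z \<in> {c \<in> Fx. c [^] n = mat_det n F h}" using cg c(1) by simp
    qed
    ultimately have "card {z \<in> ?Z. ?m z = h} \<le> card {c \<in> Fx. c [^] n = mat_det n F h}" using fin by (intro card_inj_on_le) auto
    also have "\<dots> \<le> n" by (rule card_roots[OF n])
    finally have "card {z \<in> ?Z. ?m z = h} \<le> n" .
    moreover have "(\<Sum>z\<in>{z \<in> ?Z. ?m z = h}. \<rho> (?m z)) = real (card {z \<in> ?Z. ?m z = h}) * \<rho> h" by simp
    ultimately show "(\<Sum>z\<in>{z \<in> ?Z. ?m z = h}. \<rho> (?m z)) \<le> real n * \<rho> h" using \<rho>0[of h] by (simp add: mult_right_mono)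
  qed
  also have "\<dots> \<le> (\<Sum>h\<in>carrier (GL n F). real n * \<rho> h)"
    by (rule sum_mono2[OF finite_GL]) (use smat_GL SG \<rho>0 in auto)
  finally show ?thesis by (simp add: sum_distrib_left)
qed

lemma card_GL_pos: "card (carrier (GL n F)) > 0"
proof -
  interpret G: group "GL n F" by (rule GL_group)
  show ?thesis using finite_GL G.one_closed by (metis card_gt_0_iff empty_iff)
qed

lemma Eb_nonneg: "sys.Eb n \<ge> 0"
proof -
  have "0 \<le> real q ^ n * sys.Eb n"
    using sum_wt_le_Eb[of n] by (rule order_trans[rotated]) (intro sum_nonneg wt_nonneg)
  moreover have "real q ^ n * sys.Eb n < 0" if "sys.Eb n < 0" using that q_ge_2 by (intro mult_pos_neg) auto
  ultimately show ?thesis by linarith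
qed

lemma eta_PGL_le: assumes n: "n \<ge> 1" shows "eta (PGL n F) \<le> 4 * sys.Eb n"
proof -
  interpret N: normal "scalar_mats n F" "GL n F" by (rule scalar_normal)
  let ?\<rho> = "\<lambda>g. 1 / real (group.ord (PGL n F) (scalar_mats n F #>\<^bsub>GL n F\<^esub> g))"
  have "(\<Sum>g\<in>carrier (GL n F). ?\<rho> g) \<le> real q ^ (n * n) * sys.Eb n"
  proof (rule sum_GL_le[OF n])
    fix g assume g: "g \<in> carrier (GL n F)"
    show "\<exists>N c. N \<ge> (1::nat) \<and> c \<in> Fx \<and> g [^]\<^bsub>GL n F\<^esub> N = smat n c \<and> ?\<rho> g = 1 / real N"
      using N.ord_Mod(1,2)[OF finite_GL g] unfolding PGL_def scalar_mats_eq by blast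
  qed
  also have "\<dots> \<le> (4 * real (card (carrier (GL n F)))) * sys.Eb n"
    using card_GL_ge[of n] Eb_nonneg by (intro mult_right_mono) auto
  finally have "(\<Sum>g\<in>carrier (GL n F). ?\<rho> g) / real (card (carrier (GL n F))) \<le> 4 * sys.Eb n"
    using card_GL_pos[of n] by (simp add: field_simps)
  then show ?thesis using N.eta_Mod[OF finite_GL] by (simp add: PGL_def)
qed

lemma eta_GL_le: "eta (GL n F) \<le> eta (PGL n F)"
  unfolding PGL_def by (rule normal.eta_le_eta_Mod[OF scalar_normal finite_GL])

lemma eta_SL_le: "eta (SL n F) \<le> eta (PSL n F)"
  unfolding PSL_def by (rule normal.eta_le_eta_Mod[OF scalar_SL_normal finite_SL])

text \<open>A power of \<open>g\<close> lying in the scalars of SL is scalar in GL, so orders in PSL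
  are multiples of those in PGL. Then \<open>sum_SL_le\<close> compares the sums and
  \<open>GL_le_SL\<close> the group orders.\<close>

lemma eta_PSL_le: assumes n: "n \<ge> 1" shows "eta (PSL n F) \<le> real n * eta (PGL n F)"
proof -
  interpret G: group "GL n F" by (rule GL_group)
  interpret N: normal "scalar_mats n F" "GL n F" by (rule scalar_normal)
  interpret S: normal "scalar_mats n F \<inter> carrier (SL n F)" "SL n F" by (rule scalar_SL_normal)
  let ?\<rho> = "\<lambda>g. 1 / real (group.ord (PGL n F) (scalar_mats n F #>\<^bsub>GL n F\<^esub> g))"
  let ?\<sigma> = "\<lambda>g. 1 / real (group.ord (PSL n F) ((scalar_mats n F \<inter> carrier (SL n F)) #>\<^bsub>SL n F\<^esub> g))"
  have S0: "card (carrier (SL n F)) > 0" using finite_SL subgroup.one_closed[OF SL_subgroup] by (auto simp: card_gt_0_iff)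
  have "(\<Sum>g\<in>carrier (SL n F). ?\<sigma> g) \<le> (\<Sum>g\<in>carrier (SL n F). ?\<rho> g)"
  proof (rule sum_mono)
    fix g assume g: "g \<in> carrier (SL n F)"
    then have g': "g \<in> carrier (GL n F)" by (simp add: SL_carrier)
    let ?M = "group.ord (PSL n F) ((scalar_mats n F \<inter> carrier (SL n F)) #>\<^bsub>SL n F\<^esub> g)"
    have M: "?M \<ge> 1" "g [^]\<^bsub>GL n F\<^esub> ?M \<in> scalar_mats n F" using S.ord_Mod(1,2)[OF finite_SL g] by (auto simp: PSL_def SL_pow)
    have "group.ord (PGL n F) (scalar_mats n F #>\<^bsub>GL n F\<^esub> g) dvd ?M" unfolding PGL_def by (rule N.ord_Mod(3)[OF finite_GL g' M(2)])
    then have "group.ord (PGL n F) (scalar_mats n F #>\<^bsub>GL n F\<^esub> g) \<le> ?M" using M(1) by (intro dvd_imp_le) auto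
    moreover have "group.ord (PGL n F) (scalar_mats n F #>\<^bsub>GL n F\<^esub> g) \<ge> 1" unfolding PGL_def by (rule N.ord_Mod(1)[OF finite_GL g'])
    ultimately show "?\<sigma> g \<le> ?\<rho> g" using M(1) by (intro divide_left_mono) auto
  qed
  then have 1: "real (q - 1) * (\<Sum>g\<in>carrier (SL n F). ?\<sigma> g) \<le> real (q - 1) * (\<Sum>g\<in>carrier (SL n F). ?\<rho> g)" by (rule mult_left_mono) simp
  have 2: "real (q - 1) * (\<Sum>g\<in>carrier (SL n F). ?\<rho> g) \<le> real n * (\<Sum>g\<in>carrier (GL n F). ?\<rho> g)"
  proof (rule sum_SL_le[OF n])
    fix c g assume c: "c \<in> Fx" and g: "g \<in> carrier (GL n F)"
    have h: "smat n c \<in> scalar_mats n F" using c by (simp add: scalar_mats_eq)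
    have "scalar_mats n F #>\<^bsub>GL n F\<^esub> (smat n c \<otimes>\<^bsub>GL n F\<^esub> g) = scalar_mats n F #>\<^bsub>GL n F\<^esub> smat n c #>\<^bsub>GL n F\<^esub> g"
      by (rule G.coset_mult_assoc[symmetric, OF N.subset smat_GL[OF c] g])
    also have "scalar_mats n F #>\<^bsub>GL n F\<^esub> smat n c = scalar_mats n F" using N.coset_eq_iff[OF smat_GL[OF c]] h by blast
    finally show "?\<rho> (smat n c \<otimes>\<^bsub>GL n F\<^esub> g) = ?\<rho> g" by simp
  qed simp
  let ?s = "\<Sum>g\<in>carrier (SL n F). ?\<sigma> g" and ?g = "\<Sum>g\<in>carrier (GL n F). ?\<rho> g"
  have g0: "?g \<ge> 0" by (intro sum_nonneg) simp
  have q1: "real (q - 1) > 0" using q_ge_2 by simp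
  have "?s / real (card (carrier (SL n F))) = (real (q - 1) * ?s) / (real (q - 1) * real (card (carrier (SL n F))))" using q1 by simp
  also have "\<dots> \<le> (real n * ?g) / (real (q - 1) * real (card (carrier (SL n F))))" using 1 2 by (intro divide_right_mono) auto
  also have "\<dots> \<le> (real n * ?g) / real (card (carrier (GL n F)))"
  proof (rule divide_left_mono)
    show "real (card (carrier (GL n F))) \<le> real (q - 1) * real (card (carrier (SL n F)))"
      using GL_le_SL[of n] by (simp only: of_nat_mult[symmetric] of_nat_le_iff)
    show "0 < real (q - 1) * real (card (carrier (SL n F))) * real (card (carrier (GL n F)))" using q1 S0 card_GL_pos[of n] by (intro mult_pos_pos) auto
  qed (use g0 in simp)
  finally show ?thesis using N.eta_Mod[OF finite_GL] S.eta_Mod[OF finite_SL] by (simp add: PGL_def PSL_def)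
qed

lemma eta_upper: assumes n: "n \<ge> 1" and e: "e \<in> {eta (GL n F), eta (PGL n F), eta (SL n F), eta (PSL n F)}"
  shows "e \<le> 4 * real n * sys.Eb n"
proof -
  have "sys.Eb n \<le> real n * sys.Eb n" using n Eb_nonneg[of n] mult_right_mono[of 1 "real n" "sys.Eb n"] by simp
  then have 1: "eta (PGL n F) \<le> 4 * real n * sys.Eb n" using eta_PGL_le[OF n] by linarith
  have "real n * eta (PGL n F) \<le> real n * (4 * sys.Eb n)" using eta_PGL_le[OF n] by (intro mult_left_mono) auto
  then have "eta (PSL n F) \<le> 4 * real n * sys.Eb n" using eta_PSL_le[OF n] by linarith
  then show ?thesis using e 1 eta_GL_le[of n] eta_SL_le[of n] by auto
qed

end

section \<open>The bounds\<close>

context finfield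
begin

text \<open>All the matrices of small order lie in SL, so one set \<open>T\<close> serves SL and the
  larger group GL. The quotients PSL and PGL only have larger averages.\<close>

lemma eta_lower_binomial:
  assumes r: "1 \<le> r" "r < m" and n: "n = k * m + r"
    and e: "e \<in> {eta (GL n F), eta (PGL n F), eta (SL n F), eta (PSL n F)}"
  shows "real (card (Irred m) choose k) / (real q ^ n * real (r * (q ^ m - 1))) \<le> e"
proof -
  let ?N = "r * (q ^ m - 1)" and ?B = "card (Irred m) choose k"
  have N: "?N \<ge> 1" using r qpow_minus_one_ge[of m] by (simp add: Suc_le_eq)
  obtain T where T: "T \<subseteq> carrier (SL n F)" "card (carrier (GL n F)) * ?B \<le> q ^ n * card T"
    "\<And>g. g \<in> T \<Longrightarrow> g [^]\<^bsub>GL n F\<^esub> ?N = \<one>\<^bsub>GL n F\<^esub>"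
    using many_small_order_matrices[OF r n] by metis
  have TG: "T \<subseteq> carrier (GL n F)" using T(1) by (auto simp: SL_carrier)
  have bound: "real ?B / (real q ^ n * real ?N) \<le> real (card T) / (real ?N * real c)" if c: "0 < c" "c \<le> card (carrier (GL n F))" for c
  proof -
    have "c * ?B \<le> q ^ n * card T" by (rule order_trans[OF mult_le_mono1[OF c(2)] T(2)])
    then have "real (c * ?B) \<le> real (q ^ n * card T)" by (simp only: of_nat_le_iff)
    then have "real c * real ?B \<le> real q ^ n * real (card T)" by simp
    moreover have "real q ^ n > 0" "real ?N > 0" "real c > 0" using q_ge_2 N c(1) by (simp, linarith, simp)
    ultimately show ?thesis by (simp add: field_simps del: of_nat_mult)
  qed
  have "real ?B / (real q ^ n * real ?N) \<le> eta (GL n F)"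
    using bound[of "card (carrier (GL n F))"] card_GL_pos[of n] group.eta_ge[OF GL_group finite_GL TG N T(3)] by simp
  moreover have "real ?B / (real q ^ n * real ?N) \<le> eta (SL n F)"
  proof -
    have "card (carrier (SL n F)) \<le> card (carrier (GL n F))" using finite_GL by (intro card_mono) (auto simp: SL_carrier)
    moreover have "0 < card (carrier (SL n F))" using finite_SL subgroup.one_closed[OF SL_subgroup] by (auto simp: card_gt_0_iff)
    ultimately have "real ?B / (real q ^ n * real ?N) \<le> real (card T) / (real ?N * real (card (carrier (SL n F))))" by (intro bound)
    also have "\<dots> \<le> eta (SL n F)"
      by (rule group.eta_ge[OF SL_group finite_SL T(1) N]) (simp only: SL_pow SL_simps T(3))
    finally show ?thesis .
  qed
  ultimately show ?thesis using e eta_GL_le[of n] eta_SL_le[of n] by auto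
qed

text \<open>Since m k <= n, \<open>card_Irred_ge\<close> makes the binomial coefficient at least
  (q^m/(2n))^k. With n = k m + r everything in q^n except q^r cancels, and the exponent r(q^m - 1)
  costs another q^m and a factor n.\<close>

lemma eta_lower_exp:
  assumes pp: "primepow q" and r: "1 \<le> r" "r < m" and m: "3 \<le> m" and n: "n = k * m + r" and k: "1 \<le> k" "k \<le> card (Irred m)"
    and e: "e \<in> {eta (GL n F), eta (PGL n F), eta (SL n F), eta (PSL n F)}"
  shows "exp (- ((real r + real m) * ln (real q) + real k * ln (2 * real n) + ln (real n))) \<le> e"
proof -
  let ?I = "card (Irred m)" and ?N = "r * (q ^ m - 1)"
  have q0: "real q > 0" using q_ge_2 by simp
  have "n > 0" using n r by simp
  then have n0: "real n > 0" by (simp only: of_nat_0_less_iff)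
  have mk: "m * k \<le> n" "r \<le> n" using n by auto
  have N: "0 < ?N" "?N \<le> n * q ^ m" using r qpow_minus_one_ge[of m] mk(2) by (auto intro!: mult_mono simp: Suc_le_eq)
  have "real q ^ m \<le> 2 * (real m * real ?I)"
    using card_Irred_ge[OF pp m] by (simp only: of_nat_le_iff[symmetric, where 'a=real] of_nat_mult of_nat_power of_nat_numeral)
  then have "real q ^ m / (2 * real m * real k) \<le> real ?I / real k" using m k by (simp add: field_simps)
  moreover have "real q ^ m / (2 * real n) \<le> real q ^ m / (2 * real m * real k)"
  proof (rule divide_left_mono)
    have "real (m * k) \<le> real n" using mk(1) by (simp only: of_nat_le_iff)
    then show "2 * real m * real k \<le> 2 * real n" by simp
  qed (use m k q0 n0 in auto)
  ultimately have "(real q ^ m / (2 * real n)) ^ k \<le> (real ?I / real k) ^ k" using q0 n0 by (intro power_mono) auto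
  also have "\<dots> \<le> real (?I choose k)" by (rule binomial_ge_n_over_k_pow_k[OF k(2)])
  finally have B: "(real q ^ m / (2 * real n)) ^ k \<le> real (?I choose k)" .
  have "1 / (real q ^ (r + m) * (2 * real n) ^ k * real n) = (real q ^ m / (2 * real n)) ^ k / (real q ^ n * (real n * real q ^ m))"
  proof -
    have qn: "real q ^ n = (real q ^ m) ^ k * real q ^ r" unfolding n power_add power_mult[symmetric] by (simp add: mult.commute)
    have gen: "1 / (a * b * y * N) = (A / y) / (A * a * (N * b))" if "A \<noteq> 0" for a b y N A :: real using that by simp
    show ?thesis unfolding qn power_add power_divide by (rule gen) (use q0 in simp)
  qed
  also have "\<dots> \<le> real (?I choose k) / (real q ^ n * real ?N)"
  proof (rule frac_le)
    show "real q ^ n * real ?N \<le> real q ^ n * (real n * real q ^ m)"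
    proof (rule mult_left_mono)
      have "real ?N \<le> real (n * q ^ m)" using N(2) by (simp only: of_nat_le_iff)
      then show "real ?N \<le> real n * real q ^ m" by simp
    qed (use q0 in simp)
    show "0 < real q ^ n * real ?N" using q0 N(1) by (intro mult_pos_pos) (simp, simp only: of_nat_0_less_iff)
  qed (use B in auto)
  also have "\<dots> \<le> e" by (rule eta_lower_binomial[OF r n e])
  finally have "1 / (real q ^ (r + m) * (2 * real n) ^ k * real n) \<le> e" .
  moreover have "exp (- ((real r + real m) * ln (real q) + real k * ln (2 * real n) + ln (real n))) = 1 / (real q ^ (r + m) * (2 * real n) ^ k * real n)"
  proof -
    define D where "D = real q ^ (r + m) * (2 * real n) ^ k * real n"
    have "D > 0" using q0 n0 by (simp add: D_def)
    moreover have "ln D = (real r + real m) * ln (real q) + real k * ln (2 * real n) + ln (real n)"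
      using q0 n0 by (simp add: D_def ln_mult ln_realpow distrib_left)
    ultimately show ?thesis unfolding D_def[symmetric] by (metis exp_ln exp_minus inverse_eq_divide)
  qed
  ultimately show ?thesis by simp
qed

end

text \<open>With L = ln q, x = sqrt(nL/ln n) and s = sqrt(nL ln n), taking k near x and m near n/x
  makes both m L and k ln n about s. The two main terms balance to 2s and the rest is of smaller
  order. The first condition ensures that m exceeds k.\<close>

lemma eventually_lower_parameters:
  fixes L \<delta> :: real assumes "L > 0" "\<delta> > 0"
  shows "eventually (\<lambda>n::nat. (sqrt (n * L / ln n) + 9)\<^sup>2 \<le> n \<and>
    sqrt (n * ln n * L) + (sqrt (n * L / ln n) + 1) * (ln (2 * n) + L) + ln n \<le> (2 + \<delta>) * sqrt (n * ln n * L)) at_top"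
proof -
  have 1: "eventually (\<lambda>n::nat. (sqrt (n * L / ln n) + 9)\<^sup>2 \<le> n) at_top" using assms(1) by real_asymp
  have "((\<lambda>n::nat. 1 + (1 / ln n + 1 / sqrt (n * ln n * L)) * (ln (2 * n) + L) + ln n / sqrt (n * ln n * L)) \<longlongrightarrow> 2) at_top"
    using assms(1) by real_asymp
  then have 2: "eventually (\<lambda>n::nat. 1 + (1 / ln n + 1 / sqrt (n * ln n * L)) * (ln (2 * n) + L) + ln n / sqrt (n * ln n * L) < 2 + \<delta>) at_top"
    using assms(2) by (intro order_tendstoD(2)) auto
  have 3: "eventually (\<lambda>n::nat. n \<ge> 3) at_top" by (rule eventually_ge_at_top)
  show ?thesis using 1 2 3
  proof eventually_elim
    case (elim n)
    define s where "s = sqrt (n * ln n * L)"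
    have l: "ln (real n) > 0" using elim(3) by simp
    have s: "s > 0" using l assms(1) elim(3) by (simp add: s_def)
    have x: "sqrt (n * L / ln n) = s / ln n"
    proof -
      have "n * L / ln n = (n * ln n * L) / (ln n)\<^sup>2" using l by (simp add: power2_eq_square)
      then show ?thesis using l by (simp add: s_def real_sqrt_divide)
    qed
    have "s * (1 + (1 / ln n + 1 / s) * (ln (2 * n) + L) + ln n / s) \<le> s * (2 + \<delta>)"
      using elim(2) s unfolding s_def[symmetric] by (intro mult_left_mono) auto
    also have "s * (1 + (1 / ln n + 1 / s) * (ln (2 * n) + L) + ln n / s) = s + (s / ln n + 1) * (ln (2 * n) + L) + ln n"
      using s l by (simp add: field_simps)
    finally show ?case using elim(1) unfolding s_def[symmetric] x by (simp add: mult.commute)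
  qed
qed

text \<open>With fewer than m irreducibles of degree m, \<open>card_Irred_ge\<close> would give 2^m
  < 2 m^2. This lemma excludes it, so there are enough irreducibles to choose from.\<close>

lemma square_le_two_power: "m \<ge> 7 \<Longrightarrow> 2 * m * m \<le> (2::nat) ^ m"
proof (induction m rule: dec_induct)
  case (step m)
  have "2 * m * 7 \<le> 2 * m * m" using step(1) by (rule mult_le_mono2)
  then have "4 * m + 2 \<le> 2 * m * m" using step(1) by linarith
  moreover have "2 * Suc m * Suc m = 2 * m * m + (4 * m + 2)" by simp
  moreover have "(2::nat) ^ Suc m = 2 ^ m + 2 ^ m" by simp
  ultimately show ?case using step.IH by linarith
qed simp

lemma finfieldI: "field F \<Longrightarrow> card (carrier F) = q \<Longrightarrow> primepow q \<Longrightarrow> finfield F"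
  using primepow_gt_0_nat[of q] by (auto simp: finfield_def finfield_axioms_def intro: card_ge_0_finite)

lemma eta_asymptotic_lower:
  assumes pp: "primepow q" and \<delta>: "\<delta> > 0"
  shows "\<exists>n0. \<forall>n\<ge>n0. \<forall>F :: 'a ring. field F \<and> card (carrier F) = q \<longrightarrow>
    (\<forall>e\<in>{eta (GL n F), eta (PGL n F), eta (SL n F), eta (PSL n F)}. exp (- (2 + \<delta>) * sz n q) \<le> e)"
proof -
  define L where "L = ln (real q)"
  have "q \<ge> 2" using primepow_gt_Suc_0[OF pp] by simp
  then have L: "L > 0" by (simp add: L_def)
  obtain n0 :: nat where n0: "\<And>n. n \<ge> n0 \<Longrightarrow> (sqrt (n * L / ln n) + 9)\<^sup>2 \<le> n \<and>
    sqrt (n * ln n * L) + (sqrt (n * L / ln n) + 1) * (ln (2 * n) + L) + ln n \<le> (2 + \<delta>) * sqrt (n * ln n * L)"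
    using eventually_lower_parameters[OF L \<delta>] unfolding eventually_at_top_linorder by blast
  show ?thesis
  proof (intro exI[of _ "max n0 3"] allI impI ballI)
    fix n :: nat and F :: "'a ring" and e
    assume n: "max n0 3 \<le> n" and F: "field F \<and> card (carrier F) = q"
      and e: "e \<in> {eta (GL n F), eta (PGL n F), eta (SL n F), eta (PSL n F)}"
    interpret F: finfield F using finfieldI F pp by blast
    have cq: "card (carrier F) = q" using F by simp
    define x s where "x = sqrt (n * L / ln n)" and "s = sqrt (n * ln n * L)"
    have big: "(x + 9)\<^sup>2 \<le> n" "s + (x + 1) * (ln (2 * n) + L) + ln n \<le> (2 + \<delta>) * s"
      using n0[of n] n unfolding x_def s_def by auto
    have n3: "real n \<ge> 3" using n by simp
    have l: "ln (real n) > 0" using n3 by simp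
    have x0: "x > 0" and s0: "s > 0" using n3 l L by (auto simp: x_def s_def)
    have xs: "x * s = n * L"
    proof -
      have "(n * L / ln n) * (n * ln n * L) = (n * L)\<^sup>2" using l by (simp add: power2_eq_square)
      then have "x * s = sqrt ((n * L)\<^sup>2)" unfolding x_def s_def real_sqrt_mult[symmetric] by simp
      then show ?thesis using L by simp
    qed
    define k where "k = nat \<lceil>x\<rceil>"
    have k: "x \<le> k" "k < x + 1" "k \<ge> 1" using x0 unfolding k_def by (linarith, linarith, simp add: Suc_le_eq)
    \<comment> \<open>Dividing n - 1 instead of n keeps r between 1 and k: the binomial X^r - c that
      adjusts the determinant must have positive degree.\<close>
    define m where "m = (n - 1) div k"
    define r where "r = Suc ((n - 1) mod k)"
    have nkm: "n = k * m + r" unfolding m_def r_def using mult_div_mod_eq[of k "n - 1"] n by simp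
    have rk: "1 \<le> r" "r \<le> k" unfolding r_def using k(3) by (auto simp: Suc_le_eq)
    have mk: "k + 7 \<le> m"
    proof -
      \<comment> \<open>The 9 in the hypothesis is chosen for (x + 8)(x + 1) + 1 <= (x + 9)^2; the 7
        makes m large enough for \<open>square_le_two_power\<close>.\<close>
      have "real ((k + 7) * k) \<le> (x + 8) * (x + 1)" using k x0 by (simp) (intro mult_mono, auto)
      also have "\<dots> \<le> (x + 9)\<^sup>2 - 1" using x0 by (simp add: power2_eq_square algebra_simps)
      also have "\<dots> \<le> real (n - 1)" using big(1) n by (simp add: of_nat_diff)
      finally have "(k + 7) * k \<le> n - 1" by (simp only: of_nat_le_iff)
      then show ?thesis unfolding m_def using k(3) by (simp add: less_eq_div_iff_mult_less_eq)
    qed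
    have kI: "k \<le> card (F.Irred m)"
    proof (rule ccontr)
      assume "\<not> k \<le> card (F.Irred m)"
      then have lt: "card (F.Irred m) < m" using mk by simp
      have "2 ^ m \<le> q ^ m" using \<open>q \<ge> 2\<close> by (rule power_mono) simp
      also have "\<dots> \<le> 2 * (m * card (F.Irred m))" using F.card_Irred_ge[of m] pp cq mk by simp
      also have "\<dots> < 2 * (m * m)" using lt mk by simp
      finally show False using square_le_two_power[of m] mk by simp
    qed
    have rm: "r < m" and m3: "3 \<le> m" using rk mk by auto
    have le: "exp (- ((real r + real m) * L + real k * ln (2 * real n) + ln (real n))) \<le> e"
      using F.eta_lower_exp[OF _ rk(1) rm m3 nkm k(3) kI e] pp cq by (simp add: L_def)
    have "real m * L \<le> s"
    proof -
      have "real (m * k) \<le> real n" using nkm by (simp only: of_nat_le_iff) simp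
      then have "(real m * L) * real k \<le> real n * L" using L by (simp add: mult_ac mult_left_mono)
      also have "\<dots> \<le> s * real k" using xs k(1) s0 mult_right_mono[of x "real k" s] by (simp add: mult_ac)
      finally show ?thesis using k(3) by simp
    qed
    moreover have "real r * L \<le> (x + 1) * L" using rk k(2) L by (intro mult_right_mono) auto
    moreover have "real k * ln (2 * n) \<le> (x + 1) * ln (2 * n)" using k(2) n3 by (intro mult_right_mono) auto
    ultimately have "(real r + real m) * L + real k * ln (2 * real n) + ln (real n) \<le> s + (x + 1) * (ln (2 * n) + L) + ln n"
      by (simp add: algebra_simps)
    then have "(real r + real m) * L + real k * ln (2 * real n) + ln (real n) \<le> (2 + \<delta>) * s" using big(2) by linarith
    then have "exp (- ((2 + \<delta>) * s)) \<le> exp (- ((real r + real m) * L + real k * ln (2 * real n) + ln (real n)))" by simp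
    also note le
    finally show "exp (- (2 + \<delta>) * sz n q) \<le> e" unfolding s_def sz_def L_def by (simp only: minus_mult_left)
  qed
qed

lemma eta_uniform_upper:
  assumes \<epsilon>: "\<epsilon> > 0"
  shows "\<exists>N0. \<forall>n q. \<forall>F :: 'a ring. n \<ge> 1 \<and> primepow q \<and> field F \<and> card (carrier F) = q \<and> max n q \<ge> N0 \<longrightarrow>
    (\<forall>e\<in>{eta (GL n F), eta (PGL n F), eta (SL n F), eta (PSL n F)}. e \<le> exp (- (2 - \<epsilon>) * sz n q))"
proof -
  show ?thesis
  proof (rule Eb_asymptotics[OF \<epsilon>, where 'i = "'a list"])
    fix N0 :: nat
    assume N0: "\<And>n q (I :: 'a list set) \<delta> od pr w. irr_system I \<delta> q od pr w \<Longrightarrow> n \<ge> 2 \<Longrightarrow> max n q \<ge> N0 \<Longrightarrow>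
      4 * real n * irr_system.Eb I \<delta> q w n \<le> exp (- ((2 - \<epsilon>) * sz n q))"
  show ?thesis
  proof (intro exI[of _ N0] allI impI ballI)
    fix n q :: nat and F :: "'a ring" and e
    assume A: "n \<ge> 1 \<and> primepow q \<and> field F \<and> card (carrier F) = q \<and> max n q \<ge> N0"
      and e: "e \<in> {eta (GL n F), eta (PGL n F), eta (SL n F), eta (PSL n F)}"
    interpret F: finfield F using finfieldI A by blast
    show "e \<le> exp (- (2 - \<epsilon>) * sz n q)"
    proof (cases "n = 1")
      \<comment> \<open>Here \<open>sz 1 q = 0\<close> because ln 1 = 0, so the trivial bound is
        enough; \<open>Eb_asymptotics\<close> starts at n = 2.\<close>
      case True
      have "e \<le> 1" using e eta_le_one[of "GL n F"] eta_le_one[of "PGL n F"] eta_le_one[of "SL n F"] eta_le_one[of "PSL n F"] by auto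
      then show ?thesis by (simp add: True sz_def)
    next
      case False
      have "e \<le> 4 * real n * F.sys.Eb n" using F.eta_upper[OF _ e] A by simp
      also have "\<dots> \<le> exp (- ((2 - \<epsilon>) * sz n (card (carrier F))))"
        by (rule N0[OF F.sys.irr_system_axioms]) (use A False in auto)
      finally show ?thesis using A by (simp add: algebra_simps)
    qed
  qed
  qed
qed

theorem theorem1p2:
  fixes \<eta> :: "nat \<Rightarrow> 'a ring \<Rightarrow> real"
  assumes "\<eta> \<in> {\<lambda>n F. eta (GL n F), \<lambda>n F. eta (PGL n F), \<lambda>n F. eta (SL n F), \<lambda>n F. eta (PSL n F)}"
  shows
    "(\<exists>\<epsilon> :: nat \<Rightarrow> nat \<Rightarrow> real.
        ((\<lambda>(n, q). \<epsilon> n q) \<longlongrightarrow> 0) (filtercomap (\<lambda>(n, q). max n q) at_top) \<and>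
        (\<forall>n q. \<forall>F :: 'a ring. n \<ge> 1 \<and> primepow q \<and> field F \<and> card (carrier F) = q \<longrightarrow>
          \<eta> n F \<le> exp (- (2 - \<epsilon> n q) * sqrt (real n * ln (real n) * ln (real q)))))
     \<and>
     (\<forall>q. primepow q \<longrightarrow> (\<forall>\<delta>>0. \<exists>n\<^sub>0. \<forall>n\<ge>n\<^sub>0. \<forall>F :: 'a ring. field F \<and> card (carrier F) = q \<longrightarrow>
        exp (- (2 + \<delta>) * sqrt (real n * ln (real n) * ln (real q))) \<le> \<eta> n F \<and>
        \<eta> n F \<le> exp (- (2 - \<delta>) * sqrt (real n * ln (real n) * ln (real q)))))"
proof -
  have mem: "\<eta> n F \<in> {eta (GL n F), eta (PGL n F), eta (SL n F), eta (PSL n F)}" for n and F :: "'a ring"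
    using assms by auto
  have \<eta>1: "\<eta> n F \<le> 1" for n and F :: "'a ring" 
    using mem[of n F] eta_le_one[of "GL n F"] eta_le_one[of "PGL n F"] eta_le_one[of "SL n F"] eta_le_one[of "PSL n F"] by auto
  txt \<open>The function is \<open>2/(j+1)\<close> for the largest \<open>j \<le> max n q\<close> for which the bound holds; \<open>j = 0\<close> always
    qualifies, since \<open>\<eta> \<le> 1\<close>.\<close>
  define good where "good n q j \<longleftrightarrow> (\<forall>F :: 'a ring. n \<ge> 1 \<and> primepow q \<and> field F \<and> card (carrier F) = q \<longrightarrow>
      \<eta> n F \<le> exp (- (2 - 2 / real (Suc j)) * sz n q))" for n q j
  define J where "J n q = {j. j \<le> max n q \<and> good n q j}" for n q
  define \<epsilon> where "\<epsilon> n q = 2 / real (Suc (Max (J n q)))" for n q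
  have J: "finite (J n q)" "Max (J n q) \<in> J n q" for n q
  proof -
    show f: "finite (J n q)" by (rule finite_subset[of _ "{..max n q}"]) (auto simp: J_def)
    have "0 \<in> J n q" using \<eta>1 by (simp add: J_def good_def)
    then show "Max (J n q) \<in> J n q" by (intro Max_in f) auto
  qed
  have upper: "\<exists>N0. \<forall>n q. \<forall>F :: 'a ring. n \<ge> 1 \<and> primepow q \<and> field F \<and> card (carrier F) = q \<and> max n q \<ge> N0 \<longrightarrow>
      \<eta> n F \<le> exp (- (2 - d) * sz n q)" if d: "d > 0" for d
  proof -
    obtain N0 where "\<forall>n q. \<forall>F :: 'a ring. n \<ge> 1 \<and> primepow q \<and> field F \<and> card (carrier F) = q \<and> max n q \<ge> N0 \<longrightarrow>
        (\<forall>e\<in>{eta (GL n F), eta (PGL n F), eta (SL n F), eta (PSL n F)}. e \<le> exp (- (2 - d) * sz n q))"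
      using eta_uniform_upper[OF d, where 'a = 'a] by blast
    then show ?thesis using mem by blast
  qed
  have "((\<lambda>(n, q). \<epsilon> n q) \<longlongrightarrow> 0) (filtercomap (\<lambda>(n, q). max n q) at_top)"
  proof (rule tendstoI)
    fix d :: real assume d: "d > 0"
    obtain j :: nat where j: "2 / real (Suc j) < d"
    proof -
      obtain j where "inverse (real (Suc j)) < d / 2" using reals_Archimedean[of "d / 2"] d by auto
      then show ?thesis using that[of j] by (simp add: field_simps)
    qed
    obtain N0 where N0: "\<forall>n q. \<forall>F :: 'a ring. n \<ge> 1 \<and> primepow q \<and> field F \<and> card (carrier F) = q \<and> max n q \<ge> N0 \<longrightarrow>
        \<eta> n F \<le> exp (- (2 - 2 / real (Suc j)) * sz n q)"
      using upper[of "2 / real (Suc j)"] by auto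
    \<comment> \<open>Once the accuracy 2/(j+1) is reached and max n q >= j, the index j lies in
      \<open>J n q\<close>, so its maximum is at least j.\<close>
    have small: "dist (\<epsilon> n q) 0 < d" if N: "max n q \<ge> max N0 j" for n q
    proof -
      have "good n q j" unfolding good_def using N0 N by auto
      then have "j \<in> J n q" using N by (simp add: J_def)
      then have "j \<le> Max (J n q)" by (rule Max_ge[OF J(1)])
      then have "\<epsilon> n q \<le> 2 / real (Suc j)" unfolding \<epsilon>_def by (intro divide_left_mono) auto
      moreover have "\<epsilon> n q \<ge> 0" by (simp add: \<epsilon>_def)
      ultimately show ?thesis using j by simp
    qed
    show "eventually (\<lambda>x. dist (case x of (n, q) \<Rightarrow> \<epsilon> n q) 0 < d) (filtercomap (\<lambda>(n, q). max n q) at_top)"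
      unfolding eventually_filtercomap
    proof (intro exI conjI allI impI)
      show "eventually (\<lambda>N. N \<ge> max N0 j) at_top" by (rule eventually_ge_at_top)
      show "dist (case x of (n, q) \<Rightarrow> \<epsilon> n q) 0 < d" if "(case x of (n, q) \<Rightarrow> max n q) \<ge> max N0 j" for x
        using that small by (cases x) simp
    qed
  qed
  moreover have "\<eta> n F \<le> exp (- (2 - \<epsilon> n q) * sz n q)" if "n \<ge> 1 \<and> primepow q \<and> field F \<and> card (carrier F) = q" for n q and F :: "'a ring"
    using J(2)[of n q] that unfolding J_def good_def \<epsilon>_def by blast
  moreover have "\<exists>n0. \<forall>n\<ge>n0. \<forall>F :: 'a ring. field F \<and> card (carrier F) = q \<longrightarrow>
        exp (- (2 + \<delta>) * sz n q) \<le> \<eta> n F \<and> \<eta> n F \<le> exp (- (2 - \<delta>) * sz n q)" if pp: "primepow q" and \<delta>: "\<delta> > 0" for q \<delta>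
  proof -
    obtain n1 where n1: "\<forall>n\<ge>n1. \<forall>F :: 'a ring. field F \<and> card (carrier F) = q \<longrightarrow>
        (\<forall>e\<in>{eta (GL n F), eta (PGL n F), eta (SL n F), eta (PSL n F)}. exp (- (2 + \<delta>) * sz n q) \<le> e)"
      using eta_asymptotic_lower[OF pp \<delta>, where 'a = 'a] by blast
    obtain N0 where N0: "\<forall>n q. \<forall>F :: 'a ring. n \<ge> 1 \<and> primepow q \<and> field F \<and> card (carrier F) = q \<and> max n q \<ge> N0 \<longrightarrow>
        \<eta> n F \<le> exp (- (2 - \<delta>) * sz n q)"
      using upper[OF \<delta>] by blast
    have "exp (- (2 + \<delta>) * sz n q) \<le> \<eta> n F \<and> \<eta> n F \<le> exp (- (2 - \<delta>) * sz n q)"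
      if n: "n \<ge> max n1 (max N0 1)" and F: "field F \<and> card (carrier F) = q" for n and F :: "'a ring"
    proof
      show "exp (- (2 + \<delta>) * sz n q) \<le> \<eta> n F" using n1 n F mem[of n F] by (metis max.bounded_iff)
      have "n \<ge> 1" "max n q \<ge> N0" using n by auto
      then show "\<eta> n F \<le> exp (- (2 - \<delta>) * sz n q)" using N0 F pp by blast
    qed
    then show ?thesis by blast
  qed
  ultimately show ?thesis unfolding sz_def by blast
qed

end
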